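(* Let $0\le S<T<\infty$ and let $K\in\mathcal K_{\mathbb F}(S,T;\mathbb R^{d\times d})$ be a $\star$-Volterra kernel. Suppose that there exist $m\in\mathbb N$ and points $S=U_0<U_1<\cdots<U_m=T$ such that, for every $k\in\{0,1,\dots,m-1\}$, the restricted $\star$-Volterra kernel $K_{(U_k,U_{k+1})}\in\mathcal K_{\mathbb F}(U_k,U_{k+1};\mathbb R^{d\times d})$ satisfies $\|K_{(U_k,U_{k+1})}\|_{\mathcal K_{\mathbb F}(U_k,U_{k+1})}<1$. Then $K$ has a $\star$-resolvent $R\in\mathcal K_{\mathbb F}(S,T;\mathbb R^{d\times d})$ on $(S,T)$.
   Context: $d\in\mathbb N$ is fixed; $\mathbb N_0=\mathbb N\cup\{0\}$. $(\Omega,\mathcal F,\mathbb P)$ is a complete probability space with a one-dimensional Brownian motion $W$; for $s\le t$, $\mathcal F^s_t$ is the $\mathbb P$-augmentation of the $\sigma$-field generated by $W(r)-W(s)$, $s\le r\le t$. The following is used for every interval $0\le S<T<\infty$. $\Delta_n(S,T)=\{(t_1,\dots,t_n): T>t_1>\cdots>t_n>S\}$. $|A|$ is the Frobenius norm and $|A|_{\mathrm{op}}$ the operator norm. $L^2_{\mathbb F}(S,T;\mathbb R^{d\times d})$ is the space of measurable processes $\xi$ on $(S,T)$ with $\xi(t)$ $\mathcal F^S_t$-measurable and $\mathbb E\int_S^T|\xi(t)|^2dt<\infty$. Put $\mathfrak W_0[f_0](t)=f_0(t)$ and $\mathfrak W_n[f_n](t)=\int_S^t\int_S^{t_1}\cdots\int_S^{t_{n-1}}f_n(t,t_1,\dots,t_n)\,dW(t_n)\cdots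 dW(t_1)$ for deterministic $f_n\in L^2(\Delta_{n+1}(S,T))$; each $\xi\in L^2_{\mathbb F}(S,T)$ is uniquely $\xi=\sum_{n\ge0}\mathfrak W_n[\mathfrak F_n[\xi]]$ with $\mathfrak F_n[\xi]\in L^2(\Delta_{n+1}(S,T))$ (Wiener–Itô chaos expansion). $\mathcal V_{n+1}(S,T;\mathbb R^{d\times d})$ is the set of measurable $k:\Delta_{n+1}(S,T)\to\mathbb R^{d\times d}$ with finite norm $\|k\|_{\mathcal V_1(S,T)}=\operatorname{ess\,sup}_t|k(t)|_{\mathrm{op}}$ (if $n=0$), $\|k\|_{\mathcal V_{n+1}(S,T)}=\operatorname{ess\,sup}_{t\in(S,T)}(\int_{\Delta_n(t,T)}|k(s,t)|_{\mathrm{op}}^2ds)^{1/2}$ (if $n\ge1$). The space of $\star$-Volterra kernels $\mathcal K_{\mathbb F}(S,T;\mathbb R^{d\times d})$ is the set of $K\in L^2_{\mathbb F}(S,T;\mathbb R^{d\times d})$ with $\mathfrak F_n[K]\in\mathcal V_{n+1}(S,T;\mathbb R^{d\times d})$ for all $n\in\mathbb N_0$ and $\|K\|_{\mathcal K_{\mathbb F}(S,T)}:=\sum_{n\ge0}\|\mathfrak F_n[K]\|_{\mathcal V_{n+1}(S,T)}<\infty$. For $f$ on $\Delta_{m+1}(S,T)$ and $g$ on $\Delta_{n+1}(S,T)$ ($m,n\in\mathbb N_0$), $(f\triangleright g)(t_0,\dots,t_{m+n})=f(t_0,\dots,t_m)g(t_m,\dots,t_{m+n})$. For $K_1,K_2\in\mathcal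 K_{\mathbb F}(S,T;\mathbb R^{d\times d})$, $K_1\star K_2\in\mathcal K_{\mathbb F}(S,T;\mathbb R^{d\times d})$ is defined by $\mathfrak F_n[K_1\star K_2]=\sum_{k=0}^n\mathfrak F_{n-k}[K_1]\triangleright\mathfrak F_k[K_2]$, $n\in\mathbb N_0$. $R\in\mathcal K_{\mathbb F}(S,T;\mathbb R^{d\times d})$ is a $\star$-resolvent of $K\in\mathcal K_{\mathbb F}(S,T;\mathbb R^{d\times d})$ (on $(S,T)$) if $R=K+K\star R=K+R\star K$. For a subinterval $(U,V)\subset(S,T)$, the restricted $\star$-Volterra kernel $K_{(U,V)}\in\mathcal K_{\mathbb F}(U,V;\mathbb R^{d\times d})$ is defined by the chaos expansion (with respect to the interval $(U,V)$) $\mathfrak F_n[K_{(U,V)}]=\mathfrak F_n[K]|_{\Delta_{n+1}(U,V)}$, $n\in\mathbb N_0$. *)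

theory Defs
  imports "HOL-Probability.Probability"
begin

section \<open>Brownian motion and adapted processes\<close>

locale brownian_motion = prob_space M + complete_measure M
  for M :: "'w measure" +
  fixes W :: "real \<Rightarrow> 'w \<Rightarrow> real"
  assumes measurable_W: "\<And>t. 0 \<le> t \<Longrightarrow> W t \<in> borel_measurable M"
    and W_zero: "AE \<omega> in M. W 0 \<omega> = 0"
    and W_increments_indep: "\<And>(t :: nat \<Rightarrow> real) n. 0 \<le> t 0 \<Longrightarrow> (\<forall>i<n. t i < t (Suc i)) \<Longrightarrow>
          indep_vars (\<lambda>_. borel) (\<lambda>i \<omega>. W (t (Suc i)) \<omega> - W (t i) \<omega>) {..<n}"
    and W_increments_normal: "\<And>s t. 0 \<le> s \<Longrightarrow> s < t \<Longrightarrow>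
          distributed M lborel (\<lambda>\<omega>. W t \<omega> - W s \<omega>) (normal_density 0 (sqrt (t - s)))"
    and W_continuous: "AE \<omega> in M. continuous_on {0..} (\<lambda>t. W t \<omega>)"

type_synonym 'd mat = "real^'d^'d"
type_synonym ('w, 'd) process = "real \<Rightarrow> 'w \<Rightarrow> 'd mat"

definition interval_measure :: "real \<Rightarrow> real \<Rightarrow> real measure" where
  "interval_measure S T = restrict_space lborel {S<..<T}"

text \<open>The augmented filtration generated by the increments of \<open>W\<close> from time \<open>s\<close> on. Only the
  \<open>\<sigma>\<close>-algebra matters here; the measure component of \<open>sigma\<close> is zero.\<close>

definition filt :: "'w measure \<Rightarrow> (real \<Rightarrow> 'w \<Rightarrow> real) \<Rightarrow> real \<Rightarrow> real \<Rightarrow> 'w measure" where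
  "filt M W s t = sigma (space M)
     ({(\<lambda>\<omega>. W r \<omega> - W s \<omega>) -` B \<inter> space M | r B. s \<le> r \<and> r \<le> t \<and> B \<in> sets borel}
      \<union> null_sets M)"

text \<open>On \<open>real^'d^'d\<close> the library norm is the Frobenius norm.\<close>

definition L2F :: "'w measure \<Rightarrow> (real \<Rightarrow> 'w \<Rightarrow> real) \<Rightarrow> real \<Rightarrow> real \<Rightarrow> ('w, 'd::finite) process set"
  where
  "L2F M W S T = {\<xi>. case_prod \<xi> \<in> borel_measurable (interval_measure S T \<Otimes>\<^sub>M M) \<and>
     (\<forall>t\<in>{S<..<T}. \<xi> t \<in> borel_measurable (filt M W S t)) \<and>
     (\<integral>\<^sup>+ p. ennreal ((norm (case_prod \<xi> p))\<^sup>2) \<partial>(interval_measure S T \<Otimes>\<^sub>M M)) < \<infinity>}"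

definition L2F_eq :: "'w measure \<Rightarrow> real \<Rightarrow> real \<Rightarrow> ('w, 'd::finite) process \<Rightarrow> ('w, 'd) process \<Rightarrow> bool"
  where
  "L2F_eq M S T \<xi> \<eta> \<longleftrightarrow> (AE (t, \<omega>) in interval_measure S T \<Otimes>\<^sub>M M. \<xi> t \<omega> = \<eta> t \<omega>)"


section \<open>The It\^o integral\<close>

text \<open>A simple process is given by a partition \<open>S = a\<^sub>0 < \<dots> < a\<^sub>N = T\<close> and square-integrable
  coefficients \<open>H\<^sub>i\<close>, known at time \<open>a\<^sub>i\<close>.\<close>

definition simple_data :: "'w measure \<Rightarrow> (real \<Rightarrow> 'w \<Rightarrow> real) \<Rightarrow> real \<Rightarrow> real \<Rightarrow>
    nat \<Rightarrow> (nat \<Rightarrow> real) \<Rightarrow> (nat \<Rightarrow> 'w \<Rightarrow> 'd::finite mat) \<Rightarrow> bool" where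
  "simple_data M W S T N a H \<longleftrightarrow> a 0 = S \<and> a N = T \<and> (\<forall>i<N. a i < a (Suc i)) \<and>
     (\<forall>i<N. H i \<in> borel_measurable (filt M W S (a i)) \<and> integrable M (\<lambda>\<omega>. (norm (H i \<omega>))\<^sup>2))"

definition simple_proc :: "nat \<Rightarrow> (nat \<Rightarrow> real) \<Rightarrow> (nat \<Rightarrow> 'w \<Rightarrow> 'd::finite mat) \<Rightarrow> ('w, 'd) process" where
  "simple_proc N a H t \<omega> = (\<Sum>i<N. indicator {a i<..a (Suc i)} t *\<^sub>R H i \<omega>)"

definition simple_integral :: "(real \<Rightarrow> 'w \<Rightarrow> real) \<Rightarrow> nat \<Rightarrow> (nat \<Rightarrow> real) \<Rightarrow>
    (nat \<Rightarrow> 'w \<Rightarrow> 'd::finite mat) \<Rightarrow> 'w \<Rightarrow> 'd mat" where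
  "simple_integral W N a H \<omega> = (\<Sum>i<N. (W (a (Suc i)) \<omega> - W (a i) \<omega>) *\<^sub>R H i \<omega>)"

text \<open>\<open>has_ito_integral M W S T Y X\<close> says \<open>X = \<integral>\<^sub>S\<^sup>T Y(t) dW(t)\<close> almost surely: \<open>X\<close> is the
  \<open>L\<^sup>2\<close>-limit of the integrals of simple processes approximating \<open>Y\<close>.\<close>

definition has_ito_integral :: "'w measure \<Rightarrow> (real \<Rightarrow> 'w \<Rightarrow> real) \<Rightarrow> real \<Rightarrow> real \<Rightarrow>
    ('w, 'd::finite) process \<Rightarrow> ('w \<Rightarrow> 'd mat) \<Rightarrow> bool" where
  "has_ito_integral M W S T Y X \<longleftrightarrow> Y \<in> L2F M W S T \<and> X \<in> borel_measurable M \<and>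
     (\<exists>N a H. (\<forall>j::nat. simple_data M W S T (N j) (a j) (H j)) \<and>
        (\<lambda>j. \<integral>\<^sup>+ p. ennreal ((norm (case_prod Y p - case_prod (simple_proc (N j) (a j) (H j)) p))\<^sup>2)
                \<partial>(interval_measure S T \<Otimes>\<^sub>M M)) \<longlonglongrightarrow> 0 \<and>
        (\<lambda>j. \<integral>\<^sup>+ \<omega>. ennreal ((norm (X \<omega> - simple_integral W (N j) (a j) (H j) \<omega>))\<^sup>2) \<partial>M) \<longlonglongrightarrow> 0)"


section \<open>Wiener--It\^o chaos expansion\<close>

text \<open>Points of \<open>\<real>\<^sup>n\<close> are extensional functions on \<open>{..<n}\<close>, i.e. points of the space of
  \<open>\<Pi>\<^sub>M i\<in>{..<n}. lborel\<close>; the only point for \<open>n = 0\<close> is \<open>\<lambda>_. undefined\<close>. The tuple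
  \<open>(t, s\<^sub>0, \<dots>, s\<^bsub>n-1\<^esub>)\<close> is \<open>case_nat t s\<close>, and \<open>(s\<^sub>0, \<dots>, s\<^bsub>n-1\<^esub>, t)\<close> is \<open>s(n := t)\<close>.\<close>

definition Delta :: "nat \<Rightarrow> real \<Rightarrow> real \<Rightarrow> (nat \<Rightarrow> real) set" where
  "Delta n S T = {t \<in> extensional {..<n}. (\<forall>i<n. S < t i \<and> t i < T) \<and>
     (\<forall>i. Suc i < n \<longrightarrow> t i > t (Suc i))}"

definition Delta_measure :: "nat \<Rightarrow> real \<Rightarrow> real \<Rightarrow> (nat \<Rightarrow> real) measure" where
  "Delta_measure n S T = restrict_space (\<Pi>\<^sub>M i\<in>{..<n}. lborel) (Delta n S T)"

type_synonym 'd kernel = "(nat \<Rightarrow> real) \<Rightarrow> 'd mat"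

definition L2_Delta :: "nat \<Rightarrow> real \<Rightarrow> real \<Rightarrow> 'd::finite kernel set" where
  "L2_Delta n S T = {f. f \<in> borel_measurable (Delta_measure n S T) \<and>
     (\<integral>\<^sup>+ t. ennreal ((norm (f t))\<^sup>2) \<partial>Delta_measure n S T) < \<infinity>}"

text \<open>\<open>has_iter_integral M W S n t f X\<close> says
  \<open>X = \<integral>\<^sub>S\<^sup>t \<integral>\<^sub>S\<^bsup>t\<^sub>1\<^esup> \<dots> \<integral>\<^sub>S\<^bsup>t\<^bsub>n-1\<^esub>\<^esup> f(t\<^sub>1, \<dots>, t\<^sub>n) dW(t\<^sub>n) \<dots> dW(t\<^sub>1)\<close> almost surely. In the recursion
  \<open>Y(r)\<close> is the inner iterated integral of \<open>f(r, \<cdot>)\<close> over \<open>(S, r)\<close>; as an \<open>L\<^sup>2\<close>-process it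
  is only determined for almost every \<open>r\<close>.\<close>

primrec has_iter_integral :: "'w measure \<Rightarrow> (real \<Rightarrow> 'w \<Rightarrow> real) \<Rightarrow> real \<Rightarrow>
    nat \<Rightarrow> real \<Rightarrow> 'd::finite kernel \<Rightarrow> ('w \<Rightarrow> 'd mat) \<Rightarrow> bool" where
  "has_iter_integral M W S 0 t f X \<longleftrightarrow> (AE \<omega> in M. X \<omega> = f (\<lambda>_. undefined))"
| "has_iter_integral M W S (Suc n) t f X \<longleftrightarrow>
     (\<exists>Y. (AE r in interval_measure S t. has_iter_integral M W S n r (\<lambda>s. f (case_nat r s)) (Y r)) \<and>
          has_ito_integral M W S t Y X)"

text \<open>\<open>Y = \<WW>\<^sub>n[f]\<close> as elements of \<open>L\<^sup>2\<^sub>\<FF>(S,T)\<close>.\<close>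

definition is_Wn :: "'w measure \<Rightarrow> (real \<Rightarrow> 'w \<Rightarrow> real) \<Rightarrow> real \<Rightarrow> real \<Rightarrow>
    nat \<Rightarrow> 'd::finite kernel \<Rightarrow> ('w, 'd) process \<Rightarrow> bool" where
  "is_Wn M W S T n f Y \<longleftrightarrow> f \<in> L2_Delta (Suc n) S T \<and> Y \<in> L2F M W S T \<and>
     (AE t in interval_measure S T. has_iter_integral M W S n t (\<lambda>s. f (case_nat t s)) (Y t))"

text \<open>\<open>\<xi> = (\<Sum>n. \<WW>\<^sub>n[f\<^sub>n])\<close>, with convergence in \<open>L\<^sup>2\<^sub>\<FF>(S,T)\<close>.\<close>

definition has_chaos :: "'w measure \<Rightarrow> (real \<Rightarrow> 'w \<Rightarrow> real) \<Rightarrow> real \<Rightarrow> real \<Rightarrow>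
    ('w, 'd::finite) process \<Rightarrow> (nat \<Rightarrow> 'd kernel) \<Rightarrow> bool" where
  "has_chaos M W S T \<xi> f \<longleftrightarrow> \<xi> \<in> L2F M W S T \<and>
     (\<exists>Y. (\<forall>n. is_Wn M W S T n (f n) (Y n)) \<and>
        (\<lambda>N. \<integral>\<^sup>+ p. ennreal ((norm (case_prod \<xi> p - (\<Sum>n<N. case_prod (Y n) p)))\<^sup>2)
                \<partial>(interval_measure S T \<Otimes>\<^sub>M M)) \<longlonglongrightarrow> 0)"

text \<open>The coefficients \<open>\<FF>\<^sub>n[\<xi>]\<close>, and conversely the process with prescribed coefficients. By the
  Wiener--It\^o theorem the former exist for every \<open>\<xi>\<close> in \<open>L2F\<close>; both are unique up to null sets,
  and the choice operator merely selects representatives.\<close>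

definition chaos_coeff :: "'w measure \<Rightarrow> (real \<Rightarrow> 'w \<Rightarrow> real) \<Rightarrow> real \<Rightarrow> real \<Rightarrow>
    ('w, 'd::finite) process \<Rightarrow> nat \<Rightarrow> 'd kernel" where
  "chaos_coeff M W S T \<xi> = (SOME f. has_chaos M W S T \<xi> f)"

definition chaos_process :: "'w measure \<Rightarrow> (real \<Rightarrow> 'w \<Rightarrow> real) \<Rightarrow> real \<Rightarrow> real \<Rightarrow>
    (nat \<Rightarrow> 'd::finite kernel) \<Rightarrow> ('w, 'd) process" where
  "chaos_process M W S T f = (SOME \<xi>. has_chaos M W S T \<xi> f)"


section \<open>\<open>\<star>\<close>-Volterra kernels\<close>

abbreviation op_norm :: "'d::finite mat \<Rightarrow> real" where
  "op_norm A \<equiv> onorm ((*v) A)"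

definition sqrt_ennreal :: "ennreal \<Rightarrow> ennreal" where
  "sqrt_ennreal x = (if x = \<infinity> then \<infinity> else ennreal (sqrt (enn2real x)))"

text \<open>\<open>V_norm n S T\<close> is the norm of \<open>\<V>\<^bsub>n+1\<^esub>(S,T)\<close>, with value \<open>\<infinity>\<close> allowed.\<close>

definition V_norm :: "nat \<Rightarrow> real \<Rightarrow> real \<Rightarrow> 'd::finite kernel \<Rightarrow> ennreal" where
  "V_norm n S T k =
     (if n = 0
      then esssup (interval_measure S T) (\<lambda>t. ennreal (op_norm (k (\<lambda>i\<in>{..<1}. t))))
      else esssup (interval_measure S T) (\<lambda>t. sqrt_ennreal
             (\<integral>\<^sup>+ s. ennreal ((op_norm (k (s(n := t))))\<^sup>2) \<partial>Delta_measure n t T)))"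

definition V_space :: "nat \<Rightarrow> real \<Rightarrow> real \<Rightarrow> 'd::finite kernel set" where
  "V_space n S T = {k. k \<in> borel_measurable (Delta_measure (Suc n) S T) \<and> V_norm n S T k < \<infinity>}"

definition KF_norm :: "'w measure \<Rightarrow> (real \<Rightarrow> 'w \<Rightarrow> real) \<Rightarrow> real \<Rightarrow> real \<Rightarrow>
    ('w, 'd::finite) process \<Rightarrow> ennreal" where
  "KF_norm M W S T K = (\<Sum>n. V_norm n S T (chaos_coeff M W S T K n))"

text \<open>By the Wiener--It\^o theorem the clause \<open>has_chaos\<close> holds for every \<open>K\<close> in \<open>L2F\<close>; it makes
  explicit that \<open>chaos_coeff\<close> denotes the actual coefficients.\<close>

definition KF :: "'w measure \<Rightarrow> (real \<Rightarrow> 'w \<Rightarrow> real) \<Rightarrow> real \<Rightarrow> real \<Rightarrow> ('w, 'd::finite) process set"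
  where
  "KF M W S T = {K \<in> L2F M W S T.
     has_chaos M W S T K (chaos_coeff M W S T K) \<and>
     (\<forall>n. chaos_coeff M W S T K n \<in> V_space n S T) \<and>
     KF_norm M W S T K < \<infinity>}"

text \<open>\<open>f \<triangleright> g\<close> for \<open>f\<close> on \<open>\<Delta>\<^bsub>m+1\<^esub>\<close> and \<open>g\<close> on \<open>\<Delta>\<^bsub>n+1\<^esub>\<close>.\<close>

definition tri :: "nat \<Rightarrow> nat \<Rightarrow> 'd::finite kernel \<Rightarrow> 'd kernel \<Rightarrow> 'd kernel" where
  "tri m n f g t = f (restrict t {..m}) ** g (\<lambda>i\<in>{..n}. t (m + i))"

definition star :: "'w measure \<Rightarrow> (real \<Rightarrow> 'w \<Rightarrow> real) \<Rightarrow> real \<Rightarrow> real \<Rightarrow>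
    ('w, 'd::finite) process \<Rightarrow> ('w, 'd) process \<Rightarrow> ('w, 'd) process" where
  "star M W S T K\<^sub>1 K\<^sub>2 = chaos_process M W S T
     (\<lambda>n t. \<Sum>k\<le>n. tri (n - k) k (chaos_coeff M W S T K\<^sub>1 (n - k)) (chaos_coeff M W S T K\<^sub>2 k) t)"

definition is_star_resolvent :: "'w measure \<Rightarrow> (real \<Rightarrow> 'w \<Rightarrow> real) \<Rightarrow> real \<Rightarrow> real \<Rightarrow>
    ('w, 'd::finite) process \<Rightarrow> ('w, 'd) process \<Rightarrow> bool" where
  "is_star_resolvent M W S T K R \<longleftrightarrow> R \<in> KF M W S T \<and>
     L2F_eq M S T R (\<lambda>t \<omega>. K t \<omega> + star M W S T K R t \<omega>) \<and>
     L2F_eq M S T R (\<lambda>t \<omega>. K t \<omega> + star M W S T R K t \<omega>)"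

text \<open>The kernel \<open>K\<^bsub>(U,V)\<^esub>\<close>, for a kernel \<open>K\<close> on \<open>(S,T)\<close>. This is not the restriction of the
  process \<open>K\<close> to \<open>(U,V)\<close>, which need not be adapted to the filtration started at \<open>U\<close>.\<close>

definition restricted_kernel :: "'w measure \<Rightarrow> (real \<Rightarrow> 'w \<Rightarrow> real) \<Rightarrow> real \<Rightarrow> real \<Rightarrow>
    ('w, 'd::finite) process \<Rightarrow> real \<Rightarrow> real \<Rightarrow> ('w, 'd) process" where
  "restricted_kernel M W S T K U V = chaos_process M W U V
     (\<lambda>n. restrict (chaos_coeff M W S T K n) (Delta (Suc n) U V))"

end

theory Submission
  imports Defs
begin

text \<open>On coefficient sequences the product \<open>\<star>\<close> is graded, so \<open>1 - k\<close> is invertible as soon as the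
  matrices \<open>1 - k\<^sub>0(t)\<close> are, and then \<open>r\<^sub>n\<close> is obtained from \<open>r\<^sub>0, \<dots>, r\<^bsub>n-1\<^esub>\<close> by a finite formula.
  Summability of the norms of \<open>r\<close> is shown by induction over the blocks: on \<open>(S, U\<^bsub>i+1\<^esub>)\<close> the part of
  \<open>r\<close> whose first time is at least \<open>U\<^sub>i\<close> satisfies a convolution inequality whose only self-interaction
  is with the restriction of \<open>k\<close> to the block \<open>(U\<^sub>i, U\<^bsub>i+1\<^esub>)\<close>, which has norm less than \<open>1\<close>.

  To pass from coefficients to processes one needs existence and uniqueness of chaos expansions for
  given coefficients. Both follow from the It\^o isometry, iterated: it yields the
  Pythagorean identity for sums of iterated integrals of different orders. Jointly measurable versions
  of \<open>t \<mapsto> \<WW>\<^sub>n[f\<^sub>n](t)\<close> are constructed for indicators of rectangles and extended by a Dynkin argument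
  and closure in \<open>L\<^sup>2\<close>.\<close>

section \<open>Square-integrable functions\<close>

text \<open>\<open>chaos_coeff\<close> and \<open>chaos_process\<close> are choices, so a statement
  about \<open>star\<close> or \<open>restricted_kernel\<close> has content only once an expansion
  with the required coefficients is constructed, and norms and products must be insensitive to null
  sets. Splitting r at U_i works because times decrease and, in a product of k and r, the last time
  of k is the first time of r. If that time is below U_i, all times of r are, and the previous
  interval controls r; otherwise all times of k are at least U_i, so k acts through the block alone.
  The norm of V_(n+1), a supremum over the last time and an integral over the larger ones, is
  submultiplicative for this product. In degree 0 the product is multiplication at one time, so r_n
  stands on both sides of its equation, on the right with the factor k_0. The block hypothesis
  bounds k_0 by a number below 1 on each of finitely many blocks, hence by one c < 1 almost
  everywhere, which inverts 1 - k_0 with a bounded inverse. The convolution inequality can be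
  absorbed only after each single norm of r is known to be finite; the recursive formula supplies
  this.\<close>

definition L2sq :: "'a measure \<Rightarrow> ('a \<Rightarrow> 'b::real_normed_vector) \<Rightarrow> ennreal" where
  "L2sq N f = (\<integral>\<^sup>+ x. ennreal ((norm (f x))\<^sup>2) \<partial>N)"

lemma L2sq_cong_AE: "(AE x in N. f x = g x) \<Longrightarrow> L2sq N f = L2sq N g"
  unfolding L2sq_def by (rule nn_integral_cong_AE) auto

lemma L2sq_cong: "(\<And>x. x \<in> space N \<Longrightarrow> f x = g x) \<Longrightarrow> L2sq N f = L2sq N g"
  unfolding L2sq_def by (rule nn_integral_cong) auto

lemma L2sq_zero [simp]: "L2sq N (\<lambda>_. 0) = 0"
  by (simp add: L2sq_def)

lemma L2sq_commute: "L2sq N (\<lambda>x. f x - g x) = L2sq N (\<lambda>x. g x - f x)"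
  by (simp add: L2sq_def norm_minus_commute)

lemma L2sq_eq_0_iff:
  fixes f :: "'a \<Rightarrow> 'b::{second_countable_topology, real_normed_vector}"
  assumes [measurable]: "f \<in> borel_measurable N"
  shows "L2sq N f = 0 \<longleftrightarrow> (AE x in N. f x = 0)"
  unfolding L2sq_def by (subst nn_integral_0_iff_AE) auto

text \<open>Young's inequality with a free weight. A small d keeps the constant of the first term
  close to 1, as needed for limits; d chosen as a quotient of norms gives Minkowski's
  inequality.\<close>

lemma norm_add_sq_weighted:
  fixes x y :: "'b::real_normed_vector"
  assumes "0 < d"
  shows "(norm (x + y))\<^sup>2 \<le> (1 + d) * (norm x)\<^sup>2 + (1 + 1 / d) * (norm y)\<^sup>2"
proof -
  have "(norm (x + y))\<^sup>2 \<le> (norm x + norm y)\<^sup>2"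
    by (intro power_mono norm_triangle_ineq) auto
  moreover have "2 * norm x * norm y \<le> d * (norm x)\<^sup>2 + (1 / d) * (norm y)\<^sup>2"
  proof -
    have "0 \<le> (d * norm x - norm y)\<^sup>2 / d" using assms by simp
    also have "\<dots> = d * (norm x)\<^sup>2 + (1 / d) * (norm y)\<^sup>2 - 2 * norm x * norm y"
      using assms by (simp add: power2_eq_square field_simps)
    finally show ?thesis by simp
  qed
  ultimately show ?thesis by (simp add: power2_sum algebra_simps)
qed

lemma L2sq_add_weighted:
  fixes f g :: "'a \<Rightarrow> 'b::{second_countable_topology, real_normed_vector}"
  assumes [measurable]: "f \<in> borel_measurable N" "g \<in> borel_measurable N" and d: "0 < d"
  shows "L2sq N (\<lambda>x. f x + g x) \<le> ennreal (1 + d) * L2sq N f + ennreal (1 + 1 / d) * L2sq N g"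
proof -
  have "L2sq N (\<lambda>x. f x + g x)
      \<le> (\<integral>\<^sup>+ x. ennreal (1 + d) * ennreal ((norm (f x))\<^sup>2) + ennreal (1 + 1 / d) * ennreal ((norm (g x))\<^sup>2) \<partial>N)"
    unfolding L2sq_def
    by (intro nn_integral_mono)
      (use d norm_add_sq_weighted[OF d] in \<open>simp add: ennreal_mult[symmetric] ennreal_plus[symmetric] del: ennreal_plus\<close>)
  also have "\<dots> = ennreal (1 + d) * L2sq N f + ennreal (1 + 1 / d) * L2sq N g"
    unfolding L2sq_def by (subst nn_integral_add) (auto simp: nn_integral_cmult)
  finally show ?thesis .
qed

lemma L2sq_add_le:
  fixes f g :: "'a \<Rightarrow> 'b::{second_countable_topology, real_normed_vector}"
  assumes "f \<in> borel_measurable N" "g \<in> borel_measurable N"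
  shows "L2sq N (\<lambda>x. f x + g x) \<le> 2 * L2sq N f + 2 * L2sq N g"
  using L2sq_add_weighted[OF assms, of 1] by simp

lemma L2sq_diff_le:
  fixes f g h :: "'a \<Rightarrow> 'b::{second_countable_topology, real_normed_vector}"
  assumes [measurable]: "f \<in> borel_measurable N" "g \<in> borel_measurable N" "h \<in> borel_measurable N"
  shows "L2sq N (\<lambda>x. f x - g x) \<le> 2 * L2sq N (\<lambda>x. f x - h x) + 2 * L2sq N (\<lambda>x. h x - g x)"
  using L2sq_add_le[of "\<lambda>x. f x - h x" N "\<lambda>x. h x - g x"] by simp

lemma L2sq_scaleR: 
  fixes f :: "'a \<Rightarrow> 'b::{second_countable_topology, real_normed_vector}"
  assumes [measurable]: "f \<in> borel_measurable N"
  shows "L2sq N (\<lambda>x. c *\<^sub>R f x) = ennreal (c\<^sup>2) * L2sq N f"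
  unfolding L2sq_def by (subst nn_integral_cmult[symmetric])
    (auto simp: power_mult_distrib ennreal_mult)

lemma tendsto_ennreal_mult0: "(X \<longlongrightarrow> 0) F \<Longrightarrow> c < \<infinity> \<Longrightarrow> ((\<lambda>j. c * X j) \<longlongrightarrow> (0::ennreal)) F"
  using ennreal_tendsto_cmult[of c X 0 F] by simp

text \<open>Norms pass to the limit by the weighted triangle inequality with \<open>d\<close> tending to \<open>0\<close>, which avoids
  square roots of extended reals.\<close>

lemma L2sq_limit_le:
  fixes X :: "'a \<Rightarrow> 'b::{second_countable_topology, real_normed_vector}"
    and Y :: "'c \<Rightarrow> 'd::{second_countable_topology, real_normed_vector}"
  assumes [measurable]: "X \<in> borel_measurable N" "\<And>j::nat. Xs j \<in> borel_measurable N"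
    "Y \<in> borel_measurable N'" "\<And>j. Ys j \<in> borel_measurable N'"
  assumes eq: "\<And>j. k' + L2sq N (Xs j) \<le> k + L2sq N' (Ys j)"
  assumes X: "(\<lambda>j. L2sq N (\<lambda>x. X x - Xs j x)) \<longlonglongrightarrow> 0"
    and Y: "(\<lambda>j. L2sq N' (\<lambda>x. Y x - Ys j x)) \<longlonglongrightarrow> 0"
  shows "k' + L2sq N X \<le> k + L2sq N' Y"
proof -
  define B where "B = k + L2sq N' Y"
  \<comment> \<open>One factor 1 + d is lost in replacing \<open>X\<close> by \<open>Xs j\<close>,
    the other in replacing \<open>Ys j\<close> by \<open>Y\<close>; \<open>k\<close> and
    \<open>k'\<close> are merely enlarged along with them. The remainder \<open>?e j\<close>
    vanishes in the limit.\<close>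
  have *: "k' + L2sq N X \<le> ennreal ((1 + d)\<^sup>2) * B" if d: "0 < d" for d :: real
  proof -
    let ?e = "\<lambda>j. ennreal (1 + d) * (ennreal (1 + 1 / d) * L2sq N' (\<lambda>x. Y x - Ys j x)) + ennreal (1 + 1 / d) * L2sq N (\<lambda>x. X x - Xs j x)"
    have "k' + L2sq N X \<le> ennreal ((1 + d)\<^sup>2) * B + ?e j" for j
    proof -
      have mono: "c \<le> ennreal (1 + d) * c" for c :: ennreal
      proof -
        have "1 * c \<le> ennreal (1 + d) * c"
          using d by (intro mult_right_mono) (auto simp: ennreal_1[symmetric] simp del: ennreal_1)
        then show ?thesis by simp
      qed
      have "L2sq N X \<le> ennreal (1 + d) * L2sq N (Xs j) + ennreal (1 + 1 / d) * L2sq N (\<lambda>x. X x - Xs j x)"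
        using L2sq_add_weighted[of "Xs j" N "\<lambda>x. X x - Xs j x" d] d by simp
      then have "k' + L2sq N X \<le> ennreal (1 + d) * k' + (ennreal (1 + d) * L2sq N (Xs j) + ennreal (1 + 1 / d) * L2sq N (\<lambda>x. X x - Xs j x))"
        by (intro add_mono mono)
      also have "\<dots> = ennreal (1 + d) * (k' + L2sq N (Xs j)) + ennreal (1 + 1 / d) * L2sq N (\<lambda>x. X x - Xs j x)"
        by (simp only: distrib_left add.assoc)
      also have "k' + L2sq N (Xs j) \<le> k + L2sq N' (Ys j)" by (rule eq)
      also have "L2sq N' (Ys j) \<le> ennreal (1 + d) * L2sq N' Y + ennreal (1 + 1 / d) * L2sq N' (\<lambda>x. Ys j x - Y x)"
        using L2sq_add_weighted[of Y N' "\<lambda>x. Ys j x - Y x" d] d by simp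
      also have "L2sq N' (\<lambda>x. Ys j x - Y x) = L2sq N' (\<lambda>x. Y x - Ys j x)" by (rule L2sq_commute)
      also have "k + (ennreal (1 + d) * L2sq N' Y + ennreal (1 + 1 / d) * L2sq N' (\<lambda>x. Y x - Ys j x))
        \<le> ennreal (1 + d) * B + ennreal (1 + 1 / d) * L2sq N' (\<lambda>x. Y x - Ys j x)"
        using mono[of k] by (simp only: B_def distrib_left add.assoc add_right_mono)
      finally have "k' + L2sq N X \<le> ennreal (1 + d) * (ennreal (1 + d) * B + ennreal (1 + 1 / d) * L2sq N' (\<lambda>x. Y x - Ys j x)) + ennreal (1 + 1 / d) * L2sq N (\<lambda>x. X x - Xs j x)"
        by (simp add: add_right_mono mult_left_mono)
      also have "\<dots> = ennreal ((1 + d)\<^sup>2) * B + ?e j"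
      proof -
        have "ennreal ((1 + d)\<^sup>2) = ennreal (1 + d) * ennreal (1 + d)"
          using d by (simp add: power2_eq_square ennreal_mult del: ennreal_plus)
        then show ?thesis by (simp only: distrib_left mult.assoc add.assoc)
      qed
      finally show ?thesis .
    qed
    moreover have "(\<lambda>j. ?e j) \<longlonglongrightarrow> 0 + 0"
      by (intro tendsto_add tendsto_ennreal_mult0 X Y) auto
    then have "(\<lambda>j. ennreal ((1 + d)\<^sup>2) * B + ?e j) \<longlonglongrightarrow> ennreal ((1 + d)\<^sup>2) * B + 0"
      by (intro tendsto_add tendsto_const) simp_all
    ultimately show ?thesis
      using Lim_bounded2[of "\<lambda>j. ennreal ((1 + d)\<^sup>2) * B + ?e j" "ennreal ((1 + d)\<^sup>2) * B" 0 "k' + L2sq N X"] by simp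
  qed
  show ?thesis
  proof (cases "B = \<infinity>")
    case False
    have "(\<lambda>n. ennreal ((1 + inverse (real (Suc n)))\<^sup>2)) \<longlonglongrightarrow> ennreal ((1 + 0)\<^sup>2)"
      by (intro tendsto_intros LIMSEQ_inverse_real_of_nat tendsto_ennrealI)
    then have "(\<lambda>n. ennreal ((1 + inverse (real (Suc n)))\<^sup>2) * B) \<longlonglongrightarrow> 1 * B"
      using False by (intro tendsto_mult_ennreal) auto
    then have "k' + L2sq N X \<le> 1 * B"
      by (rule Lim_bounded2[where N=0]) (use * in auto)
    then show ?thesis by (simp add: B_def)
  qed (auto simp: B_def)
qed

text \<open>The pointwise infimum of the \<open>e j\<close> has an integral below every term of a
  null sequence, hence vanishes almost everywhere. This identifies the time sections of an L2 limit
  with random variables constructed at each single time.\<close>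

lemma AE_zero_INF:
  fixes e :: "nat \<Rightarrow> 'a \<Rightarrow> ennreal"
  assumes [measurable]: "\<And>j. e j \<in> borel_measurable N"
    and lim: "(\<lambda>j. \<integral>\<^sup>+x. e j x \<partial>N) \<longlonglongrightarrow> 0"
    and le: "AE x in N. \<forall>j. \<psi> x \<le> e j x"
  shows "AE x in N. \<psi> x = 0"
proof -
  have "(\<integral>\<^sup>+x. (INF j. e j x) \<partial>N) \<le> 0"
    by (rule Lim_bounded2[OF lim, where N=0]) (auto intro!: nn_integral_mono INF_lower)
  then have "(\<integral>\<^sup>+x. (INF j. e j x) \<partial>N) = 0" by simp
  then have "AE x in N. (INF j. e j x) = 0"
    by (subst (asm) nn_integral_0_iff_AE) auto
  with le show ?thesis
  proof eventually_elim
    case (elim x)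
    then have "\<psi> x \<le> (INF j. e j x)" by (intro INF_greatest) auto
    with elim show ?case by simp
  qed
qed

text \<open>Riesz-Fischer, with the limit exhibited as a pointwise \<open>lim\<close> along a
  subsequence. The explicit form lets the limit inherit measurability with respect to smaller
  sigma-algebras, and thus adaptedness. The bound \<open>c m + c n\<close> is the shape in which the
  isometries deliver the Cauchy property.\<close>

lemma L2_complete:
  fixes f :: "nat \<Rightarrow> 'a \<Rightarrow> 'b::{banach, second_countable_topology}"
  assumes [measurable]: "\<And>n. f n \<in> borel_measurable N"
    and c: "c \<longlonglongrightarrow> (0::ennreal)"
    and cauchy: "\<And>m n. L2sq N (\<lambda>x. f m x - f n x) \<le> c m + c n"
  obtains r :: "nat \<Rightarrow> nat" where "(\<lambda>n. L2sq N (\<lambda>x. lim (\<lambda>k. f (r k) x) - f n x)) \<longlonglongrightarrow> 0"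
proof -
  \<comment> \<open>The rate 1/4^k leaves room for the weight 2^k used below: 2^k times 2/4^k is
    still summable.\<close>
  have ex: "\<exists>m. \<forall>n\<ge>m. c n \<le> ennreal ((1/4)^k)" for k :: nat
  proof -
    have "0 < ennreal ((1/4)^k)" by simp
    from order_tendstoD(2)[OF c this] show ?thesis
      by (auto simp: eventually_sequentially intro: less_imp_le)
  qed
  define r where "r k = (SOME m. \<forall>n\<ge>m. c n \<le> ennreal ((1/4)^k)) + k" for k
  have r: "c (r k) \<le> ennreal ((1/4)^k)" for k
    using someI_ex[OF ex[of k]] by (auto simp: r_def)
  have r_ge: "k \<le> r k" for k by (simp add: r_def)
  define D where "D k x = f (r (Suc k)) x - f (r k) x" for k x
  have [measurable]: "D k \<in> borel_measurable N" for k unfolding D_def by simp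
  have D: "L2sq N (D k) \<le> ennreal (2 * (1/4)^k)" for k
  proof -
    have "L2sq N (D k) \<le> c (r (Suc k)) + c (r k)" unfolding D_def by (rule cauchy)
    also have "\<dots> \<le> ennreal ((1/4)^Suc k) + ennreal ((1/4)^k)" by (intro add_mono r)
    also have "\<dots> \<le> ennreal (2 * (1/4)^k)"
      by (subst ennreal_plus[symmetric]) (auto intro!: ennreal_leI)
    finally show ?thesis .
  qed
  have "(\<integral>\<^sup>+x. (\<Sum>k. ennreal (2^k * (norm (D k x))\<^sup>2)) \<partial>N) = (\<Sum>k. \<integral>\<^sup>+x. ennreal (2^k * (norm (D k x))\<^sup>2) \<partial>N)"
    by (rule nn_integral_suminf) simp
  also have "\<dots> = (\<Sum>k. ennreal (2^k) * L2sq N (D k))"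
    unfolding L2sq_def by (subst nn_integral_cmult[symmetric]) (auto simp: ennreal_mult)
  also have "\<dots> \<le> (\<Sum>k. ennreal (2^k) * ennreal (2 * (1/4)^k))"
    by (intro suminf_le mult_left_mono D) auto
  also have "\<dots> = (\<Sum>k. ennreal (2 * (1/2)^k))"
    by (intro suminf_cong) (simp add: ennreal_mult[symmetric] power_one_over power_mult_distrib[symmetric] field_simps
       flip: power_mult)
  also have "\<dots> < \<infinity>"
    using summable_mult[OF summable_geometric[of "1/2::real"], of 2]
    by (simp add: ennreal_suminf_neq_top less_top)
  finally have "(\<integral>\<^sup>+x. (\<Sum>k. ennreal (2^k * (norm (D k x))\<^sup>2)) \<partial>N) \<noteq> \<infinity>" by simp
  then have "AE x in N. (\<Sum>k. ennreal (2^k * (norm (D k x))\<^sup>2)) \<noteq> \<infinity>"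
    by (rule nn_integral_PInf_AE[rotated]) simp
  then have conv: "AE x in N. convergent (\<lambda>k. f (r k) x)"
  proof eventually_elim
    case (elim x)
    have "summable (\<lambda>k. 2^k * (norm (D k x))\<^sup>2)"
      by (rule summable_suminf_not_top) (use elim in auto)
    then have "summable (\<lambda>k. (1/2)^k + 2^k * (norm (D k x))\<^sup>2)"
      by (intro summable_add summable_geometric) auto
    \<comment> \<open>Expanding (1/2)^k (1 - 2^k y)^2 >= 0 for y = \<open>norm (D k x)\<close>:
      summability of the weighted squares yields absolute summability of the telescoping
      series.\<close>
    moreover have "norm (D k x) \<le> (1/2)^k + 2^k * (norm (D k x))\<^sup>2" for k
    proof -
      have "0 \<le> (1/2)^k * (1 - 2^k * norm (D k x))\<^sup>2 + norm (D k x)" by simp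
      also have "(1/2)^k * (1 - 2^k * norm (D k x))\<^sup>2 + norm (D k x) = (1/2)^k + 2^k * (norm (D k x))\<^sup>2 - norm (D k x)"
        by (simp add: power2_eq_square field_simps power_one_over)
      finally show ?thesis by simp
    qed
    ultimately have "summable (\<lambda>k. D k x)"
      by (rule summable_comparison_test'[where N=0])
    then have "convergent (\<lambda>n. \<Sum>k<n. D k x)" by (simp add: summable_iff_convergent)
    then have "convergent (\<lambda>n. (\<Sum>k<n. D k x) + f (r 0) x)"
      by (intro convergent_add convergent_const)
    moreover have "(\<Sum>k<n. D k x) + f (r 0) x = f (r n) x" for n
      unfolding D_def by (subst sum_lessThan_telescope) simp
    ultimately show ?case by simp
  qed
  \<comment> \<open>Fatou along the subsequence with n fixed; of the bound
    \<open>c (r k) + c n\<close> only \<open>c n\<close> survives.\<close>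
  have "L2sq N (\<lambda>x. lim (\<lambda>k. f (r k) x) - f n x) \<le> c n" for n
  proof -
    have "L2sq N (\<lambda>x. lim (\<lambda>k. f (r k) x) - f n x) = (\<integral>\<^sup>+x. liminf (\<lambda>k. ennreal ((norm (f (r k) x - f n x))\<^sup>2)) \<partial>N)"
      unfolding L2sq_def
    proof (rule nn_integral_cong_AE, use conv in eventually_elim)
      case (elim x)
      then have "(\<lambda>k. f (r k) x) \<longlonglongrightarrow> lim (\<lambda>k. f (r k) x)" by (simp add: convergent_LIMSEQ_iff)
      then have "(\<lambda>k. ennreal ((norm (f (r k) x - f n x))\<^sup>2)) \<longlonglongrightarrow> ennreal ((norm (lim (\<lambda>k. f (r k) x) - f n x))\<^sup>2)"
        by (intro tendsto_ennrealI tendsto_intros)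
      then show ?case by (rule lim_imp_Liminf[OF trivial_limit_sequentially, symmetric])
    qed
    also have "\<dots> \<le> liminf (\<lambda>k. L2sq N (\<lambda>x. f (r k) x - f n x))"
      unfolding L2sq_def by (rule nn_integral_liminf) simp
    also have "\<dots> \<le> liminf (\<lambda>k. ennreal ((1/4)^k) + c n)"
      by (intro Liminf_mono always_eventually allI order_trans[OF cauchy] add_right_mono r)
    also have "(\<lambda>k. ennreal ((1/4)^k) + c n) \<longlonglongrightarrow> ennreal 0 + c n"
      by (intro tendsto_intros tendsto_ennrealI LIMSEQ_power_zero) auto
    then have "liminf (\<lambda>k. ennreal ((1/4)^k) + c n) = c n"
      by (simp add: lim_imp_Liminf)
    finally show ?thesis .
  qed
  then have "(\<lambda>n. L2sq N (\<lambda>x. lim (\<lambda>k. f (r k) x) - f n x)) \<longlonglongrightarrow> 0"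
    by (intro tendsto_sandwich[OF _ _ tendsto_const c]) auto
  then show thesis by (rule that)
qed

section \<open>Integration over simplices\<close>

abbreviation lborel_pow :: "nat \<Rightarrow> (nat \<Rightarrow> real) measure" where
  "lborel_pow n \<equiv> (\<Pi>\<^sub>M i\<in>{..<n}. lborel)"

interpretation lborel_pow: product_sigma_finite "\<lambda>_::nat. lborel :: real measure" ..

lemma sigma_finite_lborel_pow [simp, intro]: "sigma_finite_measure (lborel_pow n)"
  by (rule lborel_pow.sigma_finite) simp

lemma space_lborel_pow: "space (lborel_pow n) = extensional {..<n}"
  by (simp add: space_PiM PiE_def Pi_def)

lemma Delta_in_sets [measurable]: "Delta n S T \<in> sets (lborel_pow n)"
proof -
  have "Delta n S T = {t\<in>space (lborel_pow n). \<forall>i\<in>{..<n}. S < t i \<and> t i < T} \<inter>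
      {t\<in>space (lborel_pow n). \<forall>i\<in>{..<n - 1}. t (Suc i) < t i}"
    by (auto simp: Delta_def space_lborel_pow)
  also have "\<dots> \<in> sets (lborel_pow n)"
  proof (intro sets.Int sets.sets_Collect_finite_All)
    fix i assume "i \<in> {..<n}"
    then have [measurable]: "(\<lambda>t. t i) \<in> borel_measurable (lborel_pow n)"
      using measurable_component_singleton[of i "{..<n}" "\<lambda>_. lborel"] by simp
    show "{t \<in> space (lborel_pow n). S < t i \<and> t i < T} \<in> sets (lborel_pow n)" by measurable
  next
    fix i assume "i \<in> {..<n - 1}"
    then have [measurable]: "(\<lambda>t. t i) \<in> borel_measurable (lborel_pow n)"
        "(\<lambda>t. t (Suc i)) \<in> borel_measurable (lborel_pow n)"
      using measurable_component_singleton[of i "{..<n}" "\<lambda>_. lborel"]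
        measurable_component_singleton[of "Suc i" "{..<n}" "\<lambda>_. lborel"] by simp_all
    show "{t \<in> space (lborel_pow n). t (Suc i) < t i} \<in> sets (lborel_pow n)" by measurable
  qed auto
  finally show ?thesis .
qed

lemma Delta_Int_space [simp]: "Delta n S T \<inter> space (lborel_pow n) = Delta n S T"
  by (auto simp: space_lborel_pow Delta_def)

lemma space_Delta_measure [simp]: "space (Delta_measure n S T) = Delta n S T"
  by (simp add: Delta_measure_def space_restrict_space)

lemma nn_integral_Delta:
  "(\<integral>\<^sup>+ t. f t \<partial>Delta_measure n S T) = (\<integral>\<^sup>+ t. f t * indicator (Delta n S T) t \<partial>lborel_pow n)"
  unfolding Delta_measure_def by (rule nn_integral_restrict_space) simp

lemma space_interval_measure [simp]: "space (interval_measure S T) = {S<..<T}"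
  by (simp add: interval_measure_def space_restrict_space)

lemma nn_integral_interval:
  "(\<integral>\<^sup>+ t. f t \<partial>interval_measure S T) = (\<integral>\<^sup>+ t. f t * indicator {S<..<T} t \<partial>lborel)"
  unfolding interval_measure_def by (rule nn_integral_restrict_space) simp

lemma emeasure_interval_measure:
  "A \<in> sets borel \<Longrightarrow> emeasure (interval_measure S T) (A \<inter> {S<..<T}) = emeasure lborel (A \<inter> {S<..<T})"
  unfolding interval_measure_def by (subst emeasure_restrict_space) auto

lemma finite_interval_measure [simp, intro]: "finite_measure (interval_measure S T)"
proof
  show "emeasure (interval_measure S T) (space (interval_measure S T)) \<noteq> \<infinity>"
    using emeasure_interval_measure[of UNIV S T] by (cases "S \<le> T") auto
qed

lemma sigma_finite_interval_measure [simp, intro]: "sigma_finite_measure (interval_measure S T)"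
  using finite_interval_measure by (simp add: finite_measure_def)

lemma AE_interval_measure: "(AE t in interval_measure S T. P t) \<longleftrightarrow> (AE t in lborel. S < t \<and> t < T \<longrightarrow> P t)"
  unfolding interval_measure_def by (subst AE_restrict_space_iff) auto

lemma AE_interval_measure_mono:
  assumes "AE t in interval_measure S T. P t" "S \<le> S'" "T' \<le> T"
  shows "AE t in interval_measure S' T'. P t"
  using assms(1) unfolding AE_interval_measure by eventually_elim (use assms in auto)

lemma AE_interval_measure_space: "AE t in interval_measure S T. S < t \<and> t < T"
  by (auto simp: AE_interval_measure)

lemma borel_measurable_interval_measure:
  "f \<in> borel_measurable borel \<Longrightarrow> f \<in> borel_measurable (interval_measure S T)"
  unfolding interval_measure_def by (intro measurable_restrict_space1) simp

lemma Delta_0: "Delta 0 S T = {\<lambda>_. undefined}"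
  by (auto simp: Delta_def)

lemma nn_integral_Delta_0: "(\<integral>\<^sup>+ s. f s \<partial>Delta_measure 0 S T) = f (\<lambda>_. undefined)"
proof -
  have "(\<integral>\<^sup>+ s. f s \<partial>Delta_measure 0 S T) = (\<integral>\<^sup>+ s. f s \<partial>PiM {} (\<lambda>_::nat. lborel :: real measure))"
    unfolding nn_integral_Delta
    by (simp add: Delta_0, rule nn_integral_cong) (auto simp: space_PiM)
  also have "\<dots> = f (\<lambda>_. undefined)"
    by (simp add: PiM_empty nn_integral_count_space_finite)
  finally show ?thesis .
qed

section \<open>Splitting off the first or the last time of a simplex\<close>

lemma Delta_less: "s \<in> Delta n S T \<Longrightarrow> i \<le> j \<Longrightarrow> j < n \<Longrightarrow> s j \<le> s i"
proof (induction j)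
  case (Suc j)
  show ?case
  proof (cases "i = Suc j")
    case False
    with Suc have "s j \<le> s i" by simp
    moreover have "s (Suc j) < s j" using Suc by (simp add: Delta_def)
    ultimately show ?thesis by simp
  qed simp
qed simp

text \<open>The first time is the largest, and removing it leaves a simplex with upper end t: the
  recursion of the iterated integrals.\<close>

lemma case_nat_in_Delta_iff:
  "case_nat t s \<in> Delta (Suc n) S T \<longleftrightarrow> S < t \<and> t < T \<and> s \<in> Delta n S t"
proof
  assume l: "case_nat t s \<in> Delta (Suc n) S T"
  have 1: "s i \<le> s 0" "s 0 < t" "S < s i" if "i < n" for i
  proof -
    show "s i \<le> s 0" using Delta_less[OF l, of 1 "Suc i"] that by simp
    have "\<forall>i. Suc i < Suc n \<longrightarrow> case_nat t s i > case_nat t s (Suc i)" using l by (simp add: Delta_def)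
    from this[rule_format, of 0] show "s 0 < t" using that by simp
    have "\<forall>i<Suc n. S < case_nat t s i" using l by (simp add: Delta_def)
    from this[rule_format, of "Suc i"] show "S < s i" using that by simp
  qed
  have "s \<in> extensional {..<n}"
  proof -
    have "\<forall>i. i \<notin> {..<Suc n} \<longrightarrow> case_nat t s i = undefined" using l by (simp add: Delta_def extensional_def)
    then have "case_nat t s (Suc i) = undefined" if "i \<notin> {..<n}" for i
      using that by (auto simp del: nat.case)
    then show ?thesis by (simp add: extensional_def)
  qed
  moreover have "s i > s (Suc i)" if "Suc i < n" for i
  proof -
    have "\<forall>i. Suc i < Suc n \<longrightarrow> case_nat t s i > case_nat t s (Suc i)" using l by (simp add: Delta_def)
    from this[rule_format, of "Suc i"] show ?thesis using that by simp
  qed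
  moreover have "S < t" "t < T" using l by (auto simp: Delta_def)
  ultimately show "S < t \<and> t < T \<and> s \<in> Delta n S t"
    using 1(1,2,3) unfolding Delta_def mem_Collect_eq by (meson le_less_trans)
next
  assume r: "S < t \<and> t < T \<and> s \<in> Delta n S t"
  show "case_nat t s \<in> Delta (Suc n) S T"
  proof -
    have s: "s \<in> extensional {..<n}" "\<forall>i<n. S < s i \<and> s i < t" "\<forall>i. Suc i < n \<longrightarrow> s i > s (Suc i)"
      and t: "S < t" "t < T"
      using r by (auto simp: Delta_def)
    have "case_nat t s \<in> extensional {..<Suc n}"
      using s(1) by (auto simp: extensional_def split: nat.split)
    moreover have "S < case_nat t s i \<and> case_nat t s i < T" if "i < Suc n" for i
      using s(2) t that by (cases i) (auto dest: spec)
    moreover have "case_nat t s i > case_nat t s (Suc i)" if "Suc i < Suc n" for i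
      using s(2,3) t that by (cases i) auto
    ultimately show ?thesis by (simp add: Delta_def)
  qed
qed

text \<open>The last time is the smallest, and removing it leaves a simplex with lower end t: the
  section integrated in \<open>V_norm\<close>. Extensionality of s is assumed because the update
  hides the value of s at n.\<close>

lemma fun_upd_in_Delta_iff:
  assumes "s \<in> extensional {..<n}"
  shows "s(n := t) \<in> Delta (Suc n) S T \<longleftrightarrow> S < t \<and> t < T \<and> s \<in> Delta n t T"
proof
  assume l: "s(n := t) \<in> Delta (Suc n) S T"
  have "S < t" "t < T" using l by (auto simp: Delta_def)
  moreover have "t < s i" "s i < T" if "i < n" for i
  proof -
    obtain k where k: "n = Suc k" using \<open>i < n\<close> by (cases n) auto
    have "s k \<le> s i" using Delta_less[OF l, of i k] that k by simp
    moreover have "\<forall>i. Suc i < Suc n \<longrightarrow> (s(n := t)) i > (s(n := t)) (Suc i)" using l by (simp add: Delta_def)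
    then have "t < s k" unfolding k by (auto dest!: spec[of _ k])
    ultimately show "t < s i" by simp
    have "\<forall>i<Suc n. (s(n := t)) i < T" using l by (simp add: Delta_def)
    from this[rule_format, of i] show "s i < T" using that by simp
  qed
  moreover have "s i > s (Suc i)" if "Suc i < n" for i
  proof -
    have "\<forall>i. Suc i < Suc n \<longrightarrow> (s(n := t)) i > (s(n := t)) (Suc i)" using l by (simp add: Delta_def)
    from this[rule_format, of i] show ?thesis using that by simp
  qed
  ultimately show "S < t \<and> t < T \<and> s \<in> Delta n t T"
    using assms unfolding Delta_def by auto
next
  assume r: "S < t \<and> t < T \<and> s \<in> Delta n t T"
  show "s(n := t) \<in> Delta (Suc n) S T"
  proof -
    have s: "s \<in> extensional {..<n}" "\<forall>i<n. t < s i \<and> s i < T" "\<forall>i. Suc i < n \<longrightarrow> s i > s (Suc i)"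
      and t: "S < t" "t < T"
      using r by (auto simp: Delta_def)
    have "s(n := t) \<in> extensional {..<Suc n}"
      using s(1) by (auto simp: extensional_def)
    moreover have "S < (s(n := t)) i \<and> (s(n := t)) i < T" if "i < Suc n" for i
    proof (cases "i = n")
      case False
      then have "i < n" using that by simp
      with s(2) t False show ?thesis by (auto dest: spec[of _ i])
    qed (use t in simp)
    moreover have "(s(n := t)) i > (s(n := t)) (Suc i)" if "Suc i < Suc n" for i
      using s(2,3) that by (cases "Suc i = n") auto
    ultimately show ?thesis by (simp add: Delta_def)
  qed
qed

lemma measurable_fun_upd_lborel_pow [measurable]:
  "(\<lambda>p. (snd p)(n := fst p)) \<in> lborel \<Otimes>\<^sub>M lborel_pow n \<rightarrow>\<^sub>M lborel_pow (Suc n)"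
proof -
  have "(\<lambda>(f, y). f(n := y)) \<in> lborel_pow n \<Otimes>\<^sub>M lborel \<rightarrow>\<^sub>M PiM (insert n {..<n}) (\<lambda>_. lborel)"
    by (rule measurable_add_dim)
  then have "(\<lambda>(f, y). f(n := y)) \<in> lborel_pow n \<Otimes>\<^sub>M lborel \<rightarrow>\<^sub>M lborel_pow (Suc n)"
    by (simp add: lessThan_Suc)
  from measurable_compose[OF measurable_pair_swap' this] show ?thesis
    by (simp add: case_prod_beta comp_def)
qed

lemma measurable_case_nat_lborel_pow [measurable]:
  "(\<lambda>p. case_nat (fst p) (snd p)) \<in> lborel \<Otimes>\<^sub>M lborel_pow n \<rightarrow>\<^sub>M lborel_pow (Suc n)"
proof (rule measurable_PiM_single')
  fix i assume i: "i \<in> {..<Suc n}"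
  show "(\<lambda>p. case i of 0 \<Rightarrow> fst p | Suc x \<Rightarrow> snd p x) \<in> lborel \<Otimes>\<^sub>M lborel_pow n \<rightarrow>\<^sub>M lborel"
  proof (cases i)
    case (Suc j)
    with i have "(\<lambda>p. snd p j) \<in> lborel \<Otimes>\<^sub>M lborel_pow n \<rightarrow>\<^sub>M lborel"
      by (intro measurable_compose[OF measurable_snd] measurable_component_singleton) auto
    with Suc show ?thesis by simp
  qed simp
next
  show "(\<lambda>p i. case i of 0 \<Rightarrow> fst p | Suc x \<Rightarrow> snd p x) \<in> space (lborel \<Otimes>\<^sub>M lborel_pow n) \<rightarrow> {..<Suc n} \<rightarrow>\<^sub>E space lborel"
    by (auto simp: space_pair_measure space_lborel_pow PiE_def extensional_def split: nat.splits)
qed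

lemma distr_case_nat_lborel_pow:
  "distr (lborel \<Otimes>\<^sub>M lborel_pow n) (lborel_pow (Suc n)) (\<lambda>p. case_nat (fst p) (snd p)) = lborel_pow (Suc n)"
proof (rule lborel_pow.PiM_eqI)
  fix A :: "nat \<Rightarrow> real set" assume A: "\<And>i. i \<in> {..<Suc n} \<Longrightarrow> A i \<in> sets lborel"
  then have A': "A i \<in> sets borel" if "i < Suc n" for i using that by simp
  interpret sigma_finite_measure "lborel_pow n" ..
  have "(\<lambda>p. case_nat (fst p) (snd p)) -` Pi\<^sub>E {..<Suc n} A \<inter> space (lborel \<Otimes>\<^sub>M lborel_pow n)
     = A 0 \<times> Pi\<^sub>E {..<n} (\<lambda>i. A (Suc i))"
    by (auto simp: space_pair_measure space_lborel_pow PiE_def extensional_def Pi_def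
        less_Suc_eq_0_disj split: nat.splits)
  then have "emeasure (distr (lborel \<Otimes>\<^sub>M lborel_pow n) (lborel_pow (Suc n)) (\<lambda>p. case_nat (fst p) (snd p))) (Pi\<^sub>E {..<Suc n} A)
    = emeasure (lborel \<Otimes>\<^sub>M lborel_pow n) (A 0 \<times> Pi\<^sub>E {..<n} (\<lambda>i. A (Suc i)))"
    by (subst emeasure_distr) (auto intro!: sets_PiM_I_finite A')
  also have "\<dots> = emeasure lborel (A 0) * emeasure (lborel_pow n) (Pi\<^sub>E {..<n} (\<lambda>i. A (Suc i)))"
    by (rule emeasure_pair_measure_Times) (auto intro!: sets_PiM_I_finite A')
  also have "\<dots> = (\<Prod>i\<in>{..<Suc n}. emeasure lborel (A i))"
    by (subst lborel_pow.emeasure_PiM) (auto intro!: A' simp: prod.lessThan_Suc_shift simp del: prod.lessThan_Suc)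
  finally show "emeasure (distr (lborel \<Otimes>\<^sub>M lborel_pow n) (lborel_pow (Suc n)) (\<lambda>p. case_nat (fst p) (snd p))) (Pi\<^sub>E {..<Suc n} A)
     = (\<Prod>i\<in>{..<Suc n}. emeasure lborel (A i))" .
qed auto

text \<open>\<open>Theta n S T\<close> is \<open>\<Delta>\<^bsub>n+1\<^esub>(S,T)\<close> with the first coordinate split off.\<close>

definition Theta_set :: "nat \<Rightarrow> real \<Rightarrow> real \<Rightarrow> (real \<times> (nat \<Rightarrow> real)) set" where
  "Theta_set n S T = {(t, s). S < t \<and> t < T \<and> s \<in> Delta n S t}"

definition Theta :: "nat \<Rightarrow> real \<Rightarrow> real \<Rightarrow> (real \<times> (nat \<Rightarrow> real)) measure" where
  "Theta n S T = restrict_space (lborel \<Otimes>\<^sub>M lborel_pow n) (Theta_set n S T)"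

lemma Theta_set_in_sets [measurable]: "Theta_set n S T \<in> sets (lborel \<Otimes>\<^sub>M lborel_pow n)"
proof -
  have "Theta_set n S T = (\<lambda>p. case_nat (fst p) (snd p)) -` Delta (Suc n) S T \<inter> space (lborel \<Otimes>\<^sub>M lborel_pow n)"
    by (auto simp: Theta_set_def case_nat_in_Delta_iff space_pair_measure space_lborel_pow)
      (auto simp: Delta_def)
  also have "\<dots> \<in> sets (lborel \<Otimes>\<^sub>M lborel_pow n)" by measurable
  finally show ?thesis .
qed

lemma Theta_set_in_sets' [simp]: "Theta_set n S T \<in> sets (borel \<Otimes>\<^sub>M lborel_pow n)"
proof -
  have "sets (borel \<Otimes>\<^sub>M lborel_pow n) = sets (lborel \<Otimes>\<^sub>M lborel_pow n)"
    by (rule sets_pair_measure_cong) simp_all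
  with Theta_set_in_sets[of n S T] show ?thesis by blast
qed

lemma Theta_set_Int_space [simp]:
  "Theta_set n S T \<inter> space (lborel \<Otimes>\<^sub>M lborel_pow n) = Theta_set n S T"
  using sets.sets_into_space[OF Theta_set_in_sets] by auto

lemma space_Theta [simp]: "space (Theta n S T) = Theta_set n S T"
  by (simp add: Theta_def space_restrict_space)

lemma borel_measurable_ThetaD:
  fixes F :: "_ \<Rightarrow> ennreal"
  assumes "F \<in> borel_measurable (Theta n S T)"
  shows "(\<lambda>p. F p * indicator (Theta_set n S T) p) \<in> borel_measurable (lborel \<Otimes>\<^sub>M lborel_pow n)"
  using assms unfolding Theta_def by (subst (asm) borel_measurable_restrict_space_iff_ennreal) auto

lemma nn_integral_Theta:
  assumes [measurable]: "F \<in> borel_measurable (Theta n S T)"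
  shows "(\<integral>\<^sup>+ p. F p \<partial>Theta n S T) = (\<integral>\<^sup>+ t. \<integral>\<^sup>+ s. F (t, s) \<partial>Delta_measure n S t \<partial>interval_measure S T)"
    and "(\<lambda>t. \<integral>\<^sup>+ s. F (t, s) \<partial>Delta_measure n S t) \<in> borel_measurable (interval_measure S T)"
proof -
  interpret sigma_finite_measure "lborel_pow n" ..
  note [measurable] = borel_measurable_ThetaD[OF assms]
  have *: "(\<integral>\<^sup>+ s. F (t, s) * indicator (Theta_set n S T) (t, s) \<partial>lborel_pow n)
      = (\<integral>\<^sup>+ s. F (t, s) \<partial>Delta_measure n S t) * indicator {S<..<T} t" for t
    unfolding nn_integral_Delta
    by (cases "S < t \<and> t < T") (auto simp: Theta_set_def indicator_def intro!: nn_integral_cong)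
  have "(\<integral>\<^sup>+ p. F p \<partial>Theta n S T) = (\<integral>\<^sup>+ p. F p * indicator (Theta_set n S T) p \<partial>(lborel \<Otimes>\<^sub>M lborel_pow n))"
    unfolding Theta_def by (rule nn_integral_restrict_space) simp
  also have "\<dots> = (\<integral>\<^sup>+ t. \<integral>\<^sup>+ s. F (t, s) * indicator (Theta_set n S T) (t, s) \<partial>lborel_pow n \<partial>lborel)"
    by (subst nn_integral_fst[symmetric]) auto
  finally show "(\<integral>\<^sup>+ p. F p \<partial>Theta n S T) = (\<integral>\<^sup>+ t. \<integral>\<^sup>+ s. F (t, s) \<partial>Delta_measure n S t \<partial>interval_measure S T)"
    unfolding * nn_integral_interval .
  have "(\<lambda>t. \<integral>\<^sup>+ s. F (t, s) * indicator (Theta_set n S T) (t, s) \<partial>lborel_pow n) \<in> borel_measurable lborel"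
    by measurable
  then have "(\<lambda>t. \<integral>\<^sup>+ s. F (t, s) * indicator (Theta_set n S T) (t, s) \<partial>lborel_pow n) \<in> borel_measurable (interval_measure S T)"
    by (simp add: borel_measurable_interval_measure)
  then show "(\<lambda>t. \<integral>\<^sup>+ s. F (t, s) \<partial>Delta_measure n S t) \<in> borel_measurable (interval_measure S T)"
    by (rule measurable_cong[THEN iffD1, rotated]) (simp add: *)
qed

lemma measurable_case_nat_Theta [measurable]:
  "(\<lambda>p. case_nat (fst p) (snd p)) \<in> Theta n S T \<rightarrow>\<^sub>M Delta_measure (Suc n) S T"
  unfolding Theta_def Delta_measure_def
  by (rule measurable_restrict_space3[OF measurable_case_nat_lborel_pow])
    (auto simp: Theta_set_def case_nat_in_Delta_iff)

lemma nn_integral_Delta_Suc_Theta: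
  assumes "f \<in> borel_measurable (Delta_measure (Suc n) S T)"
  shows "(\<integral>\<^sup>+ x. f x \<partial>Delta_measure (Suc n) S T) = (\<integral>\<^sup>+ p. f (case_nat (fst p) (snd p)) \<partial>Theta n S T)"
proof -
  have f: "(\<lambda>x. f x * indicator (Delta (Suc n) S T) x) \<in> borel_measurable (lborel_pow (Suc n))"
    using assms unfolding Delta_measure_def by (subst (asm) borel_measurable_restrict_space_iff_ennreal) auto
  have "(\<integral>\<^sup>+ x. f x \<partial>Delta_measure (Suc n) S T)
    = (\<integral>\<^sup>+ x. f x * indicator (Delta (Suc n) S T) x \<partial>distr (lborel \<Otimes>\<^sub>M lborel_pow n) (lborel_pow (Suc n)) (\<lambda>p. case_nat (fst p) (snd p)))"
    unfolding distr_case_nat_lborel_pow by (rule nn_integral_Delta)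
  also have "\<dots> = (\<integral>\<^sup>+ p. f (case_nat (fst p) (snd p)) * indicator (Delta (Suc n) S T) (case_nat (fst p) (snd p)) \<partial>(lborel \<Otimes>\<^sub>M lborel_pow n))"
    by (rule nn_integral_distr) (use f in auto)
  also have "\<dots> = (\<integral>\<^sup>+ p. f (case_nat (fst p) (snd p)) * indicator (Theta_set n S T) p \<partial>(lborel \<Otimes>\<^sub>M lborel_pow n))"
    by (intro nn_integral_cong) (auto simp: indicator_def Theta_set_def case_nat_in_Delta_iff)
  also have "\<dots> = (\<integral>\<^sup>+ p. f (case_nat (fst p) (snd p)) \<partial>Theta n S T)"
    unfolding Theta_def by (rule nn_integral_restrict_space[symmetric]) simp
  finally show ?thesis .
qed

lemma nn_integral_Delta_Suc_head:
  assumes [measurable]: "f \<in> borel_measurable (Delta_measure (Suc n) S T)"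
  shows "(\<integral>\<^sup>+ x. f x \<partial>Delta_measure (Suc n) S T)
    = (\<integral>\<^sup>+ t. \<integral>\<^sup>+ s. f (case_nat t s) \<partial>Delta_measure n S t \<partial>interval_measure S T)"
    and "(\<lambda>t. \<integral>\<^sup>+ s. f (case_nat t s) \<partial>Delta_measure n S t) \<in> borel_measurable (interval_measure S T)"
proof -
  have m: "(\<lambda>p. f (case_nat (fst p) (snd p))) \<in> borel_measurable (Theta n S T)" by measurable
  show "(\<integral>\<^sup>+ x. f x \<partial>Delta_measure (Suc n) S T)
    = (\<integral>\<^sup>+ t. \<integral>\<^sup>+ s. f (case_nat t s) \<partial>Delta_measure n S t \<partial>interval_measure S T)"
    using nn_integral_Delta_Suc_Theta[OF assms] nn_integral_Theta(1)[OF m] by simp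
  show "(\<lambda>t. \<integral>\<^sup>+ s. f (case_nat t s) \<partial>Delta_measure n S t) \<in> borel_measurable (interval_measure S T)"
    using nn_integral_Theta(2)[OF m] by simp
qed

lemma nn_integral_Delta_Suc_tail:
  assumes "f \<in> borel_measurable (Delta_measure (Suc n) S T)"
  shows "(\<integral>\<^sup>+ x. f x \<partial>Delta_measure (Suc n) S T)
    = (\<integral>\<^sup>+ t. \<integral>\<^sup>+ s. f (s(n := t)) \<partial>Delta_measure n t T \<partial>interval_measure S T)"
    and "(\<lambda>t. \<integral>\<^sup>+ s. f (s(n := t)) \<partial>Delta_measure n t T) \<in> borel_measurable (interval_measure S T)"
proof -
  interpret sigma_finite_measure "lborel_pow n" ..
  let ?F = "\<lambda>x. f x * indicator (Delta (Suc n) S T) x"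
  have f [measurable]: "?F \<in> borel_measurable (lborel_pow (Suc n))"
    using assms unfolding Delta_measure_def by (subst (asm) borel_measurable_restrict_space_iff_ennreal) auto
  have *: "(\<integral>\<^sup>+ s. ?F (s(n := t)) \<partial>lborel_pow n)
      = (\<integral>\<^sup>+ s. f (s(n := t)) \<partial>Delta_measure n t T) * indicator {S<..<T} t" for t
  proof -
    have "(\<integral>\<^sup>+ s. ?F (s(n := t)) \<partial>lborel_pow n)
      = (\<integral>\<^sup>+ s. f (s(n := t)) * indicator (Delta n t T) s * indicator {S<..<T} t \<partial>lborel_pow n)"
      by (intro nn_integral_cong) (auto simp: space_lborel_pow fun_upd_in_Delta_iff indicator_def)
    also have "\<dots> = (\<integral>\<^sup>+ s. f (s(n := t)) \<partial>Delta_measure n t T) * indicator {S<..<T} t"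
      unfolding nn_integral_Delta by (cases "S < t \<and> t < T") auto
    finally show ?thesis .
  qed
  have "(\<integral>\<^sup>+ x. f x \<partial>Delta_measure (Suc n) S T) = (\<integral>\<^sup>+ x. ?F x \<partial>PiM (insert n {..<n}) (\<lambda>_. lborel))"
    unfolding nn_integral_Delta by (simp add: lessThan_Suc)
  also have "\<dots> = (\<integral>\<^sup>+ t. \<integral>\<^sup>+ s. ?F (s(n := t)) \<partial>lborel_pow n \<partial>lborel)"
    by (rule lborel_pow.product_nn_integral_insert_rev) (use f in \<open>auto simp: lessThan_Suc\<close>)
  finally show "(\<integral>\<^sup>+ x. f x \<partial>Delta_measure (Suc n) S T)
    = (\<integral>\<^sup>+ t. \<integral>\<^sup>+ s. f (s(n := t)) \<partial>Delta_measure n t T \<partial>interval_measure S T)"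
    unfolding * nn_integral_interval .
  have "(\<lambda>p. ?F ((snd p)(n := fst p))) \<in> borel_measurable (lborel \<Otimes>\<^sub>M lborel_pow n)"
    by measurable
  then have "(\<lambda>t. \<integral>\<^sup>+ s. ?F (s(n := t)) \<partial>lborel_pow n) \<in> borel_measurable lborel"
    using borel_measurable_nn_integral_fst[of "\<lambda>p. ?F ((snd p)(n := fst p))" lborel] by simp
  then have "(\<lambda>t. \<integral>\<^sup>+ s. ?F (s(n := t)) \<partial>lborel_pow n) \<in> borel_measurable (interval_measure S T)"
    by (simp add: borel_measurable_interval_measure)
  then show "(\<lambda>t. \<integral>\<^sup>+ s. f (s(n := t)) \<partial>Delta_measure n t T) \<in> borel_measurable (interval_measure S T)"
    by (rule measurable_cong[THEN iffD1, rotated]) (simp add: *)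
qed

lemma measurable_case_nat_section:
  assumes "S < t" "t < T"
  shows "(\<lambda>s. case_nat t s) \<in> Delta_measure n S t \<rightarrow>\<^sub>M Delta_measure (Suc n) S T"
  unfolding Delta_measure_def
proof (rule measurable_restrict_space3)
  have "(\<lambda>s. (t, s)) \<in> lborel_pow n \<rightarrow>\<^sub>M lborel \<Otimes>\<^sub>M lborel_pow n" by simp
  from measurable_compose[OF this measurable_case_nat_lborel_pow]
  show "case_nat t \<in> lborel_pow n \<rightarrow>\<^sub>M lborel_pow (Suc n)" by simp
qed (use assms in \<open>auto simp: case_nat_in_Delta_iff\<close>)

lemma measurable_fun_upd_section:
  assumes "S < t" "t < T"
  shows "(\<lambda>s. s(n := t)) \<in> Delta_measure n t T \<rightarrow>\<^sub>M Delta_measure (Suc n) S T"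
  unfolding Delta_measure_def
proof (rule measurable_restrict_space3)
  have "(\<lambda>s. (t, s)) \<in> lborel_pow n \<rightarrow>\<^sub>M lborel \<Otimes>\<^sub>M lborel_pow n" by simp
  from measurable_compose[OF this measurable_fun_upd_lborel_pow]
  show "(\<lambda>s. s(n := t)) \<in> lborel_pow n \<rightarrow>\<^sub>M lborel_pow (Suc n)" by simp
  show "(\<lambda>s. s(n := t)) \<in> Delta n t T \<rightarrow> Delta (Suc n) S T"
  proof
    fix s assume s: "s \<in> Delta n t T"
    then have "s \<in> extensional {..<n}" by (simp add: Delta_def)
    with s assms show "s(n := t) \<in> Delta (Suc n) S T" by (simp add: fun_upd_in_Delta_iff)
  qed
qed

lemma measurable_Theta_section:
  assumes "S < t" "t < T"
  shows "(\<lambda>s. (t, s)) \<in> Delta_measure n S t \<rightarrow>\<^sub>M Theta n S T"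
  unfolding Delta_measure_def Theta_def
  by (rule measurable_restrict_space3) (use assms in \<open>auto simp: Theta_set_def\<close>)

lemma emeasure_Delta_finite: "emeasure (lborel_pow n) (Delta n S T) < \<infinity>"
proof -
  have "emeasure (lborel_pow n) (Delta n S T) \<le> emeasure (lborel_pow n) (Pi\<^sub>E {..<n} (\<lambda>_. {S..T}))"
  proof (rule emeasure_mono)
    show "Delta n S T \<subseteq> Pi\<^sub>E {..<n} (\<lambda>_. {S..T})"
      by (auto simp: Delta_def PiE_def less_imp_le)
  qed (auto intro!: sets_PiM_I_finite)
  also have "\<dots> = (\<Prod>i\<in>{..<n}. emeasure lborel {S..T})"
    by (subst lborel_pow.emeasure_PiM) auto
  also have "\<dots> < \<infinity>"
    by (cases "S \<le> T") (simp_all add: ennreal_power less_top[symmetric] power_eq_top_ennreal)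
  finally show ?thesis .
qed

lemma finite_measure_Theta [simp, intro]: "finite_measure (Theta n S T)"
proof
  have "emeasure (Theta n S T) (space (Theta n S T)) = (\<integral>\<^sup>+ p. 1 \<partial>Theta n S T)" by simp
  also have "\<dots> = (\<integral>\<^sup>+ x. 1 \<partial>Delta_measure (Suc n) S T)"
    by (subst nn_integral_Delta_Suc_Theta) auto
  also have "\<dots> = emeasure (lborel_pow (Suc n)) (Delta (Suc n) S T)"
    unfolding nn_integral_Delta by simp
  also have "\<dots> \<noteq> \<infinity>" using emeasure_Delta_finite[of "Suc n" S T] by (simp add: less_top)
  finally show "emeasure (Theta n S T) (space (Theta n S T)) \<noteq> \<infinity>" .
qed

section \<open>Independence of increments\<close>

text \<open>The independence hypothesis on \<open>W\<close> and \<open>simple_data\<close> both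
  speak of strictly increasing grids; this turns a finite set of times into such a grid with known
  end points.\<close>

lemma finite_set_enum:
  fixes P :: "real set"
  assumes "finite P" "P \<noteq> {}"
  obtains t :: "nat \<Rightarrow> real" and k where "\<And>i. i < k \<Longrightarrow> t i < t (Suc i)" "P = t ` {..k}"
    "t 0 = Min P" "t k = Max P"
proof -
  let ?l = "sorted_list_of_set P"
  define k where "k = card P - 1"
  have len: "length ?l = Suc k" using assms by (simp add: k_def card_gt_0_iff)
  have mono: "?l ! i < ?l ! j" if "i < j" "j \<le> k" for i j
    proof -
    have "sorted_wrt (<) ?l" by (simp add: strict_sorted_iff)
    from sorted_wrt_nth_less[OF this, of i j] show ?thesis using that len by simp
  qed
  have im: "P = (!) ?l ` {..k}"
    using set_sorted_list_of_set[OF assms(1)] len by (simp add: set_conv_nth) (force simp: less_Suc_eq_le image_def)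
  have "?l ! 0 \<le> x \<and> x \<le> ?l ! k" if x: "x \<in> P" for x
  proof -
    obtain i where i: "x = ?l ! i" "i \<le> k" using x im by blast
    then show ?thesis using mono[of 0 i] mono[of i k] by (cases "i = 0"; cases "i = k") auto
  qed
  then have "?l ! 0 = Min P" "?l ! k = Max P"
    using assms im by (auto intro!: Min_eqI[symmetric] Max_eqI[symmetric])
  then show thesis using mono im by (intro that[of k "(!) ?l"]) auto
qed

lemma strict_chain_less:
  fixes t :: "nat \<Rightarrow> real"
  assumes "\<And>i. i < k \<Longrightarrow> t i < t (Suc i)" "i < j" "j \<le> k"
  shows "t i < t j"
  using assms(2,3)
proof (induction j)
  case (Suc j)
  have "t j < t (Suc j)" using Suc assms(1) by simp
  with Suc show ?case by (cases "i = j") auto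
qed simp

lemma strict_chain_le:
  fixes t :: "nat \<Rightarrow> real"
  assumes "\<And>i. i < k \<Longrightarrow> t i < t (Suc i)" "i \<le> j" "j \<le> k"
  shows "t i \<le> t j"
  using strict_chain_less[of k t i j] assms by (cases "i = j") auto

lemma strict_chain_less_iff:
  fixes t :: "nat \<Rightarrow> real"
  assumes "\<And>i. i < k \<Longrightarrow> t i < t (Suc i)" "i \<le> k" "j \<le> k"
  shows "t i < t j \<longleftrightarrow> i < j" "t i \<le> t j \<longleftrightarrow> i \<le> j"
  using strict_chain_less[of k t i j] strict_chain_less[of k t j i] assms
  by (metis linorder_neqE_nat order_less_asym order_less_irrefl not_less)+

context brownian_motion
begin

section \<open>The augmented filtration and its independence of later increments\<close>

abbreviation FW :: "real \<Rightarrow> real \<Rightarrow> 'w measure" where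
  "FW s t \<equiv> filt M W s t"

definition filt_gens :: "real \<Rightarrow> real \<Rightarrow> 'w set set" where
  "filt_gens s t = {(\<lambda>\<omega>. W r \<omega> - W s \<omega>) -` B \<inter> space M | r B. s \<le> r \<and> r \<le> t \<and> B \<in> sets borel} \<union> null_sets M"

lemma filt_gens_Pow: "filt_gens s t \<subseteq> Pow (space M)"
  by (auto simp: filt_gens_def dest: sets.sets_into_space[OF null_setsD2])

lemma filt_eq: "FW s t = sigma (space M) (filt_gens s t)"
  by (simp add: filt_def filt_gens_def)

lemma space_filt [simp]: "space (FW s t) = space M"
  unfolding filt_eq by (rule space_measure_of) (rule filt_gens_Pow)

lemma sets_filt: "sets (FW s t) = sigma_sets (space M) (filt_gens s t)"
  unfolding filt_eq by (rule sets_measure_of) (rule filt_gens_Pow)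

lemma filt_gens_events: "0 \<le> s \<Longrightarrow> filt_gens s t \<subseteq> sets M"
  unfolding filt_gens_def
  by (auto intro!: measurable_sets[OF borel_measurable_diff] measurable_W)

lemma subalgebra_filt: "0 \<le> s \<Longrightarrow> subalgebra M (FW s t)"
  unfolding subalgebra_def sets_filt space_filt
  using sets.sigma_sets_subset[OF filt_gens_events] by auto

lemma subalgebra_filt_mono: "t \<le> t' \<Longrightarrow> subalgebra (FW s t') (FW s t)"
  unfolding subalgebra_def sets_filt space_filt
  by (auto intro!: sigma_sets_mono' simp: filt_gens_def)
    (metis (no_types, lifting) order_trans)

lemma filt_imp_M: "f \<in> borel_measurable (FW s t) \<Longrightarrow> 0 \<le> s \<Longrightarrow> f \<in> borel_measurable M"
  by (rule measurable_from_subalg[OF subalgebra_filt])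

lemma filt_mono: "f \<in> borel_measurable (FW s t) \<Longrightarrow> t \<le> t' \<Longrightarrow> f \<in> borel_measurable (FW s t')"
  by (rule measurable_from_subalg[OF subalgebra_filt_mono])

lemma W_increment_filt:
  assumes "s \<le> u" "u \<le> t" "s \<le> v" "v \<le> t"
  shows "(\<lambda>\<omega>. W v \<omega> - W u \<omega>) \<in> borel_measurable (FW s t)"
proof -
  have "(\<lambda>\<omega>. W r \<omega> - W s \<omega>) \<in> borel_measurable (FW s t)" if "s \<le> r" "r \<le> t" for r
  proof (rule measurableI)
    fix A :: "real set" assume "A \<in> sets borel"
    with that have "(\<lambda>\<omega>. W r \<omega> - W s \<omega>) -` A \<inter> space M \<in> filt_gens s t"
      by (auto simp: filt_gens_def)
    then show "(\<lambda>\<omega>. W r \<omega> - W s \<omega>) -` A \<inter> space (FW s t) \<in> sets (FW s t)"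
      by (auto simp: sets_filt)
  qed auto
  from borel_measurable_diff[OF this[of v] this[of u]] assms show ?thesis by simp
qed

text \<open>The generators in \<open>filt_gens\<close> constrain one time each and need not be
  stable under intersection. Finite conjunctions are, so together with the null sets these events
  form a pi-system for the filtration.\<close>

definition cylinders :: "real \<Rightarrow> real \<Rightarrow> 'w set set" where
  "cylinders s u = {{\<omega> \<in> space M. \<forall>r\<in>J. W r \<omega> - W s \<omega> \<in> B r} | J B.
     finite J \<and> J \<subseteq> {s..u} \<and> (\<forall>r\<in>J. B r \<in> sets borel)}"

lemma cylinders_events: "0 \<le> s \<Longrightarrow> cylinders s u \<subseteq> sets M"
proof
  fix A assume s: "0 \<le> s" and "A \<in> cylinders s u"
  then obtain J B where A: "A = {\<omega> \<in> space M. \<forall>r\<in>J. W r \<omega> - W s \<omega> \<in> B r}"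
    and J: "finite J" "J \<subseteq> {s..u}" "\<forall>r\<in>J. B r \<in> sets borel"
    by (auto simp: cylinders_def)
  have "{\<omega> \<in> space M. W r \<omega> - W s \<omega> \<in> B r} \<in> sets M" if "r \<in> J" for r
  proof -
    have [measurable]: "W r \<in> borel_measurable M" "W s \<in> borel_measurable M" "B r \<in> sets borel"
      using J s that by (auto intro!: measurable_W)
    show ?thesis by measurable
  qed
  then show "A \<in> sets M" unfolding A using J(1) by (intro sets.sets_Collect_finite_All) auto
qed

lemma Int_stable_cylinders: "Int_stable (cylinders s u \<union> null_sets M)" if "0 \<le> s"
proof (rule Int_stableI)
  fix a b assume a: "a \<in> cylinders s u \<union> null_sets M" and b: "b \<in> cylinders s u \<union> null_sets M"
  have ev: "a \<in> sets M" "b \<in> sets M" using a b cylinders_events[OF that] by auto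
  show "a \<inter> b \<in> cylinders s u \<union> null_sets M"
  proof (cases "a \<in> null_sets M \<or> b \<in> null_sets M")
    case True
    then show ?thesis using ev by (auto intro: null_set_Int1 null_set_Int2)
  next
    case False
    with a b obtain J B J' B' where
      A: "a = {\<omega> \<in> space M. \<forall>r\<in>J. W r \<omega> - W s \<omega> \<in> B r}" "finite J" "J \<subseteq> {s..u}" "\<forall>r\<in>J. B r \<in> sets borel" and
      B: "b = {\<omega> \<in> space M. \<forall>r\<in>J'. W r \<omega> - W s \<omega> \<in> B' r}" "finite J'" "J' \<subseteq> {s..u}" "\<forall>r\<in>J'. B' r \<in> sets borel"
      by (auto simp: cylinders_def)
    \<comment> \<open>A time that occurs in only one of the two families receives the trivial
      constraint \<open>UNIV\<close> from the other.\<close>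
    let ?B = "\<lambda>r. (if r \<in> J then B r else UNIV) \<inter> (if r \<in> J' then B' r else UNIV)"
    have "a \<inter> b = {\<omega> \<in> space M. \<forall>r\<in>J \<union> J'. W r \<omega> - W s \<omega> \<in> ?B r}"
      by (auto simp: A(1) B(1))
    moreover have "\<forall>r\<in>J \<union> J'. ?B r \<in> sets borel" using A(4) B(4) by auto
    moreover have "finite (J \<union> J')" "J \<union> J' \<subseteq> {s..u}" using A B by auto
    ultimately have "a \<inter> b \<in> cylinders s u"
      unfolding cylinders_def mem_Collect_eq by (intro exI[of _ "J \<union> J'"] exI[of _ ?B] conjI)
    then show ?thesis by simp
  qed
qed

text \<open>On a grid through s, u and all times of the cylinder, each W r - W s is a sum of grid
  increments up to u, and W v - W u is the next increment. Independence of all increments separates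
  these two groups.\<close>

lemma cylinder_indep_increment:
  assumes "0 \<le> s" "s \<le> u" "u < v" and A: "A \<in> cylinders s u" and C: "C \<in> sets borel"
  shows "prob (A \<inter> ((\<lambda>\<omega>. W v \<omega> - W u \<omega>) -` C \<inter> space M)) = prob A * prob ((\<lambda>\<omega>. W v \<omega> - W u \<omega>) -` C \<inter> space M)"
proof -
  obtain J B where A: "A = {\<omega> \<in> space M. \<forall>r\<in>J. W r \<omega> - W s \<omega> \<in> B r}"
    and J: "finite J" "J \<subseteq> {s..u}" "\<forall>r\<in>J. B r \<in> sets borel"
    using A by (auto simp: cylinders_def)
  obtain t0 k where t0: "\<And>i. i < k \<Longrightarrow> t0 i < t0 (Suc i)" "J \<union> {s, u} = t0 ` {..k}"
      "t0 0 = Min (J \<union> {s, u})" "t0 k = Max (J \<union> {s, u})"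
    using finite_set_enum[of "J \<union> {s, u}"] J(1) by (metis Un_insert_right finite.intros finite_Un insert_not_empty)
  have t00: "t0 0 = s" unfolding t0(3) by (rule Min_eqI) (use J assms in auto)
  have t0k: "t0 k = u" unfolding t0(4) by (rule Max_eqI) (use J assms in auto)
  \<comment> \<open>The grid ends at u with index k and is followed by v, so increment number k is W
    v - W u.\<close>
  define t where "t i = (if i \<le> k then t0 i else v)" for i
  have t: "t i < t (Suc i)" if "i < Suc k" for i
  proof (cases "i = k")
    case True then show ?thesis using t0k assms by (simp add: t_def)
  next
    case False then show ?thesis using that t0(1)[of i] by (simp add: t_def)
  qed
  define X where "X i \<omega> = W (t (Suc i)) \<omega> - W (t i) \<omega>" for i \<omega>
  have "indep_vars (\<lambda>_. borel) X {..<Suc k}"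
    unfolding X_def by (rule W_increments_indep) (use t t00 assms in \<open>auto simp: t_def\<close>)
  then have ind: "indep_var (PiM {..<k} (\<lambda>_. borel)) (\<lambda>\<omega>. restrict (\<lambda>i. X i \<omega>) {..<k})
      (PiM {k} (\<lambda>_. borel)) (\<lambda>\<omega>. restrict (\<lambda>i. X i \<omega>) {k})"
    by (rule indep_var_restrict) auto
  have "\<exists>i\<le>k. t0 i = r" if "r \<in> J" for r
    using that t0(2) by (metis UnCI atMost_iff imageE)
  then obtain idx where idx: "\<And>r. r \<in> J \<Longrightarrow> idx r \<le> k \<and> t0 (idx r) = r" by metis
  \<comment> \<open>Both events are rewritten as sets of increment vectors, so that independence of
    the two groups applies to a product set.\<close>
  define Xa where "Xa = {x \<in> space (PiM {..<k} (\<lambda>_. borel)). \<forall>r\<in>J. (\<Sum>i<idx r. x i) \<in> B r}"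
  define Xb where "Xb = {x \<in> space (PiM {k} (\<lambda>_. borel)). x k \<in> C}"
  have [measurable]: "Xa \<in> sets (PiM {..<k} (\<lambda>_. borel))"
    unfolding Xa_def
  proof (intro sets.sets_Collect_finite_All J(1))
    fix r assume r: "r \<in> J"
    have "(\<lambda>x. \<Sum>i<idx r. x i) \<in> borel_measurable (PiM {..<k} (\<lambda>_. borel :: real measure))"
      using idx[OF r] by (intro borel_measurable_sum measurable_component_singleton) auto
    from measurable_sets[OF this, of "B r"] J(3) r
    have "(\<lambda>x. \<Sum>i<idx r. x i) -` B r \<inter> space (PiM {..<k} (\<lambda>_. borel)) \<in> sets (PiM {..<k} (\<lambda>_. borel))"
      by blast
    moreover have "{x \<in> space (PiM {..<k} (\<lambda>_. borel)). (\<Sum>i<idx r. x i) \<in> B r}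
      = (\<lambda>x. \<Sum>i<idx r. x i) -` B r \<inter> space (PiM {..<k} (\<lambda>_. borel))"
      by blast
    ultimately show "{x \<in> space (PiM {..<k} (\<lambda>_. borel)). (\<Sum>i<idx r. x i) \<in> B r} \<in> sets (PiM {..<k} (\<lambda>_. borel))"
      by metis
  qed
  have [measurable]: "Xb \<in> sets (PiM {k} (\<lambda>_. borel))"
  proof -
    have "(\<lambda>x. x k) \<in> borel_measurable (PiM {k} (\<lambda>_. borel :: real measure))"
      by (rule measurable_component_singleton) simp
    from measurable_sets[OF this C]
    have "(\<lambda>x. x k) -` C \<inter> space (PiM {k} (\<lambda>_. borel)) \<in> sets (PiM {k} (\<lambda>_. borel))" .
    moreover have "Xb = (\<lambda>x. x k) -` C \<inter> space (PiM {k} (\<lambda>_. borel))"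
      unfolding Xb_def by blast
    ultimately show ?thesis by metis
  qed
  have tel: "(\<Sum>i<j. X i \<omega>) = W (t0 j) \<omega> - W s \<omega>" if "j \<le> k" for j \<omega>
    using that
  proof (induction j)
    case (Suc j)
    then show ?case by (simp add: X_def t_def)
  qed (simp add: t00)
  have eA: "(\<lambda>\<omega>. restrict (\<lambda>i. X i \<omega>) {..<k}) -` Xa \<inter> space M = A"
  proof -
    have "(\<Sum>i<idx r. restrict (\<lambda>i. X i \<omega>) {..<k} i) = W r \<omega> - W s \<omega>" if "r \<in> J" for r \<omega>
      using idx[OF that] tel[of "idx r" \<omega>] by (subst sum.cong[OF refl, of _ _ "\<lambda>i. X i \<omega>"]) auto
    then show ?thesis unfolding A Xa_def by (auto simp: space_PiM)
  qed
  have eC: "(\<lambda>\<omega>. restrict (\<lambda>i. X i \<omega>) {k}) -` Xb \<inter> space M = (\<lambda>\<omega>. W v \<omega> - W u \<omega>) -` C \<inter> space M"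
    unfolding Xb_def by (auto simp: space_PiM X_def t_def t0k)
  have "prob ((\<lambda>x. (restrict (\<lambda>i. X i x) {..<k}, restrict (\<lambda>i. X i x) {k})) -` (Xa \<times> Xb) \<inter> space M)
      = prob A * prob ((\<lambda>\<omega>. W v \<omega> - W u \<omega>) -` C \<inter> space M)"
    by (subst indep_varD[OF ind]) (auto simp: eA eC)
  moreover have "(\<lambda>x. (restrict (\<lambda>i. X i x) {..<k}, restrict (\<lambda>i. X i x) {k})) -` (Xa \<times> Xb) \<inter> space M
     = A \<inter> ((\<lambda>\<omega>. W v \<omega> - W u \<omega>) -` C \<inter> space M)"
    unfolding eA[symmetric] eC[symmetric] by auto
  ultimately show ?thesis by simp
qed

text \<open>Dynkin's argument: cylinders and null sets form a pi-system whose sigma-algebra contains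
  the filtration, and null sets are independent of every event.\<close>

lemma filt_indep_increment:
  assumes "0 \<le> s" "s \<le> u" "u < v"
  shows "indep_set (sets (FW s u)) {(\<lambda>\<omega>. W v \<omega> - W u \<omega>) -` C \<inter> space M | C. C \<in> sets borel}"
proof -
  let ?X = "\<lambda>\<omega>. W v \<omega> - W u \<omega>"
  let ?B = "{?X -` C \<inter> space M | C. C \<in> sets borel}"
  have X: "?X \<in> borel_measurable M" using assms by (intro borel_measurable_diff measurable_W) auto
  have ind: "indep_set (cylinders s u \<union> null_sets M) ?B"
  proof (rule indep_setI)
    show "?B \<subseteq> events" using measurable_sets[OF X] by auto
    fix a b assume a: "a \<in> cylinders s u \<union> null_sets M" and "b \<in> ?B"
    then obtain C where b: "b = ?X -` C \<inter> space M" and C: "C \<in> sets borel" by auto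
    then have bev: "b \<in> events" using measurable_sets[OF X C] by simp
    show "prob (a \<inter> b) = prob a * prob b"
    proof (cases "a \<in> null_sets M")
      case True
      then have "a \<inter> b \<in> null_sets M" using bev by (intro null_set_Int2) 
      with True show ?thesis by (simp add: measure_eq_0_null_sets)
    next
      case False
      with a show ?thesis unfolding b using cylinder_indep_increment[OF assms _ C] by auto
    qed
  qed (use cylinders_events assms in auto)
  have "indep_set (sigma_sets (space M) (cylinders s u \<union> null_sets M)) (sigma_sets (space M) ?B)"
  proof (rule indep_set_sigma_sets[OF ind])
    show "Int_stable (cylinders s u \<union> null_sets M)" by (rule Int_stable_cylinders) (use assms in auto)
    show "Int_stable ?B"
    proof (rule Int_stableI, elim CollectE exE conjE)
      fix a b C C' assume "a = ?X -` C \<inter> space M" "C \<in> sets borel" "b = ?X -` C' \<inter> space M" "C' \<in> sets borel"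
      then have "a \<inter> b = ?X -` (C \<inter> C') \<inter> space M" "C \<inter> C' \<in> sets borel" by auto
      then show "a \<inter> b \<in> ?B" by blast
    qed
  qed
  moreover have "sets (FW s u) \<subseteq> sigma_sets (space M) (cylinders s u \<union> null_sets M)"
    unfolding sets_filt
  proof (rule sigma_sets_mono')
    show "filt_gens s u \<subseteq> cylinders s u \<union> null_sets M"
    proof
      fix a assume "a \<in> filt_gens s u"
      then consider "a \<in> null_sets M" | r B where "a = (\<lambda>\<omega>. W r \<omega> - W s \<omega>) -` B \<inter> space M" "s \<le> r" "r \<le> u" "B \<in> sets borel"
        by (auto simp: filt_gens_def)
      then show "a \<in> cylinders s u \<union> null_sets M"
      proof cases
        case 2
        then have "a = {\<omega> \<in> space M. \<forall>r'\<in>{r}. W r' \<omega> - W s \<omega> \<in> (\<lambda>_. B) r'}" by auto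
        moreover have "finite {r}" "{r} \<subseteq> {s..u}" "\<forall>r'\<in>{r}. (\<lambda>_. B) r' \<in> sets borel" using 2 by auto
        ultimately have "a \<in> cylinders s u"
          unfolding cylinders_def mem_Collect_eq by (intro exI[of _ "{r}"] exI[of _ "\<lambda>_. B"] conjI)
        then show ?thesis by simp
      qed simp
    qed
  qed
  moreover have "?B \<subseteq> sigma_sets (space M) ?B" by auto
  ultimately show ?thesis unfolding indep_set_def
    by (elim indep_sets_mono_sets) (auto split: bool.splits)
qed

text \<open>Needed with h the identity, to remove the cross term in
  \<open>increment_pythagoras\<close>, and with h the square, for the variance term.\<close>

lemma filt_indep_var_increment:
  fixes G :: "'w \<Rightarrow> real" and h :: "real \<Rightarrow> real"
  assumes "0 \<le> s" "s \<le> u" "u < v" and G: "G \<in> borel_measurable (FW s u)" and h: "h \<in> borel_measurable borel"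
  shows "indep_var borel G borel (\<lambda>\<omega>. h (W v \<omega> - W u \<omega>))"
proof -
  let ?X = "\<lambda>\<omega>. W v \<omega> - W u \<omega>"
  let ?B = "{?X -` C \<inter> space M | C. C \<in> sets borel}"
  have X: "?X \<in> borel_measurable M" using assms by (intro borel_measurable_diff measurable_W) auto
  have 1: "{G -` A \<inter> space M | A. A \<in> sets borel} \<subseteq> sets (FW s u)"
    using measurable_sets[OF G] by auto
  have 2: "{(\<lambda>\<omega>. h (?X \<omega>)) -` A \<inter> space M | A. A \<in> sets borel} \<subseteq> ?B"
  proof safe
    fix A :: "real set" assume "A \<in> sets borel"
    then have "h -` A \<in> sets borel" using measurable_sets[OF h] by simp
    then show "\<exists>C. (\<lambda>\<omega>. h (?X \<omega>)) -` A \<inter> space M = ?X -` C \<inter> space M \<and> C \<in> sets borel"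
      by (intro exI[of _ "h -` A"]) auto
  qed
  have "indep_vars (case_bool borel borel) (case_bool G (\<lambda>\<omega>. h (?X \<omega>))) UNIV"
    unfolding indep_vars_def2
  proof safe
    fix i show "case_bool G (\<lambda>\<omega>. h (?X \<omega>)) i \<in> M \<rightarrow>\<^sub>M case_bool borel borel i"
      using filt_imp_M[OF G assms(1)] measurable_compose[OF X h] by (cases i) auto
  next
    show "indep_sets (\<lambda>i. {case_bool G (\<lambda>\<omega>. h (?X \<omega>)) i -` A \<inter> space M |A. A \<in> sets (case_bool borel borel i)}) UNIV"
      using filt_indep_increment[OF assms(1-3)] unfolding indep_set_def
      by (rule indep_sets_mono_sets) (use 1 2 in \<open>auto split: bool.splits\<close>)
  qed
  then show ?thesis unfolding indep_var_def .
qed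

section \<open>Moments of the increments and one step of the isometry\<close>

lemma increment_moments:
  assumes "0 \<le> u" "u < v"
  shows "integrable M (\<lambda>\<omega>. W v \<omega> - W u \<omega>)" "expectation (\<lambda>\<omega>. W v \<omega> - W u \<omega>) = 0"
    "integrable M (\<lambda>\<omega>. (W v \<omega> - W u \<omega>)\<^sup>2)" "expectation (\<lambda>\<omega>. (W v \<omega> - W u \<omega>)\<^sup>2) = v - u"
proof -
  let ?X = "\<lambda>\<omega>. W v \<omega> - W u \<omega>"
  have D: "distributed M lborel ?X (normal_density 0 (sqrt (v - u)))"
    by (rule W_increments_normal) fact+
  have pos: "0 < sqrt (v - u)" using assms by simp
  show "integrable M ?X"
    using distributed_integrable[OF D, of "\<lambda>x. x"] integrable_normal_moment_nz_1[OF pos, of 0] by auto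
  show E: "expectation ?X = 0" by (rule normal_distributed_expectation[OF pos D])
  show "integrable M (\<lambda>\<omega>. (?X \<omega>)\<^sup>2)"
    using distributed_integrable[OF D, of "\<lambda>x. x\<^sup>2"] integrable_normal_moment[OF pos, of 0 2] by auto
  show "expectation (\<lambda>\<omega>. (?X \<omega>)\<^sup>2) = v - u"
    using normal_distributed_variance[OF pos D] E assms by simp
qed

lemma L2sq_eq_integral:
  assumes "integrable M (\<lambda>\<omega>. (norm (f \<omega>))\<^sup>2)"
  shows "L2sq M f = ennreal (expectation (\<lambda>\<omega>. (norm (f \<omega>))\<^sup>2))"
  unfolding L2sq_def by (rule nn_integral_eq_integral[OF assms]) auto

lemma integrable_norm_sq_iff:
  fixes f :: "'w \<Rightarrow> 'b::{second_countable_topology, real_normed_vector}"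
  assumes [measurable]: "f \<in> borel_measurable M"
  shows "integrable M (\<lambda>\<omega>. (norm (f \<omega>))\<^sup>2) \<longleftrightarrow> L2sq M f < \<infinity>"
  unfolding L2sq_def by (subst integrable_iff_bounded) auto

text \<open>\<open>Z\<close> stands for the integral accumulated up to u. The cross term has
  expectation 0 because the inner product of \<open>Z\<close> and \<open>H\<close> is known at time
  u and the increment is independent of it and centred; the square of the increment has expectation
  v - u, independently of \<open>H\<close>.\<close>

lemma increment_pythagoras:
  fixes Z H :: "'w \<Rightarrow> 'b::euclidean_space"
  assumes s: "0 \<le> s" "s \<le> u" "u < v"
    and Z: "Z \<in> borel_measurable (FW s u)" and H: "H \<in> borel_measurable (FW s u)"
    and iZ: "integrable M (\<lambda>\<omega>. (norm (Z \<omega>))\<^sup>2)" and iH: "integrable M (\<lambda>\<omega>. (norm (H \<omega>))\<^sup>2)"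
  shows "L2sq M (\<lambda>\<omega>. Z \<omega> + (W v \<omega> - W u \<omega>) *\<^sub>R H \<omega>) = L2sq M Z + ennreal (v - u) * L2sq M H"
    and "integrable M (\<lambda>\<omega>. (norm (Z \<omega> + (W v \<omega> - W u \<omega>) *\<^sub>R H \<omega>))\<^sup>2)"
proof -
  let ?X = "\<lambda>\<omega>. W v \<omega> - W u \<omega>"
  have [measurable]: "Z \<in> borel_measurable M" "H \<in> borel_measurable M"
    using filt_imp_M Z H s by blast+
  have iZH: "integrable M (\<lambda>\<omega>. Z \<omega> \<bullet> H \<omega>)"
  proof (rule Bochner_Integration.integrable_bound)
    show "integrable M (\<lambda>\<omega>. (norm (Z \<omega>))\<^sup>2 + (norm (H \<omega>))\<^sup>2)" using iZ iH by simp
    show "AE \<omega> in M. norm (Z \<omega> \<bullet> H \<omega>) \<le> norm ((norm (Z \<omega>))\<^sup>2 + (norm (H \<omega>))\<^sup>2)"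
    proof (rule AE_I2)
      fix \<omega>
      have "norm (Z \<omega> \<bullet> H \<omega>) \<le> norm (Z \<omega>) * norm (H \<omega>)" by (simp add: Cauchy_Schwarz_ineq2)
      also have "\<dots> \<le> (norm (Z \<omega>))\<^sup>2 + (norm (H \<omega>))\<^sup>2"
      proof -
        have "0 \<le> (norm (Z \<omega>) - norm (H \<omega>))\<^sup>2" by simp
        moreover have "0 \<le> norm (Z \<omega>) * norm (H \<omega>)" by simp
        ultimately show ?thesis unfolding power2_diff by linarith
      qed
      finally show "norm (Z \<omega> \<bullet> H \<omega>) \<le> norm ((norm (Z \<omega>))\<^sup>2 + (norm (H \<omega>))\<^sup>2)" by simp
    qed
  qed measurable
  note mom = increment_moments[of u v]
  have u: "0 \<le> u" using s by simp
  have ind1: "indep_var borel (\<lambda>\<omega>. Z \<omega> \<bullet> H \<omega>) borel ?X"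
    using filt_indep_var_increment[OF s borel_measurable_inner[OF Z H], of "\<lambda>x. x"] by simp
  have ind2: "indep_var borel (\<lambda>\<omega>. (norm (H \<omega>))\<^sup>2) borel (\<lambda>\<omega>. (?X \<omega>)\<^sup>2)"
    using H by (intro filt_indep_var_increment[OF s, where h = "\<lambda>x. x\<^sup>2"]) auto
  have i1: "integrable M (\<lambda>\<omega>. (Z \<omega> \<bullet> H \<omega>) * ?X \<omega>)"
    by (rule indep_var_integrable[OF ind1 iZH]) (rule mom(1)[OF u s(3)])
  have e1: "expectation (\<lambda>\<omega>. (Z \<omega> \<bullet> H \<omega>) * ?X \<omega>) = 0"
    by (subst indep_var_lebesgue_integral[OF ind1 iZH]) (use mom u s in auto)
  have i2: "integrable M (\<lambda>\<omega>. (norm (H \<omega>))\<^sup>2 * (?X \<omega>)\<^sup>2)"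
    by (rule indep_var_integrable[OF ind2 iH]) (rule mom(3)[OF u s(3)])
  have e2: "expectation (\<lambda>\<omega>. (norm (H \<omega>))\<^sup>2 * (?X \<omega>)\<^sup>2) = expectation (\<lambda>\<omega>. (norm (H \<omega>))\<^sup>2) * (v - u)"
    by (subst indep_var_lebesgue_integral[OF ind2 iH]) (use mom u s in auto)
  have eq: "(norm (Z \<omega> + ?X \<omega> *\<^sub>R H \<omega>))\<^sup>2 = (norm (Z \<omega>))\<^sup>2 + 2 * ((Z \<omega> \<bullet> H \<omega>) * ?X \<omega>) + (norm (H \<omega>))\<^sup>2 * (?X \<omega>)\<^sup>2" for \<omega>
  proof -
    have "(norm (z + x *\<^sub>R h))\<^sup>2 = (norm z)\<^sup>2 + 2 * ((z \<bullet> h) * x) + (norm h)\<^sup>2 * x\<^sup>2" for z h :: 'b and x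
      unfolding power2_norm_eq_inner
      by (simp add: inner_simps inner_commute power2_eq_square algebra_simps)
    then show ?thesis .
  qed
  show I: "integrable M (\<lambda>\<omega>. (norm (Z \<omega> + ?X \<omega> *\<^sub>R H \<omega>))\<^sup>2)"
    unfolding eq using iZ i1 i2 by simp
  have "L2sq M (\<lambda>\<omega>. Z \<omega> + ?X \<omega> *\<^sub>R H \<omega>) = ennreal (expectation (\<lambda>\<omega>. (norm (Z \<omega>))\<^sup>2) + expectation (\<lambda>\<omega>. (norm (H \<omega>))\<^sup>2) * (v - u))"
    unfolding L2sq_eq_integral[OF I] unfolding eq using iZ i1 i2 e1 e2 by simp
  also have "\<dots> = L2sq M Z + ennreal (v - u) * L2sq M H"
    unfolding L2sq_eq_integral[OF iZ] L2sq_eq_integral[OF iH]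
    using s by (simp add: ennreal_mult[symmetric] mult.commute)
  finally show "L2sq M (\<lambda>\<omega>. Z \<omega> + ?X \<omega> *\<^sub>R H \<omega>) = L2sq M Z + ennreal (v - u) * L2sq M H" .
qed

end

section \<open>Step processes\<close>

lemma norm_sum_sq_disjoint:
  fixes f :: "'i \<Rightarrow> 'b::real_normed_vector"
  assumes "finite I" and dis: "\<And>i j. i \<in> I \<Longrightarrow> j \<in> I \<Longrightarrow> i \<noteq> j \<Longrightarrow> f i = 0 \<or> f j = 0"
  shows "(norm (\<Sum>i\<in>I. f i))\<^sup>2 = (\<Sum>i\<in>I. (norm (f i))\<^sup>2)"
proof (cases "\<exists>i\<in>I. f i \<noteq> 0")
  case True
  then obtain i where i: "i \<in> I" "f i \<noteq> 0" by blast
  have z: "f j = 0" if "j \<in> I - {i}" for j using dis[OF i(1), of j] i(2) that by auto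
  have "(\<Sum>j\<in>I. f j) = f i" using assms(1) i(1) z by (simp add: sum.remove)
  moreover have "(\<Sum>j\<in>I. (norm (f j))\<^sup>2) = (norm (f i))\<^sup>2" using assms(1) i(1) z by (simp add: sum.remove)
  ultimately show ?thesis by simp
qed simp

text \<open>Cells are selected by their end points rather than their indices. Used with the paths of
  \<open>W\<close> as h, and with a step function h whose differences are the indicators of the
  cells.\<close>

lemma sum_chain_telescope:
  fixes a :: "nat \<Rightarrow> real" and h :: "real \<Rightarrow> 'b::real_vector"
  assumes chain: "\<And>i. i < N \<Longrightarrow> a i < a (Suc i)" and "p \<le> N" "q \<le> N" "a p < a q"
  shows "(\<Sum>i<N. (if a p \<le> a i \<and> a (Suc i) \<le> a q then h (a (Suc i)) - h (a i) else 0)) = h (a q) - h (a p)"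
proof -
  have pq: "p < q" using assms strict_chain_less_iff[of N a p q] by simp
  have "(a p \<le> a i \<and> a (Suc i) \<le> a q) \<longleftrightarrow> i \<in> {p..<q}" if "i < N" for i
    using that assms strict_chain_less_iff[of N a p i] strict_chain_less_iff[of N a "Suc i" q] by auto
  then have "(\<Sum>i<N. (if a p \<le> a i \<and> a (Suc i) \<le> a q then h (a (Suc i)) - h (a i) else 0))
     = (\<Sum>i<N. if i \<in> {p..<q} then h (a (Suc i)) - h (a i) else 0)"
    by (intro sum.cong) auto
  also have "\<dots> = (\<Sum>i\<in>{..<N} \<inter> {p..<q}. h (a (Suc i)) - h (a i))"
    by (rule sum.inter_restrict[symmetric]) simp
  also have "{..<N} \<inter> {p..<q} = {p..<q}" using assms by auto
  also have "(\<Sum>i\<in>{p..<q}. h (a (Suc i)) - h (a i)) = h (a q) - h (a p)"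
    using sum_Suc_diff'[of p q "\<lambda>i. h (a i)"] pq by simp
  finally show ?thesis .
qed

lemma sum_scaleR_split:
  fixes G :: "nat \<Rightarrow> 'b::real_vector"
  shows "(\<Sum>i<N. g i *\<^sub>R (G i + (if c i then H else 0))) = (\<Sum>i<N. g i *\<^sub>R G i) + (\<Sum>i<N. (if c i then g i else 0)) *\<^sub>R H"
  unfolding scaleR_sum_left sum.distrib[symmetric]
  by (intro sum.cong) (auto simp: scaleR_add_right)

context brownian_motion
begin

section \<open>Adapted square-integrable processes\<close>

abbreviation PM :: "real \<Rightarrow> real \<Rightarrow> (real \<times> 'w) measure" where
  "PM S T \<equiv> interval_measure S T \<Otimes>\<^sub>M M"

lemma L2sq_PM:
  fixes Y :: "('w, 'd::finite) process"
  assumes "case_prod Y \<in> borel_measurable (PM S T)"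
  shows "L2sq (PM S T) (case_prod Y) = (\<integral>\<^sup>+ t. L2sq M (Y t) \<partial>interval_measure S T)"
    and "(\<lambda>t. L2sq M (Y t)) \<in> borel_measurable (interval_measure S T)"
proof -
  note [measurable] = assms
  have [measurable]: "(\<lambda>p. ennreal ((norm (case_prod Y p))\<^sup>2)) \<in> borel_measurable (PM S T)"
    by measurable
  show "L2sq (PM S T) (case_prod Y) = (\<integral>\<^sup>+ t. L2sq M (Y t) \<partial>interval_measure S T)"
    unfolding L2sq_def by (subst nn_integral_fst[symmetric]) auto
  have "(\<lambda>t. \<integral>\<^sup>+ \<omega>. (\<lambda>p. ennreal ((norm (case_prod Y p))\<^sup>2)) (t, \<omega>) \<partial>M) \<in> borel_measurable (interval_measure S T)"
    by (rule borel_measurable_nn_integral_fst) measurable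
  then show "(\<lambda>t. L2sq M (Y t)) \<in> borel_measurable (interval_measure S T)"
    unfolding L2sq_def by simp
qed

lemma L2F_iff:
  "Y \<in> L2F M W S T \<longleftrightarrow> case_prod Y \<in> borel_measurable (PM S T) \<and>
     (\<forall>t\<in>{S<..<T}. Y t \<in> borel_measurable (FW S t)) \<and> L2sq (PM S T) (case_prod Y) < \<infinity>"
  by (simp add: L2F_def L2sq_def)

lemma L2F_measurable: "Y \<in> L2F M W S T \<Longrightarrow> case_prod Y \<in> borel_measurable (PM S T)"
  by (simp add: L2F_def)

lemma L2F_section_measurable:
  "Y \<in> L2F M W S T \<Longrightarrow> 0 \<le> S \<Longrightarrow> S < t \<Longrightarrow> t < T \<Longrightarrow> Y t \<in> borel_measurable M"
  by (auto simp: L2F_def intro: filt_imp_M)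

lemma L2F_finite: "Y \<in> L2F M W S T \<Longrightarrow> L2sq (PM S T) (case_prod Y) < \<infinity>"
  by (simp add: L2F_iff)

lemma L2F_add:
  fixes Y Z :: "('w, 'd::finite) process"
  assumes "Y \<in> L2F M W S T" "Z \<in> L2F M W S T"
  shows "(\<lambda>t \<omega>. Y t \<omega> + c *\<^sub>R Z t \<omega>) \<in> L2F M W S T"
proof -
  note [measurable] = L2F_measurable[OF assms(1)] L2F_measurable[OF assms(2)]
  have "L2sq (PM S T) (\<lambda>p. case_prod Y p + c *\<^sub>R case_prod Z p)
    \<le> 2 * L2sq (PM S T) (case_prod Y) + 2 * L2sq (PM S T) (\<lambda>p. c *\<^sub>R case_prod Z p)"
    by (rule L2sq_add_le) measurable
  also have "\<dots> < \<infinity>"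
    using assms by (simp add: L2sq_scaleR L2F_iff ennreal_mult_less_top)
  finally have "L2sq (PM S T) (\<lambda>p. case_prod Y p + c *\<^sub>R case_prod Z p) < \<infinity>" .
  moreover have "(\<lambda>p. case_prod Y p + c *\<^sub>R case_prod Z p) \<in> borel_measurable (PM S T)" by measurable
  moreover have "(\<lambda>\<omega>. Y t \<omega> + c *\<^sub>R Z t \<omega>) \<in> borel_measurable (FW S t)" if "t \<in> {S<..<T}" for t
    using assms that unfolding L2F_iff by (intro borel_measurable_add borel_measurable_scaleR) auto
  moreover have "case_prod (\<lambda>t \<omega>. Y t \<omega> + c *\<^sub>R Z t \<omega>) = (\<lambda>p. case_prod Y p + c *\<^sub>R case_prod Z p)"
    by (simp add: fun_eq_iff)
  ultimately show ?thesis unfolding L2F_iff by metis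
qed

lemma PM_subinterval:
  fixes Y :: "('w, 'd::finite) process"
  assumes Y: "case_prod Y \<in> borel_measurable (PM S T)" and t: "t \<le> T"
  shows "case_prod Y \<in> borel_measurable (PM S t)"
    and "L2sq (PM S t) (case_prod Y) \<le> L2sq (PM S T) (case_prod Y)"
proof -
  have "id \<in> interval_measure S t \<rightarrow>\<^sub>M interval_measure S T"
    unfolding interval_measure_def using t by (intro measurable_restrict_space3) auto
  then have "(\<lambda>p. (fst p, snd p)) \<in> PM S t \<rightarrow>\<^sub>M PM S T"
    by (intro measurable_Pair measurable_compose[OF measurable_fst] measurable_snd) (auto simp: id_def)
  from measurable_compose[OF this Y]
  show m: "case_prod Y \<in> borel_measurable (PM S t)" by (simp add: case_prod_beta')
  have "L2sq (PM S t) (case_prod Y) = (\<integral>\<^sup>+ r. L2sq M (Y r) * indicator {S<..<t} r \<partial>lborel)"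
    by (simp add: L2sq_PM(1)[OF m] nn_integral_interval)
  also have "\<dots> \<le> (\<integral>\<^sup>+ r. L2sq M (Y r) * indicator {S<..<T} r \<partial>lborel)"
    by (intro nn_integral_mono) (use t in \<open>auto simp: indicator_def\<close>)
  also have "\<dots> = L2sq (PM S T) (case_prod Y)"
    by (simp add: L2sq_PM(1)[OF Y] nn_integral_interval)
  finally show "L2sq (PM S t) (case_prod Y) \<le> L2sq (PM S T) (case_prod Y)" .
qed

lemma L2F_subinterval:
  fixes Y :: "('w, 'd::finite) process"
  assumes Y: "Y \<in> L2F M W S T" and t: "t \<le> T"
  shows "Y \<in> L2F M W S t"
proof -
  note sub = PM_subinterval[OF L2F_measurable[OF Y] t]
  have "L2sq (PM S t) (case_prod Y) < \<infinity>" using sub(2) L2F_finite[OF Y] by (rule le_less_trans)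
  moreover have "Y r \<in> borel_measurable (FW S r)" if "r \<in> {S<..<t}" for r
    using Y that t unfolding L2F_iff by simp
  ultimately show ?thesis using sub(1) unfolding L2F_iff by metis
qed

lemma L2F_cut:
  fixes Y :: "('w, 'd::finite) process"
  assumes Y: "Y \<in> L2F M W S T"
  shows "(\<lambda>t \<omega>. indicator {a<..b} t *\<^sub>R Y t \<omega>) \<in> L2F M W S T"
proof -
  note [measurable] = L2F_measurable[OF Y]
  have [measurable]: "(indicator {a<..b} :: real \<Rightarrow> real) \<in> borel_measurable (interval_measure S T)"
    by (rule borel_measurable_interval_measure) simp
  have le: "L2sq (PM S T) (\<lambda>p. indicator {a<..b} (fst p) *\<^sub>R case_prod Y p) \<le> L2sq (PM S T) (case_prod Y)"
    unfolding L2sq_def by (intro nn_integral_mono) (auto simp: indicator_def)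
  have "(\<lambda>p. indicator {a<..b} (fst p) *\<^sub>R case_prod Y p) \<in> borel_measurable (PM S T)"
    by measurable
  moreover have "case_prod (\<lambda>t \<omega>. indicator {a<..b} t *\<^sub>R Y t \<omega>) = (\<lambda>p. indicator {a<..b} (fst p) *\<^sub>R case_prod Y p)"
    by (simp add: fun_eq_iff)
  moreover have "(\<lambda>\<omega>. indicator {a<..b} t *\<^sub>R Y t \<omega>) \<in> borel_measurable (FW S t)" if "t \<in> {S<..<T}" for t
    using Y that unfolding L2F_iff by (intro borel_measurable_scaleR) auto
  moreover have "L2sq (PM S T) (\<lambda>p. indicator {a<..b} (fst p) *\<^sub>R case_prod Y p) < \<infinity>"
    using le L2F_finite[OF Y] by (rule le_less_trans)
  ultimately show ?thesis unfolding L2F_iff by (intro conjI ballI) simp_all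
qed

text \<open>Each time section of the limit is a pointwise \<open>lim\<close> of adapted sections and
  therefore adapted; here the explicit limit of \<open>L2_complete\<close> pays off.\<close>

lemma L2F_complete:
  fixes Y :: "nat \<Rightarrow> ('w, 'd::finite) process"
  assumes Y: "\<And>n. Y n \<in> L2F M W S T" and c: "c \<longlonglongrightarrow> (0::ennreal)"
    and cauchy: "\<And>m n. L2sq (PM S T) (\<lambda>p. case_prod (Y m) p - case_prod (Y n) p) \<le> c m + c n"
  shows "\<exists>Z\<in>L2F M W S T. (\<lambda>n. L2sq (PM S T) (\<lambda>p. case_prod Z p - case_prod (Y n) p)) \<longlonglongrightarrow> 0"
proof -
  note [measurable] = L2F_measurable[OF Y]
  obtain r :: "nat \<Rightarrow> nat" where
    r: "(\<lambda>n. L2sq (PM S T) (\<lambda>p. lim (\<lambda>k. case_prod (Y (r k)) p) - case_prod (Y n) p)) \<longlonglongrightarrow> 0"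
    by (rule L2_complete[of "\<lambda>n. case_prod (Y n)" "PM S T", OF _ c cauchy]) auto
  define Z where "Z t \<omega> = lim (\<lambda>k. Y (r k) t \<omega>)" for t \<omega>
  have Z: "case_prod Z p = lim (\<lambda>k. case_prod (Y (r k)) p)" for p
    by (simp add: Z_def case_prod_beta')
  have m [measurable]: "case_prod Z \<in> borel_measurable (PM S T)"
    by (subst Z[abs_def]) measurable
  have lim: "(\<lambda>n. L2sq (PM S T) (\<lambda>p. case_prod Z p - case_prod (Y n) p)) \<longlonglongrightarrow> 0"
    using r by (simp only: Z)
  have "Z t \<in> borel_measurable (FW S t)" if "t \<in> {S<..<T}" for t
  proof -
    have [measurable]: "Y n t \<in> borel_measurable (FW S t)" for n using Y that by (auto simp: L2F_iff)
    show ?thesis unfolding Z_def by measurable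
  qed
  moreover have "L2sq (PM S T) (case_prod Z) < \<infinity>"
  proof -
    from order_tendstoD(2)[OF lim, of 1] obtain n where
      n: "L2sq (PM S T) (\<lambda>p. case_prod Z p - case_prod (Y n) p) < 1"
      by (auto simp: eventually_sequentially)
    have "L2sq (PM S T) (\<lambda>p. (case_prod Z p - case_prod (Y n) p) + case_prod (Y n) p)
      \<le> 2 * L2sq (PM S T) (\<lambda>p. case_prod Z p - case_prod (Y n) p) + 2 * L2sq (PM S T) (case_prod (Y n))"
      by (rule L2sq_add_le) measurable
    also have "\<dots> < \<infinity>"
      using L2F_finite[OF Y[of n]] order_less_trans[OF n] by (auto simp: ennreal_mult_less_top)
    finally show ?thesis by (simp only: diff_add_cancel)
  qed
  ultimately have "Z \<in> L2F M W S T" using m by (simp add: L2F_iff)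
  with lim show ?thesis by blast
qed

text \<open>Pairs of a step process and its It\^o integral, with possibly overlapping intervals. In
  contrast to \<open>simple_data\<close> these are closed under addition without refining partitions.\<close>

inductive elem :: "real \<Rightarrow> real \<Rightarrow> ('w, 'd::finite) process \<Rightarrow> ('w \<Rightarrow> 'd mat) \<Rightarrow> bool" for S T where
  elem_zero: "elem S T (\<lambda>_ _. 0) (\<lambda>_. 0)"
| elem_step: "elem S T V X \<Longrightarrow> S \<le> u \<Longrightarrow> u < v \<Longrightarrow> v \<le> T \<Longrightarrow> H \<in> borel_measurable (FW S u) \<Longrightarrow>
    integrable M (\<lambda>\<omega>. (norm (H \<omega>))\<^sup>2) \<Longrightarrow>
    elem S T (\<lambda>t \<omega>. V t \<omega> + indicator {u<..v} t *\<^sub>R H \<omega>) (\<lambda>\<omega>. X \<omega> + (W v \<omega> - W u \<omega>) *\<^sub>R H \<omega>)"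

text \<open>The claim is made for every grid through the finite set of break points, since a grid
  fixed beforehand would not survive the new break points u and v of the induction step.\<close>

lemma elem_partition:
  fixes V :: "('w, 'd::finite) process"
  assumes "elem S T V X" "0 \<le> S"
  shows "\<exists>P. finite P \<and> P \<subseteq> {S..T} \<and> (\<forall>N a. a 0 = S \<and> a N = T \<and> (\<forall>i<N. a i < a (Suc i)) \<and> P \<subseteq> a ` {..N} \<longrightarrow>
     (\<exists>H. simple_data M W S T N a H \<and> V = simple_proc N a H \<and> X = simple_integral W N a H))"
  using assms
proof (induction rule: elem.induct)
  case elem_zero
  have "simple_data M W S T N a (\<lambda>_ _. 0 :: 'd mat) \<and> (\<lambda>_ _. 0 :: 'd mat) = simple_proc N a (\<lambda>_ _. 0) \<and>
      (\<lambda>_. 0 :: 'd mat) = simple_integral W N a (\<lambda>_ _. 0)"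
    if "a 0 = S" "a N = T" "\<forall>i<N. a i < a (Suc i)" for N a
    using that by (auto simp: simple_data_def simple_proc_def simple_integral_def fun_eq_iff)
  then show ?case by (intro exI[of _ "{}"]) blast
next
  case (elem_step V X u v H)
  obtain P where P: "finite P" "P \<subseteq> {S..T}"
    and PH: "\<And>N a. a 0 = S \<Longrightarrow> a N = T \<Longrightarrow> (\<forall>i<N. a i < a (Suc i)) \<Longrightarrow> P \<subseteq> a ` {..N} \<Longrightarrow>
     (\<exists>H. simple_data M W S T N a H \<and> V = simple_proc N a H \<and> X = simple_integral W N a H)"
    using elem_step.IH[OF \<open>0 \<le> S\<close>] by metis
  have "\<exists>H'. simple_data M W S T N a H' \<and> (\<lambda>t \<omega>. V t \<omega> + indicator {u<..v} t *\<^sub>R H \<omega>) = simple_proc N a H' \<and>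
        (\<lambda>\<omega>. X \<omega> + (W v \<omega> - W u \<omega>) *\<^sub>R H \<omega>) = simple_integral W N a H'"
    if a: "a 0 = S" "a N = T" "\<forall>i<N. a i < a (Suc i)" "P \<union> {u, v} \<subseteq> a ` {..N}" for N a
  proof -
    obtain G where G: "simple_data M W S T N a G" "V = simple_proc N a G" "X = simple_integral W N a G"
      using PH[of a N] a by blast
    obtain p q where pq: "p \<le> N" "q \<le> N" "u = a p" "v = a q" using a(4) by auto
    \<comment> \<open>These are the cells inside (u, v]; only there is the new coefficient
      \<open>H\<close> added.\<close>
    let ?c = "\<lambda>i. a p \<le> a i \<and> a (Suc i) \<le> a q"
    define H' where "H' i \<omega> = G i \<omega> + (if ?c i then H \<omega> else 0)" for i \<omega>
    have tel: "(\<Sum>i<N. (if ?c i then h (a (Suc i)) - h (a i) else 0)) = h v - h u" for h :: "real \<Rightarrow> real"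
      unfolding pq(3,4) by (rule sum_chain_telescope) (use pq a elem_step in auto)
    have 1: "simple_data M W S T N a H'"
      unfolding simple_data_def
    proof (intro conjI allI impI)
      fix i assume i: "i < N"
      have Gi: "G i \<in> borel_measurable (FW S (a i))" "integrable M (\<lambda>\<omega>. (norm (G i \<omega>))\<^sup>2)"
        using G(1) i by (auto simp: simple_data_def)
      have "H' i \<in> borel_measurable (FW S (a i)) \<and> integrable M (\<lambda>\<omega>. (norm (H' i \<omega>))\<^sup>2)"
      proof (cases "?c i")
        case True
        \<comment> \<open>On such a cell u <= a i, so \<open>H\<close> is already known at the left
          end point.\<close>
        have H: "H \<in> borel_measurable (FW S (a i))"
          by (rule filt_mono[OF elem_step.hyps(5)]) (use True pq in linarith)
        then have m: "H' i \<in> borel_measurable (FW S (a i))"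
          unfolding H'_def[abs_def] using True Gi by simp
        have mM: "G i \<in> borel_measurable M" "H \<in> borel_measurable M"
          using filt_imp_M Gi H \<open>0 \<le> S\<close> by blast+
        have "L2sq M (\<lambda>\<omega>. G i \<omega> + H \<omega>) \<le> 2 * L2sq M (G i) + 2 * L2sq M H"
          by (rule L2sq_add_le) fact+
        also have "\<dots> < \<infinity>"
          using Gi(2) elem_step mM by (auto simp: integrable_norm_sq_iff ennreal_mult_less_top)
        finally have "integrable M (\<lambda>\<omega>. (norm (G i \<omega> + H \<omega>))\<^sup>2)"
          using mM by (subst integrable_norm_sq_iff) auto
        with m True show ?thesis by (simp add: H'_def)
      next
        case False
        with Gi show ?thesis by (auto simp: H'_def[abs_def])
      qed
      then show "H' i \<in> borel_measurable (FW S (a i))" "integrable M (\<lambda>\<omega>. (norm (H' i \<omega>))\<^sup>2)" by auto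
    qed (use a in auto)
    have "V t \<omega> + indicator {u<..v} t *\<^sub>R H \<omega> = simple_proc N a H' t \<omega>" for t \<omega>
    proof -
      \<comment> \<open>Written as a difference of two step functions, the indicator telescopes over
        the cells just like the increments of \<open>W\<close>.\<close>
      have ind: "(indicator {x<..y} t :: real) = (if t \<le> y then 1 else 0) - (if t \<le> x then 1 else 0)" if "x < y" for x y
        using that by (auto simp: indicator_def)
      have "simple_proc N a H' t \<omega> = V t \<omega> + (\<Sum>i<N. (if ?c i then indicator {a i<..a (Suc i)} t else 0)) *\<^sub>R H \<omega>"
        unfolding G(2) simple_proc_def H'_def
        by (rule sum_scaleR_split)
      also have "(\<Sum>i<N. (if ?c i then indicator {a i<..a (Suc i)} t else 0)) = (indicator {u<..v} t :: real)"
        unfolding ind[OF elem_step(3)] tel[of "\<lambda>y. if t \<le> y then 1 else 0", symmetric]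
        by (intro sum.cong refl if_cong) (use a ind in auto)
      finally show ?thesis by simp
    qed
    moreover have "X \<omega> + (W v \<omega> - W u \<omega>) *\<^sub>R H \<omega> = simple_integral W N a H' \<omega>" for \<omega>
    proof -
      have "simple_integral W N a H' \<omega> = X \<omega> + (\<Sum>i<N. (if ?c i then W (a (Suc i)) \<omega> - W (a i) \<omega> else 0)) *\<^sub>R H \<omega>"
        unfolding G(3) simple_integral_def H'_def
        by (rule sum_scaleR_split)
      then show ?thesis by (simp only: tel[of "\<lambda>x. W x \<omega>"])
    qed
    ultimately show ?thesis using 1 by blast
  qed
  note main = this
  have "finite (P \<union> {u, v})" "P \<union> {u, v} \<subseteq> {S..T}" using P elem_step.hyps(2-4) by auto
  then show ?case
  proof (intro exI[of _ "P \<union> {u, v}"] conjI allI impI)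
    fix N a
    assume "a 0 = S \<and> a N = T \<and> (\<forall>i<N. a i < a (Suc i)) \<and> P \<union> {u, v} \<subseteq> a ` {..N}"
    then show "\<exists>H'. simple_data M W S T N a H' \<and> (\<lambda>t \<omega>. V t \<omega> + indicator {u<..v} t *\<^sub>R H \<omega>) = simple_proc N a H' \<and>
        (\<lambda>\<omega>. X \<omega> + (W v \<omega> - W u \<omega>) *\<^sub>R H \<omega>) = simple_integral W N a H'"
      by (elim conjE) (rule main)
  qed
qed

lemma elem_imp_simple:
  fixes V :: "('w, 'd::finite) process"
  assumes "elem S T V X" "0 \<le> S" "S < T"
  obtains N a H where "simple_data M W S T N a H" "V = simple_proc N a H" "X = simple_integral W N a H"
proof -
  obtain P where P: "finite P" "P \<subseteq> {S..T}"
    and PH: "\<And>N a. a 0 = S \<Longrightarrow> a N = T \<Longrightarrow> (\<forall>i<N. a i < a (Suc i)) \<Longrightarrow> P \<subseteq> a ` {..N} \<Longrightarrow>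
     (\<exists>H. simple_data M W S T N a H \<and> V = simple_proc N a H \<and> X = simple_integral W N a H)"
    using elem_partition[OF assms(1,2)] by metis
  obtain a N where a: "\<And>i. i < N \<Longrightarrow> a i < a (Suc i)" "P \<union> {S, T} = a ` {..N}"
    "a 0 = Min (P \<union> {S, T})" "a N = Max (P \<union> {S, T})"
    using finite_set_enum[of "P \<union> {S, T}"] P(1) by (metis Un_insert_right finite.intros finite_Un insert_not_empty)
  have "a 0 = S" unfolding a(3) by (rule Min_eqI) (use P assms in auto)
  moreover have "a N = T" unfolding a(4) by (rule Max_eqI) (use P assms in auto)
  ultimately show thesis using PH[of a N] a that by auto
qed

lemma simple_imp_elem:
  fixes H :: "nat \<Rightarrow> 'w \<Rightarrow> 'd::finite mat"
  assumes "simple_data M W S T N a H"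
  shows "elem S T (simple_proc N a H) (simple_integral W N a H)"
proof -
  have a: "a 0 = S" "a N = T" "\<And>i. i < N \<Longrightarrow> a i < a (Suc i)"
    and H: "\<And>i. i < N \<Longrightarrow> H i \<in> borel_measurable (FW S (a i)) \<and> integrable M (\<lambda>\<omega>. (norm (H i \<omega>))\<^sup>2)"
    using assms by (auto simp: simple_data_def)
  have "elem S T (simple_proc n a H) (simple_integral W n a H)" if "n \<le> N" for n
    using that
  proof (induction n)
    case 0
    show ?case unfolding simple_proc_def simple_integral_def using elem_zero by simp
  next
    case (Suc n)
    have "S \<le> a n" "a (Suc n) \<le> T"
      using strict_chain_le[of N a 0 n] strict_chain_le[of N a "Suc n" N] a Suc by auto
    moreover have "elem S T (simple_proc n a H) (simple_integral W n a H)" using Suc by simp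
    ultimately have "elem S T (\<lambda>t \<omega>. simple_proc n a H t \<omega> + indicator {a n<..a (Suc n)} t *\<^sub>R H n \<omega>)
       (\<lambda>\<omega>. simple_integral W n a H \<omega> + (W (a (Suc n)) \<omega> - W (a n) \<omega>) *\<^sub>R H n \<omega>)"
      using a(3)[of n] H[of n] Suc by (intro elem_step) auto
    then show ?case unfolding simple_proc_def simple_integral_def by simp
  qed
  then show ?thesis by simp
qed

lemma elem_plus:
  assumes "elem S T V X" "elem S T V' X'"
  shows "elem S T (\<lambda>t \<omega>. V t \<omega> + V' t \<omega>) (\<lambda>\<omega>. X \<omega> + X' \<omega>)"
  using assms(2)
proof (induction rule: elem.induct)
  case (elem_step V' X' u v H)
  from elem.elem_step[OF elem_step.IH elem_step.hyps(2-)] show ?case by (simp add: add.assoc)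
qed (use assms(1) in simp)

lemma elem_scale:
  assumes "elem S T V X"
  shows "elem S T (\<lambda>t \<omega>. c *\<^sub>R V t \<omega>) (\<lambda>\<omega>. c *\<^sub>R X \<omega>)"
  using assms
proof (induction rule: elem.induct)
  case (elem_step V X u v H)
  have "integrable M (\<lambda>\<omega>. (norm (c *\<^sub>R H \<omega>))\<^sup>2)"
    using elem_step by (simp add: power_mult_distrib)
  moreover have "(\<lambda>\<omega>. c *\<^sub>R H \<omega>) \<in> borel_measurable (FW S u)" using elem_step by simp
  ultimately show ?case using elem.elem_step[OF elem_step.IH elem_step.hyps(2-4), of "\<lambda>\<omega>. c *\<^sub>R H \<omega>"]
    by (simp add: scaleR_add_right mult.commute)
qed (use elem_zero in simp)

lemma elem_mono:
  assumes "elem S T V X" "T \<le> T'"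
  shows "elem S T' V X"
  using assms
proof (induction rule: elem.induct)
  case (elem_step V X u v H)
  show ?case by (rule elem.elem_step) (use elem_step in auto)
qed (rule elem_zero)

text \<open>Intersecting (u, v] with (a, b] moves the left end to max a u, where \<open>H\<close> is
  still known. The integral of the cut process is left existential, because only the step process is
  of interest.\<close>

lemma elem_cut:
  assumes "elem S T V X" "S \<le> a" "a < b"
  shows "\<exists>X'. elem S b (\<lambda>t \<omega>. indicator {a<..b} t *\<^sub>R V t \<omega>) X'"
  using assms
proof (induction rule: elem.induct)
  case elem_zero
  then show ?case using elem.elem_zero by (intro exI[of _ "\<lambda>_. 0"]) simp
next
  case (elem_step V X u v H)
  then obtain X' where X': "elem S b (\<lambda>t \<omega>. indicator {a<..b} t *\<^sub>R V t \<omega>) X'" by auto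
  show ?case
  proof (cases "max a u < min b v")
    case True
    have "(indicator {a<..b} t * indicator {u<..v} t :: real) = indicator {max a u<..min b v} t" for t
      by (auto simp: indicator_def)
    moreover have "H \<in> borel_measurable (FW S (max a u))" by (rule filt_mono[OF elem_step.hyps(5)]) simp
    then have "elem S b (\<lambda>t \<omega>. indicator {a<..b} t *\<^sub>R V t \<omega> + indicator {max a u<..min b v} t *\<^sub>R H \<omega>)
        (\<lambda>\<omega>. X' \<omega> + (W (min b v) \<omega> - W (max a u) \<omega>) *\<^sub>R H \<omega>)"
      using elem_step True by (intro elem.elem_step X') auto
    ultimately show ?thesis by (auto simp: scaleR_add_right)
  next
    case False
    then have eq: "(\<lambda>t \<omega>. indicator {a<..b} t *\<^sub>R (V t \<omega> + indicator {u<..v} t *\<^sub>R H \<omega>)) = (\<lambda>t \<omega>. indicator {a<..b} t *\<^sub>R V t \<omega>)"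
      by (auto simp: indicator_def fun_eq_iff)
    show ?thesis unfolding eq using X' by blast
  qed
qed

lemma elem_support:
  assumes "elem S T V X" "\<not> (S < t \<and> t \<le> T)"
  shows "V t \<omega> = 0"
  using assms by (induction rule: elem.induct) (auto simp: indicator_def)

lemma elem_integral_measurable:
  fixes V :: "('w, 'd::finite) process"
  assumes "elem S T V X" "0 \<le> S"
  shows "X \<in> borel_measurable (FW S T)"
  using assms
proof (induction rule: elem.induct)
  case (elem_step V X u v H)
  have [measurable]: "H \<in> borel_measurable (FW S T)" by (rule filt_mono[OF elem_step.hyps(5)]) (use elem_step.hyps(3,4) in linarith)
  have [measurable]: "(\<lambda>\<omega>. W v \<omega> - W u \<omega>) \<in> borel_measurable (FW S T)"
    by (rule W_increment_filt) (use elem_step in auto)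
  have [measurable]: "X \<in> borel_measurable (FW S T)" using elem_step by simp
  show ?case by measurable
qed simp

text \<open>The constant c is carried along so that the isometry contains the orthogonality of
  constants and integrals, the germ of the orthogonality of all chaos orders. The three claims are
  proved together since \<open>increment_pythagoras\<close> requires integrability and adaptedness
  of the partial sum.\<close>

lemma simple_isometry_aux:
  fixes H :: "nat \<Rightarrow> 'w \<Rightarrow> 'd::finite mat"
  assumes sd: "simple_data M W S T N a H" and S: "0 \<le> S" and n: "n \<le> N"
  shows "L2sq M (\<lambda>\<omega>. c + simple_integral W n a H \<omega>)
      = ennreal ((norm c)\<^sup>2) + (\<Sum>i<n. ennreal (a (Suc i) - a i) * L2sq M (H i))
    \<and> integrable M (\<lambda>\<omega>. (norm (c + simple_integral W n a H \<omega>))\<^sup>2)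
    \<and> simple_integral W n a H \<in> borel_measurable (FW S (a n))"
  using n
proof (induction n)
  case 0
  have "L2sq M (\<lambda>\<omega>. c) = ennreal ((norm c)\<^sup>2)" by (simp add: L2sq_def emeasure_space_1)
  then show ?case by (simp add: simple_integral_def[abs_def])
next
  case (Suc n)
  have a: "a 0 = S" "a N = T" "\<And>i. i < N \<Longrightarrow> a i < a (Suc i)"
    and H: "H n \<in> borel_measurable (FW S (a n))" "integrable M (\<lambda>\<omega>. (norm (H n \<omega>))\<^sup>2)"
    using sd Suc by (auto simp: simple_data_def)
  have Sa: "S \<le> a n" "a n < a (Suc n)" using strict_chain_le[of N a 0 n] a Suc by auto
  have IH: "L2sq M (\<lambda>\<omega>. c + simple_integral W n a H \<omega>)
      = ennreal ((norm c)\<^sup>2) + (\<Sum>i<n. ennreal (a (Suc i) - a i) * L2sq M (H i))"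
    "integrable M (\<lambda>\<omega>. (norm (c + simple_integral W n a H \<omega>))\<^sup>2)"
    "simple_integral W n a H \<in> borel_measurable (FW S (a n))"
    using Suc by auto
  have eq: "simple_integral W (Suc n) a H = (\<lambda>\<omega>. simple_integral W n a H \<omega> + (W (a (Suc n)) \<omega> - W (a n) \<omega>) *\<^sub>R H n \<omega>)"
    by (simp add: simple_integral_def fun_eq_iff)
  have "(\<lambda>\<omega>. c + simple_integral W n a H \<omega>) \<in> borel_measurable (FW S (a n))" using IH(3) by simp
  note P = increment_pythagoras[OF S Sa this H(1) IH(2) H(2)]
  have "simple_integral W (Suc n) a H \<in> borel_measurable (FW S (a (Suc n)))"
  proof -
    have [measurable]: "H n \<in> borel_measurable (FW S (a (Suc n)))" "simple_integral W n a H \<in> borel_measurable (FW S (a (Suc n)))"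
      by (rule filt_mono[OF H(1) less_imp_le[OF Sa(2)]], rule filt_mono[OF IH(3) less_imp_le[OF Sa(2)]])
    have [measurable]: "(\<lambda>\<omega>. W (a (Suc n)) \<omega> - W (a n) \<omega>) \<in> borel_measurable (FW S (a (Suc n)))"
      by (rule W_increment_filt) (use Sa in auto)
    show ?thesis unfolding eq by measurable
  qed
  with P IH(1) show ?case unfolding eq by (simp add: add.assoc)
qed

lemma simple_proc_L2sq:
  fixes H :: "nat \<Rightarrow> 'w \<Rightarrow> 'd::finite mat"
  assumes sd: "simple_data M W S T N a H" and S: "0 \<le> S"
  shows "L2sq (PM S T) (case_prod (simple_proc N a H)) = (\<Sum>i<N. ennreal (a (Suc i) - a i) * L2sq M (H i))"
    and "case_prod (simple_proc N a H) \<in> borel_measurable (PM S T)"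
proof -
  have a: "a 0 = S" "a N = T" "\<And>i. i < N \<Longrightarrow> a i < a (Suc i)"
    and H: "\<And>i. i < N \<Longrightarrow> H i \<in> borel_measurable (FW S (a i))"
    using sd by (auto simp: simple_data_def)
  have HM: "H i \<in> borel_measurable M" if "i < N" for i using filt_imp_M[OF H[OF that] S] .
  have ind [measurable]: "(\<lambda>t. indicator {a i<..a (Suc i)} t :: real) \<in> borel_measurable (interval_measure S T)" for i
    by (rule borel_measurable_interval_measure) simp
  have mm: "(\<lambda>p. indicator {a i<..a (Suc i)} (fst p) *\<^sub>R H i (snd p)) \<in> borel_measurable (PM S T)" if "i < N" for i
    using HM[OF that] by measurable
  have "(\<lambda>p. \<Sum>i<N. indicator {a i<..a (Suc i)} (fst p) *\<^sub>R H i (snd p)) \<in> borel_measurable (PM S T)"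
    by (intro borel_measurable_sum) (use mm in simp)
  then show m: "case_prod (simple_proc N a H) \<in> borel_measurable (PM S T)"
    by (simp add: simple_proc_def case_prod_beta')
  have pt: "ennreal ((norm (simple_proc N a H t \<omega>))\<^sup>2) = (\<Sum>i<N. indicator {a i<..a (Suc i)} t * ennreal ((norm (H i \<omega>))\<^sup>2))" for t \<omega>
  proof -
    have "(norm (simple_proc N a H t \<omega>))\<^sup>2 = (\<Sum>i<N. (norm (indicator {a i<..a (Suc i)} t *\<^sub>R H i \<omega>))\<^sup>2)"
      unfolding simple_proc_def
    proof (rule norm_sum_sq_disjoint)
      fix i j assume ij: "i \<in> {..<N}" "j \<in> {..<N}" "i \<noteq> j"
      then consider "i < j" | "j < i" by linarith
      then show "indicator {a i<..a (Suc i)} t *\<^sub>R H i \<omega> = 0 \<or> indicator {a j<..a (Suc j)} t *\<^sub>R H j \<omega> = 0"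
      proof cases
        case 1
        then have "a (Suc i) \<le> a j" using strict_chain_le[of N a "Suc i" j] a ij by auto
        then show ?thesis by (auto simp: indicator_def)
      next
        case 2
        then have "a (Suc j) \<le> a i" using strict_chain_le[of N a "Suc j" i] a ij by auto
        then show ?thesis by (auto simp: indicator_def)
      qed
    qed simp
    also have "ennreal \<dots> = (\<Sum>i<N. ennreal ((norm (indicator {a i<..a (Suc i)} t *\<^sub>R H i \<omega>))\<^sup>2))"
      by (rule sum_ennreal[symmetric]) simp
    also have "\<dots> = (\<Sum>i<N. indicator {a i<..a (Suc i)} t * ennreal ((norm (H i \<omega>))\<^sup>2))"
      by (intro sum.cong refl) (auto simp: indicator_def)
    finally show ?thesis .
  qed
  have em: "(\<integral>\<^sup>+ t. indicator {a i<..a (Suc i)} t \<partial>interval_measure S T) = ennreal (a (Suc i) - a i)" if "i < N" for i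
  proof -
    have b: "S \<le> a i" "a (Suc i) \<le> T" "a i < a (Suc i)"
      using strict_chain_le[of N a 0 i] strict_chain_le[of N a "Suc i" N] a that by auto
    have "(\<integral>\<^sup>+ t. indicator {a i<..a (Suc i)} t \<partial>interval_measure S T) = (\<integral>\<^sup>+ t. indicator {a i<..a (Suc i)} t \<partial>lborel)"
      unfolding nn_integral_interval
    proof (rule nn_integral_cong_AE)
      \<comment> \<open>The last cell contains T, whereas \<open>interval_measure\<close> lives on
        the open interval; the point T is a null set.\<close>
      show "AE t in lborel. indicator {a i<..a (Suc i)} t * indicator {S<..<T} t = (indicator {a i<..a (Suc i)} t :: ennreal)"
        using AE_lborel_singleton[of T] by eventually_elim (use b in \<open>auto simp: indicator_def\<close>)
    qed
    also have "\<dots> = ennreal (a (Suc i) - a i)" using b by simp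
    finally show ?thesis .
  qed
  have "L2sq (PM S T) (case_prod (simple_proc N a H)) = (\<integral>\<^sup>+ t. L2sq M (simple_proc N a H t) \<partial>interval_measure S T)"
    by (rule L2sq_PM(1)[OF m])
  also have "\<dots> = (\<integral>\<^sup>+ t. (\<Sum>i<N. indicator {a i<..a (Suc i)} t * L2sq M (H i)) \<partial>interval_measure S T)"
    unfolding L2sq_def pt
    by (intro nn_integral_cong, subst nn_integral_sum) (use HM in \<open>auto simp: nn_integral_cmult\<close>)
  also have "\<dots> = (\<Sum>i<N. \<integral>\<^sup>+ t. indicator {a i<..a (Suc i)} t * L2sq M (H i) \<partial>interval_measure S T)"
  proof (rule nn_integral_sum)
    fix i
    have "(\<lambda>t. indicator {a i<..a (Suc i)} t :: ennreal) \<in> borel_measurable (interval_measure S T)"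
      by (rule borel_measurable_interval_measure) simp
    then show "(\<lambda>t. indicator {a i<..a (Suc i)} t * L2sq M (H i)) \<in> borel_measurable (interval_measure S T)" by simp
  qed
  also have "\<dots> = (\<Sum>i<N. ennreal (a (Suc i) - a i) * L2sq M (H i))"
  proof (rule sum.cong[OF refl])
    fix i assume "i \<in> {..<N}"
    have "(\<lambda>t. indicator {a i<..a (Suc i)} t :: ennreal) \<in> borel_measurable (interval_measure S T)"
      by (rule borel_measurable_interval_measure) simp
    then show "(\<integral>\<^sup>+ t. indicator {a i<..a (Suc i)} t * L2sq M (H i) \<partial>interval_measure S T) = ennreal (a (Suc i) - a i) * L2sq M (H i)"
      using em[of i] \<open>i \<in> {..<N}\<close> by (subst nn_integral_multc) auto
  qed
  finally show "L2sq (PM S T) (case_prod (simple_proc N a H)) = (\<Sum>i<N. ennreal (a (Suc i) - a i) * L2sq M (H i))" .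
qed

lemma elem_isometry:
  fixes V :: "('w, 'd::finite) process"
  assumes "elem S T V X" "0 \<le> S" "S < T"
  shows "L2sq M (\<lambda>\<omega>. c + X \<omega>) = ennreal ((norm c)\<^sup>2) + L2sq (PM S T) (case_prod V)"
proof -
  obtain N a H where *: "simple_data M W S T N a H" "V = simple_proc N a H" "X = simple_integral W N a H"
    by (rule elem_imp_simple[OF assms])
  show ?thesis unfolding *(2,3)
    using simple_isometry_aux[OF *(1) assms(2) order_refl, of c] simple_proc_L2sq(1)[OF *(1) assms(2)] by simp
qed

lemma elem_finite:
  fixes V :: "('w, 'd::finite) process"
  assumes "elem S T V X" "0 \<le> S" "S < T"
  shows "L2sq (PM S T) (case_prod V) < \<infinity>"
proof -
  obtain N a H where *: "simple_data M W S T N a H" "V = simple_proc N a H" "X = simple_integral W N a H"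
    by (rule elem_imp_simple[OF assms])
  have "integrable M (\<lambda>\<omega>. (norm (0 + simple_integral W N a H \<omega>))\<^sup>2)"
    using simple_isometry_aux[OF *(1) assms(2) order_refl, of 0] by blast
  then have "L2sq M X < \<infinity>"
    using filt_imp_M[OF elem_integral_measurable[OF assms(1,2)] assms(2)]
    by (simp add: *(3) integrable_norm_sq_iff del: infinity_ennreal_def)
  then show ?thesis using elem_isometry[OF assms, of 0] by simp
qed

lemma elem_L2F:
  fixes V :: "('w, 'd::finite) process"
  assumes "elem S T V X" "0 \<le> S" "S < T"
  shows "V \<in> L2F M W S T"
proof -
  obtain N a H where *: "simple_data M W S T N a H" "V = simple_proc N a H" "X = simple_integral W N a H"
    by (rule elem_imp_simple[OF assms])
  have "V t \<in> borel_measurable (FW S t)" for t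
    using assms(1)
  proof (induction rule: elem.induct)
    case (elem_step V X u v H)
    show ?case
    proof (cases "u < t")
      case True
      have [measurable]: "H \<in> borel_measurable (FW S t)" by (rule filt_mono[OF elem_step.hyps(5)]) (use True in linarith)
      have [measurable]: "V t \<in> borel_measurable (FW S t)" by (rule elem_step.IH)
      show ?thesis by measurable
    next
      case False
      then show ?thesis using elem_step.IH by (simp add: indicator_def)
    qed
  qed simp
  then show ?thesis
    using elem_finite[OF assms] simple_proc_L2sq(2)[OF *(1) assms(2)] by (auto simp: L2F_iff *(2))
qed

end

section \<open>The It\^o integral\<close>

lemma chain_cell:
  fixes a :: "nat \<Rightarrow> real"
  assumes "a 0 < t" "t \<le> a N"
  obtains i where "i < N" "a i < t" "t \<le> a (Suc i)"
proof -
  have "\<exists>i<N. a i < t \<and> t \<le> a (Suc i)"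
    using assms
  proof (induction N)
    case (Suc N)
    show ?case
    proof (cases "t \<le> a N")
      case True
      with Suc obtain i where "i < N" "a i < t" "t \<le> a (Suc i)" by auto
      then show ?thesis by (intro exI[of _ i]) auto
    next
      case False
      with Suc show ?thesis by (intro exI[of _ N]) auto
    qed
  qed simp
  with that show thesis by blast
qed

lemma sum_indicator_cells_le:
  fixes a :: "nat \<Rightarrow> real"
  assumes "\<And>i. i < N \<Longrightarrow> a i < a (Suc i)"
  shows "(\<Sum>i<N. indicator {a i<..<a (Suc i)} t) \<le> (indicator {a 0<..<a N} t :: ennreal)"
  using assms
proof (induction N)
  case (Suc N)
  have "(\<Sum>i<Suc N. indicator {a i<..<a (Suc i)} t) \<le> indicator {a 0<..<a N} t + (indicator {a N<..<a (Suc N)} t :: ennreal)"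
    using Suc by (simp add: add_right_mono)
  also have "\<dots> \<le> indicator {a 0<..<a (Suc N)} t"
    using Suc.prems[of N] strict_chain_le[of N a 0 N] Suc.prems by (force simp: indicator_def)
  finally show ?case .
qed simp

lemma tendsto_0_le_ennreal:
  fixes f g :: "nat \<Rightarrow> ennreal"
  assumes "g \<longlonglongrightarrow> 0" "\<And>j. f j \<le> g j"
  shows "f \<longlonglongrightarrow> 0"
  by (rule tendsto_sandwich[OF _ _ tendsto_const assms(1)]) (use assms(2) in \<open>auto intro: always_eventually\<close>)

context brownian_motion
begin

text \<open>With \<open>elem\<close> in place of partitions the approximants are closed under linear
  combinations, so linearity of the integral requires no common refinement.\<close>

lemma has_ito_integral_iff:
  fixes Y :: "('w, 'd::finite) process"
  assumes "0 \<le> S" "S < T"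
  shows "has_ito_integral M W S T Y X \<longleftrightarrow> Y \<in> L2F M W S T \<and> X \<in> borel_measurable M \<and>
    (\<exists>V Xs. (\<forall>j. elem S T (V j) (Xs j)) \<and>
      (\<lambda>j::nat. L2sq (PM S T) (\<lambda>p. case_prod Y p - case_prod (V j) p)) \<longlonglongrightarrow> 0 \<and>
      (\<lambda>j. L2sq M (\<lambda>\<omega>. X \<omega> - Xs j \<omega>)) \<longlonglongrightarrow> 0)" (is "_ \<longleftrightarrow> _ \<and> _ \<and> ?R")
proof -
  have "?R \<longleftrightarrow> (\<exists>N a H. (\<forall>j::nat. simple_data M W S T (N j) (a j) (H j)) \<and>
        (\<lambda>j. L2sq (PM S T) (\<lambda>p. case_prod Y p - case_prod (simple_proc (N j) (a j) (H j)) p)) \<longlonglongrightarrow> 0 \<and>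
        (\<lambda>j. L2sq M (\<lambda>\<omega>. X \<omega> - simple_integral W (N j) (a j) (H j) \<omega>)) \<longlonglongrightarrow> 0)" (is "_ \<longleftrightarrow> ?L")
  proof
    assume ?L
    then obtain N a H where *: "\<forall>j::nat. simple_data M W S T (N j) (a j) (H j)"
        "(\<lambda>j. L2sq (PM S T) (\<lambda>p. case_prod Y p - case_prod (simple_proc (N j) (a j) (H j)) p)) \<longlonglongrightarrow> 0"
        "(\<lambda>j. L2sq M (\<lambda>\<omega>. X \<omega> - simple_integral W (N j) (a j) (H j) \<omega>)) \<longlonglongrightarrow> 0" by (elim exE conjE) (rule that)
    show ?R
      by (rule exI[of _ "\<lambda>j. simple_proc (N j) (a j) (H j)"], rule exI[of _ "\<lambda>j. simple_integral W (N j) (a j) (H j)"])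
        (intro conjI allI simple_imp_elem *(2,3) *(1)[rule_format])
  next
    assume ?R
    then obtain V Xs where *: "\<forall>j::nat. elem S T (V j) (Xs j)"
      "(\<lambda>j. L2sq (PM S T) (\<lambda>p. case_prod Y p - case_prod (V j) p)) \<longlonglongrightarrow> 0"
      "(\<lambda>j. L2sq M (\<lambda>\<omega>. X \<omega> - Xs j \<omega>)) \<longlonglongrightarrow> 0" by (elim exE conjE) (rule that)
    have "\<exists>N a H. simple_data M W S T N a H \<and> V j = simple_proc N a H \<and> Xs j = simple_integral W N a H" for j
      using elem_imp_simple[OF *(1)[rule_format, of j] assms] by metis
    then obtain N a H where **: "\<And>j. simple_data M W S T (N j) (a j) (H j)"
      "\<And>j. V j = simple_proc (N j) (a j) (H j)" "\<And>j. Xs j = simple_integral W (N j) (a j) (H j)" by metis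
    show ?L
      by (rule exI[of _ N], rule exI[of _ a], rule exI[of _ H])
        (intro conjI allI **(1) *(2,3)[unfolded **(2,3)])
  qed
  then show ?thesis unfolding has_ito_integral_def L2sq_def by simp
qed

lemma has_ito_integralE:
  fixes Y :: "('w, 'd::finite) process"
  assumes "has_ito_integral M W S T Y X" "0 \<le> S" "S < T"
  obtains V Xs where "\<forall>j. elem S T (V j) (Xs j)"
    "(\<lambda>j::nat. L2sq (PM S T) (\<lambda>p. case_prod Y p - case_prod (V j) p)) \<longlonglongrightarrow> 0"
    "(\<lambda>j. L2sq M (\<lambda>\<omega>. X \<omega> - Xs j \<omega>)) \<longlonglongrightarrow> 0"
  using assms(1) unfolding has_ito_integral_iff[OF assms(2,3)]
  by (elim exE conjE) (rule that)

lemma has_ito_integralI: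
  fixes Y :: "('w, 'd::finite) process"
  assumes "0 \<le> S" "S < T" "Y \<in> L2F M W S T" "X \<in> borel_measurable M" "\<And>j. elem S T (V j) (Xs j)"
    "(\<lambda>j::nat. L2sq (PM S T) (\<lambda>p. case_prod Y p - case_prod (V j) p)) \<longlonglongrightarrow> 0"
    "(\<lambda>j. L2sq M (\<lambda>\<omega>. X \<omega> - Xs j \<omega>)) \<longlonglongrightarrow> 0"
  shows "has_ito_integral M W S T Y X"
  unfolding has_ito_integral_iff[OF assms(1,2)]
  by (intro conjI exI[of _ V] exI[of _ Xs] allI assms)

lemma has_ito_integral_L2F: "has_ito_integral M W S T Y X \<Longrightarrow> Y \<in> L2F M W S T"
  by (simp add: has_ito_integral_def)

lemma has_ito_integral_measurable: "has_ito_integral M W S T Y X \<Longrightarrow> X \<in> borel_measurable M"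
  by (simp add: has_ito_integral_def)

lemma elem_measurable:
  fixes V :: "('w, 'd::finite) process"
  assumes "elem S T V X" "0 \<le> S" "S < T"
  shows "case_prod V \<in> borel_measurable (PM S T)" "X \<in> borel_measurable M"
  using L2F_measurable[OF elem_L2F[OF assms]] filt_imp_M[OF elem_integral_measurable[OF assms(1,2)] assms(2)] by auto

text \<open>Two applications of \<open>L2sq_limit_le\<close> in opposite directions, the squared
  norm of c being the offset on the side of the integrand.\<close>

lemma ito_isometry:
  fixes Y :: "('w, 'd::finite) process"
  assumes ito: "has_ito_integral M W S T Y X" and S: "0 \<le> S" "S < T"
  shows "L2sq M (\<lambda>\<omega>. c + X \<omega>) = ennreal ((norm c)\<^sup>2) + L2sq (PM S T) (case_prod Y)"
proof -
  obtain V Xs where V0: "\<forall>j. elem S T (V j) (Xs j)"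
    and lim: "(\<lambda>j::nat. L2sq (PM S T) (\<lambda>p. case_prod Y p - case_prod (V j) p)) \<longlonglongrightarrow> 0"
    "(\<lambda>j. L2sq M (\<lambda>\<omega>. X \<omega> - Xs j \<omega>)) \<longlonglongrightarrow> 0"
    by (rule has_ito_integralE[OF assms])
  note V = V0[rule_format]
  note [measurable] = elem_measurable[OF V S] L2F_measurable[OF has_ito_integral_L2F[OF ito]]
    has_ito_integral_measurable[OF ito]
  have lim': "(\<lambda>j. L2sq M (\<lambda>\<omega>. (c + X \<omega>) - (c + Xs j \<omega>))) \<longlonglongrightarrow> 0" using lim(2) by simp
  have mc: "(\<lambda>\<omega>. c + X \<omega>) \<in> borel_measurable M" "\<And>j. (\<lambda>\<omega>. c + Xs j \<omega>) \<in> borel_measurable M"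
    "case_prod Y \<in> borel_measurable (PM S T)" "\<And>j. case_prod (V j) \<in> borel_measurable (PM S T)"
    by measurable
  have "0 + L2sq M (\<lambda>\<omega>. c + X \<omega>) \<le> ennreal ((norm c)\<^sup>2) + L2sq (PM S T) (case_prod Y)"
    by (rule L2sq_limit_le[OF mc _ lim' lim(1)]) (simp add: elem_isometry[OF V S])
  moreover have "ennreal ((norm c)\<^sup>2) + L2sq (PM S T) (case_prod Y) \<le> 0 + L2sq M (\<lambda>\<omega>. c + X \<omega>)"
    by (rule L2sq_limit_le[OF mc(3,4,1,2) _ lim(1) lim']) (simp add: elem_isometry[OF V S])
  ultimately show ?thesis by simp
qed

lemma ito_isometry0:
  fixes Y :: "('w, 'd::finite) process"
  assumes "has_ito_integral M W S T Y X" "0 \<le> S" "S < T"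
  shows "L2sq M X = L2sq (PM S T) (case_prod Y)"
  using ito_isometry[OF assms, of 0] by simp

lemma ito_finite:
  fixes Y :: "('w, 'd::finite) process"
  assumes "has_ito_integral M W S T Y X" "0 \<le> S" "S < T"
  shows "L2sq M X < \<infinity>"
  unfolding ito_isometry0[OF assms] by (rule L2F_finite[OF has_ito_integral_L2F[OF assms(1)]])

lemma ito_AE:
  assumes "has_ito_integral M W S T Y X" "AE \<omega> in M. X \<omega> = X' \<omega>" "X' \<in> borel_measurable M"
  shows "has_ito_integral M W S T Y X'"
proof -
  have "(\<integral>\<^sup>+ \<omega>. ennreal ((norm (X \<omega> - Z \<omega>))\<^sup>2) \<partial>M) = (\<integral>\<^sup>+ \<omega>. ennreal ((norm (X' \<omega> - Z \<omega>))\<^sup>2) \<partial>M)" for Z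
    using assms(2) by (intro nn_integral_cong_AE) auto
  then show ?thesis using assms(1,3) unfolding has_ito_integral_def by simp
qed

lemma L2sq_lincomb_tendsto:
  fixes A B :: "'a \<Rightarrow> 'b::{second_countable_topology, real_normed_vector}"
  assumes [measurable]: "A \<in> borel_measurable N" "B \<in> borel_measurable N"
    "\<And>j. As j \<in> borel_measurable N" "\<And>j. Bs j \<in> borel_measurable N"
    and lim: "(\<lambda>j::nat. L2sq N (\<lambda>x. A x - As j x)) \<longlonglongrightarrow> 0" "(\<lambda>j. L2sq N (\<lambda>x. B x - Bs j x)) \<longlonglongrightarrow> 0"
  shows "(\<lambda>j. L2sq N (\<lambda>x. (A x + c *\<^sub>R B x) - (As j x + c *\<^sub>R Bs j x))) \<longlonglongrightarrow> 0"
proof (rule tendsto_sandwich[OF _ _ tendsto_const])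
  show "\<forall>\<^sub>F j in sequentially. 0 \<le> L2sq N (\<lambda>x. (A x + c *\<^sub>R B x) - (As j x + c *\<^sub>R Bs j x))" by simp
  show "\<forall>\<^sub>F j in sequentially. L2sq N (\<lambda>x. (A x + c *\<^sub>R B x) - (As j x + c *\<^sub>R Bs j x))
      \<le> 2 * L2sq N (\<lambda>x. A x - As j x) + (2 * ennreal (c\<^sup>2)) * L2sq N (\<lambda>x. B x - Bs j x)"
  proof (rule always_eventually, rule allI)
    fix j
    have "L2sq N (\<lambda>x. (A x - As j x) + c *\<^sub>R (B x - Bs j x))
      \<le> 2 * L2sq N (\<lambda>x. A x - As j x) + 2 * L2sq N (\<lambda>x. c *\<^sub>R (B x - Bs j x))"
      by (rule L2sq_add_le) measurable
    also have "L2sq N (\<lambda>x. c *\<^sub>R (B x - Bs j x)) = ennreal (c\<^sup>2) * L2sq N (\<lambda>x. B x - Bs j x)"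
      by (rule L2sq_scaleR) measurable
    finally show "L2sq N (\<lambda>x. (A x + c *\<^sub>R B x) - (As j x + c *\<^sub>R Bs j x))
      \<le> 2 * L2sq N (\<lambda>x. A x - As j x) + (2 * ennreal (c\<^sup>2)) * L2sq N (\<lambda>x. B x - Bs j x)"
      by (simp add: algebra_simps scaleR_diff_right)
  qed
  have "(\<lambda>j. 2 * L2sq N (\<lambda>x. A x - As j x) + (2 * ennreal (c\<^sup>2)) * L2sq N (\<lambda>x. B x - Bs j x)) \<longlonglongrightarrow> 0 + 0"
    by (intro tendsto_add tendsto_ennreal_mult0 lim) (auto simp: ennreal_mult_less_top)
  then show "(\<lambda>j. 2 * L2sq N (\<lambda>x. A x - As j x) + (2 * ennreal (c\<^sup>2)) * L2sq N (\<lambda>x. B x - Bs j x)) \<longlonglongrightarrow> 0"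
    by simp
qed

lemma ito_linear:
  fixes Y Y' :: "('w, 'd::finite) process"
  assumes ito: "has_ito_integral M W S T Y X" "has_ito_integral M W S T Y' X'" and S: "0 \<le> S" "S < T"
  shows "has_ito_integral M W S T (\<lambda>t \<omega>. Y t \<omega> + c *\<^sub>R Y' t \<omega>) (\<lambda>\<omega>. X \<omega> + c *\<^sub>R X' \<omega>)"
proof -
  obtain V Xs where V0: "\<forall>j. elem S T (V j) (Xs j)"
    and lim: "(\<lambda>j::nat. L2sq (PM S T) (\<lambda>p. case_prod Y p - case_prod (V j) p)) \<longlonglongrightarrow> 0"
    "(\<lambda>j. L2sq M (\<lambda>\<omega>. X \<omega> - Xs j \<omega>)) \<longlonglongrightarrow> 0"
    by (rule has_ito_integralE[OF ito(1) S])
  note V = V0[rule_format]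
  obtain V' Xs' where V'0: "\<forall>j. elem S T (V' j) (Xs' j)"
    and lim': "(\<lambda>j::nat. L2sq (PM S T) (\<lambda>p. case_prod Y' p - case_prod (V' j) p)) \<longlonglongrightarrow> 0"
    "(\<lambda>j. L2sq M (\<lambda>\<omega>. X' \<omega> - Xs' j \<omega>)) \<longlonglongrightarrow> 0"
    by (rule has_ito_integralE[OF ito(2) S])
  note V' = V'0[rule_format]
  note mY = L2F_measurable[OF has_ito_integral_L2F[OF ito(1)]] L2F_measurable[OF has_ito_integral_L2F[OF ito(2)]]
  note mX [measurable] = has_ito_integral_measurable[OF ito(1)] has_ito_integral_measurable[OF ito(2)]
  show ?thesis
  proof (rule has_ito_integralI[OF S, where V = "\<lambda>j t \<omega>. V j t \<omega> + c *\<^sub>R V' j t \<omega>" and Xs = "\<lambda>j \<omega>. Xs j \<omega> + c *\<^sub>R Xs' j \<omega>"])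
    show "(\<lambda>t \<omega>. Y t \<omega> + c *\<^sub>R Y' t \<omega>) \<in> L2F M W S T"
      using ito by (intro L2F_add has_ito_integral_L2F)
    show "(\<lambda>\<omega>. X \<omega> + c *\<^sub>R X' \<omega>) \<in> borel_measurable M" by measurable
    show "elem S T (\<lambda>t \<omega>. V j t \<omega> + c *\<^sub>R V' j t \<omega>) (\<lambda>\<omega>. Xs j \<omega> + c *\<^sub>R Xs' j \<omega>)" for j
      by (intro elem_plus elem_scale V V')
    show "(\<lambda>j. L2sq M (\<lambda>\<omega>. X \<omega> + c *\<^sub>R X' \<omega> - (Xs j \<omega> + c *\<^sub>R Xs' j \<omega>))) \<longlonglongrightarrow> 0"
      by (rule L2sq_lincomb_tendsto[OF mX elem_measurable(2)[OF V S] elem_measurable(2)[OF V' S] lim(2) lim'(2)])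
    show "(\<lambda>j. L2sq (PM S T) (\<lambda>p. (case p of (t, \<omega>) \<Rightarrow> Y t \<omega> + c *\<^sub>R Y' t \<omega>) - (case p of (t, \<omega>) \<Rightarrow> V j t \<omega> + c *\<^sub>R V' j t \<omega>))) \<longlonglongrightarrow> 0"
      using L2sq_lincomb_tendsto[OF mY elem_measurable(1)[OF V S] elem_measurable(1)[OF V' S] lim(1) lim'(1), of c]
      by (simp add: case_prod_beta')
  qed
qed

text \<open>The L2 closure of the step processes: the property that provides an Ito integral. No
  integral of \<open>Y\<close> is part of it, and it is carried through every construction that
  follows, so that each resulting process can serve as an integrand again.\<close>

definition appr :: "real \<Rightarrow> real \<Rightarrow> ('w, 'd::finite) process \<Rightarrow> bool" where
  "appr S T Y \<longleftrightarrow> Y \<in> L2F M W S T \<and>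
    (\<exists>V Xs. (\<forall>j. elem S T (V j) (Xs j)) \<and>
      (\<lambda>j::nat. L2sq (PM S T) (\<lambda>p. case_prod Y p - case_prod (V j) p)) \<longlonglongrightarrow> 0)"

lemma apprI:
  "Y \<in> L2F M W S T \<Longrightarrow> (\<And>j. elem S T (V j) (Xs j)) \<Longrightarrow>
    (\<lambda>j::nat. L2sq (PM S T) (\<lambda>p. case_prod Y p - case_prod (V j) p)) \<longlonglongrightarrow> 0 \<Longrightarrow> appr S T Y"
  unfolding appr_def by (intro conjI exI[of _ V] exI[of _ Xs] allI)

lemma apprE:
  assumes "appr S T Y"
  obtains V Xs where "\<forall>j. elem S T (V j) (Xs j)"
    "(\<lambda>j::nat. L2sq (PM S T) (\<lambda>p. case_prod Y p - case_prod (V j) p)) \<longlonglongrightarrow> 0"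
  using assms unfolding appr_def
  by (elim exE conjE) (rule that)

lemma appr_L2F: "appr S T Y \<Longrightarrow> Y \<in> L2F M W S T"
  by (simp add: appr_def)

lemma elem_appr:
  fixes V :: "('w, 'd::finite) process"
  shows "elem S T V X \<Longrightarrow> 0 \<le> S \<Longrightarrow> S < T \<Longrightarrow> appr S T V"
  by (rule apprI[where V = "\<lambda>_. V"]) (auto intro: elem_L2F)

lemma appr_linear:
  fixes Y Y' :: "('w, 'd::finite) process"
  assumes Y: "appr S T Y" "appr S T Y'" and S: "0 \<le> S" "S < T"
  shows "appr S T (\<lambda>t \<omega>. Y t \<omega> + c *\<^sub>R Y' t \<omega>)"
proof -
  obtain V Xs where V0: "\<forall>j. elem S T (V j) (Xs j)"
    and lim: "(\<lambda>j::nat. L2sq (PM S T) (\<lambda>p. case_prod Y p - case_prod (V j) p)) \<longlonglongrightarrow> 0"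
    using Y(1) by (rule apprE)
  note V = V0[rule_format]
  obtain V' Xs' where V'0: "\<forall>j. elem S T (V' j) (Xs' j)"
    and lim': "(\<lambda>j::nat. L2sq (PM S T) (\<lambda>p. case_prod Y' p - case_prod (V' j) p)) \<longlonglongrightarrow> 0"
    using Y(2) by (rule apprE)
  note V' = V'0[rule_format]
  note mY = L2F_measurable[OF appr_L2F[OF Y(1)]] L2F_measurable[OF appr_L2F[OF Y(2)]]
  show ?thesis
  proof (rule apprI)
    show "elem S T (\<lambda>t \<omega>. V j t \<omega> + c *\<^sub>R V' j t \<omega>) (\<lambda>\<omega>. Xs j \<omega> + c *\<^sub>R Xs' j \<omega>)" for j
      by (intro elem_plus elem_scale V V')
    show "(\<lambda>t \<omega>. Y t \<omega> + c *\<^sub>R Y' t \<omega>) \<in> L2F M W S T" using Y by (intro L2F_add appr_L2F)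
    show "(\<lambda>j. L2sq (PM S T) (\<lambda>p. (case p of (t, \<omega>) \<Rightarrow> Y t \<omega> + c *\<^sub>R Y' t \<omega>) - (case p of (t, \<omega>) \<Rightarrow> V j t \<omega> + c *\<^sub>R V' j t \<omega>))) \<longlonglongrightarrow> 0"
      using L2sq_lincomb_tendsto[OF mY elem_measurable(1)[OF V S] elem_measurable(1)[OF V' S] lim lim', of c]
      by (simp add: case_prod_beta')
  qed
qed

text \<open>A diagonal choice: \<open>V n\<close> is a step process whose squared distance from
  \<open>Z n\<close> is at most 1/(n + 1).\<close>

lemma appr_closed:
  fixes Y :: "('w, 'd::finite) process"
  assumes Y: "Y \<in> L2F M W S T" and Z: "\<And>n. appr S T (Z n)"
    and lim: "(\<lambda>n::nat. L2sq (PM S T) (\<lambda>p. case_prod Y p - case_prod (Z n) p)) \<longlonglongrightarrow> 0" and S: "0 \<le> S" "S < T"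
  shows "appr S T Y"
proof -
  have "\<exists>V X. elem S T V X \<and> L2sq (PM S T) (\<lambda>p. case_prod (Z n) p - case_prod V p) \<le> ennreal (inverse (real (Suc n)))" for n
  proof -
    obtain V Xs where V0: "\<forall>j. elem S T (V j) (Xs j)"
      and l: "(\<lambda>j::nat. L2sq (PM S T) (\<lambda>p. case_prod (Z n) p - case_prod (V j) p)) \<longlonglongrightarrow> 0"
      using Z[of n] by (rule apprE)
  note V = V0[rule_format]
    have "0 < ennreal (inverse (real (Suc n)))" by simp
    from order_tendstoD(2)[OF l this] obtain j where "L2sq (PM S T) (\<lambda>p. case_prod (Z n) p - case_prod (V j) p) < ennreal (inverse (real (Suc n)))"
      by (auto simp: eventually_sequentially)
    with V[of j] show ?thesis by (auto intro: less_imp_le)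
  qed
  then obtain V X where V: "\<And>n. elem S T (V n) (X n)"
    "\<And>n. L2sq (PM S T) (\<lambda>p. case_prod (Z n) p - case_prod (V n) p) \<le> ennreal (inverse (real (Suc n)))" by metis
  show ?thesis
  proof (rule apprI[OF Y V(1)], rule tendsto_sandwich[OF _ _ tendsto_const])
    show "\<forall>\<^sub>F n in sequentially. L2sq (PM S T) (\<lambda>p. case_prod Y p - case_prod (V n) p) \<le>
      2 * L2sq (PM S T) (\<lambda>p. case_prod Y p - case_prod (Z n) p) + 2 * ennreal (inverse (real (Suc n)))"
    proof (rule always_eventually, rule allI)
      fix n
      have "L2sq (PM S T) (\<lambda>p. case_prod Y p - case_prod (V n) p) \<le>
        2 * L2sq (PM S T) (\<lambda>p. case_prod Y p - case_prod (Z n) p) + 2 * L2sq (PM S T) (\<lambda>p. case_prod (Z n) p - case_prod (V n) p)"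
        by (rule L2sq_diff_le[OF L2F_measurable[OF Y] elem_measurable(1)[OF V(1) S] L2F_measurable[OF appr_L2F[OF Z]]])
      also have "\<dots> \<le> 2 * L2sq (PM S T) (\<lambda>p. case_prod Y p - case_prod (Z n) p) + 2 * ennreal (inverse (real (Suc n)))"
        by (intro add_left_mono mult_left_mono V(2)) auto
      finally show "L2sq (PM S T) (\<lambda>p. case_prod Y p - case_prod (V n) p) \<le>
        2 * L2sq (PM S T) (\<lambda>p. case_prod Y p - case_prod (Z n) p) + 2 * ennreal (inverse (real (Suc n)))" .
    qed
    have "(\<lambda>n. ennreal (inverse (real (Suc n)))) \<longlonglongrightarrow> ennreal 0"
      by (intro tendsto_ennrealI LIMSEQ_inverse_real_of_nat)
    then have "(\<lambda>n. 2 * L2sq (PM S T) (\<lambda>p. case_prod Y p - case_prod (Z n) p) + 2 * ennreal (inverse (real (Suc n)))) \<longlonglongrightarrow> 0 + 0"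
      by (intro tendsto_add tendsto_ennreal_mult0 lim) auto
    then show "(\<lambda>n. 2 * L2sq (PM S T) (\<lambda>p. case_prod Y p - case_prod (Z n) p) + 2 * ennreal (inverse (real (Suc n)))) \<longlonglongrightarrow> 0"
      by simp
  qed simp
qed

text \<open>The isometry for differences of step processes turns convergence of the processes into
  the Cauchy property of their integrals. The limit is a pointwise \<open>lim\<close> of variables
  known at time T, hence itself known at time T.\<close>

lemma ito_exists:
  fixes Y :: "('w, 'd::finite) process"
  assumes Y: "appr S T Y" and S: "0 \<le> S" "S < T"
  shows "\<exists>X\<in>borel_measurable (FW S T). has_ito_integral M W S T Y X"
proof -
  obtain V Xs where V0: "\<forall>j. elem S T (V j) (Xs j)"
    and lim: "(\<lambda>j::nat. L2sq (PM S T) (\<lambda>p. case_prod Y p - case_prod (V j) p)) \<longlonglongrightarrow> 0"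
    using Y by (rule apprE)
  note V = V0[rule_format]
  note mV = elem_measurable[OF V S]
  note [measurable] = L2F_measurable[OF appr_L2F[OF Y]] mV
  let ?c = "\<lambda>j. 2 * L2sq (PM S T) (\<lambda>p. case_prod Y p - case_prod (V j) p)"
  have "(\<lambda>j. ?c j) \<longlonglongrightarrow> 0" using lim by (intro tendsto_ennreal_mult0) auto
  moreover have "L2sq M (\<lambda>\<omega>. Xs m \<omega> - Xs n \<omega>) \<le> ?c m + ?c n" for m n
  proof -
    have "elem S T (\<lambda>t \<omega>. V m t \<omega> + (-1) *\<^sub>R V n t \<omega>) (\<lambda>\<omega>. Xs m \<omega> + (-1) *\<^sub>R Xs n \<omega>)"
      by (intro elem_plus elem_scale V)
    from elem_isometry[OF this S, of 0]
    have "L2sq M (\<lambda>\<omega>. Xs m \<omega> - Xs n \<omega>) = L2sq (PM S T) (\<lambda>p. case_prod (V m) p - case_prod (V n) p)"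
      by (simp add: case_prod_beta')
    also have "\<dots> \<le> 2 * L2sq (PM S T) (\<lambda>p. case_prod (V m) p - case_prod Y p) + 2 * L2sq (PM S T) (\<lambda>p. case_prod Y p - case_prod (V n) p)"
      by (rule L2sq_diff_le) measurable
    also have "L2sq (PM S T) (\<lambda>p. case_prod (V m) p - case_prod Y p) = L2sq (PM S T) (\<lambda>p. case_prod Y p - case_prod (V m) p)"
      by (rule L2sq_commute)
    finally show ?thesis .
  qed
  ultimately obtain r :: "nat \<Rightarrow> nat" where
    r: "(\<lambda>n. L2sq M (\<lambda>\<omega>. lim (\<lambda>k. Xs (r k) \<omega>) - Xs n \<omega>)) \<longlonglongrightarrow> 0"
    using L2_complete[of Xs M ?c] mV(2) by metis
  have X: "(\<lambda>\<omega>. lim (\<lambda>k. Xs (r k) \<omega>)) \<in> borel_measurable (FW S T)"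
  proof -
    have [measurable]: "Xs n \<in> borel_measurable (FW S T)" for n by (rule elem_integral_measurable[OF V S(1)])
    show ?thesis by measurable
  qed
  have "has_ito_integral M W S T Y (\<lambda>\<omega>. lim (\<lambda>k. Xs (r k) \<omega>))"
    by (rule has_ito_integralI[OF S appr_L2F[OF Y] filt_imp_M[OF X S(1)] V lim r])
  with X show ?thesis by blast
qed

section \<open>Cutting integrands and varying the upper limit of integration\<close>

lemma L2sq_cut_le:
  fixes Y V :: "('w, 'd::finite) process"
  shows "L2sq (PM S T) (\<lambda>p. case_prod (\<lambda>t \<omega>. indicator {a<..b} t *\<^sub>R Y t \<omega>) p - case_prod (\<lambda>t \<omega>. indicator {a<..b} t *\<^sub>R V t \<omega>) p)
    \<le> L2sq (PM S T) (\<lambda>p. case_prod Y p - case_prod V p)"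
  unfolding L2sq_def by (intro nn_integral_mono) (auto simp: indicator_def)

lemma appr_cut:
  fixes Y :: "('w, 'd::finite) process"
  assumes Y: "appr S T Y" and S: "0 \<le> S" "S < T" and ab: "S \<le> a" "a < b" "b \<le> T"
  shows "appr S T (\<lambda>t \<omega>. indicator {a<..b} t *\<^sub>R Y t \<omega>)"
proof -
  obtain V Xs where V0: "\<forall>j. elem S T (V j) (Xs j)"
    and lim: "(\<lambda>j::nat. L2sq (PM S T) (\<lambda>p. case_prod Y p - case_prod (V j) p)) \<longlonglongrightarrow> 0"
    using Y by (rule apprE)
  note V = V0[rule_format]
  have "\<exists>X'. elem S T (\<lambda>t \<omega>. indicator {a<..b} t *\<^sub>R V j t \<omega>) X'" for j
    by (rule exE[OF elem_cut[OF V ab(1,2), of j]]) (rule exI, erule elem_mono[OF _ ab(3)])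
  then have "\<forall>j. \<exists>X'. elem S T (\<lambda>t \<omega>. indicator {a<..b} t *\<^sub>R V j t \<omega>) X'" ..
  from choice[OF this] obtain Xs' where V'0: "\<forall>j. elem S T (\<lambda>t \<omega>. indicator {a<..b} t *\<^sub>R V j t \<omega>) (Xs' j)" ..
  note V' = V'0[rule_format]
  show ?thesis
    by (rule apprI[OF L2F_cut[OF appr_L2F[OF Y]] V' tendsto_0_le_ennreal[OF lim]])
      (rule L2sq_cut_le)
qed

lemma L2sq_PM_AE_cong:
  fixes Y Z :: "('w, 'd::finite) process"
  assumes "case_prod Y \<in> borel_measurable (PM S T)" "case_prod Z \<in> borel_measurable (PM S T')"
    "\<And>t. t \<notin> A \<Longrightarrow> L2sq M (Y t) * indicator {S<..<T} t = L2sq M (Z t) * indicator {S<..<T'} t" "A \<in> null_sets lborel"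
  shows "L2sq (PM S T) (case_prod Y) = L2sq (PM S T') (case_prod Z)"
  unfolding L2sq_PM(1)[OF assms(1)] L2sq_PM(1)[OF assms(2)] nn_integral_interval
  by (rule nn_integral_cong_AE) (use AE_not_in[OF assms(4)] assms(3) in auto)

lemma appr_subinterval:
  fixes Y :: "('w, 'd::finite) process"
  assumes Y: "appr S T Y" and S: "0 \<le> S" and t: "S < t" "t \<le> T"
  shows "appr S t Y"
proof -
  have ST: "S < T" using t by simp
  obtain V Xs where V0: "\<forall>j. elem S T (V j) (Xs j)"
    and lim: "(\<lambda>j::nat. L2sq (PM S T) (\<lambda>p. case_prod Y p - case_prod (V j) p)) \<longlonglongrightarrow> 0"
    using Y by (rule apprE)
  note V = V0[rule_format]
  have "\<forall>j. \<exists>X'. elem S t (\<lambda>r \<omega>. indicator {S<..t} r *\<^sub>R V j r \<omega>) X'"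
    by (intro allI elem_cut[OF V order_refl t(1)])
  from choice[OF this] obtain Xs' where V'0: "\<forall>j. elem S t (\<lambda>r \<omega>. indicator {S<..t} r *\<^sub>R V j r \<omega>) (Xs' j)" ..
  note V' = V'0[rule_format]
  have le: "L2sq (PM S t) (\<lambda>p. case_prod Y p - case_prod (\<lambda>r \<omega>. indicator {S<..t} r *\<^sub>R V j r \<omega>) p)
    \<le> L2sq (PM S T) (\<lambda>p. case_prod Y p - case_prod (V j) p)" for j
  proof -
    have "L2sq (PM S t) (\<lambda>p. case_prod Y p - case_prod (\<lambda>r \<omega>. indicator {S<..t} r *\<^sub>R V j r \<omega>) p)
      = L2sq (PM S t) (case_prod (\<lambda>r \<omega>. Y r \<omega> - V j r \<omega>))"
      by (rule L2sq_cong) (auto simp: space_pair_measure indicator_def)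
    also have "\<dots> \<le> L2sq (PM S T) (case_prod (\<lambda>r \<omega>. Y r \<omega> - V j r \<omega>))"
    proof (rule PM_subinterval(2)[OF _ t(2)])
      note [measurable] = L2F_measurable[OF appr_L2F[OF Y]] elem_measurable[OF V S ST]
      have "(\<lambda>p. case_prod Y p - case_prod (V j) p) \<in> borel_measurable (PM S T)" by measurable
      then show "case_prod (\<lambda>r \<omega>. Y r \<omega> - V j r \<omega>) \<in> borel_measurable (PM S T)" by (simp add: case_prod_beta')
    qed
    finally show ?thesis by (simp add: case_prod_beta')
  qed
  show ?thesis
    by (rule apprI[OF L2F_subinterval[OF appr_L2F[OF Y] t(2)] V' tendsto_0_le_ennreal[OF lim le]])
qed

text \<open>Integrals with different upper limits can be subtracted by linearity once both are
  written over the same interval. The approximating step processes on (S, s] serve unchanged on (S,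
  t].\<close>

lemma ito_extend:
  fixes Y :: "('w, 'd::finite) process"
  assumes ito: "has_ito_integral M W S s Y X" and Y: "Y \<in> L2F M W S t" and S: "0 \<le> S" "S < s" "s \<le> t"
  shows "has_ito_integral M W S t (\<lambda>r \<omega>. indicator {S<..s} r *\<^sub>R Y r \<omega>) X"
proof -
  have St: "S < t" using S by simp
  obtain V Xs where V0: "\<forall>j. elem S s (V j) (Xs j)"
    and lim: "(\<lambda>j::nat. L2sq (PM S s) (\<lambda>p. case_prod Y p - case_prod (V j) p)) \<longlonglongrightarrow> 0"
    "(\<lambda>j. L2sq M (\<lambda>\<omega>. X \<omega> - Xs j \<omega>)) \<longlonglongrightarrow> 0"
    by (rule has_ito_integralE[OF ito S(1,2)])
  note V = V0[rule_format]
  note V' = elem_mono[OF V S(3)]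
  have eq: "L2sq (PM S t) (\<lambda>p. case_prod (\<lambda>r \<omega>. indicator {S<..s} r *\<^sub>R Y r \<omega>) p - case_prod (V j) p)
     = L2sq (PM S s) (\<lambda>p. case_prod Y p - case_prod (V j) p)" for j
  proof -
    have m1: "(\<lambda>p. case_prod (\<lambda>r \<omega>. indicator {S<..s} r *\<^sub>R Y r \<omega>) p - case_prod (V j) p) \<in> borel_measurable (PM S t)"
      by (intro borel_measurable_diff L2F_measurable[OF L2F_cut[OF Y]] elem_measurable(1)[OF V' S(1) St])
    have m2: "(\<lambda>p. case_prod Y p - case_prod (V j) p) \<in> borel_measurable (PM S s)"
      by (intro borel_measurable_diff L2F_measurable[OF has_ito_integral_L2F[OF ito]] elem_measurable(1)[OF V S(1,2)])
    have "L2sq (PM S t) (case_prod (\<lambda>r \<omega>. indicator {S<..s} r *\<^sub>R Y r \<omega> - V j r \<omega>))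
       = L2sq (PM S s) (case_prod (\<lambda>r \<omega>. Y r \<omega> - V j r \<omega>))"
    \<comment> \<open>At time s itself the cut process is still alive while the shorter interval is
      open; beyond s the approximants vanish by \<open>elem_support\<close>.\<close>
    proof (rule L2sq_PM_AE_cong[where A = "{s}"])
      show "case_prod (\<lambda>r \<omega>. indicator {S<..s} r *\<^sub>R Y r \<omega> - V j r \<omega>) \<in> borel_measurable (PM S t)"
        using m1 by (simp add: case_prod_beta')
      show "case_prod (\<lambda>r \<omega>. Y r \<omega> - V j r \<omega>) \<in> borel_measurable (PM S s)"
        using m2 by (simp add: case_prod_beta')
      show "L2sq M (\<lambda>\<omega>. indicator {S<..s} r *\<^sub>R Y r \<omega> - V j r \<omega>) * indicator {S<..<t} r
        = L2sq M (\<lambda>\<omega>. Y r \<omega> - V j r \<omega>) * indicator {S<..<s} r" if "r \<notin> {s}" for r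
        using that S elem_support[OF V, of r j] by (auto simp: indicator_def)
    qed auto
    then show ?thesis by (simp add: case_prod_beta')
  qed
  show ?thesis
    by (rule has_ito_integralI[OF S(1) St L2F_cut[OF Y] has_ito_integral_measurable[OF ito] V' _ lim(2)])
      (use lim(1) in \<open>simp only: eq\<close>)
qed

text \<open>The difference of the integrals is the integral of \<open>Y\<close> minus its cut at s,
  a process living on (s, t), and the isometry measures it.\<close>

lemma ito_increment:
  fixes Y :: "('w, 'd::finite) process"
  assumes ito: "has_ito_integral M W S s Y X" "has_ito_integral M W S t Y X'" and S: "0 \<le> S" "S < s" "s \<le> t"
  shows "L2sq M (\<lambda>\<omega>. X' \<omega> - X \<omega>) = (\<integral>\<^sup>+ r. L2sq M (Y r) * indicator {s<..<t} r \<partial>lborel)"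
proof -
  have St: "S < t" using S by simp
  have Y: "Y \<in> L2F M W S t" by (rule has_ito_integral_L2F[OF ito(2)])
  let ?Z = "\<lambda>r \<omega>. Y r \<omega> + (-1) *\<^sub>R (indicator {S<..s} r *\<^sub>R Y r \<omega>)"
  have Z: "has_ito_integral M W S t ?Z (\<lambda>\<omega>. X' \<omega> + (-1) *\<^sub>R X \<omega>)"
    by (rule ito_linear[OF ito(2) ito_extend[OF ito(1) Y S] S(1) St])
  have "L2sq M (\<lambda>\<omega>. X' \<omega> - X \<omega>) = L2sq (PM S t) (case_prod ?Z)"
    using ito_isometry0[OF Z S(1) St] by simp
  also have "\<dots> = (\<integral>\<^sup>+ r. L2sq M (?Z r) * indicator {S<..<t} r \<partial>lborel)"
    by (simp only: L2sq_PM(1)[OF L2F_measurable[OF has_ito_integral_L2F[OF Z]]] nn_integral_interval)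
  also have "\<dots> = (\<integral>\<^sup>+ r. L2sq M (Y r) * indicator {s<..<t} r \<partial>lborel)"
    by (intro nn_integral_cong) (use S in \<open>auto simp: indicator_def\<close>)
  finally show ?thesis .
qed

text \<open>The indefinite integral \<open>X\<close> is a jointly measurable \<open>L\<^sup>2\<close>-limit of the step processes \<open>V n\<close> that
  freeze \<open>X\<close> at the left grid points: on a cell, \<open>X(t) - X(a\<^sub>i)\<close> is bounded in \<open>L\<^sup>2\<close> by the mass of \<open>Z\<close> on that
  cell, so the total error is at most the mesh times the squared norm of \<open>Z\<close>. Path continuity of \<open>W\<close>
  plays no role.\<close>

lemma indefinite_ito_integral:
  fixes Z :: "('w, 'd::finite) process"
  assumes Z: "appr S T Z" and S: "0 \<le> S" "S < T"
  shows "\<exists>Y. appr S T Y \<and> (AE t in interval_measure S T. has_ito_integral M W S t Z (Y t))"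
proof -
  have "\<exists>X\<in>borel_measurable (FW S t). has_ito_integral M W S t Z X" if "S < t" "t \<le> T" for t
    using ito_exists[OF appr_subinterval[OF Z S(1) that]] S that by simp
  then have "\<forall>t. \<exists>X. S < t \<and> t \<le> T \<longrightarrow> X \<in> borel_measurable (FW S t) \<and> has_ito_integral M W S t Z X"
    by blast
  then obtain X0 where X0: "\<And>t. S < t \<Longrightarrow> t \<le> T \<Longrightarrow> X0 t \<in> borel_measurable (FW S t) \<and> has_ito_integral M W S t Z (X0 t)"
    by metis
  \<comment> \<open>The value 0 up to S represents the integral over the empty interval, needed as
    the coefficient at the first grid point S.\<close>
  define XX where "XX t = (if t \<le> S then (\<lambda>_. 0) else X0 t)" for t
  have XX: "XX t \<in> borel_measurable (FW S t)" "has_ito_integral M W S t Z (XX t)" if "S < t" "t \<le> T" for t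
    using X0[OF that] that by (auto simp: XX_def)
  have XXm: "XX t \<in> borel_measurable (FW S t)" if "t \<le> T" for t
    using X0[of t] that by (auto simp: XX_def)
  have XXM: "XX t \<in> borel_measurable M" if "t \<le> T" for t
    using XXm[OF that] S(1) by (rule filt_imp_M)
  note mZ = L2F_measurable[OF appr_L2F[OF Z]]
  define \<phi> where "\<phi> r = L2sq M (Z r)" for r
  define tot where "tot = L2sq (PM S T) (case_prod Z)"
  have tot: "tot < \<infinity>" unfolding tot_def by (rule L2F_finite[OF appr_L2F[OF Z]])
  have tot_eq: "tot = (\<integral>\<^sup>+ r. \<phi> r * indicator {S<..<T} r \<partial>lborel)"
    unfolding tot_def \<phi>_def L2sq_PM(1)[OF mZ] nn_integral_interval ..
  have \<phi>m: "(\<lambda>r. \<phi> r * indicator {S<..<T} r) \<in> borel_measurable lborel"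
    using L2sq_PM(2)[OF mZ] unfolding \<phi>_def interval_measure_def
    by (subst (asm) borel_measurable_restrict_space_iff_ennreal) auto
  have incr: "L2sq M (\<lambda>\<omega>. XX t \<omega> - XX s \<omega>) = (\<integral>\<^sup>+ r. \<phi> r * indicator {s<..<t} r \<partial>lborel)"
    if "S \<le> s" "s < t" "t \<le> T" for s t
  proof (cases "s = S")
    case True
    have "L2sq M (\<lambda>\<omega>. XX t \<omega> - XX s \<omega>) = L2sq (PM S t) (case_prod Z)"
      using ito_isometry0[OF XX(2)[of t] S(1)] that True by (simp add: XX_def)
    also have "\<dots> = (\<integral>\<^sup>+ r. \<phi> r * indicator {s<..<t} r \<partial>lborel)"
      unfolding L2sq_PM(1)[OF PM_subinterval(1)[OF mZ that(3)]] nn_integral_interval \<phi>_def True ..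
    finally show ?thesis .
  next
    case False
    then show ?thesis unfolding \<phi>_def
      using ito_increment[OF XX(2) XX(2), of s t] that S by simp
  qed
  define a where "a n i = S + (T - S) * real i / real (Suc n)" for n i
  have a0: "a n 0 = S" and aN: "a n (Suc n) = T" for n by (simp_all add: a_def)
  have amono: "a n i < a n (Suc i)" for n i
    using S by (simp add: a_def divide_strict_right_mono)
  have adiff: "a n (Suc i) - a n i = (T - S) / real (Suc n)" for n i
    by (simp add: a_def diff_divide_distrib[symmetric] algebra_simps del: of_nat_Suc) (simp add: algebra_simps)
  have aS: "S \<le> a n i" for n i using S by (simp add: a_def)
  have aT: "a n i \<le> T" if "i \<le> Suc n" for n i
    using strict_chain_le[of "Suc n" "a n" i "Suc n"] amono that aN by auto
  have sd: "simple_data M W S T (Suc n) (a n) (\<lambda>i. XX (a n i))" for n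
    unfolding simple_data_def
  proof (intro conjI allI impI a0 aN amono)
    fix i assume i: "i < Suc n"
    show "XX (a n i) \<in> borel_measurable (FW S (a n i))" using XXm aT[of i n] i by simp
    have "L2sq M (XX (a n i)) < \<infinity>"
    proof (cases "a n i \<le> S")
      case False
      then show ?thesis using ito_finite[OF XX(2)[of "a n i"] S(1)] aT[of i n] i by simp
    qed (simp add: XX_def)
    then show "integrable M (\<lambda>\<omega>. (norm (XX (a n i) \<omega>))\<^sup>2)"
      using XXM aT[of i n] i by (simp add: integrable_norm_sq_iff)
  qed
  define V where "V n = simple_proc (Suc n) (a n) (\<lambda>i. XX (a n i))" for n
  have V: "elem S T (V n) (simple_integral W (Suc n) (a n) (\<lambda>i. XX (a n i)))" for n
    unfolding V_def by (rule simple_imp_elem[OF sd])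
  note V_L2F = elem_L2F[OF V S]
  note V_meas [measurable] = L2F_measurable[OF V_L2F]
  \<comment> \<open>For t in the i-th cell this is the mass of \<open>Z\<close> on that cell. As a
    step function of t it is measurable, although \<open>XX\<close> was chosen separately at every
    t.\<close>
  define q where "q n t = (\<Sum>i<Suc n. indicator {a n i<..a n (Suc i)} t * (\<integral>\<^sup>+ r. \<phi> r * indicator {a n i<..<a n (Suc i)} r \<partial>lborel))" for n t
  have [measurable]: "q n \<in> borel_measurable (interval_measure S T)" for n
    unfolding q_def[abs_def]
    by (intro borel_measurable_interval_measure borel_measurable_sum borel_measurable_times_ennreal
        borel_measurable_indicator borel_measurable_const) auto
  have Vq: "L2sq M (\<lambda>\<omega>. V n t \<omega> - XX t \<omega>) \<le> q n t" if t: "S < t" "t < T" for n t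
  proof -
    obtain i where i: "i < Suc n" "a n i < t" "t \<le> a n (Suc i)"
      using chain_cell[of "a n" t "Suc n"] t a0 aN by auto
    have "V n t \<omega> = XX (a n i) \<omega>" for \<omega>
    proof -
      have "V n t \<omega> = (\<Sum>j<Suc n. if j = i then XX (a n i) \<omega> else 0)"
        unfolding V_def simple_proc_def
      proof (rule sum.cong[OF refl])
        fix j assume j: "j \<in> {..<Suc n}"
        consider "j = i" | "j < i" | "i < j" by linarith
        then show "indicator {a n j<..a n (Suc j)} t *\<^sub>R XX (a n j) \<omega> = (if j = i then XX (a n i) \<omega> else 0)"
        proof cases
          case 2
          then have "a n (Suc j) \<le> a n i" using strict_chain_le[of "Suc n" "a n" "Suc j" i] amono i by auto
          with 2 i show ?thesis by simp
        next
          case 3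
          then have "a n (Suc i) \<le> a n j" using strict_chain_le[of "Suc n" "a n" "Suc i" j] amono i j by auto
          with 3 i show ?thesis by simp
        qed (use i in simp)
      qed
      then show ?thesis using i(1) by simp
    qed
    then have "L2sq M (\<lambda>\<omega>. V n t \<omega> - XX t \<omega>) = L2sq M (\<lambda>\<omega>. XX t \<omega> - XX (a n i) \<omega>)"
      by (simp add: L2sq_commute[of _ "XX t"])
    also have "\<dots> = (\<integral>\<^sup>+ r. \<phi> r * indicator {a n i<..<t} r \<partial>lborel)"
      by (rule incr) (use aS i t in auto)
    also have "\<dots> \<le> (\<integral>\<^sup>+ r. \<phi> r * indicator {a n i<..<a n (Suc i)} r \<partial>lborel)"
      by (intro nn_integral_mono) (use i in \<open>auto simp: indicator_def\<close>)
    also have "\<dots> = indicator {a n i<..a n (Suc i)} t * (\<integral>\<^sup>+ r. \<phi> r * indicator {a n i<..<a n (Suc i)} r \<partial>lborel)"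
      using i by simp
    also have "\<dots> \<le> q n t"
      unfolding q_def using i(1) by (intro member_le_sum) auto
    finally show ?thesis .
  qed
  \<comment> \<open>\<open>\<phi>\<close> is known to be measurable only on (S, T), so each cell is
    first intersected with the whole interval.\<close>
  have \<phi>c: "(\<lambda>r. \<phi> r * indicator {a n i<..<a n (Suc i)} r) \<in> borel_measurable lborel" if "i < Suc n" for n i
  proof -
    have "(\<lambda>r. (\<phi> r * indicator {S<..<T} r) * indicator {a n i<..<a n (Suc i)} r) \<in> borel_measurable lborel"
      using \<phi>m by measurable
    moreover have "(\<phi> r * indicator {S<..<T} r) * indicator {a n i<..<a n (Suc i)} r = \<phi> r * indicator {a n i<..<a n (Suc i)} r" for r
      using aS[of n i] aT[of "Suc i" n] that by (auto simp: indicator_def)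
    ultimately show ?thesis by simp
  qed
  have Iq: "(\<integral>\<^sup>+ t. q n t \<partial>interval_measure S T) \<le> ennreal ((T - S) / real (Suc n)) * tot" for n
  proof -
    have "(\<integral>\<^sup>+ t. q n t \<partial>interval_measure S T) \<le> (\<integral>\<^sup>+ t. q n t \<partial>lborel)"
      unfolding nn_integral_interval by (intro nn_integral_mono) (auto simp: indicator_def)
    also have "\<dots> = (\<Sum>i<Suc n. ennreal (a n (Suc i) - a n i) * (\<integral>\<^sup>+ r. \<phi> r * indicator {a n i<..<a n (Suc i)} r \<partial>lborel))"
      unfolding q_def by (subst nn_integral_sum) (use amono in \<open>auto simp: nn_integral_multc less_imp_le\<close>)
    also have "\<dots> = ennreal ((T - S) / real (Suc n)) * (\<Sum>i<Suc n. (\<integral>\<^sup>+ r. \<phi> r * indicator {a n i<..<a n (Suc i)} r \<partial>lborel))"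
      by (simp only: adiff sum_distrib_left)
    also have "(\<Sum>i<Suc n. (\<integral>\<^sup>+ r. \<phi> r * indicator {a n i<..<a n (Suc i)} r \<partial>lborel)) = (\<integral>\<^sup>+ r. (\<Sum>i<Suc n. \<phi> r * indicator {a n i<..<a n (Suc i)} r) \<partial>lborel)"
      by (rule nn_integral_sum[symmetric]) (use \<phi>c in simp)
    also have "\<dots> \<le> tot"
      unfolding tot_eq sum_distrib_left[symmetric]
      using sum_indicator_cells_le[of "Suc n" "a n"] amono a0[of n] aN[of n]
      by (intro nn_integral_mono mult_left_mono) auto
    finally show ?thesis by (simp add: mult_left_mono)
  qed
  \<comment> \<open>Mesh times total mass, as in \<open>Iq\<close>, with the factor 2 of the squared
    triangle inequality.\<close>
  let ?c = "\<lambda>n. (2 * tot) * ennreal ((T - S) / real (Suc n))"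
  have c0: "?c \<longlonglongrightarrow> 0"
  proof -
    have "(\<lambda>n. ennreal ((T - S) * inverse (real (Suc n)))) \<longlonglongrightarrow> ennreal ((T - S) * 0)"
      by (intro tendsto_ennrealI tendsto_mult tendsto_const LIMSEQ_inverse_real_of_nat)
    then have "(\<lambda>n. ennreal ((T - S) / real (Suc n))) \<longlonglongrightarrow> 0" by (simp add: divide_inverse)
    then show ?thesis using tot by (intro tendsto_ennreal_mult0) (auto simp: ennreal_mult_less_top)
  qed
  have cauchy: "L2sq (PM S T) (\<lambda>p. case_prod (V m) p - case_prod (V n) p) \<le> ?c m + ?c n" for m n
  proof -
    have m: "case_prod (\<lambda>t \<omega>. V m t \<omega> - V n t \<omega>) \<in> borel_measurable (PM S T)"
    proof -
      have "(\<lambda>p. case_prod (V m) p - case_prod (V n) p) \<in> borel_measurable (PM S T)" by measurable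
      then show ?thesis by (simp add: case_prod_beta')
    qed
    have "L2sq (PM S T) (\<lambda>p. case_prod (V m) p - case_prod (V n) p) = (\<integral>\<^sup>+ t. L2sq M (\<lambda>\<omega>. V m t \<omega> - V n t \<omega>) \<partial>interval_measure S T)"
      using L2sq_PM(1)[OF m] by (simp add: case_prod_beta')
    also have "\<dots> \<le> (\<integral>\<^sup>+ t. 2 * q m t + 2 * q n t \<partial>interval_measure S T)"
    proof (rule nn_integral_mono)
      fix t assume "t \<in> space (interval_measure S T)"
      then have t: "S < t" "t < T" by auto
      have mV: "V k t \<in> borel_measurable M" for k by (rule L2F_section_measurable[OF V_L2F S(1) t])
      have "L2sq M (\<lambda>\<omega>. V m t \<omega> - V n t \<omega>) \<le> 2 * L2sq M (\<lambda>\<omega>. V m t \<omega> - XX t \<omega>) + 2 * L2sq M (\<lambda>\<omega>. XX t \<omega> - V n t \<omega>)"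
        using t by (intro L2sq_diff_le mV XXM) auto
      also have "L2sq M (\<lambda>\<omega>. XX t \<omega> - V n t \<omega>) = L2sq M (\<lambda>\<omega>. V n t \<omega> - XX t \<omega>)" by (rule L2sq_commute)
      also have "2 * L2sq M (\<lambda>\<omega>. V m t \<omega> - XX t \<omega>) + 2 * L2sq M (\<lambda>\<omega>. V n t \<omega> - XX t \<omega>) \<le> 2 * q m t + 2 * q n t"
        by (intro add_mono mult_left_mono Vq t) auto
      finally show "L2sq M (\<lambda>\<omega>. V m t \<omega> - V n t \<omega>) \<le> 2 * q m t + 2 * q n t" .
    qed
    also have "\<dots> = 2 * (\<integral>\<^sup>+ t. q m t \<partial>interval_measure S T) + 2 * (\<integral>\<^sup>+ t. q n t \<partial>interval_measure S T)"
      by (simp add: nn_integral_add nn_integral_cmult)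
    also have "\<dots> \<le> 2 * (ennreal ((T - S) / real (Suc m)) * tot) + 2 * (ennreal ((T - S) / real (Suc n)) * tot)"
      by (intro add_mono mult_left_mono Iq) auto
    finally show ?thesis by (simp only: mult.assoc mult.commute[of tot])
  qed
  obtain Y where Y: "Y \<in> L2F M W S T" and lim: "(\<lambda>n. L2sq (PM S T) (\<lambda>p. case_prod Y p - case_prod (V n) p)) \<longlonglongrightarrow> 0"
    using L2F_complete[OF V_L2F c0 cauchy] by blast
  have "appr S T Y" by (rule apprI[OF Y V lim])
  moreover have "AE t in interval_measure S T. has_ito_integral M W S t Z (Y t)"
  proof -
    have m: "case_prod (\<lambda>t \<omega>. Y t \<omega> - V n t \<omega>) \<in> borel_measurable (PM S T)" for n
    proof -
      have "(\<lambda>p. case_prod Y p - case_prod (V n) p) \<in> borel_measurable (PM S T)"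
        using L2F_measurable[OF Y] by (intro borel_measurable_diff V_meas)
      then show ?thesis by (simp add: case_prod_beta')
    qed
    note [measurable] = L2sq_PM(2)[OF m]
    \<comment> \<open>Both Y - V n and V n - XX become small in mean square integrated over time, so
      \<open>Y\<close> is a jointly measurable version of the pointwise chosen
      \<open>XX\<close>.\<close>
    have "AE t in interval_measure S T. L2sq M (\<lambda>\<omega>. Y t \<omega> - XX t \<omega>) = 0"
    proof (rule AE_zero_INF)
      show "(\<lambda>t. 2 * L2sq M (\<lambda>\<omega>. Y t \<omega> - V n t \<omega>) + 2 * q n t) \<in> borel_measurable (interval_measure S T)" for n
        by measurable
      have eq: "(\<integral>\<^sup>+ t. 2 * L2sq M (\<lambda>\<omega>. Y t \<omega> - V n t \<omega>) + 2 * q n t \<partial>interval_measure S T)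
        = 2 * L2sq (PM S T) (\<lambda>p. case_prod Y p - case_prod (V n) p) + 2 * (\<integral>\<^sup>+ t. q n t \<partial>interval_measure S T)" for n
        using L2sq_PM(1)[OF m, of n] by (simp add: nn_integral_add nn_integral_cmult case_prod_beta')
      have "(\<lambda>n. \<integral>\<^sup>+ t. q n t \<partial>interval_measure S T) \<longlonglongrightarrow> 0"
      proof (rule tendsto_sandwich[OF _ _ tendsto_const c0])
        show "\<forall>\<^sub>F n in sequentially. (\<integral>\<^sup>+ t. q n t \<partial>interval_measure S T) \<le> ?c n"
        proof (rule always_eventually, rule allI)
          fix n
          have "(\<integral>\<^sup>+ t. q n t \<partial>interval_measure S T) \<le> 1 * (ennreal ((T - S) / real (Suc n)) * tot)" using Iq[of n] by simp
          also have "\<dots> \<le> 2 * (ennreal ((T - S) / real (Suc n)) * tot)" by (intro mult_right_mono) auto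
          finally show "(\<integral>\<^sup>+ t. q n t \<partial>interval_measure S T) \<le> ?c n" by (simp only: mult.assoc mult.commute[of tot])
        qed
      qed simp
      then have "(\<lambda>n. 2 * L2sq (PM S T) (\<lambda>p. case_prod Y p - case_prod (V n) p) + 2 * (\<integral>\<^sup>+ t. q n t \<partial>interval_measure S T)) \<longlonglongrightarrow> 0 + 0"
        by (intro tendsto_add tendsto_ennreal_mult0 lim) auto
      then show "(\<lambda>n. \<integral>\<^sup>+ t. 2 * L2sq M (\<lambda>\<omega>. Y t \<omega> - V n t \<omega>) + 2 * q n t \<partial>interval_measure S T) \<longlonglongrightarrow> 0"
        unfolding eq by simp
      show "AE t in interval_measure S T. \<forall>n. L2sq M (\<lambda>\<omega>. Y t \<omega> - XX t \<omega>) \<le> 2 * L2sq M (\<lambda>\<omega>. Y t \<omega> - V n t \<omega>) + 2 * q n t"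
        using AE_interval_measure_space
      proof eventually_elim
        case (elim t)
        then have t: "S < t" "t < T" by auto
        show ?case
        proof
          fix n
          have "L2sq M (\<lambda>\<omega>. Y t \<omega> - XX t \<omega>) \<le> 2 * L2sq M (\<lambda>\<omega>. Y t \<omega> - V n t \<omega>) + 2 * L2sq M (\<lambda>\<omega>. V n t \<omega> - XX t \<omega>)"
            using t by (intro L2sq_diff_le L2F_section_measurable[OF Y S(1) t] L2F_section_measurable[OF V_L2F S(1) t] XXM) auto
          also have "\<dots> \<le> 2 * L2sq M (\<lambda>\<omega>. Y t \<omega> - V n t \<omega>) + 2 * q n t"
            by (intro add_left_mono mult_left_mono Vq t) auto
          finally show "L2sq M (\<lambda>\<omega>. Y t \<omega> - XX t \<omega>) \<le> 2 * L2sq M (\<lambda>\<omega>. Y t \<omega> - V n t \<omega>) + 2 * q n t" .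
        qed
      qed
    qed
    with AE_interval_measure_space show ?thesis
    proof eventually_elim
      case (elim t)
      then have t: "S < t" "t < T" by auto
      note mY = L2F_section_measurable[OF Y S(1) t] and mX = XXM[of t]
      have "AE \<omega> in M. Y t \<omega> - XX t \<omega> = 0"
        using elim mY mX t by (subst L2sq_eq_0_iff[symmetric]) auto
      then have "AE \<omega> in M. XX t \<omega> = Y t \<omega>" by eventually_elim simp
      then show ?case using t by (intro ito_AE[OF XX(2) _ mY]) auto
    qed
  qed
  ultimately show ?thesis by blast
qed

end

section \<open>Iterated integrals\<close>

lemma L2sq_dominated:
  fixes F :: "'a \<Rightarrow> 'b::{second_countable_topology, real_normed_vector}"
  assumes [measurable]: "F \<in> borel_measurable N" "\<And>j. Fs j \<in> borel_measurable N" "w \<in> borel_measurable N"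
    and lim: "\<And>x. x \<in> space N \<Longrightarrow> (\<lambda>j. Fs j x) \<longlonglongrightarrow> F x"
    and bd: "\<And>j x. x \<in> space N \<Longrightarrow> norm (Fs j x) \<le> w x"
    and w: "(\<integral>\<^sup>+ x. ennreal ((w x)\<^sup>2) \<partial>N) < \<infinity>"
  shows "(\<lambda>j. L2sq N (\<lambda>x. F x - Fs j x)) \<longlonglongrightarrow> 0"
proof -
  have "(\<lambda>j. \<integral>\<^sup>+ x. ennreal ((norm (F x - Fs j x))\<^sup>2) \<partial>N) \<longlonglongrightarrow> (\<integral>\<^sup>+ x. 0 \<partial>N)"
  proof (rule nn_integral_dominated_convergence[where w = "\<lambda>x. 4 * ennreal ((w x)\<^sup>2)"])
    show "(\<integral>\<^sup>+ x. 4 * ennreal ((w x)\<^sup>2) \<partial>N) < \<infinity>"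
      using w by (simp add: nn_integral_cmult ennreal_mult_less_top)
    show "AE x in N. ennreal ((norm (F x - Fs j x))\<^sup>2) \<le> 4 * ennreal ((w x)\<^sup>2)" for j
    proof (rule AE_I2)
      fix x assume x: "x \<in> space N"
      have "norm (F x) \<le> w x"
        by (rule Lim_bounded[OF tendsto_norm[OF lim[OF x]]]) (use bd[OF x] in auto)
      then have "norm (F x - Fs j x) \<le> 2 * w x"
        using norm_triangle_ineq4[of "F x" "Fs j x"] bd[OF x, of j] by linarith
      then have "(norm (F x - Fs j x))\<^sup>2 \<le> (2 * w x)\<^sup>2" by (intro power_mono) auto
      also have "\<dots> = 4 * (w x)\<^sup>2" by (simp add: power2_eq_square)
      finally show "ennreal ((norm (F x - Fs j x))\<^sup>2) \<le> 4 * ennreal ((w x)\<^sup>2)"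
        by (metis ennreal_leI ennreal_mult' ennreal_numeral zero_le_numeral)
    qed
    show "AE x in N. (\<lambda>j. ennreal ((norm (F x - Fs j x))\<^sup>2)) \<longlonglongrightarrow> 0"
    proof (rule AE_I2)
      fix x assume x: "x \<in> space N"
      have "(\<lambda>j. ennreal ((norm (F x - Fs j x))\<^sup>2)) \<longlonglongrightarrow> ennreal ((norm (F x - F x))\<^sup>2)"
        by (intro tendsto_ennrealI tendsto_intros lim[OF x])
      then show "(\<lambda>j. ennreal ((norm (F x - Fs j x))\<^sup>2)) \<longlonglongrightarrow> 0" by simp
    qed
  qed measurable
  then show ?thesis by (simp add: L2sq_def)
qed

lemma L2sq_Theta:
  fixes F :: "real \<times> (nat \<Rightarrow> real) \<Rightarrow> 'b::{second_countable_topology, real_normed_vector}"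
  assumes [measurable]: "F \<in> borel_measurable (Theta n S T)"
  shows "L2sq (Theta n S T) F = (\<integral>\<^sup>+ t. L2sq (Delta_measure n S t) (\<lambda>s. F (t, s)) \<partial>interval_measure S T)"
    and "(\<lambda>t. L2sq (Delta_measure n S t) (\<lambda>s. F (t, s))) \<in> borel_measurable (interval_measure S T)"
proof -
  have m: "(\<lambda>p. ennreal ((norm (F p))\<^sup>2)) \<in> borel_measurable (Theta n S T)" by measurable
  show "L2sq (Theta n S T) F = (\<integral>\<^sup>+ t. L2sq (Delta_measure n S t) (\<lambda>s. F (t, s)) \<partial>interval_measure S T)"
    unfolding L2sq_def by (rule nn_integral_Theta(1)[OF m])
  show "(\<lambda>t. L2sq (Delta_measure n S t) (\<lambda>s. F (t, s))) \<in> borel_measurable (interval_measure S T)"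
    unfolding L2sq_def by (rule nn_integral_Theta(2)[OF m])
qed

lemma L2sq_Delta_0:
  fixes f :: "(nat \<Rightarrow> real) \<Rightarrow> 'b::real_normed_vector"
  shows "L2sq (Delta_measure 0 S T) f = ennreal ((norm (f (\<lambda>_. undefined)))\<^sup>2)"
  unfolding L2sq_def by (rule nn_integral_Delta_0)

context brownian_motion
begin

section \<open>Algebra and orthogonality of iterated integrals\<close>

lemma ito_zero: "0 \<le> S \<Longrightarrow> S < T \<Longrightarrow> has_ito_integral M W S T (\<lambda>_ _. 0 :: 'd::finite mat) (\<lambda>_. 0)"
  by (rule has_ito_integralI[where V = "\<lambda>_ _ _. 0" and Xs = "\<lambda>_ _. 0"])
    (auto intro: elem_zero elem_L2F[OF elem_zero])

lemma ito_sum: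
  fixes Y :: "nat \<Rightarrow> ('w, 'd::finite) process"
  assumes "\<And>n. n < N \<Longrightarrow> has_ito_integral M W S T (Y n) (X n)" "0 \<le> S" "S < T"
  shows "has_ito_integral M W S T (\<lambda>t \<omega>. \<Sum>n<N. Y n t \<omega>) (\<lambda>\<omega>. \<Sum>n<N. X n \<omega>)"
  using assms(1)
proof (induction N)
  case (Suc N)
  have "has_ito_integral M W S T (\<lambda>t \<omega>. (\<Sum>n<N. Y n t \<omega>) + 1 *\<^sub>R Y N t \<omega>) (\<lambda>\<omega>. (\<Sum>n<N. X n \<omega>) + 1 *\<^sub>R X N \<omega>)"
    by (rule ito_linear[OF _ _ assms(2,3)]) (use Suc in auto)
  then show ?case by simp
qed (use ito_zero assms in simp)

lemma iter_SucE:
  assumes "has_iter_integral M W S (Suc n) t f X"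
  obtains Y where "AE r in interval_measure S t. has_iter_integral M W S n r (\<lambda>s. f (case_nat r s)) (Y r)"
    "has_ito_integral M W S t Y X"
  using assms by auto

lemma iter_linear:
  fixes f g :: "'d::finite kernel"
  assumes "has_iter_integral M W S n t f X" "has_iter_integral M W S n t g X'" "0 \<le> S" "S < t"
  shows "has_iter_integral M W S n t (\<lambda>s. f s + c *\<^sub>R g s) (\<lambda>\<omega>. X \<omega> + c *\<^sub>R X' \<omega>)"
  using assms(1,2,4)
proof (induction n arbitrary: t f g X X')
  case 0
  from "0.prems"(1,2) have "AE \<omega> in M. X \<omega> = f (\<lambda>_. undefined)" "AE \<omega> in M. X' \<omega> = g (\<lambda>_. undefined)" by simp_all
  then show ?case unfolding has_iter_integral.simps by eventually_elim simp
next
  case (Suc n)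
  obtain Y where Y: "AE r in interval_measure S t. has_iter_integral M W S n r (\<lambda>s. f (case_nat r s)) (Y r)"
    "has_ito_integral M W S t Y X" by (rule iter_SucE[OF Suc.prems(1)])
  obtain Y' where Y': "AE r in interval_measure S t. has_iter_integral M W S n r (\<lambda>s. g (case_nat r s)) (Y' r)"
    "has_ito_integral M W S t Y' X'" by (rule iter_SucE[OF Suc.prems(2)])
  have "AE r in interval_measure S t. has_iter_integral M W S n r (\<lambda>s. f (case_nat r s) + c *\<^sub>R g (case_nat r s)) (\<lambda>\<omega>. Y r \<omega> + c *\<^sub>R Y' r \<omega>)"
    using Y(1) Y'(1) AE_interval_measure_space by eventually_elim (rule Suc.IH, auto)
  moreover have "has_ito_integral M W S t (\<lambda>r \<omega>. Y r \<omega> + c *\<^sub>R Y' r \<omega>) (\<lambda>\<omega>. X \<omega> + c *\<^sub>R X' \<omega>)"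
    by (rule ito_linear[OF Y(2) Y'(2) assms(3) Suc.prems(3)])
  ultimately show ?case unfolding has_iter_integral.simps by (intro exI conjI)
qed

lemma iter_cong:
  fixes f g :: "'d::finite kernel"
  assumes "has_iter_integral M W S n t f X" "\<And>s. s \<in> Delta n S t \<Longrightarrow> f s = g s" "S < t"
  shows "has_iter_integral M W S n t g X"
  using assms
proof (induction n arbitrary: t f g X)
  case 0
  then show ?case by (simp add: Delta_0)
next
  case (Suc n)
  obtain Y where Y: "AE r in interval_measure S t. has_iter_integral M W S n r (\<lambda>s. f (case_nat r s)) (Y r)"
    "has_ito_integral M W S t Y X" by (rule iter_SucE[OF Suc.prems(1)])
  have "AE r in interval_measure S t. has_iter_integral M W S n r (\<lambda>s. g (case_nat r s)) (Y r)"
    using Y(1) AE_interval_measure_space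
  proof eventually_elim
    case (elim r)
    show ?case
      by (rule Suc.IH[OF elim(1)]) (use elim(2) in \<open>auto intro!: Suc.prems(2) simp: case_nat_in_Delta_iff\<close>)
  qed
  with Y(2) show ?case unfolding has_iter_integral.simps by (intro exI conjI)
qed

lemma iter_AE:
  fixes f :: "'d::finite kernel"
  assumes "has_iter_integral M W S n t f X" "AE \<omega> in M. X \<omega> = X' \<omega>" "X' \<in> borel_measurable M"
  shows "has_iter_integral M W S n t f X'"
proof (cases n)
  case 0
  with assms(1) have "AE \<omega> in M. X \<omega> = f (\<lambda>_. undefined)" by simp
  with assms(2) have "AE \<omega> in M. X' \<omega> = f (\<lambda>_. undefined)" by eventually_elim simp
  with 0 show ?thesis by simp
next
  case (Suc k)
  obtain Y where Y: "AE r in interval_measure S t. has_iter_integral M W S k r (\<lambda>s. f (case_nat r s)) (Y r)"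
    "has_ito_integral M W S t Y X" using assms(1) unfolding Suc by (rule iter_SucE)
  show ?thesis unfolding Suc has_iter_integral.simps
    using Y(1) ito_AE[OF Y(2) assms(2,3)] by (intro exI conjI)
qed

lemma iter_zero:
  assumes "0 \<le> S" "S < t"
  shows "has_iter_integral M W S n t (\<lambda>_. 0 :: 'd::finite mat) (\<lambda>_. 0)"
  using assms(2)
proof (induction n arbitrary: t)
  case (Suc n)
  have "AE r in interval_measure S t. has_iter_integral M W S n r (\<lambda>_. 0 :: 'd mat) (\<lambda>_. 0)"
    using AE_interval_measure_space by eventually_elim (rule Suc.IH, auto)
  then show ?case unfolding has_iter_integral.simps
    using ito_zero[OF assms(1) Suc.prems] by (intro exI conjI)
qed simp

text \<open>Induction on the number of orders. Order 0 contributes a constant c; all higher orders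
  together form one Ito integral whose integrand at r is a sum of iterated integrals over (S, r)
  with every order lowered by one. The isometry separates c from this integral, and the induction
  hypothesis applies at almost every r. Cross terms between different orders never appear
  explicitly.\<close>

lemma iter_pythagoras:
  fixes f :: "nat \<Rightarrow> 'd::finite kernel"
  assumes "\<And>n. n < N \<Longrightarrow> has_iter_integral M W S n t (f n) (X n)"
    and "\<And>n. n < N \<Longrightarrow> f n \<in> borel_measurable (Delta_measure n S t)"
    and "0 \<le> S" "S < t"
  shows "L2sq M (\<lambda>\<omega>. \<Sum>n<N. X n \<omega>) = (\<Sum>n<N. L2sq (Delta_measure n S t) (f n))"
  using assms(1,2,4)
proof (induction N arbitrary: t f X)
  case (Suc N)
  have "\<forall>n. \<exists>Y. n < N \<longrightarrow> (AE r in interval_measure S t. has_iter_integral M W S n r (\<lambda>s. f (Suc n) (case_nat r s)) (Y r))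
      \<and> has_ito_integral M W S t Y (X (Suc n))"
  proof
    fix n
    show "\<exists>Y. n < N \<longrightarrow> (AE r in interval_measure S t. has_iter_integral M W S n r (\<lambda>s. f (Suc n) (case_nat r s)) (Y r))
      \<and> has_ito_integral M W S t Y (X (Suc n))"
      using Suc.prems(1)[of "Suc n"] by (cases "n < N") auto
  qed
  from choice[OF this] obtain Y where
    Y0: "\<forall>n. n < N \<longrightarrow> (AE r in interval_measure S t. has_iter_integral M W S n r (\<lambda>s. f (Suc n) (case_nat r s)) (Y n r))
      \<and> has_ito_integral M W S t (Y n) (X (Suc n))" ..
  have Y1: "AE r in interval_measure S t. \<forall>n\<in>{..<N}. has_iter_integral M W S n r (\<lambda>s. f (Suc n) (case_nat r s)) (Y n r)"
    by (rule AE_finite_allI) (use Y0 in auto)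
  have Y2: "has_ito_integral M W S t (Y n) (X (Suc n))" if "n < N" for n using Y0 that by simp
  define c where "c = f 0 (\<lambda>_. undefined)"
  have X0: "AE \<omega> in M. X 0 \<omega> = c" using Suc.prems(1)[of 0] by (simp add: c_def)
  have ito: "has_ito_integral M W S t (\<lambda>r \<omega>. \<Sum>n<N. Y n r \<omega>) (\<lambda>\<omega>. \<Sum>n<N. X (Suc n) \<omega>)"
    by (rule ito_sum[OF Y2 assms(3) Suc.prems(3)])
  note fm = Suc.prems(2)
  have fm2: "(\<lambda>x. ennreal ((norm (f (Suc n) x))\<^sup>2)) \<in> borel_measurable (Delta_measure (Suc n) S t)" if "n < N" for n
    using fm[of "Suc n"] that by simp
  have "L2sq M (\<lambda>\<omega>. \<Sum>n<Suc N. X n \<omega>) = L2sq M (\<lambda>\<omega>. c + (\<Sum>n<N. X (Suc n) \<omega>))"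
    by (rule L2sq_cong_AE) (use X0 in eventually_elim, simp add: sum.lessThan_Suc_shift del: sum.lessThan_Suc)
  also have "\<dots> = ennreal ((norm c)\<^sup>2) + L2sq (PM S t) (case_prod (\<lambda>r \<omega>. \<Sum>n<N. Y n r \<omega>))"
    by (rule ito_isometry[OF ito assms(3) Suc.prems(3)])
  also have "L2sq (PM S t) (case_prod (\<lambda>r \<omega>. \<Sum>n<N. Y n r \<omega>)) = (\<integral>\<^sup>+ r. L2sq M (\<lambda>\<omega>. \<Sum>n<N. Y n r \<omega>) \<partial>interval_measure S t)"
    by (rule L2sq_PM(1)[OF L2F_measurable[OF has_ito_integral_L2F[OF ito]]])
  also have "\<dots> = (\<integral>\<^sup>+ r. (\<Sum>n<N. L2sq (Delta_measure n S r) (\<lambda>s. f (Suc n) (case_nat r s))) \<partial>interval_measure S t)"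
  proof (rule nn_integral_cong_AE, use Y1 AE_interval_measure_space in eventually_elim)
    case (elim r)
    show ?case
    proof (rule Suc.IH)
      fix n assume n: "n < N"
      show "has_iter_integral M W S n r (\<lambda>s. f (Suc n) (case_nat r s)) (Y n r)" using elim n by simp
      show "(\<lambda>s. f (Suc n) (case_nat r s)) \<in> borel_measurable (Delta_measure n S r)"
        by (rule measurable_compose[OF measurable_case_nat_section fm]) (use elim n in auto)
    qed (use elim in simp)
  qed
  also have "\<dots> = (\<Sum>n<N. \<integral>\<^sup>+ r. L2sq (Delta_measure n S r) (\<lambda>s. f (Suc n) (case_nat r s)) \<partial>interval_measure S t)"
    unfolding L2sq_def by (rule nn_integral_sum) (use nn_integral_Delta_Suc_head(2)[OF fm2] in simp)
  also have "\<dots> = (\<Sum>n<N. L2sq (Delta_measure (Suc n) S t) (f (Suc n)))"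
    unfolding L2sq_def by (rule sum.cong[OF refl], rule nn_integral_Delta_Suc_head(1)[OF fm2, symmetric]) simp
  also have "ennreal ((norm c)\<^sup>2) + \<dots> = (\<Sum>n<Suc N. L2sq (Delta_measure n S t) (f n))"
    by (simp add: sum.lessThan_Suc_shift L2sq_Delta_0 c_def del: sum.lessThan_Suc)
  finally show ?case .
qed simp

text \<open>Pythagoras for a family that vanishes except in order n.\<close>

lemma iter_isometry:
  fixes f :: "'d::finite kernel"
  assumes "has_iter_integral M W S n t f X" "f \<in> borel_measurable (Delta_measure n S t)" "0 \<le> S" "S < t"
  shows "L2sq M X = L2sq (Delta_measure n S t) f"
proof -
  have "L2sq M (\<lambda>\<omega>. \<Sum>k<Suc n. (if k = n then X else (\<lambda>_. 0)) \<omega>)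
     = (\<Sum>k<Suc n. L2sq (Delta_measure k S t) (if k = n then f else (\<lambda>_. 0)))"
    by (rule iter_pythagoras) (use assms iter_zero in auto)
  also have "(\<lambda>\<omega>. \<Sum>k<Suc n. (if k = n then X else (\<lambda>_. 0)) \<omega>) = X" by auto
  also have "(\<Sum>k<Suc n. L2sq (Delta_measure k S t) (if k = n then f else (\<lambda>_. 0))) = L2sq (Delta_measure n S t) f"
    by simp
  finally show ?thesis .
qed

text \<open>A form of \<open>is_Wn\<close> with the kernel a function of the pair (t, s), so that
  rectangles and general product-measurable sets can be kernels, and without the clause on
  square-integrability.\<close>

definition wiener :: "real \<Rightarrow> real \<Rightarrow> nat \<Rightarrow> (real \<times> (nat \<Rightarrow> real) \<Rightarrow> 'd::finite mat) \<Rightarrow> ('w, 'd) process \<Rightarrow> bool" where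
  "wiener S T n F Y \<longleftrightarrow> Y \<in> L2F M W S T \<and>
     (AE t in interval_measure S T. has_iter_integral M W S n t (\<lambda>s. F (t, s)) (Y t))"

lemma wiener_linear:
  fixes Y :: "('w, 'd::finite) process"
  assumes "wiener S T n F Y" "wiener S T n G Z" "0 \<le> S"
  shows "wiener S T n (\<lambda>p. F p + c *\<^sub>R G p) (\<lambda>t \<omega>. Y t \<omega> + c *\<^sub>R Z t \<omega>)"
proof -
  have "AE t in interval_measure S T. has_iter_integral M W S n t (\<lambda>s. F (t, s)) (Y t)"
    "AE t in interval_measure S T. has_iter_integral M W S n t (\<lambda>s. G (t, s)) (Z t)"
    using assms by (auto simp: wiener_def)
  then have "AE t in interval_measure S T. has_iter_integral M W S n t (\<lambda>s. F (t, s) + c *\<^sub>R G (t, s)) (\<lambda>\<omega>. Y t \<omega> + c *\<^sub>R Z t \<omega>)"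
    using AE_interval_measure_space by eventually_elim (rule iter_linear, use assms in auto)
  with assms(1,2) show ?thesis unfolding wiener_def by (auto intro: L2F_add)
qed

lemma wiener_pythagoras:
  fixes Y :: "nat \<Rightarrow> ('w, 'd::finite) process"
  assumes Y: "\<And>n. n < N \<Longrightarrow> wiener S T n (F n) (Y n)"
    and F: "\<And>n. n < N \<Longrightarrow> F n \<in> borel_measurable (Theta n S T)" and S: "0 \<le> S"
  shows "L2sq (PM S T) (\<lambda>p. \<Sum>n<N. case_prod (Y n) p) = (\<Sum>n<N. L2sq (Theta n S T) (F n))"
proof -
  have m: "(\<lambda>p. \<Sum>n<N. case_prod (Y n) p) \<in> borel_measurable (PM S T)"
    by (intro borel_measurable_sum L2F_measurable) (use Y in \<open>auto simp: wiener_def\<close>)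
  then have m': "case_prod (\<lambda>t \<omega>. \<Sum>n<N. Y n t \<omega>) \<in> borel_measurable (PM S T)" by (simp add: case_prod_beta')
  have "L2sq (PM S T) (\<lambda>p. \<Sum>n<N. case_prod (Y n) p) = (\<integral>\<^sup>+ t. L2sq M (\<lambda>\<omega>. \<Sum>n<N. Y n t \<omega>) \<partial>interval_measure S T)"
    using L2sq_PM(1)[OF m'] by (simp add: case_prod_beta')
  also have "\<dots> = (\<integral>\<^sup>+ t. (\<Sum>n<N. L2sq (Delta_measure n S t) (\<lambda>s. F n (t, s))) \<partial>interval_measure S T)"
  proof (rule nn_integral_cong_AE)
    have "AE t in interval_measure S T. \<forall>n\<in>{..<N}. has_iter_integral M W S n t (\<lambda>s. F n (t, s)) (Y n t)"
      by (rule AE_finite_allI) (use Y in \<open>auto simp: wiener_def\<close>)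
    then show "AE t in interval_measure S T. L2sq M (\<lambda>\<omega>. \<Sum>n<N. Y n t \<omega>) = (\<Sum>n<N. L2sq (Delta_measure n S t) (\<lambda>s. F n (t, s)))"
      using AE_interval_measure_space
    proof eventually_elim
      case (elim t)
      show ?case
      proof (rule iter_pythagoras)
        fix n assume n: "n < N"
        show "has_iter_integral M W S n t (\<lambda>s. F n (t, s)) (Y n t)" using elim n by simp
        show "(\<lambda>s. F n (t, s)) \<in> borel_measurable (Delta_measure n S t)"
          by (rule measurable_compose[OF measurable_Theta_section F[OF n]]) (use elim in auto)
      qed (use elim S in auto)
    qed
  qed
  also have "\<dots> = (\<Sum>n<N. \<integral>\<^sup>+ t. L2sq (Delta_measure n S t) (\<lambda>s. F n (t, s)) \<partial>interval_measure S T)"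
    by (rule nn_integral_sum) (use L2sq_Theta(2)[OF F] in simp)
  also have "\<dots> = (\<Sum>n<N. L2sq (Theta n S T) (F n))"
    by (rule sum.cong[OF refl], rule L2sq_Theta(1)[OF F, symmetric]) simp
  finally show ?thesis .
qed

lemma wiener_zero:
  assumes "0 \<le> S" "S < T"
  shows "wiener S T n (\<lambda>_. 0 :: 'd::finite mat) (\<lambda>_ _. 0)"
proof -
  have "AE t in interval_measure S T. has_iter_integral M W S n t (\<lambda>_. 0 :: 'd mat) (\<lambda>_. 0)"
    using AE_interval_measure_space by eventually_elim (rule iter_zero, use assms in auto)
  then show ?thesis unfolding wiener_def using elem_L2F[OF elem_zero assms] by simp
qed

lemma wiener_isometry:
  fixes Y :: "('w, 'd::finite) process"
  assumes "wiener S T n F Y" "F \<in> borel_measurable (Theta n S T)" "0 \<le> S" "S < T"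
  shows "L2sq (PM S T) (case_prod Y) = L2sq (Theta n S T) F"
proof -
  have "L2sq (PM S T) (\<lambda>p. \<Sum>k<Suc n. case_prod (if k = n then Y else (\<lambda>_ _. 0)) p)
     = (\<Sum>k<Suc n. L2sq (Theta k S T) (if k = n then F else (\<lambda>_. 0)))"
    by (rule wiener_pythagoras) (use assms wiener_zero in auto)
  also have "(\<lambda>p. \<Sum>k<Suc n. case_prod (if k = n then Y else (\<lambda>_ _. 0)) p) = case_prod Y" by auto
  also have "(\<Sum>k<Suc n. L2sq (Theta k S T) (if k = n then F else (\<lambda>_. 0))) = L2sq (Theta n S T) F"
    by simp
  finally show ?thesis .
qed

section \<open>Existence of iterated integrals as adapted processes\<close>

definition iter_solvable :: "real \<Rightarrow> nat \<Rightarrow> 'd::finite itself \<Rightarrow> bool" where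
  "iter_solvable S n _ \<longleftrightarrow> (\<forall>t (f :: 'd kernel). S < t \<longrightarrow> f \<in> borel_measurable (Delta_measure n S t) \<longrightarrow>
     L2sq (Delta_measure n S t) f < \<infinity> \<longrightarrow> (\<exists>X\<in>borel_measurable M. has_iter_integral M W S n t f X))"

text \<open>Approximability is included because the process is to be the integrand of the next Ito
  integral.\<close>

definition has_wiener :: "real \<Rightarrow> real \<Rightarrow> nat \<Rightarrow> (real \<times> (nat \<Rightarrow> real) \<Rightarrow> 'd::finite mat) \<Rightarrow> bool" where
  "has_wiener S T n F \<longleftrightarrow> (\<exists>Y. appr S T Y \<and> wiener S T n F Y)"

lemma has_wiener_linear:
  fixes F G :: "real \<times> (nat \<Rightarrow> real) \<Rightarrow> 'd::finite mat"
  assumes "has_wiener S T n F" "has_wiener S T n G" "0 \<le> S" "S < T"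
  shows "has_wiener S T n (\<lambda>p. F p + c *\<^sub>R G p)"
proof -
  obtain Y where "appr S T Y" "wiener S T n F Y" using assms(1) unfolding has_wiener_def by (elim exE conjE)
  moreover obtain Z where "appr S T Z" "wiener S T n G Z" using assms(2) unfolding has_wiener_def by (elim exE conjE)
  ultimately show ?thesis unfolding has_wiener_def
    by (intro exI conjI) (rule appr_linear[OF _ _ assms(3,4)], assumption+, rule wiener_linear[OF _ _ assms(3)])
qed

lemma has_wiener_zero:
  "0 \<le> S \<Longrightarrow> S < T \<Longrightarrow> has_wiener S T n (\<lambda>_. 0 :: 'd::finite mat)"
  unfolding has_wiener_def by (intro exI conjI) (rule elem_appr[OF elem_zero], assumption+, rule wiener_zero)

lemma has_wiener_cong:
  fixes F G :: "real \<times> (nat \<Rightarrow> real) \<Rightarrow> 'd::finite mat"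
  assumes "has_wiener S T n F" "\<And>p. p \<in> Theta_set n S T \<Longrightarrow> F p = G p"
  shows "has_wiener S T n G"
proof -
  obtain Y where Y: "appr S T Y" "wiener S T n F Y" using assms(1) unfolding has_wiener_def by (elim exE conjE)
  have "AE t in interval_measure S T. has_iter_integral M W S n t (\<lambda>s. F (t, s)) (Y t)"
    using Y(2) by (simp add: wiener_def)
  then have "AE t in interval_measure S T. has_iter_integral M W S n t (\<lambda>s. G (t, s)) (Y t)"
    using AE_interval_measure_space
  proof eventually_elim
    case (elim t)
    show ?case by (rule iter_cong[OF elim(1)]) (use elim(2) in \<open>auto intro!: assms(2) simp: Theta_set_def\<close>)
  qed
  then have "wiener S T n G Y" using Y(2) by (simp add: wiener_def)
  with Y(1) show ?thesis unfolding has_wiener_def by (intro exI conjI)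
qed

lemma has_wiener_sum:
  fixes F :: "'i \<Rightarrow> real \<times> (nat \<Rightarrow> real) \<Rightarrow> 'd::finite mat"
  assumes "finite I" "\<And>i. i \<in> I \<Longrightarrow> has_wiener S T n (F i)" "0 \<le> S" "S < T"
  shows "has_wiener S T n (\<lambda>p. \<Sum>i\<in>I. F i p)"
  using assms(1,2)
proof (induction I rule: finite_induct)
  case empty
  then show ?case using has_wiener_zero assms by simp
next
  case (insert i I)
  have "has_wiener S T n (\<lambda>p. F i p + 1 *\<^sub>R (\<Sum>i\<in>I. F i p))"
    by (rule has_wiener_linear[OF _ _ assms(3,4)]) (use insert in auto)
  with insert show ?case by simp
qed

text \<open>By the isometry the processes of the \<open>Fs j\<close> converge to some
  \<open>Z\<close>. Solvability at a single time supplies an iterated integral \<open>XX t\<close>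
  of the limit kernel for almost every t, and comparing both with the approximants shows that
  \<open>Z t\<close> is a version of \<open>XX t\<close>.\<close>

lemma has_wiener_closed:
  fixes F :: "real \<times> (nat \<Rightarrow> real) \<Rightarrow> 'd::finite mat"
  assumes S: "0 \<le> S" "S < T" and ex: "iter_solvable S n TYPE('d)"
    and F: "F \<in> borel_measurable (Theta n S T)" "L2sq (Theta n S T) F < \<infinity>"
    and Fs: "\<And>j::nat. Fs j \<in> borel_measurable (Theta n S T)" "\<And>j. has_wiener S T n (Fs j)"
    and lim: "(\<lambda>j. L2sq (Theta n S T) (\<lambda>p. F p - Fs j p)) \<longlonglongrightarrow> 0"
  shows "has_wiener S T n F"
proof -
  have "\<forall>j. \<exists>Y. appr S T Y \<and> wiener S T n (Fs j) Y" using Fs(2) by (simp add: has_wiener_def)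
  from choice[OF this] obtain Y where Y0: "\<forall>j. appr S T (Y j) \<and> wiener S T n (Fs j) (Y j)" ..
  then have Y: "appr S T (Y j)" "wiener S T n (Fs j) (Y j)" for j by auto
  note [measurable] = F(1) Fs(1)
  let ?c = "\<lambda>j. 2 * L2sq (Theta n S T) (\<lambda>p. F p - Fs j p)"
  have c0: "?c \<longlonglongrightarrow> 0" using lim by (intro tendsto_ennreal_mult0) auto
  have cauchy: "L2sq (PM S T) (\<lambda>p. case_prod (Y i) p - case_prod (Y j) p) \<le> ?c i + ?c j" for i j
  proof -
    have "wiener S T n (\<lambda>p. Fs i p + (-1) *\<^sub>R Fs j p) (\<lambda>t \<omega>. Y i t \<omega> + (-1) *\<^sub>R Y j t \<omega>)"
      by (rule wiener_linear[OF Y(2) Y(2) S(1)])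
    from wiener_isometry[OF this _ S]
    have "L2sq (PM S T) (\<lambda>p. case_prod (Y i) p - case_prod (Y j) p) = L2sq (Theta n S T) (\<lambda>p. Fs i p - Fs j p)"
      by (simp add: case_prod_beta')
    also have "\<dots> \<le> 2 * L2sq (Theta n S T) (\<lambda>p. Fs i p - F p) + 2 * L2sq (Theta n S T) (\<lambda>p. F p - Fs j p)"
      by (rule L2sq_diff_le) measurable
    also have "L2sq (Theta n S T) (\<lambda>p. Fs i p - F p) = L2sq (Theta n S T) (\<lambda>p. F p - Fs i p)" by (rule L2sq_commute)
    finally show ?thesis .
  qed
  obtain Z where Z: "Z \<in> L2F M W S T" and Zlim: "(\<lambda>j. L2sq (PM S T) (\<lambda>p. case_prod Z p - case_prod (Y j) p)) \<longlonglongrightarrow> 0"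
    using L2F_complete[OF appr_L2F[OF Y(1)] c0 cauchy] by (elim bexE)
  have aZ: "appr S T Z" by (rule appr_closed[OF Z Y(1) Zlim S])
  \<comment> \<open>Only times with a square-integrable section are served; by Fubini these are
    almost all times, see \<open>fin\<close>.\<close>
  have "\<forall>t. \<exists>X. S < t \<and> t < T \<and> L2sq (Delta_measure n S t) (\<lambda>s. F (t, s)) < \<infinity> \<longrightarrow>
      X \<in> borel_measurable M \<and> has_iter_integral M W S n t (\<lambda>s. F (t, s)) X"
  proof
    fix t
    have "(\<lambda>s. F (t, s)) \<in> borel_measurable (Delta_measure n S t)" if "S < t" "t < T"
      by (rule measurable_compose[OF measurable_Theta_section[OF that] F(1)])
    then show "\<exists>X. S < t \<and> t < T \<and> L2sq (Delta_measure n S t) (\<lambda>s. F (t, s)) < \<infinity> \<longrightarrow>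
      X \<in> borel_measurable M \<and> has_iter_integral M W S n t (\<lambda>s. F (t, s)) X"
      using ex unfolding iter_solvable_def by blast
  qed
  from choice[OF this] obtain XX where XX: "\<forall>t. S < t \<and> t < T \<and> L2sq (Delta_measure n S t) (\<lambda>s. F (t, s)) < \<infinity> \<longrightarrow>
      XX t \<in> borel_measurable M \<and> has_iter_integral M W S n t (\<lambda>s. F (t, s)) (XX t)" ..
  have fin: "AE t in interval_measure S T. L2sq (Delta_measure n S t) (\<lambda>s. F (t, s)) < \<infinity>"
    using nn_integral_PInf_AE[OF L2sq_Theta(2)[OF F(1)]] F(2) unfolding L2sq_Theta(1)[OF F(1)]
    by (auto simp: less_top)
  have mZ: "case_prod (\<lambda>t \<omega>. Z t \<omega> - Y j t \<omega>) \<in> borel_measurable (PM S T)" for j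
  proof -
    have "(\<lambda>p. case_prod Z p - case_prod (Y j) p) \<in> borel_measurable (PM S T)"
      by (intro borel_measurable_diff L2F_measurable[OF Z] L2F_measurable[OF appr_L2F[OF Y(1)]])
    then show ?thesis by (simp add: case_prod_beta')
  qed
  have mF: "(\<lambda>p. Fs j p - F p) \<in> borel_measurable (Theta n S T)" for j by measurable
  let ?e = "\<lambda>j t. 2 * L2sq M (\<lambda>\<omega>. Z t \<omega> - Y j t \<omega>) + 2 * L2sq (Delta_measure n S t) (\<lambda>s. Fs j (t, s) - F (t, s))"
  have "AE t in interval_measure S T. L2sq M (\<lambda>\<omega>. Z t \<omega> - XX t \<omega>) = 0"
  proof (rule AE_zero_INF)
    note [measurable] = L2sq_PM(2)[OF mZ] L2sq_Theta(2)[OF mF]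
    show "?e j \<in> borel_measurable (interval_measure S T)" for j by measurable
    have "(\<integral>\<^sup>+ t. ?e j t \<partial>interval_measure S T) = 2 * L2sq (PM S T) (case_prod (\<lambda>t \<omega>. Z t \<omega> - Y j t \<omega>)) + 2 * L2sq (Theta n S T) (\<lambda>p. Fs j p - F p)" for j
      unfolding L2sq_PM(1)[OF mZ] L2sq_Theta(1)[OF mF] by (simp add: nn_integral_add nn_integral_cmult)
    moreover have "case_prod (\<lambda>t \<omega>. Z t \<omega> - Y j t \<omega>) = (\<lambda>p. case_prod Z p - case_prod (Y j) p)" for j
      by (simp add: fun_eq_iff)
    ultimately have eq: "(\<integral>\<^sup>+ t. ?e j t \<partial>interval_measure S T) = 2 * L2sq (PM S T) (\<lambda>p. case_prod Z p - case_prod (Y j) p) + ?c j" for j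
      by (simp only: L2sq_commute[of _ "Fs j" F])
    have "(\<lambda>j. 2 * L2sq (PM S T) (\<lambda>p. case_prod Z p - case_prod (Y j) p) + ?c j) \<longlonglongrightarrow> 0 + 0"
      by (intro tendsto_add c0 tendsto_ennreal_mult0 Zlim) auto
    then show "(\<lambda>j. \<integral>\<^sup>+ t. ?e j t \<partial>interval_measure S T) \<longlonglongrightarrow> 0" unfolding eq by simp
    have "AE t in interval_measure S T. \<forall>j. has_iter_integral M W S n t (\<lambda>s. Fs j (t, s)) (Y j t)"
      using Y(2) by (auto simp: wiener_def AE_all_countable)
    with AE_interval_measure_space fin
    show "AE t in interval_measure S T. \<forall>j. L2sq M (\<lambda>\<omega>. Z t \<omega> - XX t \<omega>) \<le> ?e j t"
    proof eventually_elim
      case (elim t)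
      then have t: "S < t" "t < T" by auto
      have X: "XX t \<in> borel_measurable M" "has_iter_integral M W S n t (\<lambda>s. F (t, s)) (XX t)"
        by (rule XX[rule_format, OF conjI[OF t(1) conjI[OF t(2) elim(2)]], THEN conjunct1],
            rule XX[rule_format, OF conjI[OF t(1) conjI[OF t(2) elim(2)]], THEN conjunct2])
      show ?case
      proof
        fix j
        note mY = L2F_section_measurable[OF appr_L2F[OF Y(1)] S(1) t, of j]
        have "has_iter_integral M W S n t (\<lambda>s. Fs j (t, s) + (-1) *\<^sub>R F (t, s)) (\<lambda>\<omega>. Y j t \<omega> + (-1) *\<^sub>R XX t \<omega>)"
          by (rule iter_linear[OF _ X(2) S(1) t(1)]) (use elim in simp)
        from iter_isometry[OF this _ S(1) t(1)] measurable_compose[OF measurable_Theta_section[OF t] mF[of j]]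
        have eq: "L2sq M (\<lambda>\<omega>. Y j t \<omega> - XX t \<omega>) = L2sq (Delta_measure n S t) (\<lambda>s. Fs j (t, s) - F (t, s))" by simp
        have "L2sq M (\<lambda>\<omega>. Z t \<omega> - XX t \<omega>) \<le> 2 * L2sq M (\<lambda>\<omega>. Z t \<omega> - Y j t \<omega>) + 2 * L2sq M (\<lambda>\<omega>. Y j t \<omega> - XX t \<omega>)"
          by (intro L2sq_diff_le mY X(1) L2F_section_measurable[OF Z S(1) t])
        then show "L2sq M (\<lambda>\<omega>. Z t \<omega> - XX t \<omega>) \<le> ?e j t" by (simp only: eq)
      qed
    qed
  qed
  with AE_interval_measure_space fin
  have "AE t in interval_measure S T. has_iter_integral M W S n t (\<lambda>s. F (t, s)) (Z t)"
  proof eventually_elim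
    case (elim t)
    then have t: "S < t" "t < T" by auto
    have X: "XX t \<in> borel_measurable M" "has_iter_integral M W S n t (\<lambda>s. F (t, s)) (XX t)"
      by (rule XX[rule_format, OF conjI[OF t(1) conjI[OF t(2) elim(2)]], THEN conjunct1],
          rule XX[rule_format, OF conjI[OF t(1) conjI[OF t(2) elim(2)]], THEN conjunct2])
    note mZt = L2F_section_measurable[OF Z S(1) t]
    have "AE \<omega> in M. Z t \<omega> - XX t \<omega> = 0"
      by (subst L2sq_eq_0_iff[symmetric]) (use elim(3) in \<open>auto intro: borel_measurable_diff mZt X(1)\<close>)
    then have "AE \<omega> in M. XX t \<omega> = Z t \<omega>" by eventually_elim simp
    then show ?case by (rule iter_AE[OF X(2) _ mZt])
  qed
  then have "wiener S T n F Z" using Z by (simp add: wiener_def)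
  with aZ show ?thesis unfolding has_wiener_def by (intro exI conjI)
qed

text \<open>Here the kernel does not depend on the outer time: the process is the iterated integral
  of one fixed g over (S, t) as a function of t, the building block for rectangles. The
  \<open>itself\<close> argument, here and in \<open>iter_solvable\<close>, records the matrix
  dimension.\<close>

definition const_solvable :: "real \<Rightarrow> nat \<Rightarrow> 'd::finite itself \<Rightarrow> bool" where
  "const_solvable S n _ \<longleftrightarrow> (\<forall>T (g :: 'd kernel). S < T \<longrightarrow> g \<in> borel_measurable (Delta_measure n S T) \<longrightarrow>
     L2sq (Delta_measure n S T) g < \<infinity> \<longrightarrow>
     (\<exists>Y. appr S T Y \<and> (AE t in interval_measure S T. has_iter_integral M W S n t g (Y t))))"

lemma iter_solvable_0: "iter_solvable S 0 TYPE('d::finite)"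
  unfolding iter_solvable_def
proof (intro allI impI)
  fix t and f :: "'d kernel"
  show "\<exists>X\<in>borel_measurable M. has_iter_integral M W S 0 t f X"
    by (rule bexI[of _ "\<lambda>_. f (\<lambda>_. undefined)"]) auto
qed

lemma const_solvable_0:
  assumes "0 \<le> S"
  shows "const_solvable S 0 TYPE('d::finite)"
  unfolding const_solvable_def
proof (intro allI impI)
  fix T and g :: "'d kernel" assume T: "S < T"
  let ?c = "g (\<lambda>_. undefined)"
  have "elem S T (\<lambda>t \<omega>. 0 + indicator {S<..T} t *\<^sub>R (\<lambda>_. ?c) \<omega>) (\<lambda>\<omega>. 0 + (W T \<omega> - W S \<omega>) *\<^sub>R (\<lambda>_. ?c) \<omega>)"
    by (rule elem_step[OF elem_zero]) (use T in auto)
  from elem_appr[OF this assms T] have "appr S T (\<lambda>t (\<omega> :: 'w). indicator {S<..T} t *\<^sub>R ?c)" by simp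
  moreover have "AE t in interval_measure S T. has_iter_integral M W S 0 t g (\<lambda>\<omega>. indicator {S<..T} t *\<^sub>R ?c)"
    using AE_interval_measure_space by eventually_elim auto
  ultimately show "\<exists>Y. appr S T Y \<and> (AE t in interval_measure S T. has_iter_integral M W S 0 t g (Y t))"
    by (intro exI conjI)
qed

text \<open>On a rectangle the outer time enters only through a cut: the process of the fixed kernel
  \<open>indicator B\<close> times C, multiplied by the indicator of the time interval.\<close>

lemma has_wiener_rectangle:
  fixes C :: "'d::finite mat"
  assumes S: "0 \<le> S" "S < T" and const: "const_solvable S n TYPE('d)" and B: "B \<in> sets (lborel_pow n)"
  shows "has_wiener S T n (\<lambda>p. indicator ({a<..b} \<times> B) p *\<^sub>R C)"
proof (cases "max a S < min b T")
  case True
  let ?g = "\<lambda>s. indicator B s *\<^sub>R C"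
  have g: "?g \<in> borel_measurable (Delta_measure n S T)"
    unfolding Delta_measure_def by (rule measurable_restrict_space1) (use B in measurable)
  have "L2sq (Delta_measure n S T) ?g \<le> (\<integral>\<^sup>+ s. ennreal ((norm C)\<^sup>2) \<partial>Delta_measure n S T)"
    unfolding L2sq_def by (intro nn_integral_mono) (auto simp: indicator_def)
  also have "\<dots> < \<infinity>"
    unfolding nn_integral_Delta using emeasure_Delta_finite[of n S T]
    by (subst nn_integral_cmult_indicator) (auto simp: ennreal_mult_less_top)
  finally have gfin: "L2sq (Delta_measure n S T) ?g < \<infinity>" .
  obtain Y where Y: "appr S T Y" "AE t in interval_measure S T. has_iter_integral M W S n t ?g (Y t)"
    using const[unfolded const_solvable_def, rule_format, OF S(2) g gfin] by (elim exE conjE)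
  let ?Y = "\<lambda>t \<omega>. indicator {max a S<..min b T} t *\<^sub>R Y t \<omega>"
  have aY: "appr S T ?Y" by (rule appr_cut[OF Y(1) S]) (use True in auto)
  have "AE t in interval_measure S T. has_iter_integral M W S n t (\<lambda>s. indicator ({a<..b} \<times> B) (t, s) *\<^sub>R C) (?Y t)"
    using Y(2) AE_interval_measure_space
  proof eventually_elim
    case (elim t)
    show ?case
    proof (cases "t \<in> {max a S<..min b T}")
      case True
      then have "(\<lambda>s. indicator ({a<..b} \<times> B) (t, s) *\<^sub>R C) = ?g" by (auto simp: indicator_def fun_eq_iff)
      then show ?thesis using elim(1) True by (simp only: indicator_simps scaleR_one)
    next
      case False
      then have k0: "(\<lambda>s. indicator ({a<..b} \<times> B) (t, s) *\<^sub>R C) = (\<lambda>_. 0)"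
        using elim(2) by (auto simp: indicator_def fun_eq_iff)
      have Y0: "?Y t = (\<lambda>_. 0)" using False by simp
      show ?thesis unfolding k0 Y0 using iter_zero[OF S(1)] elim(2) by blast
    qed
  qed
  then have "wiener S T n (\<lambda>p. indicator ({a<..b} \<times> B) p *\<^sub>R C) ?Y"
    unfolding wiener_def using appr_L2F[OF aY] by (intro conjI)
  with aY show ?thesis unfolding has_wiener_def by (intro exI conjI)
next
  case False
  show ?thesis
    by (rule has_wiener_cong[OF has_wiener_zero[OF S]]) (use False in \<open>auto simp: Theta_set_def indicator_def\<close>)
qed

lemma sets_lborel_lborel_pow:
  "sets (lborel \<Otimes>\<^sub>M lborel_pow n) = sigma_sets (UNIV \<times> space (lborel_pow n))
     {A \<times> B |A B. A \<in> range (\<lambda>(a, b). {a<..b::real}) \<and> B \<in> sets (lborel_pow n)}"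
proof -
  have "sets (lborel \<Otimes>\<^sub>M lborel_pow n) = sets (sigma (space lborel \<times> space (lborel_pow n))
     {A \<times> B |A B. A \<in> range (\<lambda>(a, b). {a<..b::real}) \<and> B \<in> sets (lborel_pow n)})"
  proof (rule sets_pair_eq)
    show "sets lborel = sigma_sets (space lborel) (range (\<lambda>(a, b). {a<..b::real}))"
      by (subst sets_lborel, subst borel_sigma_sets_Ioc) simp
    show "sets (lborel_pow n) = sigma_sets (space (lborel_pow n)) (sets (lborel_pow n))"
      by (simp add: sets.sigma_sets_eq)
    show "range (\<lambda>i::nat. {- real i<..real i}) \<subseteq> range (\<lambda>(a, b). {a<..b::real})" by auto
    have "\<exists>i::nat. - real i < x \<and> x \<le> real i" for x :: real
    proof -
      obtain i :: nat where "\<bar>x\<bar> < real i" using reals_Archimedean2 by blast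
      then show ?thesis by (intro exI[of _ i]) auto
    qed
    then show "\<Union> (range (\<lambda>i::nat. {- real i<..real i})) = space lborel" by auto
    show "{space (lborel_pow n)} \<subseteq> sets (lborel_pow n)" by auto
  qed (auto dest: sets.sets_into_space)
  also have "\<dots> = sigma_sets (UNIV \<times> space (lborel_pow n))
     {A \<times> B |A B. A \<in> range (\<lambda>(a, b). {a<..b::real}) \<and> B \<in> sets (lborel_pow n)}"
    by (subst sets_measure_of) (auto dest: sets.sets_into_space)
  finally show ?thesis .
qed

lemma indicator_scaleR_Theta:
  assumes "A \<in> sets (lborel \<Otimes>\<^sub>M lborel_pow n)"
  shows "(\<lambda>p. indicator A p *\<^sub>R (C :: 'd::finite mat)) \<in> borel_measurable (Theta n S T)"
  unfolding Theta_def by (rule measurable_restrict_space1) (use assms in measurable)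

lemma has_wiener_indicator:
  fixes C :: "'d::finite mat"
  assumes S: "0 \<le> S" "S < T" and const: "const_solvable S n TYPE('d)" and iter: "iter_solvable S n TYPE('d)"
    and A: "A \<in> sets (lborel \<Otimes>\<^sub>M lborel_pow n)"
  shows "has_wiener S T n (\<lambda>p. indicator A p *\<^sub>R C)"
proof -
  let ?G = "{A \<times> B |A B. A \<in> range (\<lambda>(a, b). {a<..b::real}) \<and> B \<in> sets (lborel_pow n)}"
  let ?\<Omega> = "UNIV \<times> space (lborel_pow n)"
  have "Int_stable ?G"
  proof (rule Int_stableI, elim CollectE exE conjE)
    fix x y A B A' B' assume x: "x = A \<times> B" "A \<in> range (\<lambda>(a, b). {a<..b::real})" "B \<in> sets (lborel_pow n)"
      and y: "y = A' \<times> B'" "A' \<in> range (\<lambda>(a, b). {a<..b::real})" "B' \<in> sets (lborel_pow n)"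
    obtain a b a' b' where "A = {a<..b}" "A' = {a'<..b'}" using x(2) y(2) by auto
    then have "A \<inter> A' = {max a a'<..min b b'}" by auto
    then have "A \<inter> A' \<in> range (\<lambda>(a, b). {a<..b::real})" by auto
    moreover have "x \<inter> y = (A \<inter> A') \<times> (B \<inter> B')" using x y by auto
    moreover have "B \<inter> B' \<in> sets (lborel_pow n)" using x(3) y(3) by (rule sets.Int)
    ultimately show "x \<inter> y \<in> ?G" by (intro CollectI exI[of _ "A \<inter> A'"] exI[of _ "B \<inter> B'"] conjI)
  qed
  moreover have "?G \<subseteq> Pow ?\<Omega>" by (auto dest: sets.sets_into_space)
  moreover have "A \<in> sigma_sets ?\<Omega> ?G" using A by (simp only: sets_lborel_lborel_pow)
  ultimately show ?thesis
  proof (induction A rule: sigma_sets_induct_disjoint)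
    case (basic A)
    then obtain a b B where "A = {a<..b} \<times> B" "B \<in> sets (lborel_pow n)" by auto
    then show ?case using has_wiener_rectangle[OF S const] by simp
  next
    case empty
    show ?case using has_wiener_zero[OF S] by simp
  next
    case (compl A)
    \<comment> \<open>The complement is taken inside a rectangle containing
      \<open>Theta_set n S T\<close>; values outside that set are immaterial by
      \<open>has_wiener_cong\<close>.\<close>
    have "has_wiener S T n (\<lambda>p. indicator ({S<..T} \<times> space (lborel_pow n)) p *\<^sub>R C + (-1) *\<^sub>R (indicator A p *\<^sub>R C))"
      by (rule has_wiener_linear[OF has_wiener_rectangle[OF S const] compl.IH S]) simp
    then show ?case
    proof (rule has_wiener_cong)
      fix p assume "p \<in> Theta_set n S T"
      then have "p \<in> {S<..T} \<times> space (lborel_pow n)"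
        by (auto simp: Theta_set_def space_lborel_pow Delta_def)
      then show "indicator ({S<..T} \<times> space (lborel_pow n)) p *\<^sub>R C + (-1) *\<^sub>R (indicator A p *\<^sub>R C) = indicator (?\<Omega> - A) p *\<^sub>R C"
        by (auto simp: indicator_def)
    qed
  next
    case (union A)
    have A: "A i \<in> sets (lborel \<Otimes>\<^sub>M lborel_pow n)" for i
      using union.hyps(2) by (auto simp only: sets_lborel_lborel_pow)
    then have UA: "(\<Union>i. A i) \<in> sets (lborel \<Otimes>\<^sub>M lborel_pow n)" by auto
    let ?F = "\<lambda>p. indicator (\<Union>i. A i) p *\<^sub>R C" and ?Fs = "\<lambda>j p. \<Sum>i<j. indicator (A i) p *\<^sub>R C"
    \<comment> \<open>By disjointness the partial sums take only the values 0 and C, so the constant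
      \<open>norm C\<close> dominates them; it is square-integrable because \<open>Theta\<close> is
      a finite measure.\<close>
    have val: "?Fs j p = (if \<exists>i<j. p \<in> A i then C else 0)" for j p
    proof (cases "\<exists>i<j. p \<in> A i")
      case True
      then obtain k where k: "k < j" "p \<in> A k" by auto
      have "p \<notin> A i" if "i \<noteq> k" for i
        using union.hyps(1) k(2) that by (auto simp: disjoint_family_on_def)
      then have "?Fs j p = (\<Sum>i<j. if i = k then C else 0)"
        using k by (intro sum.cong) (auto simp: indicator_def)
      with k True show ?thesis by auto
    qed (auto simp: indicator_def)
    have mFs: "?Fs j \<in> borel_measurable (Theta n S T)" for j
      by (intro borel_measurable_sum indicator_scaleR_Theta A)
    have mF: "?F \<in> borel_measurable (Theta n S T)" by (rule indicator_scaleR_Theta[OF UA])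
    have wfin: "(\<integral>\<^sup>+ x. ennreal ((norm C)\<^sup>2) \<partial>Theta n S T) < \<infinity>"
      using finite_measure.emeasure_finite[OF finite_measure_Theta[of n S T], of "space (Theta n S T)"]
      by (simp add: ennreal_mult_less_top less_top)
    show ?case
    proof (rule has_wiener_closed[OF S iter mF _ mFs])
      have "L2sq (Theta n S T) ?F \<le> (\<integral>\<^sup>+ x. ennreal ((norm C)\<^sup>2) \<partial>Theta n S T)"
        unfolding L2sq_def by (intro nn_integral_mono) (auto simp: indicator_def)
      then show "L2sq (Theta n S T) ?F < \<infinity>" using wfin by (rule le_less_trans)
      show "has_wiener S T n (?Fs j)" for j
        by (rule has_wiener_sum[OF _ _ S]) (use union.IH in auto)
      show "(\<lambda>j. L2sq (Theta n S T) (\<lambda>p. ?F p - ?Fs j p)) \<longlonglongrightarrow> 0"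
      proof (rule L2sq_dominated[OF mF mFs _ _ _ wfin])
        show "(\<lambda>j. ?Fs j p) \<longlonglongrightarrow> ?F p" for p
        proof (rule tendsto_eventually, cases "p \<in> (\<Union>i. A i)")
          case True
          then obtain k where "p \<in> A k" by auto
          then show "\<forall>\<^sub>F j in sequentially. ?Fs j p = ?F p"
            unfolding val using True by (intro eventually_sequentiallyI[of "Suc k"]) (auto simp: Suc_le_eq)
        qed (unfold val, auto)
        show "norm (?Fs j p) \<le> norm C" for j p unfolding val by auto
      qed simp
    qed
  qed
qed

text \<open>Simple functions bounded by 2 |F| converge to F pointwise, hence in L2 by dominated
  convergence, and each of them is a finite sum of multiples of indicators.\<close>

lemma has_wiener_if_solvable:
  fixes F :: "real \<times> (nat \<Rightarrow> real) \<Rightarrow> 'd::finite mat"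
  assumes S: "0 \<le> S" "S < T" and const: "const_solvable S n TYPE('d)" and iter: "iter_solvable S n TYPE('d)"
    and F: "F \<in> borel_measurable (Theta n S T)" "L2sq (Theta n S T) F < \<infinity>"
  shows "has_wiener S T n F"
proof -
  let ?N = "lborel \<Otimes>\<^sub>M lborel_pow n"
  have F': "(\<lambda>p. indicator (Theta_set n S T) p *\<^sub>R F p) \<in> borel_measurable ?N"
    using F(1) unfolding Theta_def by (subst (asm) borel_measurable_restrict_space_iff) auto
  obtain Fs where Fs: "\<forall>i. simple_function ?N (Fs i)"
      "\<forall>x\<in>space ?N. (\<lambda>i. Fs i x) \<longlonglongrightarrow> indicator (Theta_set n S T) x *\<^sub>R F x"
      "\<forall>i. \<forall>x\<in>space ?N. dist (Fs i x) 0 \<le> 2 * dist (indicator (Theta_set n S T) x *\<^sub>R F x) 0"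
    using borel_measurable_implies_sequence_metric[OF F', of 0] by (elim exE conjE)
  have sp: "p \<in> space ?N" if "p \<in> Theta_set n S T" for p
    using that sets.sets_into_space[OF Theta_set_in_sets] by blast
  have mFs: "Fs j \<in> borel_measurable (Theta n S T)" for j
    unfolding Theta_def by (rule measurable_restrict_space1) (use Fs(1) in \<open>auto intro: borel_measurable_simple_function\<close>)
  have good: "has_wiener S T n (Fs j)" for j
  proof -
    have fin: "finite (Fs j ` space ?N)" using Fs(1) by (auto dest: simple_functionD)
    have "has_wiener S T n (\<lambda>p. \<Sum>y\<in>Fs j ` space ?N. indicator (Fs j -` {y} \<inter> space ?N) p *\<^sub>R y)"
    proof (rule has_wiener_sum[OF fin _ S])
      fix y
      have "Fs j -` {y} \<inter> space ?N \<in> sets ?N"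
        by (rule simple_functionD(2)[OF Fs(1)[rule_format]])
      then show "has_wiener S T n (\<lambda>p. indicator (Fs j -` {y} \<inter> space ?N) p *\<^sub>R y)"
        by (rule has_wiener_indicator[OF S const iter])
    qed
    then show ?thesis
    proof (rule has_wiener_cong)
      fix p assume p: "p \<in> Theta_set n S T"
      have "(\<Sum>y\<in>Fs j ` space ?N. indicator (Fs j -` {y} \<inter> space ?N) p *\<^sub>R y) = (\<Sum>y\<in>Fs j ` space ?N. if y = Fs j p then y else 0)"
        using sp[OF p] by (intro sum.cong) (auto simp: indicator_def)
      also have "\<dots> = Fs j p" using sp[OF p] fin by simp
      finally show "(\<Sum>y\<in>Fs j ` space ?N. indicator (Fs j -` {y} \<inter> space ?N) p *\<^sub>R y) = Fs j p" .
    qed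
  qed
  show ?thesis
  proof (rule has_wiener_closed[OF S iter F mFs good])
    show "(\<lambda>j. L2sq (Theta n S T) (\<lambda>p. F p - Fs j p)) \<longlonglongrightarrow> 0"
    proof (rule L2sq_dominated[OF F(1) mFs])
      show "(\<lambda>p. 2 * norm (F p)) \<in> borel_measurable (Theta n S T)" using F(1) by measurable
      fix p assume "p \<in> space (Theta n S T)"
      then have p: "p \<in> Theta_set n S T" by simp
      show "(\<lambda>j. Fs j p) \<longlonglongrightarrow> F p" using Fs(2)[rule_format, OF sp[OF p]] p by simp
      show "norm (Fs j p) \<le> 2 * norm (F p)" for j using Fs(3)[rule_format, OF sp[OF p], of j] p by simp
    next
      have "(\<integral>\<^sup>+ p. ennreal ((2 * norm (F p))\<^sup>2) \<partial>Theta n S T) = 4 * L2sq (Theta n S T) F"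
        unfolding L2sq_def using F(1)
        by (subst nn_integral_cmult[symmetric]) (auto simp: power_mult_distrib ennreal_mult)
      then show "(\<integral>\<^sup>+ p. ennreal ((2 * norm (F p))\<^sup>2) \<partial>Theta n S T) < \<infinity>"
        using F(2) by (simp add: ennreal_mult_less_top)
    qed
  qed
qed

text \<open>Solvability in order n gives a process Z whose value at r is the inner iterated integral
  of g(r, .). Integrating Z up to one time t solves order n + 1 at that time; the indefinite
  integral of Z solves it for almost all times with a jointly measurable process. The construction
  of Z uses both properties, so they climb together.\<close>

lemma solvable_Suc:
  assumes S: "0 \<le> S" and const: "const_solvable S n TYPE('d::finite)" and iter: "iter_solvable S n TYPE('d)"
  shows "const_solvable S (Suc n) TYPE('d)" "iter_solvable S (Suc n) TYPE('d)"
proof -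
  have ex: "\<exists>Y. appr S T Y \<and> (AE t in interval_measure S T. has_iter_integral M W S n t (\<lambda>s. g (case_nat t s)) (Y t))"
    if T: "S < T" and g: "g \<in> borel_measurable (Delta_measure (Suc n) S T)" "L2sq (Delta_measure (Suc n) S T) g < \<infinity>"
    for T and g :: "'d kernel"
  proof -
    have m: "(\<lambda>p. g (case_nat (fst p) (snd p))) \<in> borel_measurable (Theta n S T)"
      by (rule measurable_compose[OF measurable_case_nat_Theta g(1)])
    have "L2sq (Theta n S T) (\<lambda>p. g (case_nat (fst p) (snd p))) = L2sq (Delta_measure (Suc n) S T) g"
      unfolding L2sq_def by (rule nn_integral_Delta_Suc_Theta[symmetric]) (use g(1) in measurable)
    with g(2) have "has_wiener S T n (\<lambda>p. g (case_nat (fst p) (snd p)))"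
      by (intro has_wiener_if_solvable[OF S T const iter m]) simp
    then show ?thesis unfolding has_wiener_def wiener_def by (auto simp only: fst_conv snd_conv)
  qed
  show "const_solvable S (Suc n) TYPE('d)"
    unfolding const_solvable_def
  proof (intro allI impI)
    fix T and g :: "'d kernel"
    assume T: "S < T" and g: "g \<in> borel_measurable (Delta_measure (Suc n) S T)" "L2sq (Delta_measure (Suc n) S T) g < \<infinity>"
    obtain Z where Z: "appr S T Z" "AE t in interval_measure S T. has_iter_integral M W S n t (\<lambda>s. g (case_nat t s)) (Z t)"
      using ex[OF T g] by (elim exE conjE)
    obtain Y where Y: "appr S T Y" "AE t in interval_measure S T. has_ito_integral M W S t Z (Y t)"
      using indefinite_ito_integral[OF Z(1) S T] by (elim exE conjE)
    have "AE t in interval_measure S T. has_iter_integral M W S (Suc n) t g (Y t)"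
      using Y(2) AE_interval_measure_space
    proof eventually_elim
      case (elim t)
      have "AE r in interval_measure S t. has_iter_integral M W S n r (\<lambda>s. g (case_nat r s)) (Z r)"
        by (rule AE_interval_measure_mono[OF Z(2)]) (use elim in auto)
      with elim(1) show ?case unfolding has_iter_integral.simps by (intro exI conjI)
    qed
    with Y(1) show "\<exists>Y. appr S T Y \<and> (AE t in interval_measure S T. has_iter_integral M W S (Suc n) t g (Y t))"
      by (intro exI conjI)
  qed
  show "iter_solvable S (Suc n) TYPE('d)"
    unfolding iter_solvable_def
  proof (intro allI impI)
    fix t and f :: "'d kernel"
    assume t: "S < t" and f: "f \<in> borel_measurable (Delta_measure (Suc n) S t)" "L2sq (Delta_measure (Suc n) S t) f < \<infinity>"
    obtain Z where Z: "appr S t Z" "AE r in interval_measure S t. has_iter_integral M W S n r (\<lambda>s. f (case_nat r s)) (Z r)"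
      using ex[OF t f] by (elim exE conjE)
    obtain X where X: "X \<in> borel_measurable (FW S t)" "has_ito_integral M W S t Z X"
      using ito_exists[OF Z(1) S t] by (elim bexE)
    have "has_iter_integral M W S (Suc n) t f X"
      unfolding has_iter_integral.simps using Z(2) X(2) by (intro exI conjI)
    then show "\<exists>X\<in>borel_measurable M. has_iter_integral M W S (Suc n) t f X"
      using filt_imp_M[OF X(1) S] by blast
  qed
qed

lemma solvable:
  assumes "0 \<le> S"
  shows "const_solvable S n TYPE('d::finite) \<and> iter_solvable S n TYPE('d)"
proof (induction n)
  case (Suc n)
  then show ?case using solvable_Suc[OF assms] by blast
qed (use const_solvable_0[OF assms] iter_solvable_0 in blast)

lemma is_Wn_iff:
  fixes f :: "'d::finite kernel"
  shows "is_Wn M W S T n f Y \<longleftrightarrow> f \<in> L2_Delta (Suc n) S T \<and> wiener S T n (\<lambda>p. f (case_nat (fst p) (snd p))) Y"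
  by (simp add: is_Wn_def wiener_def)

lemma L2_Delta_iff:
  "f \<in> L2_Delta n S T \<longleftrightarrow> f \<in> borel_measurable (Delta_measure n S T) \<and> L2sq (Delta_measure n S T) f < \<infinity>"
  by (simp add: L2_Delta_def L2sq_def)

lemma L2_Delta_Theta:
  fixes f :: "'d::finite kernel"
  assumes "f \<in> borel_measurable (Delta_measure (Suc n) S T)"
  shows "(\<lambda>p. f (case_nat (fst p) (snd p))) \<in> borel_measurable (Theta n S T)"
    and "L2sq (Theta n S T) (\<lambda>p. f (case_nat (fst p) (snd p))) = L2sq (Delta_measure (Suc n) S T) f"
proof -
  show "(\<lambda>p. f (case_nat (fst p) (snd p))) \<in> borel_measurable (Theta n S T)"
    by (rule measurable_compose[OF measurable_case_nat_Theta assms])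
  show "L2sq (Theta n S T) (\<lambda>p. f (case_nat (fst p) (snd p))) = L2sq (Delta_measure (Suc n) S T) f"
    unfolding L2sq_def by (rule nn_integral_Delta_Suc_Theta[symmetric]) (use assms in measurable)
qed

lemma is_Wn_exists:
  fixes f :: "'d::finite kernel"
  assumes "f \<in> L2_Delta (Suc n) S T" "0 \<le> S" "S < T"
  shows "\<exists>Y. is_Wn M W S T n f Y"
proof -
  have f: "f \<in> borel_measurable (Delta_measure (Suc n) S T)" "L2sq (Delta_measure (Suc n) S T) f < \<infinity>"
    using assms(1) by (simp_all add: L2_Delta_iff)
  have "has_wiener S T n (\<lambda>p. f (case_nat (fst p) (snd p)))"
    by (rule has_wiener_if_solvable) (use solvable[OF assms(2)] L2_Delta_Theta[OF f(1)] f assms in auto)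
  then show ?thesis unfolding has_wiener_def is_Wn_iff using assms(1) by blast
qed

end

section \<open>Chaos expansions\<close>

lemma L2_Delta_linear:
  fixes f g :: "'d::finite kernel"
  assumes "f \<in> L2_Delta n S T" "g \<in> L2_Delta n S T"
  shows "(\<lambda>t. f t + c *\<^sub>R g t) \<in> L2_Delta n S T"
proof -
  have m: "f \<in> borel_measurable (Delta_measure n S T)" "g \<in> borel_measurable (Delta_measure n S T)"
    and fin: "L2sq (Delta_measure n S T) f < \<infinity>" "L2sq (Delta_measure n S T) g < \<infinity>"
    using assms by (auto simp: L2_Delta_def L2sq_def)
  have "L2sq (Delta_measure n S T) (\<lambda>t. f t + c *\<^sub>R g t) \<le> 2 * L2sq (Delta_measure n S T) f + 2 * L2sq (Delta_measure n S T) (\<lambda>t. c *\<^sub>R g t)"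
    using m by (intro L2sq_add_le) auto
  also have "\<dots> < \<infinity>" using fin m by (simp add: L2sq_scaleR ennreal_mult_less_top)
  finally show ?thesis using m by (simp add: L2_Delta_def L2sq_def)
qed

context brownian_motion
begin

lemma is_Wn_linear:
  fixes f g :: "'d::finite kernel"
  assumes "is_Wn M W S T n f Y" "is_Wn M W S T n g Z" "0 \<le> S"
  shows "is_Wn M W S T n (\<lambda>t. f t + c *\<^sub>R g t) (\<lambda>t \<omega>. Y t \<omega> + c *\<^sub>R Z t \<omega>)"
  using assms wiener_linear[of S T n _ Y _ Z c] unfolding is_Wn_iff by (auto intro: L2_Delta_linear)

lemma is_Wn_measurable: "is_Wn M W S T n f Y \<Longrightarrow> case_prod Y \<in> borel_measurable (PM S T)"
  by (simp add: is_Wn_def L2F_measurable)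

lemma is_Wn_pythagoras:
  fixes f :: "nat \<Rightarrow> 'd::finite kernel"
  assumes "\<And>n. n < N \<Longrightarrow> is_Wn M W S T n (f n) (Y n)" "0 \<le> S"
  shows "L2sq (PM S T) (\<lambda>p. \<Sum>n<N. case_prod (Y n) p) = (\<Sum>n<N. L2sq (Delta_measure (Suc n) S T) (f n))"
proof -
  have m: "f n \<in> borel_measurable (Delta_measure (Suc n) S T)" if "n < N" for n
    using assms(1)[OF that] by (simp add: is_Wn_def L2_Delta_def)
  have "L2sq (PM S T) (\<lambda>p. \<Sum>n<N. case_prod (Y n) p) = (\<Sum>n<N. L2sq (Theta n S T) (\<lambda>p. f n (case_nat (fst p) (snd p))))"
    by (rule wiener_pythagoras) (use assms m L2_Delta_Theta in \<open>auto simp: is_Wn_iff\<close>)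
  also have "\<dots> = (\<Sum>n<N. L2sq (Delta_measure (Suc n) S T) (f n))"
    using m by (intro sum.cong) (auto simp: L2_Delta_Theta(2))
  finally show ?thesis .
qed

lemma is_Wn_zero:
  assumes "0 \<le> S" "S < T"
  shows "is_Wn M W S T n (\<lambda>_. 0 :: 'd::finite mat) (\<lambda>_ _. 0)"
  using wiener_zero[OF assms] by (simp add: is_Wn_iff L2_Delta_def)

lemma has_chaosE:
  fixes \<xi> :: "('w, 'd::finite) process"
  assumes "has_chaos M W S T \<xi> f"
  obtains Y where "\<forall>n. is_Wn M W S T n (f n) (Y n)"
    "(\<lambda>N. L2sq (PM S T) (\<lambda>p. case_prod \<xi> p - (\<Sum>n<N. case_prod (Y n) p))) \<longlonglongrightarrow> 0"
  using assms unfolding has_chaos_def by (elim exE conjE) (rule that, assumption, simp only: L2sq_def)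

lemma has_chaosI:
  fixes \<xi> :: "('w, 'd::finite) process"
  assumes "\<xi> \<in> L2F M W S T" "\<forall>n. is_Wn M W S T n (f n) (Y n)"
    "(\<lambda>N. L2sq (PM S T) (\<lambda>p. case_prod \<xi> p - (\<Sum>n<N. case_prod (Y n) p))) \<longlonglongrightarrow> 0"
  shows "has_chaos M W S T \<xi> f"
  using assms unfolding has_chaos_def L2sq_def by (intro conjI exI)

lemma has_chaos_L2F: "has_chaos M W S T \<xi> f \<Longrightarrow> \<xi> \<in> L2F M W S T"
  by (simp add: has_chaos_def)

lemma has_chaos_L2_Delta:
  fixes \<xi> :: "('w, 'd::finite) process"
  assumes "has_chaos M W S T \<xi> f"
  shows "f n \<in> L2_Delta (Suc n) S T"
proof -
  obtain Y where "\<forall>n. is_Wn M W S T n (f n) (Y n)" by (rule has_chaosE[OF assms])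
  then show ?thesis by (simp add: is_Wn_def)
qed

lemma has_chaos_measurable:
  fixes \<xi> :: "('w, 'd::finite) process"
  assumes "has_chaos M W S T \<xi> f"
  shows "f n \<in> borel_measurable (Delta_measure (Suc n) S T)"
  using has_chaos_L2_Delta[OF assms, of n] by (simp add: L2_Delta_def)

text \<open>By Pythagoras the squared distance of two partial sums is a section of the series of
  squared coefficient norms. Its tails therefore control the Cauchy property, and completeness gives
  the process.\<close>

lemma has_chaos_exists:
  fixes f :: "nat \<Rightarrow> 'd::finite kernel"
  assumes f: "\<And>n. f n \<in> L2_Delta (Suc n) S T" and sum: "(\<Sum>n. L2sq (Delta_measure (Suc n) S T) (f n)) < \<infinity>"
    and S: "0 \<le> S" "S < T"
  shows "\<exists>\<xi>. has_chaos M W S T \<xi> f"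
proof -
  have "\<forall>n. \<exists>Y. is_Wn M W S T n (f n) Y" using is_Wn_exists[OF f S] by blast
  from choice[OF this] obtain Y where Y: "\<forall>n. is_Wn M W S T n (f n) (Y n)" ..
  define a where "a n = enn2real (L2sq (Delta_measure (Suc n) S T) (f n))" for n
  have a: "L2sq (Delta_measure (Suc n) S T) (f n) = ennreal (a n)" "0 \<le> a n" for n
    using f[of n] by (auto simp: a_def L2_Delta_iff)
  have sa: "summable a"
    using sum unfolding a(1) by (intro summable_suminf_not_top a) auto
  define c where "c i = ennreal (suminf a - (\<Sum>n<i. a n))" for i
  have c0: "c \<longlonglongrightarrow> 0"
  proof -
    have "(\<lambda>i. suminf a - (\<Sum>n<i. a n)) \<longlonglongrightarrow> suminf a - suminf a"
      by (intro tendsto_diff tendsto_const summable_LIMSEQ sa)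
    then have "c \<longlonglongrightarrow> ennreal (suminf a - suminf a)" unfolding c_def by (rule tendsto_ennrealI)
    then show ?thesis by simp
  qed
  have diff: "L2sq (PM S T) (\<lambda>p. (\<Sum>n<j. case_prod (Y n) p) - (\<Sum>n<i. case_prod (Y n) p)) \<le> c i" if "i \<le> j" for i j
  proof -
    \<comment> \<open>Zero processes in the orders below i turn the difference into a sum over all n
      < j, the form that \<open>is_Wn_pythagoras\<close> accepts.\<close>
    have "(\<Sum>n<j. case_prod (Y n) p) - (\<Sum>n<i. case_prod (Y n) p) = (\<Sum>n<j. case_prod (if n < i then (\<lambda>_ _. 0) else Y n) p)" for p
    proof -
      have "(\<Sum>n<j. case_prod (Y n) p) = (\<Sum>n<i. case_prod (Y n) p) + (\<Sum>n\<in>{i..<j}. case_prod (Y n) p)"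
        using that by (metis atLeast0LessThan le0 sum.atLeastLessThan_concat)
      moreover have "(\<Sum>n<j. case_prod (if n < i then (\<lambda>_ _. 0) else Y n) p) = (\<Sum>n<j. if n \<in> {i..<j} then case_prod (Y n) p else 0)"
        by (intro sum.cong) auto
      moreover have "\<dots> = (\<Sum>n\<in>{..<j} \<inter> {i..<j}. case_prod (Y n) p)" by (rule sum.inter_restrict[symmetric]) simp
      moreover have "{..<j} \<inter> {i..<j} = {i..<j}" by auto
      ultimately show ?thesis by simp
    qed
    then have "L2sq (PM S T) (\<lambda>p. (\<Sum>n<j. case_prod (Y n) p) - (\<Sum>n<i. case_prod (Y n) p))
      = L2sq (PM S T) (\<lambda>p. \<Sum>n<j. case_prod (if n < i then (\<lambda>_ _. 0) else Y n) p)" by simp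
    also have "\<dots> = (\<Sum>n<j. L2sq (Delta_measure (Suc n) S T) (if n < i then (\<lambda>_. 0) else f n))"
      by (rule is_Wn_pythagoras) (use Y is_Wn_zero[OF S] S in auto)
    also have "\<dots> = (\<Sum>n<j. ennreal (if n < i then 0 else a n))"
      using a(1) by (intro sum.cong) auto
    also have "\<dots> = ennreal (\<Sum>n<j. if n < i then 0 else a n)"
      using a(2) by (intro sum_ennreal) auto
    also have "(\<Sum>n<j. if n < i then 0 else a n) \<le> suminf a - (\<Sum>n<i. a n)"
    proof -
      have "(\<Sum>n<j. if n < i then 0 else a n) + (\<Sum>n<i. a n) = (\<Sum>n<j. a n)"
      proof -
        have "(\<Sum>n<i. a n) = (\<Sum>n<j. if n < i then a n else 0)"
          using that by (subst sum.inter_filter[symmetric]) (auto intro!: sum.cong)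
        then have "(\<Sum>n<j. if n < i then 0 else a n) + (\<Sum>n<i. a n) = (\<Sum>n<j. (if n < i then 0 else a n) + (if n < i then a n else 0))"
          by (simp add: sum.distrib)
        also have "\<dots> = (\<Sum>n<j. a n)" by (intro sum.cong) auto
        finally show ?thesis .
      qed
      moreover have "(\<Sum>n<j. a n) \<le> suminf a" by (rule sum_le_suminf[OF sa]) (auto simp: a)
      ultimately show ?thesis by simp
    qed
    finally show ?thesis by (simp add: c_def ennreal_leI)
  qed
  define P where "P N t \<omega> = (\<Sum>n<N. Y n t \<omega>)" for N t \<omega>
  have P: "case_prod (P N) p = (\<Sum>n<N. case_prod (Y n) p)" for N p
    by (simp add: P_def case_prod_beta')
  have P_L2F: "P N \<in> L2F M W S T" for N
  proof (induction N)
    case 0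
    show ?case using elem_L2F[OF elem_zero S] by (simp add: P_def[abs_def])
  next
    case (Suc N)
    have "(\<lambda>t \<omega>. P N t \<omega> + 1 *\<^sub>R Y N t \<omega>) \<in> L2F M W S T"
      by (rule L2F_add) (use Suc Y in \<open>auto simp: is_Wn_def\<close>)
    then show ?case by (simp add: P_def[abs_def])
  qed
  have cauchy: "L2sq (PM S T) (\<lambda>p. case_prod (P i) p - case_prod (P j) p) \<le> c i + c j" for i j
  proof (cases "i \<le> j")
    case True
    have "L2sq (PM S T) (\<lambda>p. case_prod (P i) p - case_prod (P j) p) \<le> c i"
      using diff[OF True] unfolding P by (subst L2sq_commute)
    then show ?thesis by (rule order_trans) simp
  next
    case False
    then have "L2sq (PM S T) (\<lambda>p. case_prod (P i) p - case_prod (P j) p) \<le> c j"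
      using diff[of j i] unfolding P by simp
    then show ?thesis by (rule order_trans) simp
  qed
  obtain \<xi> where \<xi>: "\<xi> \<in> L2F M W S T" "(\<lambda>N. L2sq (PM S T) (\<lambda>p. case_prod \<xi> p - case_prod (P N) p)) \<longlonglongrightarrow> 0"
    using L2F_complete[OF P_L2F c0 cauchy] by (elim bexE)
  have "has_chaos M W S T \<xi> f"
    by (rule has_chaosI[OF \<xi>(1) Y]) (use \<xi>(2) in \<open>simp only: P\<close>)
  then show ?thesis by blast
qed

lemma is_Wn_diff_pythagoras:
  fixes f g :: "nat \<Rightarrow> 'd::finite kernel"
  assumes "\<forall>n. is_Wn M W S T n (f n) (Y n)" "\<forall>n. is_Wn M W S T n (g n) (Z n)" "0 \<le> S"
  shows "L2sq (PM S T) (\<lambda>p. (\<Sum>n<N. case_prod (Y n) p) - (\<Sum>n<N. case_prod (Z n) p))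
    = (\<Sum>n<N. L2sq (Delta_measure (Suc n) S T) (\<lambda>t. f n t - g n t))"
proof -
  have "is_Wn M W S T n (\<lambda>t. f n t + (-1) *\<^sub>R g n t) (\<lambda>t \<omega>. Y n t \<omega> + (-1) *\<^sub>R Z n t \<omega>)" for n
    by (rule is_Wn_linear) (use assms in auto)
  from is_Wn_pythagoras[of N S T "\<lambda>n t. f n t + (-1) *\<^sub>R g n t" "\<lambda>n t \<omega>. Y n t \<omega> + (-1) *\<^sub>R Z n t \<omega>", OF this assms(3)]
  show ?thesis by (simp add: sum_subtractf case_prod_beta')
qed

text \<open>Pythagoras for the differences of coefficients makes the two sequences of partial sums
  agree almost everywhere, and so do their limits. This makes \<open>chaos_process\<close> well
  defined as an element of L2.\<close>

lemma has_chaos_process_unique: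
  fixes \<xi> \<eta> :: "('w, 'd::finite) process"
  assumes \<xi>: "has_chaos M W S T \<xi> f" and \<eta>: "has_chaos M W S T \<eta> g" and S: "0 \<le> S"
    and eq: "\<And>n. AE t in Delta_measure (Suc n) S T. f n t = g n t"
  shows "L2F_eq M S T \<xi> \<eta>"
proof -
  obtain Y where Y: "\<forall>n. is_Wn M W S T n (f n) (Y n)"
    "(\<lambda>N. L2sq (PM S T) (\<lambda>p. case_prod \<xi> p - (\<Sum>n<N. case_prod (Y n) p))) \<longlonglongrightarrow> 0" by (rule has_chaosE[OF \<xi>])
  obtain Z where Z: "\<forall>n. is_Wn M W S T n (g n) (Z n)"
    "(\<lambda>N. L2sq (PM S T) (\<lambda>p. case_prod \<eta> p - (\<Sum>n<N. case_prod (Z n) p))) \<longlonglongrightarrow> 0" by (rule has_chaosE[OF \<eta>])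
  note m = L2F_measurable[OF has_chaos_L2F[OF \<xi>]] L2F_measurable[OF has_chaos_L2F[OF \<eta>]]
  have mY: "(\<lambda>p. \<Sum>n<N. case_prod (Y n) p) \<in> borel_measurable (PM S T)"
    and mZ: "(\<lambda>p. \<Sum>n<N. case_prod (Z n) p) \<in> borel_measurable (PM S T)" for N
    using Y(1) Z(1) by (auto intro!: borel_measurable_sum is_Wn_measurable)
  have z: "L2sq (PM S T) (\<lambda>p. (\<Sum>n<N. case_prod (Y n) p) + (-1) *\<^sub>R (\<Sum>n<N. case_prod (Z n) p)) = 0" for N
  proof -
    have "L2sq (Delta_measure (Suc n) S T) (\<lambda>t. f n t - g n t) = 0" for n
    proof -
      have "L2sq (Delta_measure (Suc n) S T) (\<lambda>t. f n t - g n t) = L2sq (Delta_measure (Suc n) S T) (\<lambda>_. 0 :: 'd mat)"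
        by (rule L2sq_cong_AE) (use eq[of n] in eventually_elim, simp)
      then show ?thesis by simp
    qed
    then show ?thesis using is_Wn_diff_pythagoras[OF Y(1) Z(1) S, of N] by simp
  qed
  have lim: "(\<lambda>N. L2sq (PM S T) (\<lambda>p. (case_prod \<xi> p + (-1) *\<^sub>R case_prod \<eta> p) - ((\<Sum>n<N. case_prod (Y n) p) + (-1) *\<^sub>R (\<Sum>n<N. case_prod (Z n) p)))) \<longlonglongrightarrow> 0"
    by (rule L2sq_lincomb_tendsto[OF m mY mZ Y(2) Z(2)])
  have m1: "(\<lambda>p. case_prod \<xi> p + (-1) *\<^sub>R case_prod \<eta> p) \<in> borel_measurable (PM S T)"
    and m2: "\<And>N. (\<lambda>p. (\<Sum>n<N. case_prod (Y n) p) + (-1) *\<^sub>R (\<Sum>n<N. case_prod (Z n) p)) \<in> borel_measurable (PM S T)"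
    using m mY mZ by (auto intro!: borel_measurable_add borel_measurable_scaleR)
  have "0 + L2sq (PM S T) (\<lambda>p. case_prod \<xi> p + (-1) *\<^sub>R case_prod \<eta> p) \<le> 0 + L2sq (PM S T) (\<lambda>_. 0 :: 'd mat)"
    by (rule L2sq_limit_le[where Ys = "\<lambda>_ _. 0", OF m1 m2 borel_measurable_const borel_measurable_const _ lim]) (simp_all only: z L2sq_zero, auto)
  then have "L2sq (PM S T) (\<lambda>p. case_prod \<xi> p + (-1) *\<^sub>R case_prod \<eta> p) = 0" by simp
  then have "AE p in PM S T. case_prod \<xi> p + (-1) *\<^sub>R case_prod \<eta> p = 0"
    by (subst (asm) L2sq_eq_0_iff[OF m1])
  then have "AE p in PM S T. case_prod \<xi> p = case_prod \<eta> p" by eventually_elim (auto split: prod.splits)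
  then show ?thesis unfolding L2F_eq_def by (simp add: case_prod_beta')
qed

text \<open>As in Bessel's inequality, one order is dominated by the full Pythagorean sum, which
  here is the squared distance of two partial sums with a common limit. This makes
  \<open>chaos_coeff\<close> well defined up to null sets.\<close>

lemma has_chaos_coeff_unique:
  fixes \<xi> :: "('w, 'd::finite) process"
  assumes \<xi>: "has_chaos M W S T \<xi> f" and \<eta>: "has_chaos M W S T \<xi> g" and S: "0 \<le> S"
  shows "AE t in Delta_measure (Suc n) S T. f n t = g n t"
proof -
  obtain Y where Y: "\<forall>n. is_Wn M W S T n (f n) (Y n)"
    "(\<lambda>N. L2sq (PM S T) (\<lambda>p. case_prod \<xi> p - (\<Sum>n<N. case_prod (Y n) p))) \<longlonglongrightarrow> 0" by (rule has_chaosE[OF \<xi>])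
  obtain Z where Z: "\<forall>n. is_Wn M W S T n (g n) (Z n)"
    "(\<lambda>N. L2sq (PM S T) (\<lambda>p. case_prod \<xi> p - (\<Sum>n<N. case_prod (Z n) p))) \<longlonglongrightarrow> 0" by (rule has_chaosE[OF \<eta>])
  note m = L2F_measurable[OF has_chaos_L2F[OF \<xi>]]
  have mY: "(\<lambda>p. \<Sum>n<N. case_prod (Y n) p) \<in> borel_measurable (PM S T)"
    and mZ: "(\<lambda>p. \<Sum>n<N. case_prod (Z n) p) \<in> borel_measurable (PM S T)" for N
    using Y(1) Z(1) by (auto intro!: borel_measurable_sum is_Wn_measurable)
  let ?D = "\<lambda>n. L2sq (Delta_measure (Suc n) S T) (\<lambda>t. f n t - g n t)"
  let ?b = "\<lambda>N. 2 * L2sq (PM S T) (\<lambda>p. case_prod \<xi> p - (\<Sum>n<N. case_prod (Y n) p)) + 2 * L2sq (PM S T) (\<lambda>p. case_prod \<xi> p - (\<Sum>n<N. case_prod (Z n) p))"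
  have "?D n \<le> ?b N" if "Suc n \<le> N" for N
  proof -
    have "?D n \<le> (\<Sum>n<N. ?D n)" using that by (intro member_le_sum) auto
    also have "\<dots> = L2sq (PM S T) (\<lambda>p. (\<Sum>n<N. case_prod (Y n) p) - (\<Sum>n<N. case_prod (Z n) p))"
      by (rule is_Wn_diff_pythagoras[OF Y(1) Z(1) S, symmetric])
    also have "\<dots> \<le> 2 * L2sq (PM S T) (\<lambda>p. (\<Sum>n<N. case_prod (Y n) p) - case_prod \<xi> p) + 2 * L2sq (PM S T) (\<lambda>p. case_prod \<xi> p - (\<Sum>n<N. case_prod (Z n) p))"
      by (rule L2sq_diff_le[OF mY mZ m])
    also have "L2sq (PM S T) (\<lambda>p. (\<Sum>n<N. case_prod (Y n) p) - case_prod \<xi> p) = L2sq (PM S T) (\<lambda>p. case_prod \<xi> p - (\<Sum>n<N. case_prod (Y n) p))"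
      by (rule L2sq_commute)
    finally show ?thesis .
  qed
  moreover have "?b \<longlonglongrightarrow> 0 + 0"
    by (intro tendsto_add tendsto_ennreal_mult0 Y(2) Z(2)) auto
  ultimately have "?D n \<le> 0 + 0" by (intro Lim_bounded2[of ?b "0 + 0" "Suc n"]) auto
  then have "?D n = 0" by simp
  then have "AE t in Delta_measure (Suc n) S T. f n t - g n t = 0"
    by (subst (asm) L2sq_eq_0_iff) (auto intro: borel_measurable_diff has_chaos_measurable[OF \<xi>] has_chaos_measurable[OF \<eta>])
  then show ?thesis by eventually_elim simp
qed

lemma has_chaos_add:
  fixes \<xi> \<eta> :: "('w, 'd::finite) process"
  assumes \<xi>: "has_chaos M W S T \<xi> f" and \<eta>: "has_chaos M W S T \<eta> g" and S: "0 \<le> S"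
  shows "has_chaos M W S T (\<lambda>t \<omega>. \<xi> t \<omega> + \<eta> t \<omega>) (\<lambda>n t. f n t + g n t)"
proof -
  obtain Y where Y: "\<forall>n. is_Wn M W S T n (f n) (Y n)"
    "(\<lambda>N. L2sq (PM S T) (\<lambda>p. case_prod \<xi> p - (\<Sum>n<N. case_prod (Y n) p))) \<longlonglongrightarrow> 0" by (rule has_chaosE[OF \<xi>])
  obtain Z where Z: "\<forall>n. is_Wn M W S T n (g n) (Z n)"
    "(\<lambda>N. L2sq (PM S T) (\<lambda>p. case_prod \<eta> p - (\<Sum>n<N. case_prod (Z n) p))) \<longlonglongrightarrow> 0" by (rule has_chaosE[OF \<eta>])
  note m = L2F_measurable[OF has_chaos_L2F[OF \<xi>]] L2F_measurable[OF has_chaos_L2F[OF \<eta>]]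
  have mY: "(\<lambda>p. \<Sum>n<N. case_prod (Y n) p) \<in> borel_measurable (PM S T)"
    and mZ: "(\<lambda>p. \<Sum>n<N. case_prod (Z n) p) \<in> borel_measurable (PM S T)" for N
    using Y(1) Z(1) by (auto intro!: borel_measurable_sum is_Wn_measurable)
  have W: "is_Wn M W S T n (\<lambda>t. f n t + g n t) (\<lambda>t \<omega>. Y n t \<omega> + Z n t \<omega>)" for n
    using is_Wn_linear[OF Y(1)[rule_format] Z(1)[rule_format] S, of n 1] by simp
  have L: "(\<lambda>t \<omega>. \<xi> t \<omega> + \<eta> t \<omega>) \<in> L2F M W S T"
    using L2F_add[OF has_chaos_L2F[OF \<xi>] has_chaos_L2F[OF \<eta>], of 1] by simp
  show ?thesis
  proof (rule has_chaosI[OF L, where Y = "\<lambda>n t \<omega>. Y n t \<omega> + Z n t \<omega>"])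
    show "(\<lambda>N. L2sq (PM S T) (\<lambda>p. (case p of (t, \<omega>) \<Rightarrow> \<xi> t \<omega> + \<eta> t \<omega>) - (\<Sum>n<N. case p of (t, \<omega>) \<Rightarrow> Y n t \<omega> + Z n t \<omega>))) \<longlonglongrightarrow> 0"
      using L2sq_lincomb_tendsto[OF m mY mZ Y(2) Z(2), of 1] by (simp add: case_prod_beta' sum.distrib)
  qed (use W in simp)
qed

lemma has_chaos_chaos_process:
  "\<exists>\<xi>. has_chaos M W S T \<xi> f \<Longrightarrow> has_chaos M W S T (chaos_process M W S T f) f"
  unfolding chaos_process_def by (rule someI_ex[where P = "\<lambda>\<xi>. has_chaos M W S T \<xi> f"])

lemma has_chaos_chaos_coeff:
  "has_chaos M W S T \<xi> f \<Longrightarrow> has_chaos M W S T \<xi> (chaos_coeff M W S T \<xi>)"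
  unfolding chaos_coeff_def by (rule someI[where P = "has_chaos M W S T \<xi>"])

end

section \<open>Norms of kernels\<close>

lemma bounded_linear_matrix_vector: "bounded_linear ((*v) (A :: real^'n^'m))"
  by (rule matrix_vector_mul_bounded_linear)

lemma op_norm_nonneg [simp]: "0 \<le> op_norm (A :: 'd::finite mat)"
  by (rule onorm_pos_le[OF bounded_linear_matrix_vector])

lemma op_norm_0 [simp]: "op_norm (0 :: 'd::finite mat) = 0"
  by (simp add: onorm_eq_0[OF bounded_linear_matrix_vector])

lemma op_norm_triangle: "op_norm (A + B :: 'd::finite mat) \<le> op_norm A + op_norm B"
  using onorm_triangle[OF bounded_linear_matrix_vector[of A] bounded_linear_matrix_vector[of B]]
  unfolding matrix_vector_mult_add_rdistrib .

lemma op_norm_mult: "op_norm (A ** B :: 'd::finite mat) \<le> op_norm A * op_norm B"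
  using onorm_compose[OF bounded_linear_matrix_vector[of A] bounded_linear_matrix_vector[of B]]
  by (simp add: o_def matrix_vector_mul_assoc)

lemma matrix_entry_le_norm: "\<bar>A $ i $ j\<bar> \<le> norm (A :: 'd::finite mat)"
  using component_le_norm_cart[of "A $ i" j] Finite_Cartesian_Product.norm_nth_le[of A i] by linarith

text \<open>The constant is the number of entries, a crude choice that is good enough for
  continuity, and hence measurability, of the operator norm.\<close>

lemma op_norm_le_norm: "op_norm (A :: 'd::finite mat) \<le> (real CARD('d))\<^sup>2 * norm A"
proof -
  have "op_norm A \<le> (\<Sum>i\<in>UNIV. \<Sum>j\<in>UNIV. \<bar>A $ i $ j\<bar>)" by (rule onorm_le_matrix_component_sum)
  also have "\<dots> \<le> (\<Sum>i\<in>(UNIV :: 'd set). \<Sum>j\<in>(UNIV :: 'd set). norm A)"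
    by (intro sum_mono matrix_entry_le_norm)
  finally show ?thesis by (simp add: power2_eq_square)
qed

lemma norm_le_op_norm: "norm (A :: 'd::finite mat) \<le> (real CARD('d))\<^sup>2 * op_norm A"
proof -
  have "norm A \<le> (\<Sum>i\<in>UNIV. norm (A $ i))"
    unfolding norm_vec_def by (rule L2_set_le_sum) simp
  also have "\<dots> \<le> (\<Sum>i\<in>UNIV. \<Sum>j\<in>UNIV. \<bar>A $ i $ j\<bar>)"
    by (intro sum_mono norm_le_l1_cart)
  also have "\<dots> \<le> (\<Sum>i\<in>(UNIV :: 'd set). \<Sum>j\<in>(UNIV :: 'd set). op_norm A)"
    by (intro sum_mono matrix_component_le_onorm)
  finally show ?thesis by (simp add: power2_eq_square)
qed

lemma continuous_op_norm: "continuous_on UNIV (\<lambda>A :: 'd::finite mat. op_norm A)"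
proof (rule continuous_onI)
  fix A :: "'d mat" and e :: real assume e: "0 < e"
  let ?D = "(real CARD('d))\<^sup>2"
  have D: "0 < ?D" by simp
  have "\<bar>op_norm B - op_norm A\<bar> \<le> ?D * dist B A" for B :: "'d mat"
  proof -
    have "op_norm B \<le> op_norm A + op_norm (B - A)" using op_norm_triangle[of A "B - A"] by simp
    moreover have "op_norm A \<le> op_norm B + op_norm (A - B)" using op_norm_triangle[of B "A - B"] by simp
    ultimately show ?thesis
      using op_norm_le_norm[of "B - A"] op_norm_le_norm[of "A - B"] by (simp add: dist_norm norm_minus_commute)
  qed
  then have "dist (op_norm B) (op_norm A) \<le> e" if "dist B A < e / ?D" for B :: "'d mat"
  proof -
    have "?D * dist B A \<le> ?D * (e / ?D)" using that D by (intro mult_left_mono) auto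
    with \<open>\<bar>op_norm B - op_norm A\<bar> \<le> ?D * dist B A\<close> show ?thesis using D by (simp add: dist_real_def)
  qed
  then show "\<exists>d>0. \<forall>B\<in>UNIV. dist B A < d \<longrightarrow> dist (op_norm B) (op_norm A) \<le> e"
    using e D by (intro exI[of _ "e / ?D"]) auto
qed

lemma borel_measurable_op_norm [measurable]:
  "f \<in> borel_measurable N \<Longrightarrow> (\<lambda>x. op_norm (f x :: 'd::finite mat)) \<in> borel_measurable N"
  by (rule measurable_compose[OF _ borel_measurable_continuous_onI[OF continuous_op_norm]])

lemma borel_measurable_matrix_mult [measurable (raw)]:
  fixes f g :: "'a \<Rightarrow> 'd::finite mat"
  assumes "f \<in> borel_measurable N" "g \<in> borel_measurable N"
  shows "(\<lambda>x. f x ** g x) \<in> borel_measurable N"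
proof (rule borel_measurable_continuous_Pair[OF assms])
  show "continuous_on UNIV (\<lambda>x :: 'd mat \<times> 'd mat. fst x ** snd x)"
    unfolding matrix_matrix_mult_def by (intro continuous_intros)
qed

text \<open>The weighted inequality with the optimal weight b/a. Both norms are first enlarged by h
  > 0, so that the quotient is defined when a norm vanishes; then h tends to 0.\<close>

lemma L2sq_minkowski:
  fixes f g :: "'a \<Rightarrow> 'b::{second_countable_topology, real_normed_vector}"
  assumes [measurable]: "f \<in> borel_measurable N" "g \<in> borel_measurable N"
    and a: "0 \<le> a" "L2sq N f \<le> ennreal (a\<^sup>2)" and b: "0 \<le> b" "L2sq N g \<le> ennreal (b\<^sup>2)"
  shows "L2sq N (\<lambda>x. f x + g x) \<le> ennreal ((a + b)\<^sup>2)"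
proof (rule Lim_bounded2)
  show "(\<lambda>n. ennreal ((a + b + 2 * inverse (real (Suc n)))\<^sup>2)) \<longlonglongrightarrow> ennreal ((a + b)\<^sup>2)"
  proof -
    have "(\<lambda>n. (a + b + 2 * inverse (real (Suc n)))\<^sup>2) \<longlonglongrightarrow> (a + b + 2 * 0)\<^sup>2"
      by (intro tendsto_intros LIMSEQ_inverse_real_of_nat)
    then show ?thesis by (intro tendsto_ennrealI) simp
  qed
  show "\<forall>n\<ge>0. L2sq N (\<lambda>x. f x + g x) \<le> ennreal ((a + b + 2 * inverse (real (Suc n)))\<^sup>2)"
  proof (intro allI impI)
    fix n
    define h where "h = inverse (real (Suc n))"
    have h: "0 < h" by (simp add: h_def)
    let ?d = "(b + h) / (a + h)"
    have d: "0 < ?d" using a b h by simp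
    have "L2sq N (\<lambda>x. f x + g x) \<le> ennreal (1 + ?d) * L2sq N f + ennreal (1 + 1 / ?d) * L2sq N g"
      by (rule L2sq_add_weighted[OF assms(1,2) d])
    also have "\<dots> \<le> ennreal (1 + ?d) * ennreal ((a + h)\<^sup>2) + ennreal (1 + 1 / ?d) * ennreal ((b + h)\<^sup>2)"
      using a b h by (intro add_mono mult_left_mono order_trans[OF a(2)] order_trans[OF b(2)] ennreal_leI power_mono) auto
    also have "\<dots> = ennreal ((1 + ?d) * (a + h)\<^sup>2 + (1 + 1 / ?d) * (b + h)\<^sup>2)"
    proof -
      have "0 \<le> 1 + ?d" "0 \<le> 1 + 1 / ?d" using d by (simp_all add: add_nonneg_nonneg less_imp_le del: divide_divide_eq_right)
      then show ?thesis by (simp only: ennreal_mult ennreal_plus mult_nonneg_nonneg zero_le_power2)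
    qed
    also have "(1 + ?d) * (a + h)\<^sup>2 + (1 + 1 / ?d) * (b + h)\<^sup>2 = (a + b + 2 * h)\<^sup>2"
    proof -
      have nz: "a + h \<noteq> 0" "b + h \<noteq> 0" using a b h by auto
      have "(1 + ?d) * (a + h)\<^sup>2 = (a + h)\<^sup>2 + (a + h) * (b + h)"
        using nz by (simp add: field_simps power2_eq_square)
      moreover have "(1 + 1 / ?d) * (b + h)\<^sup>2 = (b + h)\<^sup>2 + (a + h) * (b + h)"
        using nz by (simp add: field_simps power2_eq_square)
      ultimately show ?thesis by (simp add: power2_eq_square algebra_simps)
    qed
    finally show "L2sq N (\<lambda>x. f x + g x) \<le> ennreal ((a + b + 2 * inverse (real (Suc n)))\<^sup>2)"
      by (simp add: h_def)
  qed
qed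

text \<open>Integration over the larger times with the last time fixed at t. For n = 0 this
  evaluates the function at the 1-tuple t, so that \<open>Qsec\<close> covers both cases in the
  definition of \<open>V_norm\<close>.\<close>

definition Isec :: "nat \<Rightarrow> real \<Rightarrow> ((nat \<Rightarrow> real) \<Rightarrow> ennreal) \<Rightarrow> real \<Rightarrow> ennreal" where
  "Isec n T \<phi> t = (\<integral>\<^sup>+ s. \<phi> (s(n := t)) \<partial>Delta_measure n t T)"

abbreviation Qsec :: "nat \<Rightarrow> real \<Rightarrow> 'd::finite kernel \<Rightarrow> real \<Rightarrow> ennreal" where
  "Qsec n T k \<equiv> Isec n T (\<lambda>x. ennreal ((op_norm (k x))\<^sup>2))"

lemma Isec_measurable:
  "\<phi> \<in> borel_measurable (Delta_measure (Suc n) S T) \<Longrightarrow> Isec n T \<phi> \<in> borel_measurable (interval_measure S T)"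
  unfolding Isec_def[abs_def] by (rule nn_integral_Delta_Suc_tail(2))

lemma nn_integral_Isec:
  "\<phi> \<in> borel_measurable (Delta_measure (Suc n) S T) \<Longrightarrow>
    (\<integral>\<^sup>+ x. \<phi> x \<partial>Delta_measure (Suc n) S T) = (\<integral>\<^sup>+ t. Isec n T \<phi> t \<partial>interval_measure S T)"
  unfolding Isec_def[abs_def] by (rule nn_integral_Delta_Suc_tail(1))

lemma sqrt_ennreal_le_iff: "0 \<le> c \<Longrightarrow> sqrt_ennreal x \<le> ennreal c \<longleftrightarrow> x \<le> ennreal (c\<^sup>2)"
proof (cases x)
  case (real r)
  assume c: "0 \<le> c"
  have "sqrt r \<le> c \<longleftrightarrow> r \<le> c\<^sup>2" using real c by (metis real_le_lsqrt real_sqrt_le_iff real_sqrt_abs abs_of_nonneg)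
  then show ?thesis using real c by (simp add: sqrt_ennreal_def)
qed (simp add: sqrt_ennreal_def top_unique)

lemma measurable_sqrt_ennreal [measurable]: "sqrt_ennreal \<in> borel_measurable borel"
  unfolding sqrt_ennreal_def[abs_def] by measurable

lemma V_norm_eq:
  fixes k :: "'d::finite kernel"
  shows "V_norm n S T k = esssup (interval_measure S T) (\<lambda>t. sqrt_ennreal (Qsec n T k t))"
proof (cases "n = 0")
  case True
  have "sqrt_ennreal (Qsec 0 T k t) = ennreal (op_norm (k (\<lambda>i\<in>{..<1}. t)))" for t
  proof -
    have "(\<lambda>_. undefined)(0 := t) = (\<lambda>i\<in>{..<1::nat}. t)" by (auto simp: fun_eq_iff)
    then show ?thesis by (simp add: Isec_def nn_integral_Delta_0 sqrt_ennreal_def)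
  qed
  then show ?thesis by (simp add: True V_norm_def)
qed (simp add: V_norm_def Isec_def)

lemma op_norm_sq_measurable:
  fixes k :: "'d::finite kernel"
  assumes "k \<in> borel_measurable N"
  shows "(\<lambda>x. ennreal ((op_norm (k x))\<^sup>2)) \<in> borel_measurable N"
  using assms by measurable

text \<open>Trades the essential supremum of square roots for an almost-everywhere bound on
  integrals of squares, the form in which the norm estimates are carried out.\<close>

lemma V_norm_le_iff:
  fixes k :: "'d::finite kernel"
  assumes k: "k \<in> borel_measurable (Delta_measure (Suc n) S T)" and c: "0 \<le> c"
  shows "V_norm n S T k \<le> ennreal c \<longleftrightarrow> (AE t in interval_measure S T. Qsec n T k t \<le> ennreal (c\<^sup>2))"
proof
  assume l: "V_norm n S T k \<le> ennreal c"
  have "AE t in interval_measure S T. sqrt_ennreal (Qsec n T k t) \<le> V_norm n S T k"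
    unfolding V_norm_eq by (rule esssup_AE)
  then show "AE t in interval_measure S T. Qsec n T k t \<le> ennreal (c\<^sup>2)"
  proof eventually_elim
    case (elim t)
    then have "sqrt_ennreal (Qsec n T k t) \<le> ennreal c" using l by (rule order_trans)
    then show ?case using c by (simp add: sqrt_ennreal_le_iff)
  qed
next
  assume r: "AE t in interval_measure S T. Qsec n T k t \<le> ennreal (c\<^sup>2)"
  show "V_norm n S T k \<le> ennreal c"
    unfolding V_norm_eq
  proof (rule esssup_I)
    show "(\<lambda>t. sqrt_ennreal (Qsec n T k t)) \<in> borel_measurable (interval_measure S T)"
      by (rule measurable_compose[OF Isec_measurable[OF op_norm_sq_measurable[OF k]] measurable_sqrt_ennreal])
    show "AE t in interval_measure S T. sqrt_ennreal (Qsec n T k t) \<le> ennreal c"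
      using r by eventually_elim (simp add: sqrt_ennreal_le_iff c)
  qed
qed

text \<open>Lowering the upper end shrinks the domain of every section integral, and raising the
  lower end discards sections; a smaller kernel is treated at the same time.\<close>

lemma V_norm_mono:
  fixes k k' :: "'d::finite kernel"
  assumes k: "k \<in> borel_measurable (Delta_measure (Suc n) S T)" and k': "k' \<in> borel_measurable (Delta_measure (Suc n) S' T')"
    and sub: "S \<le> S'" "T' \<le> T"
    and le: "\<And>x. x \<in> Delta (Suc n) S' T' \<Longrightarrow> op_norm (k' x) \<le> op_norm (k x)"
  shows "V_norm n S' T' k' \<le> V_norm n S T k"
proof (cases "V_norm n S T k = \<infinity>")
  case False
  define c where "c = enn2real (V_norm n S T k)"
  have c: "V_norm n S T k = ennreal c" "0 \<le> c" using False by (auto simp: c_def less_top)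
  have "AE t in interval_measure S' T'. Qsec n T k t \<le> ennreal (c\<^sup>2)"
    by (rule AE_interval_measure_mono[OF _ sub]) (use V_norm_le_iff[OF k c(2)] c(1) in simp)
  then have "AE t in interval_measure S' T'. Qsec n T' k' t \<le> ennreal (c\<^sup>2)"
    using AE_interval_measure_space
  proof eventually_elim
    case (elim t)
    have "Qsec n T' k' t \<le> Qsec n T k t"
      unfolding Isec_def nn_integral_Delta
    proof (rule nn_integral_mono)
      fix s assume s: "s \<in> space (lborel_pow n)"
      show "ennreal ((op_norm (k' (s(n := t))))\<^sup>2) * indicator (Delta n t T') s \<le> ennreal ((op_norm (k (s(n := t))))\<^sup>2) * indicator (Delta n t T) s"
      proof (cases "s \<in> Delta n t T'")
        case True
        then have "s \<in> Delta n t T" using sub by (force simp: Delta_def)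
        moreover have "s(n := t) \<in> Delta (Suc n) S' T'"
          using True elim(2) s by (simp add: fun_upd_in_Delta_iff space_lborel_pow)
        ultimately show ?thesis using True le by (auto intro!: ennreal_leI power_mono)
      qed simp
    qed
    with elim(1) show ?case by simp
  qed
  then show ?thesis unfolding c(1) by (subst V_norm_le_iff[OF k' c(2)])
qed simp

lemma borel_measurable_Delta_subinterval:
  assumes k: "k \<in> borel_measurable (Delta_measure n S T)" and sub: "S \<le> S'" "T' \<le> T"
  shows "k \<in> borel_measurable (Delta_measure n S' T')"
proof -
  have "(\<lambda>x. x) \<in> Delta_measure n S' T' \<rightarrow>\<^sub>M Delta_measure n S T"
    unfolding Delta_measure_def by (rule measurable_restrict_space3) (use sub in \<open>force simp: Delta_def\<close>)+
  from measurable_compose[OF this k] show ?thesis by simp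
qed

lemma V_norm_subinterval:
  fixes k :: "'d::finite kernel"
  assumes "k \<in> borel_measurable (Delta_measure (Suc n) S T)" "S \<le> S'" "T' \<le> T"
  shows "V_norm n S' T' k \<le> V_norm n S T k"
  by (rule V_norm_mono[OF assms(1) borel_measurable_Delta_subinterval[OF assms]]) (use assms in auto)

lemma V_norm_add:
  fixes k k' :: "'d::finite kernel"
  assumes k: "k \<in> borel_measurable (Delta_measure (Suc n) S T)" and k': "k' \<in> borel_measurable (Delta_measure (Suc n) S T)"
  shows "V_norm n S T (\<lambda>x. k x + k' x) \<le> V_norm n S T k + V_norm n S T k'"
proof (cases "V_norm n S T k = \<infinity> \<or> V_norm n S T k' = \<infinity>")
  case False
  define c c' where "c = enn2real (V_norm n S T k)" and "c' = enn2real (V_norm n S T k')"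
  have c: "V_norm n S T k = ennreal c" "0 \<le> c" "V_norm n S T k' = ennreal c'" "0 \<le> c'"
    using False by (auto simp: c_def c'_def less_top)
  have "AE t in interval_measure S T. Qsec n T k t \<le> ennreal (c\<^sup>2)" "AE t in interval_measure S T. Qsec n T k' t \<le> ennreal (c'\<^sup>2)"
    using V_norm_le_iff[OF k c(2)] V_norm_le_iff[OF k' c(4)] c by simp_all
  then have "AE t in interval_measure S T. Qsec n T (\<lambda>x. k x + k' x) t \<le> ennreal ((c + c')\<^sup>2)"
    using AE_interval_measure_space
  proof eventually_elim
    case (elim t)
    then have t: "S < t" "t < T" by auto
    have L: "Qsec n T h t = L2sq (Delta_measure n t T) (\<lambda>s. op_norm (h (s(n := t))))" for h :: "'d kernel"
      by (simp add: Isec_def L2sq_def)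
    note [measurable] = measurable_compose[OF measurable_fun_upd_section[OF t] k] measurable_compose[OF measurable_fun_upd_section[OF t] k']
    have "Qsec n T (\<lambda>x. k x + k' x) t \<le> L2sq (Delta_measure n t T) (\<lambda>s. op_norm (k (s(n := t))) + op_norm (k' (s(n := t))))"
      unfolding L L2sq_def by (intro nn_integral_mono ennreal_leI) (auto intro!: power_mono op_norm_triangle)
    also have "\<dots> \<le> ennreal ((c + c')\<^sup>2)"
      by (rule L2sq_minkowski) (use elim c in \<open>auto simp: L\<close>)
    finally show ?case .
  qed
  then have "V_norm n S T (\<lambda>x. k x + k' x) \<le> ennreal (c + c')"
    using k k' c by (subst V_norm_le_iff) auto
  then show ?thesis using c by simp
qed auto

lemma V_norm_zero: "V_norm n S T (\<lambda>_. 0 :: 'd::finite mat) = 0"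
proof -
  have "V_norm n S T (\<lambda>_. 0 :: 'd mat) \<le> ennreal 0"
    by (subst V_norm_le_iff) (auto simp: Isec_def)
  then show ?thesis by simp
qed

lemma V_norm_sum:
  fixes k :: "'i \<Rightarrow> 'd::finite kernel"
  assumes "finite I" "\<And>i. i \<in> I \<Longrightarrow> k i \<in> borel_measurable (Delta_measure (Suc n) S T)"
  shows "V_norm n S T (\<lambda>x. \<Sum>i\<in>I. k i x) \<le> (\<Sum>i\<in>I. V_norm n S T (k i))"
  using assms
proof (induction I rule: finite_induct)
  case (insert i I)
  have "V_norm n S T (\<lambda>x. k i x + (\<Sum>i\<in>I. k i x)) \<le> V_norm n S T (k i) + V_norm n S T (\<lambda>x. \<Sum>i\<in>I. k i x)"
    by (rule V_norm_add) (use insert in auto)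
  also have "\<dots> \<le> V_norm n S T (k i) + (\<Sum>i\<in>I. V_norm n S T (k i))"
    using insert by (intro add_left_mono) auto
  finally show ?case using insert by simp
qed (simp add: V_norm_zero)

lemma AE_Delta_tail:
  assumes "AE x in Delta_measure (Suc n) S T. P x"
  shows "AE t in interval_measure S T. AE s in Delta_measure n t T. P (s(n := t))"
proof -
  obtain A where A: "{x \<in> space (Delta_measure (Suc n) S T). \<not> P x} \<subseteq> A" "emeasure (Delta_measure (Suc n) S T) A = 0"
     "A \<in> sets (Delta_measure (Suc n) S T)"
    using assms by (rule AE_E)
  have ind: "(indicator A :: _ \<Rightarrow> ennreal) \<in> borel_measurable (Delta_measure (Suc n) S T)" using A(3) by simp
  have "(\<integral>\<^sup>+ t. Isec n T (indicator A) t \<partial>interval_measure S T) = 0"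
    using nn_integral_Isec[OF ind] A(2,3) by simp
  then have "AE t in interval_measure S T. Isec n T (indicator A) t = 0"
    by (subst (asm) nn_integral_0_iff_AE) (auto intro: Isec_measurable[OF ind])
  then show ?thesis using AE_interval_measure_space
  proof eventually_elim
    case (elim t)
    then have t: "S < t" "t < T" by auto
    have "AE s in Delta_measure n t T. indicator A (s(n := t)) = (0 :: ennreal)"
      using elim(1) measurable_compose[OF measurable_fun_upd_section[OF t] ind]
      unfolding Isec_def by (subst (asm) nn_integral_0_iff_AE) auto
    then show ?case
    proof (rule AE_mp, intro AE_I2 impI)
      fix s assume s: "s \<in> space (Delta_measure n t T)" and i: "indicator A (s(n := t)) = (0 :: ennreal)"
      have "s(n := t) \<in> space (Delta_measure (Suc n) S T)"
        using measurable_space[OF measurable_fun_upd_section[OF t] s] .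
      moreover have "s(n := t) \<notin> A" using i by (auto simp: indicator_def split: if_splits)
      ultimately show "P (s(n := t))" using A(1) by blast
    qed
  qed
qed

text \<open>Coefficients are known only modulo null sets, so their norms must not depend on
  representatives. A null set of the simplex has null sections at almost every last time.\<close>

lemma V_norm_cong_AE:
  fixes k k' :: "'d::finite kernel"
  assumes k: "k \<in> borel_measurable (Delta_measure (Suc n) S T)" and k': "k' \<in> borel_measurable (Delta_measure (Suc n) S T)"
    and eq: "AE x in Delta_measure (Suc n) S T. k x = k' x"
  shows "V_norm n S T k = V_norm n S T k'"
  unfolding V_norm_eq
proof (rule esssup_AE_cong)
  show "(\<lambda>t. sqrt_ennreal (Qsec n T k t)) \<in> borel_measurable (interval_measure S T)"
    by (rule measurable_compose[OF Isec_measurable[OF op_norm_sq_measurable[OF k]] measurable_sqrt_ennreal])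
  show "(\<lambda>t. sqrt_ennreal (Qsec n T k' t)) \<in> borel_measurable (interval_measure S T)"
    by (rule measurable_compose[OF Isec_measurable[OF op_norm_sq_measurable[OF k']] measurable_sqrt_ennreal])
  show "AE t in interval_measure S T. sqrt_ennreal (Qsec n T k t) = sqrt_ennreal (Qsec n T k' t)"
    using AE_Delta_tail[OF eq]
  proof eventually_elim
    case (elim t)
    have "Qsec n T k t = Qsec n T k' t" unfolding Isec_def
      by (rule nn_integral_cong_AE) (use elim in eventually_elim, simp)
    then show ?case by simp
  qed
qed

section \<open>The product of kernels and its norm\<close>

lemma tri_left_in_Delta: "x \<in> Delta (Suc (m + k)) S T \<Longrightarrow> restrict x {..m} \<in> Delta (Suc m) S T"
  by (auto simp: Delta_def extensional_def)

lemma tri_right_in_Delta: "x \<in> Delta (Suc (m + k)) S T \<Longrightarrow> (\<lambda>i\<in>{..k}. x (m + i)) \<in> Delta (Suc k) S T"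
  by (auto simp: Delta_def extensional_def)

lemma measurable_tri_left: "(\<lambda>x. restrict x {..m}) \<in> Delta_measure (Suc (m + k)) S T \<rightarrow>\<^sub>M Delta_measure (Suc m) S T"
  unfolding Delta_measure_def
proof (rule measurable_restrict_space3)
  show "(\<lambda>x. restrict x {..m}) \<in> lborel_pow (Suc (m + k)) \<rightarrow>\<^sub>M lborel_pow (Suc m)"
    unfolding lessThan_Suc_atMost by (rule measurable_restrict_subset) auto
qed (use tri_left_in_Delta in auto)

lemma measurable_tri_right: "(\<lambda>x. \<lambda>i\<in>{..k}. x (m + i)) \<in> Delta_measure (Suc (m + k)) S T \<rightarrow>\<^sub>M Delta_measure (Suc k) S T"
  unfolding Delta_measure_def
proof (rule measurable_restrict_space3)
  show "(\<lambda>x. \<lambda>i\<in>{..k}. x (m + i)) \<in> lborel_pow (Suc (m + k)) \<rightarrow>\<^sub>M lborel_pow (Suc k)"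
    unfolding lessThan_Suc_atMost by (intro measurable_restrict measurable_component_singleton) auto
qed (use tri_right_in_Delta in auto)

lemma tri_measurable:
  fixes f g :: "'d::finite kernel"
  assumes f: "f \<in> borel_measurable (Delta_measure (Suc m) S T)" and g: "g \<in> borel_measurable (Delta_measure (Suc k) S T)"
  shows "tri m k f g \<in> borel_measurable (Delta_measure (Suc (m + k)) S T)"
  unfolding tri_def[abs_def]
  by (intro borel_measurable_matrix_mult measurable_compose[OF measurable_tri_left f] measurable_compose[OF measurable_tri_right g])

text \<open>Induction on \<open>k\<close>: peeling off the last coordinate leaves a product of the same shape on the
  shorter interval \<open>(t, T)\<close>, so no Fubini theorem for general splittings is needed.\<close>

lemma Isec_tri_le:
  assumes "\<phi> \<in> borel_measurable (Delta_measure (Suc m) S T)" "\<psi> \<in> borel_measurable (Delta_measure (Suc k) S T)"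
    and "AE u in interval_measure S T. Isec m T \<phi> u \<le> C"
  shows "AE t in interval_measure S T.
     Isec (m + k) T (\<lambda>x. \<phi> (restrict x {..m}) * \<psi> (\<lambda>i\<in>{..k}. x (m + i))) t \<le> C * Isec k T \<psi> t"
  using assms
proof (induction k arbitrary: S \<psi>)
  case 0
  from "0.prems"(3) AE_interval_measure_space show ?case
  proof eventually_elim
    case (elim t)
    then have t: "S < t" "t < T" by auto
    let ?c = "\<psi> (\<lambda>i\<in>{..0}. t)"
    have "Isec (m + 0) T (\<lambda>x. \<phi> (restrict x {..m}) * \<psi> (\<lambda>i\<in>{..0}. x (m + i))) t = (\<integral>\<^sup>+ s. \<phi> (s(m := t)) * ?c \<partial>Delta_measure m t T)"
      unfolding Isec_def add_0_right
    proof (rule nn_integral_cong)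
      fix s assume "s \<in> space (Delta_measure m t T)"
      then have "restrict (s(m := t)) {..m} = s(m := t)"
        by (auto simp: Delta_def extensional_def restrict_def fun_eq_iff)
      moreover have "(\<lambda>i\<in>{..0}. (s(m := t)) (m + i)) = (\<lambda>i\<in>{..0}. t)" by auto
      ultimately show "\<phi> (restrict (s(m := t)) {..m}) * \<psi> (\<lambda>i\<in>{..0}. (s(m := t)) (m + i)) = \<phi> (s(m := t)) * ?c" by simp
    qed
    also have "\<dots> = Isec m T \<phi> t * ?c"
      unfolding Isec_def by (rule nn_integral_multc) (rule measurable_compose[OF measurable_fun_upd_section[OF t] "0.prems"(1)])
    also have "\<dots> \<le> C * ?c" using elim(1) by (rule mult_right_mono) simp
    also have "?c = Isec 0 T \<psi> t"
    proof -
      have "(\<lambda>i\<in>{..0::nat}. t) = (\<lambda>_. undefined)(0 := t)" by (auto simp: fun_eq_iff)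
      then show ?thesis by (simp add: Isec_def nn_integral_Delta_0)
    qed
    finally show ?case .
  qed
next
  case (Suc k)
  show ?case
    using AE_interval_measure_space
  proof eventually_elim
    case (elim t)
    then have t: "S < t" "t < T" by auto
    let ?\<Phi> = "\<lambda>x. \<phi> (restrict x {..m}) * \<psi> (\<lambda>i\<in>{..Suc k}. x (m + i))"
    let ?\<psi> = "\<lambda>y. \<psi> (y(Suc k := t))"
    let ?\<Phi>t = "\<lambda>y. \<phi> (restrict y {..m}) * ?\<psi> (\<lambda>i\<in>{..k}. y (m + i))"
    have \<phi>: "\<phi> \<in> borel_measurable (Delta_measure (Suc m) t T)"
      by (rule borel_measurable_Delta_subinterval[OF Suc.prems(1)]) (use t in auto)
    have \<psi>: "?\<psi> \<in> borel_measurable (Delta_measure (Suc k) t T)"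
      by (rule measurable_compose[OF measurable_fun_upd_section[OF t] Suc.prems(2)])
    have m: "?\<Phi>t \<in> borel_measurable (Delta_measure (Suc (m + k)) t T)"
      by (intro borel_measurable_times_ennreal measurable_compose[OF measurable_tri_left \<phi>] measurable_compose[OF measurable_tri_right \<psi>])
    have "Isec (m + Suc k) T ?\<Phi> t = (\<integral>\<^sup>+ y. ?\<Phi>t y \<partial>Delta_measure (Suc (m + k)) t T)"
      unfolding Isec_def add_Suc_right
    proof (rule nn_integral_cong)
      fix y assume y: "y \<in> space (Delta_measure (Suc (m + k)) t T)"
      have "restrict (y(Suc (m + k) := t)) {..m} = restrict y {..m}" by (auto simp: fun_eq_iff)
      moreover have "(\<lambda>i\<in>{..Suc k}. (y(Suc (m + k) := t)) (m + i)) = (\<lambda>i\<in>{..k}. y (m + i))(Suc k := t)"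
        by (auto simp: fun_eq_iff restrict_def)
      ultimately show "\<phi> (restrict (y(Suc (m + k) := t)) {..m}) * \<psi> (\<lambda>i\<in>{..Suc k}. (y(Suc (m + k) := t)) (m + i)) = ?\<Phi>t y"
        by simp
    qed
    also have "\<dots> = (\<integral>\<^sup>+ u. Isec (m + k) T ?\<Phi>t u \<partial>interval_measure t T)" by (rule nn_integral_Isec[OF m])
    also have "\<dots> \<le> (\<integral>\<^sup>+ u. C * Isec k T ?\<psi> u \<partial>interval_measure t T)"
    proof (rule nn_integral_mono_AE, rule Suc.IH[OF \<phi> \<psi>])
      \<comment> \<open>The section integral of \<open>\<phi>\<close> at u involves u and T but no
        lower end, so the bound passes to the shorter interval.\<close>
      show "AE u in interval_measure t T. Isec m T \<phi> u \<le> C"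
        by (rule AE_interval_measure_mono[OF Suc.prems(3)]) (use t in auto)
    qed
    also have "\<dots> = C * (\<integral>\<^sup>+ u. Isec k T ?\<psi> u \<partial>interval_measure t T)"
      by (rule nn_integral_cmult) (rule Isec_measurable[OF \<psi>])
    also have "(\<integral>\<^sup>+ u. Isec k T ?\<psi> u \<partial>interval_measure t T) = (\<integral>\<^sup>+ y. ?\<psi> y \<partial>Delta_measure (Suc k) t T)"
      by (rule nn_integral_Isec[OF \<psi>, symmetric])
    also have "\<dots> = Isec (Suc k) T \<psi> t" by (simp add: Isec_def)
    finally show ?case .
  qed
qed

text \<open>Submultiplicativity: the factors share the time t_m, and the essential supremum over t_m
  bounds the integral of the f-part over the larger times by a constant, leaving the section
  integral of g.\<close>

lemma V_norm_tri:
  fixes f g :: "'d::finite kernel"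
  assumes f: "f \<in> borel_measurable (Delta_measure (Suc m) S T)" and g: "g \<in> borel_measurable (Delta_measure (Suc k) S T)"
    and fin: "V_norm m S T f < \<infinity>" "V_norm k S T g < \<infinity>"
  shows "V_norm (m + k) S T (tri m k f g) \<le> V_norm m S T f * V_norm k S T g"
proof -
  define c c' where "c = enn2real (V_norm m S T f)" and "c' = enn2real (V_norm k S T g)"
  have c: "V_norm m S T f = ennreal c" "0 \<le> c" "V_norm k S T g = ennreal c'" "0 \<le> c'"
    using fin by (auto simp: c_def c'_def)
  have Qf: "AE u in interval_measure S T. Qsec m T f u \<le> ennreal (c\<^sup>2)"
    and Qg: "AE u in interval_measure S T. Qsec k T g u \<le> ennreal (c'\<^sup>2)"
    using V_norm_le_iff[OF f c(2)] V_norm_le_iff[OF g c(4)] c by simp_all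
  have "AE t in interval_measure S T. Qsec (m + k) T (tri m k f g) t \<le> ennreal ((c * c')\<^sup>2)"
    using Isec_tri_le[OF op_norm_sq_measurable[OF f] op_norm_sq_measurable[OF g] Qf] Qg
  proof eventually_elim
    case (elim t)
    have "Qsec (m + k) T (tri m k f g) t \<le> Isec (m + k) T (\<lambda>x. ennreal ((op_norm (f (restrict x {..m})))\<^sup>2) * ennreal ((op_norm (g (\<lambda>i\<in>{..k}. x (m + i))))\<^sup>2)) t"
      unfolding Isec_def tri_def
    proof (rule nn_integral_mono)
      fix s
      let ?x = "s(m + k := t)"
      have "(op_norm (f (restrict ?x {..m}) ** g (\<lambda>i\<in>{..k}. ?x (m + i))))\<^sup>2 \<le> (op_norm (f (restrict ?x {..m})) * op_norm (g (\<lambda>i\<in>{..k}. ?x (m + i))))\<^sup>2"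
        by (intro power_mono op_norm_mult) simp
      then show "ennreal ((op_norm (f (restrict ?x {..m}) ** g (\<lambda>i\<in>{..k}. ?x (m + i))))\<^sup>2)
         \<le> ennreal ((op_norm (f (restrict ?x {..m})))\<^sup>2) * ennreal ((op_norm (g (\<lambda>i\<in>{..k}. ?x (m + i))))\<^sup>2)"
        by (simp add: ennreal_mult[symmetric] power_mult_distrib ennreal_leI)
    qed
    also have "\<dots> \<le> ennreal (c\<^sup>2) * Qsec k T g t" by (rule elim(1))
    also have "\<dots> \<le> ennreal (c\<^sup>2) * ennreal (c'\<^sup>2)" using elim(2) by (rule mult_left_mono) simp
    also have "\<dots> = ennreal ((c * c')\<^sup>2)" by (simp add: ennreal_mult[symmetric] power_mult_distrib)
    finally show ?case .
  qed
  then have "V_norm (m + k) S T (tri m k f g) \<le> ennreal (c * c')"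
    using c by (subst V_norm_le_iff[OF tri_measurable[OF f g]]) auto
  then show ?thesis using c by (simp add: ennreal_mult)
qed

lemma AE_Delta_if_Isec:
  assumes \<phi>: "\<phi> \<in> borel_measurable (Delta_measure (Suc n) S T)" and z: "AE t in interval_measure S T. Isec n T \<phi> t \<le> 0"
  shows "AE x in Delta_measure (Suc n) S T. \<phi> x = 0"
proof -
  have "(\<integral>\<^sup>+ x. \<phi> x \<partial>Delta_measure (Suc n) S T) = (\<integral>\<^sup>+ t. Isec n T \<phi> t \<partial>interval_measure S T)" by (rule nn_integral_Isec[OF \<phi>])
  also have "\<dots> = (\<integral>\<^sup>+ t. 0 \<partial>interval_measure S T)"
    by (rule nn_integral_cong_AE) (use z in eventually_elim, simp)
  finally have "(\<integral>\<^sup>+ x. \<phi> x \<partial>Delta_measure (Suc n) S T) = 0" by simp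
  then show ?thesis by (subst (asm) nn_integral_0_iff_AE[OF \<phi>])
qed

lemma Isec_indicator_null:
  assumes "A \<in> null_sets (Delta_measure (Suc n) S T)"
  shows "AE t in interval_measure S T. Isec n T (indicator A) t = 0"
proof -
  have ind: "(indicator A :: _ \<Rightarrow> ennreal) \<in> borel_measurable (Delta_measure (Suc n) S T)"
    using assms by (auto intro: borel_measurable_indicator)
  have "(\<integral>\<^sup>+ t. Isec n T (indicator A) t \<partial>interval_measure S T) = 0"
    using nn_integral_Isec[OF ind] assms by (auto simp: null_sets_def)
  then show ?thesis
    by (subst (asm) nn_integral_0_iff_AE) (auto intro: Isec_measurable[OF ind])
qed

lemma tri_cong_AE:
  fixes f g :: "'d::finite kernel"
  assumes f: "AE x in Delta_measure (Suc m) S T. f x = f' x" and g: "AE x in Delta_measure (Suc k) S T. g x = g' x"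
  shows "AE x in Delta_measure (Suc (m + k)) S T. tri m k f g x = tri m k f' g' x"
proof -
  obtain A where A': "{x \<in> space (Delta_measure (Suc m) S T). \<not> f x = f' x} \<subseteq> A"
    "emeasure (Delta_measure (Suc m) S T) A = 0" "A \<in> sets (Delta_measure (Suc m) S T)"
    using f by (rule AE_E)
  note A = A'(1) null_setsI[OF A'(2,3)]
  obtain B where B': "{x \<in> space (Delta_measure (Suc k) S T). \<not> g x = g' x} \<subseteq> B"
    "emeasure (Delta_measure (Suc k) S T) B = 0" "B \<in> sets (Delta_measure (Suc k) S T)"
    using g by (rule AE_E)
  note B = B'(1) null_setsI[OF B'(2,3)]
  have iA: "(indicator A :: _ \<Rightarrow> ennreal) \<in> borel_measurable (Delta_measure (Suc m) S T)"
    and iB: "(indicator B :: _ \<Rightarrow> ennreal) \<in> borel_measurable (Delta_measure (Suc k) S T)"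
    using A(2) B(2) by (auto intro: borel_measurable_indicator)
  have "AE t in interval_measure S T. Isec m T (indicator A) t \<le> 0"
    using Isec_indicator_null[OF A(2)] by eventually_elim simp
  \<comment> \<open>The exceptional sets are treated as kernels. Here \<open>\<phi>\<close> is the
    indicator of \<open>A\<close> with bound C = 0, and \<open>\<psi>\<close> is 1.\<close>
  from Isec_tri_le[OF iA borel_measurable_const this, of k 1]
  have 1: "AE x in Delta_measure (Suc (m + k)) S T. (indicator A (restrict x {..m}) * 1 :: ennreal) = 0"
    by (intro AE_Delta_if_Isec) (auto intro: measurable_compose[OF measurable_tri_left iA])
  \<comment> \<open>Here \<open>\<phi>\<close> is 1 with the trivial bound C = \<top>, which is good
    enough because \<top> * 0 = 0 in \<open>ennreal\<close>.\<close>
  from Isec_tri_le[OF borel_measurable_const iB, of m 1 \<top>] Isec_indicator_null[OF B(2)]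
  have "AE t in interval_measure S T. Isec (m + k) T (\<lambda>x. 1 * indicator B (\<lambda>i\<in>{..k}. x (m + i))) t \<le> 0"
    by (auto elim!: AE_mp)
  then have 2: "AE x in Delta_measure (Suc (m + k)) S T. (1 * indicator B (\<lambda>i\<in>{..k}. x (m + i)) :: ennreal) = 0"
    by (intro AE_Delta_if_Isec) (auto intro: measurable_compose[OF measurable_tri_right iB])
  have "AE x in Delta_measure (Suc (m + k)) S T. x \<in> Delta (Suc (m + k)) S T" by (rule AE_I2) simp
  with 1 2 show ?thesis
  proof eventually_elim
    case (elim x)
    have "restrict x {..m} \<notin> A" "(\<lambda>i\<in>{..k}. x (m + i)) \<notin> B"
      using elim(1,2) by (auto simp: indicator_def split: if_splits)
    then have "f (restrict x {..m}) = f' (restrict x {..m})" "g (\<lambda>i\<in>{..k}. x (m + i)) = g' (\<lambda>i\<in>{..k}. x (m + i))"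
      using A(1) B(1) tri_left_in_Delta[OF elim(3)] tri_right_in_Delta[OF elim(3)] by auto
    then show ?case by (simp add: tri_def)
  qed
qed

text \<open>The fourth power is the square of the constant in \<open>norm_le_op_norm\<close>; T - S
  comes from integrating the essential bound over the last time.\<close>

lemma L2sq_le_V_norm:
  fixes k :: "'d::finite kernel"
  assumes k: "k \<in> borel_measurable (Delta_measure (Suc n) S T)" and c: "0 \<le> c" "V_norm n S T k \<le> ennreal c" and S: "S \<le> T"
  shows "L2sq (Delta_measure (Suc n) S T) k \<le> ennreal ((real CARD('d))^4 * (T - S) * c\<^sup>2)"
proof -
  let ?D = "(real CARD('d))^4"
  note m = op_norm_sq_measurable[OF k]
  have "L2sq (Delta_measure (Suc n) S T) k \<le> (\<integral>\<^sup>+ x. ennreal ?D * ennreal ((op_norm (k x))\<^sup>2) \<partial>Delta_measure (Suc n) S T)"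
    unfolding L2sq_def
  proof (rule nn_integral_mono)
    fix x
    have "(norm (k x))\<^sup>2 \<le> ((real CARD('d))\<^sup>2 * op_norm (k x))\<^sup>2" by (intro power_mono norm_le_op_norm) simp
    then show "ennreal ((norm (k x))\<^sup>2) \<le> ennreal ?D * ennreal ((op_norm (k x))\<^sup>2)"
      by (simp add: ennreal_mult[symmetric] power_mult_distrib ennreal_leI)
  qed
  also have "\<dots> = ennreal ?D * (\<integral>\<^sup>+ t. Qsec n T k t \<partial>interval_measure S T)"
    using m by (simp add: nn_integral_cmult nn_integral_Isec[OF m])
  also have "(\<integral>\<^sup>+ t. Qsec n T k t \<partial>interval_measure S T) \<le> (\<integral>\<^sup>+ t. ennreal (c\<^sup>2) \<partial>interval_measure S T)"
    by (rule nn_integral_mono_AE) (use V_norm_le_iff[OF k c(1)] c(2) in simp)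
  also have "(\<integral>\<^sup>+ t. ennreal (c\<^sup>2) \<partial>interval_measure S T) = ennreal (c\<^sup>2) * ennreal (T - S)"
    using emeasure_interval_measure[of UNIV S T] S by simp
  also have "ennreal ?D * \<dots> = ennreal (?D * (T - S) * c\<^sup>2)"
    using S by (simp add: ennreal_mult[symmetric] mult_ac)
  finally show ?thesis by (simp add: mult_left_mono)
qed

section \<open>The resolvent of a sequence of kernels\<close>

definition conv :: "(nat \<Rightarrow> 'd::finite kernel) \<Rightarrow> (nat \<Rightarrow> 'd kernel) \<Rightarrow> nat \<Rightarrow> 'd kernel" where
  "conv f g n = (\<lambda>t. \<Sum>j\<le>n. tri (n - j) j (f (n - j)) (g j) t)"

text \<open>Interchange of summation over the triangle i <= j <= n with l = j - i. It serves both
  associativity and the summation of the convolution inequality.\<close>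

lemma sum_triangle_reindex:
  fixes F :: "nat \<Rightarrow> nat \<Rightarrow> 'b::comm_monoid_add"
  shows "(\<Sum>j\<le>n. \<Sum>i\<le>j. F j i) = (\<Sum>i\<le>n. \<Sum>l\<le>n - i. F (i + l) i)"
proof -
  have "(\<Sum>j\<le>n. \<Sum>i\<le>j. F j i) = (\<Sum>(j, i)\<in>Sigma {..n} (\<lambda>j. {..j}). F j i)" by (rule sum.Sigma) auto
  also have "\<dots> = (\<Sum>(i, l)\<in>Sigma {..n} (\<lambda>i. {..n - i}). F (i + l) i)"
    by (rule sum.reindex_bij_witness[of _ "\<lambda>(i, l). (i + l, i)" "\<lambda>(j, i). (i, j - i)"]) auto
  also have "\<dots> = (\<Sum>i\<le>n. \<Sum>l\<le>n - i. F (i + l) i)" by (rule sum.Sigma[symmetric]) auto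
  finally show ?thesis .
qed

lemma matrix_add_rdistrib: "((B :: real^'n^'m) + C) ** (A :: real^'p^'n) = B ** A + C ** A"
  by (vector matrix_matrix_mult_def sum.distrib[symmetric] field_simps)

lemma matrix_mult_sum_right: "(A :: 'd::finite mat) ** (\<Sum>i\<in>I. B i) = (\<Sum>i\<in>I. A ** B i)"
  by (induction I rule: infinite_finite_induct) (auto simp: matrix_add_ldistrib)

lemma matrix_mult_sum_left: "(\<Sum>i\<in>I. B i) ** (A :: 'd::finite mat) = (\<Sum>i\<in>I. B i ** A)"
  by (induction I rule: infinite_finite_induct) (auto simp: matrix_add_rdistrib)

lemma matrix_diff_ldistrib: "(A :: 'd::finite mat) ** (B - C) = A ** B - A ** C"
  using matrix_add_ldistrib[of A "B - C" C] by (simp add: algebra_simps)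

lemma matrix_diff_rdistrib: "((B :: real^'n^'m) - C) ** (A :: real^'p^'n) = B ** A - C ** A"
  using matrix_add_rdistrib[of "B - C" C A] by (simp add: algebra_simps)

lemma tri_assoc: "tri a (b + c) f (tri b c g h) = tri (a + b) c (tri a b f g) (h :: 'd::finite kernel)"
proof
  fix t :: "nat \<Rightarrow> real"
  have 1: "restrict (\<lambda>i\<in>{..b + c}. t (a + i)) {..b} = (\<lambda>i\<in>{..b}. restrict t {..a + b} (a + i))"
    by (auto simp: fun_eq_iff restrict_def)
  have 2: "(\<lambda>i\<in>{..c}. (\<lambda>i\<in>{..b + c}. t (a + i)) (b + i)) = (\<lambda>i\<in>{..c}. t (a + b + i))"
    by (auto simp: fun_eq_iff restrict_def add.assoc)
  have 3: "restrict (restrict t {..a + b}) {..a} = restrict t {..a}"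
    by (auto simp: fun_eq_iff restrict_def)
  show "tri a (b + c) f (tri b c g h) t = tri (a + b) c (tri a b f g) h t"
    unfolding tri_def 1 2 3 by (rule matrix_mul_assoc)
qed

lemma conv_assoc: "conv f (conv g h) n t = conv (conv f g) (h :: nat \<Rightarrow> 'd::finite kernel) n t"
proof -
  have "conv f (conv g h) n t = (\<Sum>j\<le>n. \<Sum>i\<le>j. tri (n - j) j (f (n - j)) (tri (j - i) i (g (j - i)) (h i)) t)"
    unfolding conv_def tri_def[of _ _ "f _" "\<lambda>t. \<Sum>j\<le>_. _ j t"] matrix_mult_sum_right by (simp add: tri_def)
  also have "\<dots> = (\<Sum>j\<le>n. \<Sum>i\<le>j. tri (n - i) i (tri (n - j) (j - i) (f (n - j)) (g (j - i))) (h i) t)"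
  proof (intro sum.cong refl)
    fix i j assume "j \<in> {..n}" "i \<in> {..j}"
    then show "tri (n - j) j (f (n - j)) (tri (j - i) i (g (j - i)) (h i)) t = tri (n - i) i (tri (n - j) (j - i) (f (n - j)) (g (j - i))) (h i) t"
      using tri_assoc[of "n - j" "j - i" i "f (n - j)" "g (j - i)" "h i"] by simp
  qed
  also have "\<dots> = (\<Sum>i\<le>n. \<Sum>l\<le>n - i. tri (n - i) i (tri (n - (i + l)) (i + l - i) (f (n - (i + l))) (g (i + l - i))) (h i) t)"
    by (rule sum_triangle_reindex)
  also have "\<dots> = (\<Sum>i\<le>n. \<Sum>l\<le>n - i. tri (n - i) i (tri (n - i - l) l (f (n - i - l)) (g l)) (h i) t)"
    by simp
  also have "\<dots> = conv (conv f g) h n t"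
    unfolding conv_def tri_def[of _ _ "\<lambda>t. \<Sum>j\<le>_. _ j t"] matrix_mult_sum_left by (simp add: tri_def)
  finally show ?thesis .
qed

lemma tri_cong:
  assumes "\<And>t. t \<in> extensional {..<Suc m} \<Longrightarrow> f t = f' t" "\<And>t. t \<in> extensional {..<Suc k} \<Longrightarrow> g t = g' t"
  shows "tri m k f g t = tri m k f' (g' :: 'd::finite kernel) t"
  unfolding tri_def by (subst assms(1), simp add: extensional_def, subst assms(2)) (simp_all add: extensional_def)

text \<open>Both factors of \<open>tri\<close> are evaluated at extensional tuples, and the
  resolvent equation substituted through this rule is available only there.\<close>

lemma conv_cong:
  assumes "\<And>n t. t \<in> extensional {..<Suc n} \<Longrightarrow> f n t = f' n t" "\<And>n t. t \<in> extensional {..<Suc n} \<Longrightarrow> g n t = g' n t"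
  shows "conv f g n t = conv f' (g' :: nat \<Rightarrow> 'd::finite kernel) n t"
  unfolding conv_def by (intro sum.cong refl tri_cong assms)

lemma conv_diff_right: "conv f (\<lambda>n t. g n t - h n t) n t = conv f g n t - conv f (h :: nat \<Rightarrow> 'd::finite kernel) n t"
  by (simp add: conv_def tri_def matrix_diff_ldistrib sum_subtractf)

lemma conv_diff_left: "conv (\<lambda>n t. g n t - h n t) f n t = conv g f n t - conv h (f :: nat \<Rightarrow> 'd::finite kernel) n t"
  by (simp add: conv_def tri_def matrix_diff_rdistrib sum_subtractf)

lemma tri_0_left:
  assumes "t \<in> extensional {..<Suc n}"
  shows "tri 0 n f g t = f (restrict t {..0}) ** (g t :: 'd::finite mat)"
proof -
  have "(\<lambda>i\<in>{..n}. t (0 + i)) = t" using assms by (auto simp: extensional_def fun_eq_iff)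
  then show ?thesis unfolding tri_def by (simp only:)
qed

lemma conv_split_last:
  assumes "t \<in> extensional {..<Suc n}"
  shows "conv f g n t = (\<Sum>j<n. tri (n - j) j (f (n - j)) (g j) t) + f 0 (restrict t {..0}) ** (g n t :: 'd::finite mat)"
proof -
  have "conv f g n t = (\<Sum>j<Suc n. tri (n - j) j (f (n - j)) (g j) t)" by (simp add: conv_def lessThan_Suc_atMost)
  then show ?thesis using tri_0_left[OF assms, of "f 0" "g n"] by simp
qed

section \<open>The inverse of 1 - A for a matrix A of operator norm below 1\<close>

definition neumann :: "'d::finite mat \<Rightarrow> 'd mat" where
  "neumann A = matrix_inv (mat 1 - A)"

lemma op_norm_apply: "norm ((A :: 'd::finite mat) *v x) \<le> op_norm A * norm x"
  by (rule onorm[OF bounded_linear_matrix_vector])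

text \<open>This lower bound yields all that is needed of the inverse: injectivity of 1 - A, hence
  invertibility in finite dimension, and the norm bound 1 / (1 - c).\<close>

lemma neumann_lower:
  assumes "op_norm (A :: 'd::finite mat) \<le> c"
  shows "(1 - c) * norm y \<le> norm ((mat 1 - A) *v y)"
proof -
  have "norm y = norm ((mat 1 - A) *v y + A *v y)" by (simp add: matrix_vector_mult_diff_rdistrib)
  also have "\<dots> \<le> norm ((mat 1 - A) *v y) + op_norm A * norm y"
    by (intro norm_triangle_le add_left_mono op_norm_apply)
  also have "op_norm A * norm y \<le> c * norm y" using assms by (rule mult_right_mono) simp
  finally show ?thesis by (simp add: algebra_simps)
qed

lemma neumann_inverse:
  assumes "op_norm (A :: 'd::finite mat) \<le> c" "c < 1"
  shows "(mat 1 - A) ** neumann A = mat 1" "neumann A ** (mat 1 - A) = mat 1"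
proof -
  have "\<forall>x. (mat 1 - A) *v x = 0 \<longrightarrow> x = 0"
  proof (intro allI impI)
    fix x assume "(mat 1 - A) *v x = 0"
    then have "(1 - c) * norm x \<le> 0" using neumann_lower[OF assms(1), of x] by simp
    then show "x = 0" using assms(2) by (simp add: mult_le_0_iff)
  qed
  then obtain B where "B ** (mat 1 - A) = mat 1" using matrix_left_invertible_ker by blast
  then have "(mat 1 - A) ** B = mat 1 \<and> B ** (mat 1 - A) = mat 1" using matrix_left_right_inverse by blast
  then have "(mat 1 - A) ** neumann A = mat 1 \<and> neumann A ** (mat 1 - A) = mat 1"
    unfolding neumann_def matrix_inv_def
    by (rule someI[where P = "\<lambda>A'. (mat 1 - A) ** A' = mat 1 \<and> A' ** (mat 1 - A) = mat 1"])
  then show "(mat 1 - A) ** neumann A = mat 1" "neumann A ** (mat 1 - A) = mat 1" by auto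
qed

lemma op_norm_neumann:
  assumes "op_norm (A :: 'd::finite mat) \<le> c" "c < 1"
  shows "op_norm (neumann A) \<le> 1 / (1 - c)"
proof (rule onorm_le)
  fix x
  have "(1 - c) * norm (neumann A *v x) \<le> norm ((mat 1 - A) *v (neumann A *v x))" by (rule neumann_lower[OF assms(1)])
  also have "\<dots> = norm x" using neumann_inverse(1)[OF assms] by (simp add: matrix_vector_mul_assoc)
  finally show "norm (neumann A *v x) \<le> 1 / (1 - c) * norm x" using assms(2) by (simp add: field_simps)
qed

text \<open>Writing N for \<open>neumann\<close>, the identity N(B) - N(A) = N(B) (B - A) N(A) and
  the uniform bound on N make the inverse Lipschitz on this closed set. This is the source of its
  measurability.\<close>

lemma continuous_on_neumann:
  assumes c: "c < 1"
  shows "continuous_on {A :: 'd::finite mat. op_norm A \<le> c} neumann"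
proof (rule continuous_onI)
  fix A :: "'d mat" and e :: real assume A: "A \<in> {A. op_norm A \<le> c}" and e: "0 < e"
  let ?D = "(real CARD('d))\<^sup>2" and ?q = "1 / (1 - c)"
  define L where "L = ?D * (?q * ?D * ?q)"
  have L: "0 < L" using c by (simp add: L_def)
  have lip: "dist (neumann B) (neumann A) \<le> L * dist B A" if B: "op_norm B \<le> c" for B
  proof -
    have A': "op_norm A \<le> c" using A by simp
    have "neumann B - neumann A = neumann B ** ((mat 1 - A) ** neumann A) - (neumann B ** (mat 1 - B)) ** neumann A"
      by (simp add: neumann_inverse[OF A' c] neumann_inverse[OF B c])
    also have "\<dots> = (neumann B ** (B - A)) ** neumann A"
    proof -
      have "B - A = (mat 1 - A) - (mat 1 - B)" by simp
      then show ?thesis by (simp only: matrix_mul_assoc matrix_diff_ldistrib matrix_diff_rdistrib)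
    qed
    finally have eq: "neumann B - neumann A = (neumann B ** (B - A)) ** neumann A" .
    have "norm (neumann B - neumann A) \<le> ?D * op_norm ((neumann B ** (B - A)) ** neumann A)"
      unfolding eq by (rule norm_le_op_norm)
    also have "op_norm ((neumann B ** (B - A)) ** neumann A) \<le> (op_norm (neumann B) * op_norm (B - A)) * op_norm (neumann A)"
      by (intro order_trans[OF op_norm_mult] mult_right_mono op_norm_mult) simp
    also have "\<dots> \<le> (?q * (?D * norm (B - A))) * ?q"
      using c by (intro mult_mono op_norm_neumann[OF A' c] op_norm_neumann[OF B c] op_norm_le_norm) auto
    finally show ?thesis by (simp add: dist_norm L_def mult_ac mult_left_mono)
  qed
  have "dist (neumann B) (neumann A) \<le> e" if "op_norm B \<le> c" "dist B A < e / L" for B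
  proof -
    have "L * dist B A \<le> L * (e / L)" using that(2) L by (intro mult_left_mono) auto
    also have "\<dots> = e" using L by simp
    finally show ?thesis using lip[OF that(1)] by linarith
  qed
  then show "\<exists>d>0. \<forall>B\<in>{A. op_norm A \<le> c}. dist B A < d \<longrightarrow> dist (neumann B) (neumann A) \<le> e"
    using e L by (intro exI[of _ "e / L"]) auto
qed

lemma neumann_measurable:
  fixes f :: "'a \<Rightarrow> 'd::finite mat"
  assumes f: "f \<in> borel_measurable N" and c: "\<And>x. op_norm (f x) \<le> c" "c < 1"
  shows "(\<lambda>x. neumann (f x)) \<in> borel_measurable N"
proof -
  let ?S = "{A :: 'd mat. op_norm A \<le> c}"
  have "closed ?S" by (rule closed_Collect_le[OF continuous_op_norm continuous_on_const])
  then have "(\<lambda>A. indicator ?S A *\<^sub>R neumann A) \<in> borel_measurable borel"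
    by (intro borel_measurable_continuous_on_indicator continuous_on_neumann c) simp
  from measurable_compose[OF f this] show ?thesis using c(1) by simp
qed

text \<open>The right equation in degree n solved for r_n. Its summand with index n is k_0 at the
  first time multiplied by r_n; moved to the left it leaves the factor 1 - k_0, and only r_j with j
  < n remain on the right.\<close>

function resolvent :: "(nat \<Rightarrow> 'd::finite kernel) \<Rightarrow> nat \<Rightarrow> 'd kernel" where
  "resolvent k n = (\<lambda>t. neumann (k 0 (restrict t {..0})) **
     (k n t + (\<Sum>j\<in>{..<n}. tri (n - j) j (k (n - j)) (resolvent k j) t)))"
  by auto
termination by (relation "Wellfounded.measure snd") auto

declare resolvent.simps [simp del]

lemma resolvent_right:
  fixes k :: "nat \<Rightarrow> 'd::finite kernel"
  assumes c: "\<And>x. op_norm (k 0 x) \<le> c" "c < 1" and t: "t \<in> extensional {..<Suc n}"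
  shows "resolvent k n t = k n t + conv k (resolvent k) n t"
proof -
  let ?A = "k 0 (restrict t {..0})"
  let ?B = "k n t + (\<Sum>j<n. tri (n - j) j (k (n - j)) (resolvent k j) t)"
  have r: "resolvent k n t = neumann ?A ** ?B" by (subst resolvent.simps) simp
  have "(mat 1 - ?A) ** resolvent k n t = ?B"
    unfolding r matrix_mul_assoc neumann_inverse(1)[OF c(1) c(2)] by simp
  then have "resolvent k n t = ?B + ?A ** resolvent k n t"
    by (simp add: matrix_diff_rdistrib algebra_simps)
  then show ?thesis unfolding conv_split_last[OF t] by (simp add: add.assoc)
qed

text \<open>The defect \<open>d = r - k - r \<star> k\<close> of the left resolvent equation satisfies \<open>d = k \<star> d\<close>, which
  forces \<open>d = 0\<close> degree by degree.\<close>

lemma resolvent_left: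
  fixes k :: "nat \<Rightarrow> 'd::finite kernel"
  assumes c: "\<And>x. op_norm (k 0 x) \<le> c" "c < 1" and t: "t \<in> extensional {..<Suc n}"
  shows "resolvent k n t = k n t + conv (resolvent k) k n t"
proof -
  let ?r = "resolvent k"
  define d where "d n t = (?r n t - k n t) - conv ?r k n t" for n t
  have r: "?r n t - k n t = conv k ?r n t" if "t \<in> extensional {..<Suc n}" for n t
    using resolvent_right[of k c, OF c that] by simp
  have dd: "d n t = conv k d n t" if t: "t \<in> extensional {..<Suc n}" for n t
  proof -
    \<comment> \<open>Associativity and the right equation: k \<star> (r \<star> k) = (k \<star> r)
      \<star> k = (r - k) \<star> k.\<close>
    have "conv k (conv ?r k) n t = conv (conv k ?r) k n t" by (rule conv_assoc)
    also have "\<dots> = conv (\<lambda>n t. ?r n t - k n t) k n t" by (rule conv_cong) (simp_all add: r)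
    also have "\<dots> = conv ?r k n t - conv k k n t" by (rule conv_diff_left)
    finally have 1: "conv k (conv ?r k) n t = conv ?r k n t - conv k k n t" .
    have d_eq: "d = (\<lambda>n t. (?r n t - k n t) - conv ?r k n t)" by (intro ext) (rule d_def)
    have "conv k d n t = conv k (\<lambda>n t. ?r n t - k n t) n t - conv k (conv ?r k) n t"
      unfolding d_eq by (rule conv_diff_right)
    also have "conv k (\<lambda>n t. ?r n t - k n t) n t = conv k ?r n t - conv k k n t" by (rule conv_diff_right)
    finally have "conv k d n t = (conv k ?r n t - conv k k n t) - (conv ?r k n t - conv k k n t)" unfolding 1 .
    then show ?thesis unfolding d_def r[OF t] by simp
  qed
  have "d n t = 0" if "t \<in> extensional {..<Suc n}" for n t
    using that
  proof (induction n arbitrary: t rule: less_induct)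
    case (less n)
    have z: "tri (n - j) j (k (n - j)) (d j) t = 0" if "j < n" for j
    proof -
      have "d j (\<lambda>i\<in>{..j}. t (n - j + i)) = 0" by (rule less.IH[OF that]) (simp add: extensional_def)
      then show ?thesis by (simp add: tri_def)
    qed
    let ?A = "k 0 (restrict t {..0})"
    have "d n t = (\<Sum>j<n. tri (n - j) j (k (n - j)) (d j) t) + ?A ** d n t"
      using dd[OF less.prems] unfolding conv_split_last[OF less.prems] .
    also have "(\<Sum>j<n. tri (n - j) j (k (n - j)) (d j) t) = 0" by (rule sum.neutral) (use z in blast)
    finally have "d n t = 0 + ?A ** d n t" .
    then have "d n t = ?A ** d n t" unfolding add_0_left .
    then have "(mat 1 - ?A) ** d n t = 0" unfolding matrix_diff_rdistrib matrix_mul_lid right_minus_eq .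
    then have "neumann ?A ** ((mat 1 - ?A) ** d n t) = neumann ?A ** 0" by (rule arg_cong)
    then show "d n t = 0"
      unfolding matrix_mul_assoc neumann_inverse(2)[OF c(1) c(2)] matrix_mul_lid by simp
  qed
  from this[OF t] show ?thesis by (simp add: d_def algebra_simps)
qed

section \<open>Measurability and finite norm of each degree of the resolvent\<close>

lemma resolvent_measurable:
  fixes k :: "nat \<Rightarrow> 'd::finite kernel"
  assumes c: "\<And>x. op_norm (k 0 x) \<le> c" "c < 1" and k: "\<And>n. k n \<in> borel_measurable (Delta_measure (Suc n) S T)"
  shows "resolvent k n \<in> borel_measurable (Delta_measure (Suc n) S T)"
proof (induction n rule: less_induct)
  case (less n)
  have 1: "(\<lambda>t. neumann (k 0 (restrict t {..0}))) \<in> borel_measurable (Delta_measure (Suc n) S T)"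
    using measurable_compose[OF measurable_tri_left[of 0 n S T] neumann_measurable[OF k[of 0] c]] by simp
  have 2: "tri (n - j) j (k (n - j)) (resolvent k j) \<in> borel_measurable (Delta_measure (Suc n) S T)" if "j < n" for j
    using tri_measurable[OF k[of "n - j"] less.IH[OF that]] that by simp
  show ?case unfolding resolvent.simps[of k n]
    by (intro borel_measurable_matrix_mult 1 borel_measurable_add borel_measurable_sum k) (use 2 in auto)
qed

lemma conv_measurable:
  fixes f g :: "nat \<Rightarrow> 'd::finite kernel"
  assumes f: "\<And>n. f n \<in> borel_measurable (Delta_measure (Suc n) S T)" and g: "\<And>n. g n \<in> borel_measurable (Delta_measure (Suc n) S T)"
  shows "conv f g n \<in> borel_measurable (Delta_measure (Suc n) S T)"
  unfolding conv_def
proof (rule borel_measurable_sum)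
  fix j assume "j \<in> {..n}"
  then show "tri (n - j) j (f (n - j)) (g j) \<in> borel_measurable (Delta_measure (Suc n) S T)"
    using tri_measurable[OF f[of "n - j"] g[of j]] by simp
qed

lemma V_norm_conv:
  fixes f g :: "nat \<Rightarrow> 'd::finite kernel"
  assumes f: "\<And>n. f n \<in> borel_measurable (Delta_measure (Suc n) S T)" and g: "\<And>n. g n \<in> borel_measurable (Delta_measure (Suc n) S T)"
    and fin: "\<And>n. V_norm n S T (f n) < \<infinity>" "\<And>n. V_norm n S T (g n) < \<infinity>"
  shows "V_norm n S T (conv f g n) \<le> (\<Sum>j\<le>n. V_norm (n - j) S T (f (n - j)) * V_norm j S T (g j))"
proof -
  have m: "tri (n - j) j (f (n - j)) (g j) \<in> borel_measurable (Delta_measure (Suc n) S T)" if "j \<in> {..n}" for j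
    using tri_measurable[OF f[of "n - j"] g[of j]] that by simp
  have "V_norm n S T (conv f g n) \<le> (\<Sum>j\<le>n. V_norm n S T (tri (n - j) j (f (n - j)) (g j)))"
    unfolding conv_def by (rule V_norm_sum) (use m in auto)
  also have "\<dots> \<le> (\<Sum>j\<le>n. V_norm (n - j) S T (f (n - j)) * V_norm j S T (g j))"
  proof (rule sum_mono)
    fix j assume "j \<in> {..n}"
    then show "V_norm n S T (tri (n - j) j (f (n - j)) (g j)) \<le> V_norm (n - j) S T (f (n - j)) * V_norm j S T (g j)"
      using V_norm_tri[OF f[of "n - j"] g[of j] fin(1) fin(2)] by simp
  qed
  finally show ?thesis .
qed

lemma V_norm_0_le:
  fixes k :: "'d::finite kernel"
  assumes k: "k \<in> borel_measurable (Delta_measure (Suc 0) S T)" and c: "\<And>x. op_norm (k x) \<le> c"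
  shows "V_norm 0 S T k \<le> ennreal c"
proof -
  have c0: "0 \<le> c" using c[of "\<lambda>_. 0"] op_norm_nonneg[of "k (\<lambda>_. 0)"] by linarith
  show ?thesis
    by (subst V_norm_le_iff[OF k c0])
      (auto simp: Isec_def nn_integral_Delta_0 intro!: AE_I2 ennreal_leI power_mono c)
qed

text \<open>No uniformity in n is claimed. Finiteness turns the later convolution inequality into
  one between real numbers, where a term can be absorbed.\<close>

lemma resolvent_V_norm_finite:
  fixes k :: "nat \<Rightarrow> 'd::finite kernel"
  assumes c: "\<And>x. op_norm (k 0 x) \<le> c" "c < 1" and k: "\<And>n. k n \<in> borel_measurable (Delta_measure (Suc n) S T)"
    and fin: "\<And>n. V_norm n S T (k n) < \<infinity>"
  shows "V_norm n S T (resolvent k n) < \<infinity>"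
proof (induction n rule: less_induct)
  case (less n)
  note r = resolvent_measurable[OF c k]
  let ?G = "\<lambda>t. neumann (k 0 t)"
  let ?B = "\<lambda>t. k n t + (\<Sum>j<n. tri (n - j) j (k (n - j)) (resolvent k j) t)"
  have G: "?G \<in> borel_measurable (Delta_measure (Suc 0) S T)" by (rule neumann_measurable[OF k c])
  have VG: "V_norm 0 S T ?G < \<infinity>"
    using V_norm_0_le[OF G op_norm_neumann[OF c(1) c(2)]] by (rule le_less_trans) simp
  have m: "tri (n - j) j (k (n - j)) (resolvent k j) \<in> borel_measurable (Delta_measure (Suc n) S T)" if "j < n" for j
    using tri_measurable[OF k[of "n - j"] r[of j]] that by simp
  have ms: "(\<lambda>t. \<Sum>j<n. tri (n - j) j (k (n - j)) (resolvent k j) t) \<in> borel_measurable (Delta_measure (Suc n) S T)"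
    by (rule borel_measurable_sum) (use m in auto)
  have B: "?B \<in> borel_measurable (Delta_measure (Suc n) S T)" by (intro borel_measurable_add k ms)
  have Vt: "V_norm n S T (tri (n - j) j (k (n - j)) (resolvent k j)) < \<infinity>" if "j < n" for j
  proof -
    have "V_norm n S T (tri (n - j) j (k (n - j)) (resolvent k j)) \<le> V_norm (n - j) S T (k (n - j)) * V_norm j S T (resolvent k j)"
      using V_norm_tri[OF k[of "n - j"] r[of j] fin less.IH[OF that]] that by simp
    also have "\<dots> < \<infinity>" using fin[of "n - j"] less.IH[OF that] by (simp add: ennreal_mult_less_top)
    finally show ?thesis .
  qed
  have "V_norm n S T ?B \<le> V_norm n S T (k n) + (\<Sum>j<n. V_norm n S T (tri (n - j) j (k (n - j)) (resolvent k j)))"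
    by (rule order_trans[OF V_norm_add[OF k ms] add_left_mono[OF V_norm_sum]]) (use m in auto)
  also have "\<dots> < \<infinity>" using fin[of n] Vt by (simp add: less_top)
  finally have VB: "V_norm n S T ?B < \<infinity>" .
  \<comment> \<open>Left multiplication by the inverse matrix is a product with a kernel of degree
    0, so \<open>V_norm_tri\<close> applies to it.\<close>
  have "V_norm n S T (resolvent k n) \<le> V_norm (0 + n) S T (tri 0 n ?G ?B)"
  proof (simp, rule V_norm_mono)
    show "tri 0 n ?G ?B \<in> borel_measurable (Delta_measure (Suc n) S T)" using tri_measurable[OF G B] by simp
    fix x assume "x \<in> Delta (Suc n) S T"
    then have "x \<in> extensional {..<Suc n}" by (simp add: Delta_def)
    from tri_0_left[OF this, of ?G ?B] show "op_norm (resolvent k n x) \<le> op_norm (tri 0 n ?G ?B x)"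
      by (simp add: resolvent.simps[of k n])
  qed (auto intro: r)
  also have "\<dots> \<le> V_norm 0 S T ?G * V_norm n S T ?B" by (rule V_norm_tri[OF G B VG VB])
  also have "\<dots> < \<infinity>" using VG VB by (simp add: ennreal_mult_less_top)
  finally show ?case .
qed

text \<open>Summation up to a finite m keeps everything finite: the partial sum X satisfies X <=
  suminf a + suminf b * X, and the last term is absorbed since suminf b < 1.\<close>

lemma summable_convolution_inequality:
  fixes a b x :: "nat \<Rightarrow> real"
  assumes nn: "\<And>n. 0 \<le> a n" "\<And>n. 0 \<le> b n" "\<And>n. 0 \<le> x n" and sa: "summable a" and sb: "summable b" "suminf b < 1"
    and le: "\<And>n. x n \<le> a n + (\<Sum>j\<le>n. b (n - j) * x j)"
  shows "summable x"
proof (rule summableI_nonneg_bounded)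
  fix N
  show "(\<Sum>n<N. x n) \<le> suminf a / (1 - suminf b)"
  proof (cases N)
    case (Suc m)
    let ?X = "\<Sum>n\<le>m. x n"
    have "?X \<le> (\<Sum>n\<le>m. a n) + (\<Sum>n\<le>m. \<Sum>j\<le>n. b (n - j) * x j)"
      unfolding sum.distrib[symmetric] by (rule sum_mono) (rule le)
    also have "(\<Sum>n\<le>m. \<Sum>j\<le>n. b (n - j) * x j) = (\<Sum>j\<le>m. \<Sum>l\<le>m - j. b (j + l - j) * x j)"
      by (rule sum_triangle_reindex)
    also have "\<dots> = (\<Sum>j\<le>m. (\<Sum>l\<le>m - j. b l) * x j)" by (simp add: sum_distrib_right)
    also have "\<dots> \<le> (\<Sum>j\<le>m. suminf b * x j)"
      by (intro sum_mono mult_right_mono sum_le_suminf sb nn) auto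
    also have "(\<Sum>n\<le>m. a n) \<le> suminf a" by (intro sum_le_suminf sa nn) auto
    finally have "?X \<le> suminf a + suminf b * ?X" by (simp add: sum_distrib_left)
    then have "?X * (1 - suminf b) \<le> suminf a" by (simp add: algebra_simps)
    then have "?X \<le> suminf a / (1 - suminf b)" using sb(2) by (simp add: pos_le_divide_eq)
    then show ?thesis by (simp add: Suc lessThan_Suc_atMost)
  qed (use sb nn sa suminf_nonneg in \<open>auto intro!: divide_nonneg_nonneg\<close>)
qed (rule nn)

section \<open>Truncation of kernels at a time and the induction over the blocks\<close>

lemma first_coord_measurable: "(\<lambda>x. x 0) \<in> borel_measurable (Delta_measure (Suc n) S T)"
  unfolding Delta_measure_def
  using measurable_component_singleton[of 0 "{..<Suc n}" "\<lambda>_. lborel"] by (intro measurable_restrict_space1) simp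

lemma last_coord_measurable: "(\<lambda>x. x n) \<in> borel_measurable (Delta_measure (Suc n) S T)"
  unfolding Delta_measure_def
  using measurable_component_singleton[of n "{..<Suc n}" "\<lambda>_. lborel"] by (intro measurable_restrict_space1) simp

text \<open>The first time is the largest, so the cut \<open>x 0 < P\<close> forces the whole tuple
  below P.\<close>

lemma V_norm_truncate_first:
  fixes k :: "'d::finite kernel"
  assumes k: "k \<in> borel_measurable (Delta_measure (Suc n) S U)" and P: "P \<le> U"
  shows "V_norm n S U (\<lambda>x. indicator {..<P} (x 0) *\<^sub>R k x) \<le> V_norm n S P k"
proof (cases "V_norm n S P k = \<infinity>")
  case False
  define c where "c = enn2real (V_norm n S P k)"
  have c: "V_norm n S P k = ennreal c" "0 \<le> c" using False by (auto simp: c_def less_top)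
  have k': "k \<in> borel_measurable (Delta_measure (Suc n) S P)" by (rule borel_measurable_Delta_subinterval[OF k]) (use P in auto)
  let ?k = "\<lambda>x. indicator {..<P} (x 0) *\<^sub>R k x"
  have m: "?k \<in> borel_measurable (Delta_measure (Suc n) S U)"
    by (intro borel_measurable_scaleR k measurable_compose[OF first_coord_measurable]) simp
  have "AE t in lborel. S < t \<and> t < P \<longrightarrow> Qsec n P k t \<le> ennreal (c\<^sup>2)"
    using V_norm_le_iff[OF k' c(2)] c(1) by (simp add: AE_interval_measure)
  then have "AE t in lborel. S < t \<and> t < U \<longrightarrow> Qsec n U ?k t \<le> ennreal (c\<^sup>2)"
  proof eventually_elim
    case (elim t)
    show ?case
    proof
      assume t: "S < t \<and> t < U"
      have first: "t \<le> (s(n := t)) 0" if "s \<in> Delta n t U" for s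
        using that by (cases n) (auto simp: Delta_def less_imp_le)
      have "Qsec n U ?k t \<le> (if t < P then Qsec n P k t else 0)"
      proof (cases "t < P")
        case True
        have "Qsec n U ?k t \<le> Qsec n P k t"
          unfolding Isec_def nn_integral_Delta
        proof (rule nn_integral_mono)
          fix s
          show "ennreal ((op_norm (?k (s(n := t))))\<^sup>2) * indicator (Delta n t U) s \<le> ennreal ((op_norm (k (s(n := t))))\<^sup>2) * indicator (Delta n t P) s"
          proof (cases "s \<in> Delta n t U \<and> (s(n := t)) 0 < P")
            case True
            then have s: "s \<in> Delta n t U" and s0: "(s(n := t)) 0 < P" by auto
            have "s i < P" if "i < n" for i
              using Delta_less[OF s, of 0 i] that s0 by (cases n) auto
            then have "s \<in> Delta n t P" using s by (auto simp: Delta_def)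
            then show ?thesis using True by (auto simp: indicator_def)
          qed (auto simp: indicator_def)
        qed
        with True show ?thesis by simp
      next
        case False
        have "Qsec n U ?k t = (\<integral>\<^sup>+ s. 0 \<partial>Delta_measure n t U)"
          unfolding Isec_def by (rule nn_integral_cong) (use first False in \<open>fastforce simp: indicator_def\<close>)
        with False show ?thesis by simp
      qed
      also have "\<dots> \<le> ennreal (c\<^sup>2)" using elim t by auto
      finally show "Qsec n U ?k t \<le> ennreal (c\<^sup>2)" .
    qed
  qed
  then show ?thesis unfolding c(1) V_norm_le_iff[OF m c(2)] AE_interval_measure .
qed simp

text \<open>The last time is the smallest and is the variable of the essential supremum: the cut
  annihilates the sections at times below P and leaves those above P unchanged.\<close>

lemma V_norm_truncate_last:
  fixes k :: "'d::finite kernel"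
  assumes k: "k \<in> borel_measurable (Delta_measure (Suc n) S U)" and P: "S \<le> P"
  shows "V_norm n S U (\<lambda>x. indicator {P..} (x n) *\<^sub>R k x) \<le> V_norm n P U k"
proof (cases "V_norm n P U k = \<infinity>")
  case False
  define c where "c = enn2real (V_norm n P U k)"
  have c: "V_norm n P U k = ennreal c" "0 \<le> c" using False by (auto simp: c_def less_top)
  have k': "k \<in> borel_measurable (Delta_measure (Suc n) P U)" by (rule borel_measurable_Delta_subinterval[OF k]) (use P in auto)
  let ?k = "\<lambda>x. indicator {P..} (x n) *\<^sub>R k x"
  have m: "?k \<in> borel_measurable (Delta_measure (Suc n) S U)"
    by (intro borel_measurable_scaleR k measurable_compose[OF last_coord_measurable]) simp
  have "AE t in lborel. P < t \<and> t < U \<longrightarrow> Qsec n U k t \<le> ennreal (c\<^sup>2)"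
    using V_norm_le_iff[OF k' c(2)] c(1) by (simp add: AE_interval_measure)
  then have "AE t in lborel. S < t \<and> t < U \<longrightarrow> Qsec n U ?k t \<le> ennreal (c\<^sup>2)"
    \<comment> \<open>At t = P the cut keeps the kernel although the block is open there; this
      single time is discarded.\<close>
    using AE_lborel_singleton[of P]
  proof eventually_elim
    case (elim t)
    show ?case
    proof
      assume t: "S < t \<and> t < U"
      show "Qsec n U ?k t \<le> ennreal (c\<^sup>2)"
        using elim t by (cases "P < t") (auto simp: Isec_def indicator_def)
    qed
  qed
  then show ?thesis unfolding c(1) V_norm_le_iff[OF m c(2)] AE_interval_measure .
qed simp

text \<open>\<open>lo\<close> is controlled by the interval already treated. The norms of
  \<open>hi\<close> are bounded by those of k, of k \<star> lo and of kd \<star> hi; the norms of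
  \<open>kd\<close> are at most those of k on the block (P, U), whose sum is below 1, so the last
  term is absorbed.\<close>

lemma resolvent_summable_step:
  fixes k :: "nat \<Rightarrow> 'd::finite kernel"
  assumes c: "\<And>x. op_norm (k 0 x) \<le> c" "c < 1" and k: "\<And>n. k n \<in> borel_measurable (Delta_measure (Suc n) S U)"
    and sum: "(\<Sum>n. V_norm n S U (k n)) < \<infinity>" and P: "S \<le> P" "P \<le> U"
    and low: "(\<Sum>n. V_norm n S P (resolvent k n)) < \<infinity>" and block: "(\<Sum>n. V_norm n P U (k n)) < 1"
  shows "(\<Sum>n. V_norm n S U (resolvent k n)) < \<infinity>"
proof -
  let ?r = "resolvent k"
  define lo where "lo n x = indicator {..<P} (x 0) *\<^sub>R ?r n x" for n and x :: "nat \<Rightarrow> real"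
  define hi where "hi n x = indicator {P..} (x 0) *\<^sub>R ?r n x" for n and x :: "nat \<Rightarrow> real"
  define kd where "kd n x = indicator {P..} (x n) *\<^sub>R k n x" for n and x :: "nat \<Rightarrow> real"
  have finite_terms: "f n < \<infinity>" if "(\<Sum>n. f n) < (\<infinity> :: ennreal)" for f :: "nat \<Rightarrow> ennreal" and n
  proof -
    have "f n \<le> (\<Sum>n. f n)" using sum_le_suminf[of f "{n}"] by simp
    then show ?thesis using that by (rule le_less_trans)
  qed
  note kfin = finite_terms[OF sum]
  note r = resolvent_measurable[OF c k]
  note rfin = resolvent_V_norm_finite[OF c k kfin]
  have lo_m: "lo n \<in> borel_measurable (Delta_measure (Suc n) S U)"
    and hi_m: "hi n \<in> borel_measurable (Delta_measure (Suc n) S U)"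
    and kd_m: "kd n \<in> borel_measurable (Delta_measure (Suc n) S U)" for n
    unfolding lo_def[abs_def] hi_def[abs_def] kd_def[abs_def]
    by (intro borel_measurable_scaleR r k measurable_compose[OF first_coord_measurable] measurable_compose[OF last_coord_measurable]; simp)+
  have lo_le: "V_norm n S U (lo n) \<le> V_norm n S P (?r n)" for n
    unfolding lo_def[abs_def] by (rule V_norm_truncate_first[OF r P(2)])
  have kd_le: "V_norm n S U (kd n) \<le> V_norm n P U (k n)" for n
    unfolding kd_def[abs_def] by (rule V_norm_truncate_last[OF k P(1)])
  have bfin: "V_norm n P U (k n) < \<infinity>" for n
    by (rule finite_terms) (rule less_trans[OF block], simp)
  have lo_fin: "V_norm n S U (lo n) < \<infinity>" for n using lo_le finite_terms[OF low] by (rule le_less_trans)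
  have kd_fin: "V_norm n S U (kd n) < \<infinity>" for n using kd_le bfin by (rule le_less_trans)
  have hi_fin: "V_norm n S U (hi n) < \<infinity>" for n
  proof -
    have "V_norm n S U (hi n) \<le> V_norm n S U (?r n)"
      by (rule V_norm_mono[OF r hi_m]) (auto simp: hi_def indicator_def)
    then show ?thesis using rfin by (rule le_less_trans)
  qed
  \<comment> \<open>The first time of r is also the last time of k, so the indicator in
    \<open>hi\<close> may be placed on k a second time. This confines the self-interaction of
    \<open>hi\<close> to the block.\<close>
  have split: "conv k ?r n t = conv k lo n t + conv kd hi n t" for n t
  proof -
    have "tri (n - j) j (k (n - j)) (?r j) t = tri (n - j) j (k (n - j)) (lo j) t + tri (n - j) j (kd (n - j)) (hi j) t" for j
      by (auto simp: tri_def lo_def hi_def kd_def indicator_def)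
    then show ?thesis by (simp add: conv_def sum.distrib)
  qed
  note conv_m = conv_measurable[OF k lo_m] conv_measurable[OF kd_m hi_m]
  have main: "V_norm n S U (hi n) \<le> V_norm n S U (k n) + ((\<Sum>j\<le>n. V_norm (n - j) S U (k (n - j)) * V_norm j S U (lo j))
      + (\<Sum>j\<le>n. V_norm (n - j) S U (kd (n - j)) * V_norm j S U (hi j)))" for n
  proof -
    have "V_norm n S U (hi n) \<le> V_norm n S U (\<lambda>t. k n t + (conv k lo n t + conv kd hi n t))"
    proof (rule V_norm_mono)
      fix x assume "x \<in> Delta (Suc n) S U"
      then have "x \<in> extensional {..<Suc n}" by (simp add: Delta_def)
      from resolvent_right[of k c, OF c this] have "?r n x = k n x + (conv k lo n x + conv kd hi n x)" by (simp add: split)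
      then show "op_norm (hi n x) \<le> op_norm (k n x + (conv k lo n x + conv kd hi n x))"
        by (auto simp: hi_def indicator_def)
    qed (rule borel_measurable_add[OF k borel_measurable_add[OF conv_m]] hi_m order_refl)+
    also have "\<dots> \<le> V_norm n S U (k n) + V_norm n S U (\<lambda>t. conv k lo n t + conv kd hi n t)"
      by (intro V_norm_add k borel_measurable_add conv_m)
    also have "\<dots> \<le> V_norm n S U (k n) + (V_norm n S U (conv k lo n) + V_norm n S U (conv kd hi n))"
      by (intro add_left_mono V_norm_add conv_m)
    also have "\<dots> \<le> V_norm n S U (k n) + ((\<Sum>j\<le>n. V_norm (n - j) S U (k (n - j)) * V_norm j S U (lo j))
      + (\<Sum>j\<le>n. V_norm (n - j) S U (kd (n - j)) * V_norm j S U (hi j)))"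
      by (intro add_left_mono add_mono V_norm_conv k lo_m kd_m hi_m kfin lo_fin kd_fin hi_fin)
    finally show ?thesis .
  qed
  define \<kappa> where "\<kappa> n = enn2real (V_norm n S U (k n))" for n
  define \<rho> where "\<rho> n = enn2real (V_norm n S P (?r n))" for n
  define b where "b n = enn2real (V_norm n P U (k n))" for n
  define x where "x n = enn2real (V_norm n S U (hi n))" for n
  have \<kappa>: "V_norm n S U (k n) = ennreal (\<kappa> n)" "0 \<le> \<kappa> n" for n using kfin[of n] by (auto simp: \<kappa>_def)
  have \<rho>: "V_norm n S P (?r n) = ennreal (\<rho> n)" "0 \<le> \<rho> n" for n using finite_terms[OF low, of n] by (auto simp: \<rho>_def)
  have b: "V_norm n P U (k n) = ennreal (b n)" "0 \<le> b n" for n using bfin[of n] by (auto simp: b_def)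
  have x: "V_norm n S U (hi n) = ennreal (x n)" "0 \<le> x n" for n using hi_fin[of n] by (auto simp: x_def)
  have s\<kappa>: "summable \<kappa>" using sum unfolding \<kappa>(1) by (intro summable_suminf_not_top \<kappa>) auto
  have s\<rho>: "summable \<rho>" using low unfolding \<rho>(1) by (intro summable_suminf_not_top \<rho>) auto
  have sb: "summable b" using less_trans[OF block ennreal_one_less_top] unfolding b(1) by (intro summable_suminf_not_top b) auto
  have sb1: "suminf b < 1"
  proof -
    have "ennreal (suminf b) < 1" using block unfolding b(1) suminf_ennreal2[OF b(2) sb] .
    then show ?thesis by (metis ennreal_1 ennreal_less_iff suminf_nonneg sb b(2))
  qed
  have "summable x"
  proof (rule summable_convolution_inequality)
    \<comment> \<open>The forcing term collects k and k \<star> lo; the second part is a Cauchy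
      product of summable sequences.\<close>
    show "summable (\<lambda>n. \<kappa> n + (\<Sum>j\<le>n. \<rho> j * \<kappa> (n - j)))"
      using s\<kappa> s\<rho> \<kappa>(2) \<rho>(2) by (intro summable_add summable_Cauchy_product) auto
    show "x n \<le> (\<kappa> n + (\<Sum>j\<le>n. \<rho> j * \<kappa> (n - j))) + (\<Sum>j\<le>n. b (n - j) * x j)" for n
    proof -
      have "ennreal (x n) \<le> ennreal (\<kappa> n) + ((\<Sum>j\<le>n. ennreal (\<kappa> (n - j)) * ennreal (\<rho> j)) + (\<Sum>j\<le>n. ennreal (b (n - j)) * ennreal (x j)))"
      proof -
        have "ennreal (x n) \<le> ennreal (\<kappa> n) + ((\<Sum>j\<le>n. ennreal (\<kappa> (n - j)) * V_norm j S U (lo j))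
          + (\<Sum>j\<le>n. V_norm (n - j) S U (kd (n - j)) * ennreal (x j)))"
          using main[of n] unfolding \<kappa>(1) x(1) .
        also have "\<dots> \<le> ennreal (\<kappa> n) + ((\<Sum>j\<le>n. ennreal (\<kappa> (n - j)) * ennreal (\<rho> j)) + (\<Sum>j\<le>n. ennreal (b (n - j)) * ennreal (x j)))"
          using lo_le kd_le unfolding \<rho>(1) b(1)
          by (intro add_left_mono add_mono sum_mono mult_left_mono mult_right_mono) auto
        finally show ?thesis .
      qed
      also have "\<dots> = ennreal ((\<kappa> n + (\<Sum>j\<le>n. \<rho> j * \<kappa> (n - j))) + (\<Sum>j\<le>n. b (n - j) * x j))"
        using \<kappa>(2) \<rho>(2) b(2) x(2)
        by (simp add: ennreal_mult[symmetric] sum_nonneg mult.commute add.assoc)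
      finally show ?thesis
        using \<kappa>(2) \<rho>(2) b(2) x(2) by (subst (asm) ennreal_le_iff) (auto intro!: add_nonneg_nonneg sum_nonneg)
    qed
  qed (use \<kappa>(2) \<rho>(2) b(2) x(2) sb sb1 in \<open>auto intro!: add_nonneg_nonneg sum_nonneg\<close>)
  have le: "V_norm n S U (?r n) \<le> ennreal (\<rho> n + x n)" for n
  proof -
    have "V_norm n S U (?r n) \<le> V_norm n S U (\<lambda>t. lo n t + hi n t)"
      by (rule V_norm_mono[OF borel_measurable_add[OF lo_m hi_m] r order_refl order_refl])
        (auto simp: lo_def hi_def indicator_def)
    also have "\<dots> \<le> V_norm n S U (lo n) + V_norm n S U (hi n)" by (rule V_norm_add[OF lo_m hi_m])
    also have "\<dots> \<le> ennreal (\<rho> n) + ennreal (x n)" using lo_le[of n] unfolding \<rho>(1) x(1) by (rule add_right_mono)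
    finally show ?thesis using \<rho>(2) x(2) by simp
  qed
  have "(\<Sum>n. V_norm n S U (?r n)) \<le> (\<Sum>n. ennreal (\<rho> n + x n))" by (intro suminf_le le) auto
  also have "\<dots> < \<infinity>"
    using \<rho>(2) x(2) s\<rho> \<open>summable x\<close> by (subst suminf_ennreal2) (auto intro: summable_add)
  finally show ?thesis .
qed

lemma V_norm_empty:
  fixes k :: "'d::finite kernel"
  assumes "k \<in> borel_measurable (Delta_measure (Suc n) S S)"
  shows "V_norm n S S k = 0"
proof -
  have "V_norm n S S k \<le> ennreal 0"
    by (subst V_norm_le_iff[OF assms]) (auto simp: AE_interval_measure)
  then show ?thesis by simp
qed

text \<open>Induction along the break points, starting from the empty interval (S, S), on which
  every norm is 0.\<close>

lemma resolvent_summable: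
  fixes k :: "nat \<Rightarrow> 'd::finite kernel"
  assumes c: "\<And>x. op_norm (k 0 x) \<le> c" "c < 1" and k: "\<And>n. k n \<in> borel_measurable (Delta_measure (Suc n) S T)"
    and sum: "(\<Sum>n. V_norm n S T (k n)) < \<infinity>"
    and U: "U 0 = S" "U m = T" "\<And>i. i < m \<Longrightarrow> U i < U (Suc i)"
    and block: "\<And>i. i < m \<Longrightarrow> (\<Sum>n. V_norm n (U i) (U (Suc i)) (k n)) < 1"
  shows "(\<Sum>n. V_norm n S T (resolvent k n)) < \<infinity>"
proof -
  have "(\<Sum>n. V_norm n S (U i) (resolvent k n)) < \<infinity>" if "i \<le> m" for i
    using that
  proof (induction i)
    case 0
    have "resolvent k n \<in> borel_measurable (Delta_measure (Suc n) S S)" for n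
      by (rule borel_measurable_Delta_subinterval[OF resolvent_measurable[OF c k]])
        (use strict_chain_le[of m U 0 m] U in auto)
    then show ?case by (simp add: U(1) V_norm_empty)
  next
    case (Suc i)
    have le: "S \<le> U i" "U i \<le> U (Suc i)" "U (Suc i) \<le> T"
      using strict_chain_le[of m U 0 i] strict_chain_le[of m U "Suc i" m] U Suc.prems less_imp_le[OF U(3)[of i]] by auto
    have k': "k n \<in> borel_measurable (Delta_measure (Suc n) S (U (Suc i)))" for n
      by (rule borel_measurable_Delta_subinterval[OF k]) (use le in auto)
    show ?case
    proof (rule resolvent_summable_step[OF c k' _ le(1,2)])
      have "(\<Sum>n. V_norm n S (U (Suc i)) (k n)) \<le> (\<Sum>n. V_norm n S T (k n))"
        using le by (intro suminf_le V_norm_subinterval[OF k]) auto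
      then show "(\<Sum>n. V_norm n S (U (Suc i)) (k n)) < \<infinity>" using sum by (rule le_less_trans)
      show "(\<Sum>n. V_norm n S (U i) (resolvent k n)) < \<infinity>" using Suc by simp
      show "(\<Sum>n. V_norm n (U i) (U (Suc i)) (k n)) < 1" using block Suc.prems by simp
    qed
  qed
  from this[of m] show ?thesis by (simp add: U(2))
qed

section \<open>Resolvents of \<open>\<star>\<close>-Volterra kernels\<close>

lemma V_norm_sum_conv_finite:
  fixes f g :: "nat \<Rightarrow> 'd::finite kernel"
  assumes f: "\<And>n. f n \<in> borel_measurable (Delta_measure (Suc n) S T)" and g: "\<And>n. g n \<in> borel_measurable (Delta_measure (Suc n) S T)"
    and sum: "(\<Sum>n. V_norm n S T (f n)) < \<infinity>" "(\<Sum>n. V_norm n S T (g n)) < \<infinity>"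
  shows "(\<Sum>n. V_norm n S T (conv f g n)) < \<infinity>"
proof -
  have fin: "V_norm n S T (h n) < \<infinity>" if "(\<Sum>n. V_norm n S T (h n)) < \<infinity>" for n and h :: "nat \<Rightarrow> 'd kernel"
    using sum_le_suminf[of "\<lambda>n. V_norm n S T (h n)" "{n}"] that by (auto intro: le_less_trans)
  note ffin = fin[OF sum(1)] and gfin = fin[OF sum(2)]
  define a where "a n = enn2real (V_norm n S T (f n))" for n
  define b where "b n = enn2real (V_norm n S T (g n))" for n
  have a: "V_norm n S T (f n) = ennreal (a n)" "0 \<le> a n" for n using ffin[of n] by (auto simp: a_def)
  have b: "V_norm n S T (g n) = ennreal (b n)" "0 \<le> b n" for n using gfin[of n] by (auto simp: b_def)
  have sa: "summable a" using sum(1) unfolding a(1) by (intro summable_suminf_not_top a) auto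
  have sb: "summable b" using sum(2) unfolding b(1) by (intro summable_suminf_not_top b) auto
  have "V_norm n S T (conv f g n) \<le> ennreal (\<Sum>j\<le>n. b j * a (n - j))" for n
  proof -
    have "V_norm n S T (conv f g n) \<le> (\<Sum>j\<le>n. ennreal (a (n - j)) * ennreal (b j))"
      using V_norm_conv[OF f g ffin gfin, of n] unfolding a(1) b(1) .
    also have "\<dots> = ennreal (\<Sum>j\<le>n. b j * a (n - j))"
      using a(2) b(2) by (simp add: ennreal_mult[symmetric] mult.commute)
    finally show ?thesis .
  qed
  then have "(\<Sum>n. V_norm n S T (conv f g n)) \<le> (\<Sum>n. ennreal (\<Sum>j\<le>n. b j * a (n - j)))"
    by (intro suminf_le) auto
  also have "\<dots> < \<infinity>"
    using a(2) b(2) sa sb summable_Cauchy_product[of b a]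
    by (subst suminf_ennreal2) (auto intro!: sum_nonneg)
  finally show ?thesis .
qed

lemma conv_cong_AE:
  fixes f g :: "nat \<Rightarrow> 'd::finite kernel"
  assumes f: "\<And>n. AE x in Delta_measure (Suc n) S T. f n x = f' n x" and g: "\<And>n. AE x in Delta_measure (Suc n) S T. g n x = g' n x"
  shows "AE x in Delta_measure (Suc n) S T. conv f g n x = conv f' g' n x"
proof -
  have "AE x in Delta_measure (Suc n) S T. \<forall>j\<in>{..n}. tri (n - j) j (f (n - j)) (g j) x = tri (n - j) j (f' (n - j)) (g' j) x"
  proof (rule AE_finite_allI)
    fix j assume "j \<in> {..n}"
    then have n: "n - j + j = n" by simp
    show "AE x in Delta_measure (Suc n) S T. tri (n - j) j (f (n - j)) (g j) x = tri (n - j) j (f' (n - j)) (g' j) x"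
      using tri_cong_AE[OF f[of "n - j"] g[of j]] unfolding n .
  qed simp
  then show ?thesis by eventually_elim (simp add: conv_def)
qed

lemma op_norm_le_V_norm_0:
  fixes k :: "'d::finite kernel"
  assumes k: "k \<in> borel_measurable (Delta_measure (Suc 0) S T)" and c: "0 \<le> c" "V_norm 0 S T k \<le> ennreal c"
  shows "AE t in interval_measure S T. op_norm (k ((\<lambda>_. undefined)(0 := t))) \<le> c"
proof -
  have "AE t in interval_measure S T. Qsec 0 T k t \<le> ennreal (c\<^sup>2)" using V_norm_le_iff[OF k c(1)] c(2) by simp
  then show ?thesis
  proof eventually_elim
    case (elim t)
    then have "(op_norm (k ((\<lambda>_. undefined)(0 := t))))\<^sup>2 \<le> c\<^sup>2"
      by (simp add: Isec_def nn_integral_Delta_0)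
    then show ?case using c(1) by (rule power2_le_imp_le)
  qed
qed

text \<open>The open blocks cover (S, T) up to finitely many break points, which form a null
  set.\<close>

lemma AE_interval_measure_chain:
  assumes "U 0 = S" "U m = T" "\<And>i. i < m \<Longrightarrow> AE t in interval_measure (U i) (U (Suc i)). P t"
  shows "AE t in interval_measure S T. P t"
proof -
  have "AE t in lborel. \<forall>i\<in>{..<m}. (U i < t \<and> t < U (Suc i) \<longrightarrow> P t)"
    by (rule AE_finite_allI) (use assms(3) in \<open>auto simp: AE_interval_measure\<close>)
  moreover have "AE t in lborel. \<forall>i\<in>{..m}. t \<noteq> U i"
    by (rule AE_finite_allI) (auto intro: AE_lborel_singleton)
  ultimately show ?thesis unfolding AE_interval_measure
  proof eventually_elim
    case (elim t)
    show ?case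
    proof
      assume t: "S < t \<and> t < T"
      obtain i where i: "i < m" "U i < t" "t \<le> U (Suc i)"
        using chain_cell[of U t m] assms(1,2) t by auto
      then have "t \<noteq> U (Suc i)" using elim(2) by auto
      with i show "P t" using elim(1) by auto
    qed
  qed
qed

lemma AE_Delta_1:
  assumes "AE t in interval_measure S T. P ((\<lambda>_. undefined)(0 := t))" and P: "{x \<in> space (Delta_measure (Suc 0) S T). P x} \<in> sets (Delta_measure (Suc 0) S T)"
  shows "AE x in Delta_measure (Suc 0) S T. P x"
proof -
  let ?A = "{x \<in> space (Delta_measure (Suc 0) S T). \<not> P x}"
  have "?A = space (Delta_measure (Suc 0) S T) - {x \<in> space (Delta_measure (Suc 0) S T). P x}" by auto
  then have A: "?A \<in> sets (Delta_measure (Suc 0) S T)" using sets.compl_sets[OF P] by (simp only:)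
  then have ind: "(indicator ?A :: _ \<Rightarrow> ennreal) \<in> borel_measurable (Delta_measure (Suc 0) S T)" by simp
  have "AE t in interval_measure S T. Isec 0 T (indicator ?A) t \<le> 0"
    using assms(1) by eventually_elim (simp add: Isec_def nn_integral_Delta_0)
  from AE_Delta_if_Isec[OF ind this] AE_space show ?thesis
    by eventually_elim (auto simp: indicator_def split: if_splits)
qed

context brownian_motion
begin

text \<open>On a bounded interval the V norm dominates the L2 norm up to a constant, and a summable
  sequence of norms is square-summable.\<close>

lemma has_chaos_if_V_norm_summable:
  fixes f :: "nat \<Rightarrow> 'd::finite kernel"
  assumes f: "\<And>n. f n \<in> borel_measurable (Delta_measure (Suc n) S T)"
    and sum: "(\<Sum>n. V_norm n S T (f n)) < \<infinity>" and S: "0 \<le> S" "S < T"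
  shows "\<exists>\<xi>. has_chaos M W S T \<xi> f"
proof -
  have fin: "V_norm n S T (f n) < \<infinity>" for n
    using sum_le_suminf[of "\<lambda>n. V_norm n S T (f n)" "{n}"] sum by (auto intro: le_less_trans)
  define a where "a n = enn2real (V_norm n S T (f n))" for n
  have a: "V_norm n S T (f n) = ennreal (a n)" "0 \<le> a n" for n using fin[of n] by (auto simp: a_def)
  have sa: "summable a" using sum unfolding a(1) by (intro summable_suminf_not_top a) auto
  let ?D = "(real CARD('d))^4 * (T - S)"
  have L: "L2sq (Delta_measure (Suc n) S T) (f n) \<le> ennreal (?D * (a n)\<^sup>2)" for n
    by (rule L2sq_le_V_norm[OF f a(2)]) (use a S in auto)
  have sq: "summable (\<lambda>n. ?D * (a n)\<^sup>2)"
  \<comment> \<open>Every a n is at most suminf a, hence (a n)^2 <= suminf a * a n.\<close>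
  proof (rule summable_mult, rule summable_comparison_test'[where N = 0])
    show "summable (\<lambda>n. suminf a * a n)" by (rule summable_mult[OF sa])
    fix n
    have "a n \<le> suminf a" using sum_le_suminf[OF sa, of "{n}"] a(2) by simp
    then show "norm ((a n)\<^sup>2) \<le> suminf a * a n" using a(2)[of n] by (simp add: power2_eq_square mult_right_mono)
  qed
  show ?thesis
  proof (rule has_chaos_exists[OF _ _ S])
    show "f n \<in> L2_Delta (Suc n) S T" for n
      unfolding L2_Delta_iff using f[of n] le_less_trans[OF L[of n]] by simp
    have "(\<Sum>n. L2sq (Delta_measure (Suc n) S T) (f n)) \<le> (\<Sum>n. ennreal (?D * (a n)\<^sup>2))" by (intro suminf_le L) auto
    also have "\<dots> < \<infinity>" using sq S by (subst suminf_ennreal2) auto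
    finally show "(\<Sum>n. L2sq (Delta_measure (Suc n) S T) (f n)) < \<infinity>" .
  qed
qed

text \<open>The left side concerns a chosen process and then its chosen coefficients. A process with
  the truncated coefficients exists because their norms are dominated by those on (S, T), and its
  coefficients are unique up to null sets, so the block hypothesis becomes a condition on the
  coefficients of \<open>K\<close>.\<close>

lemma restricted_kernel_norm:
  fixes K :: "('w, 'd::finite) process"
  assumes K: "K \<in> KF M W S T" and S: "0 \<le> S" and UV: "S \<le> U" "U < V" "V \<le> T"
  shows "KF_norm M W U V (restricted_kernel M W S T K U V) = (\<Sum>n. V_norm n U V (chaos_coeff M W S T K n))"
proof -
  let ?k = "chaos_coeff M W S T K"
  let ?f = "\<lambda>n. restrict (?k n) (Delta (Suc n) U V)"
  let ?R = "restricted_kernel M W S T K U V"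
  have k: "?k n \<in> borel_measurable (Delta_measure (Suc n) S T)" for n
    using K by (simp add: KF_def V_space_def)
  have k': "?k n \<in> borel_measurable (Delta_measure (Suc n) U V)" for n
    by (rule borel_measurable_Delta_subinterval[OF k]) (use UV in auto)
  have f: "?f n \<in> borel_measurable (Delta_measure (Suc n) U V)" for n
    by (rule measurable_cong[THEN iffD1, OF _ k']) simp
  \<comment> \<open>\<open>V_norm\<close> sees the kernel only on the simplex, where
    \<open>restrict\<close> changes nothing.\<close>
  have Vf: "V_norm n U V (?f n) = V_norm n U V (?k n)" for n
    by (intro antisym V_norm_mono[OF k' f] V_norm_mono[OF f k']) auto
  have "(\<Sum>n. V_norm n U V (?f n)) \<le> (\<Sum>n. V_norm n S T (?k n))"
    unfolding Vf using UV by (intro suminf_le V_norm_subinterval[OF k]) auto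
  also have "\<dots> < \<infinity>" using K by (simp add: KF_def KF_norm_def)
  finally have "\<exists>\<xi>. has_chaos M W U V \<xi> ?f"
    using UV S by (intro has_chaos_if_V_norm_summable f) auto
  then have R: "has_chaos M W U V ?R ?f" unfolding restricted_kernel_def by (rule has_chaos_chaos_process)
  note R' = has_chaos_chaos_coeff[OF R]
  have "V_norm n U V (chaos_coeff M W U V ?R n) = V_norm n U V (?f n)" for n
    by (rule V_norm_cong_AE[OF has_chaos_measurable[OF R'] f has_chaos_coeff_unique[OF R' R]]) (use UV S in auto)
  then show ?thesis by (simp add: KF_norm_def Vf)
qed

lemma KF_if_V_norm_summable:
  fixes R :: "('w, 'd::finite) process"
  assumes R: "has_chaos M W S T R r" and sum: "(\<Sum>n. V_norm n S T (r n)) < \<infinity>" and S: "0 \<le> S"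
  shows "R \<in> KF M W S T"
proof -
  let ?r = "chaos_coeff M W S T R"
  note R' = has_chaos_chaos_coeff[OF R]
  have V: "V_norm n S T (?r n) = V_norm n S T (r n)" for n
    by (rule V_norm_cong_AE[OF has_chaos_measurable[OF R'] has_chaos_measurable[OF R] has_chaos_coeff_unique[OF R' R S]])
  have fin: "V_norm n S T (r n) < \<infinity>" for n
    using sum_le_suminf[of "\<lambda>n. V_norm n S T (r n)" "{n}"] sum by (auto intro: le_less_trans)
  show ?thesis
    unfolding KF_def KF_norm_def V_space_def
    using has_chaos_L2F[OF R] R' has_chaos_measurable[OF R'] sum fin by (simp add: V)
qed

lemma star_eq: "star M W S T K1 K2 = chaos_process M W S T (conv (chaos_coeff M W S T K1) (chaos_coeff M W S T K2))"
  by (simp add: star_def conv_def[abs_def])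

text \<open>Identifies the right sides of both resolvent equations by their coefficients.
  Summability of the convolved norms ensures that the choice in \<open>star\<close> denotes an
  actual expansion.\<close>

lemma KF_add_star:
  fixes K K1 K2 :: "('w, 'd::finite) process"
  assumes K: "K \<in> KF M W S T" and K1: "K1 \<in> KF M W S T" and K2: "K2 \<in> KF M W S T" and S: "0 \<le> S" "S < T"
  shows "has_chaos M W S T (\<lambda>t \<omega>. K t \<omega> + star M W S T K1 K2 t \<omega>)
    (\<lambda>n t. chaos_coeff M W S T K n t + conv (chaos_coeff M W S T K1) (chaos_coeff M W S T K2) n t)"
proof (rule has_chaos_add[OF _ _ S(1)])
  show "has_chaos M W S T K (chaos_coeff M W S T K)" using K by (simp add: KF_def)
  show "has_chaos M W S T (star M W S T K1 K2) (conv (chaos_coeff M W S T K1) (chaos_coeff M W S T K2))"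
    unfolding star_eq
  proof (rule has_chaos_chaos_process, rule has_chaos_if_V_norm_summable[OF _ _ S])
    have m: "chaos_coeff M W S T K1 n \<in> borel_measurable (Delta_measure (Suc n) S T)"
      "chaos_coeff M W S T K2 n \<in> borel_measurable (Delta_measure (Suc n) S T)" for n
      using K1 K2 by (simp_all add: KF_def V_space_def)
    show "conv (chaos_coeff M W S T K1) (chaos_coeff M W S T K2) n \<in> borel_measurable (Delta_measure (Suc n) S T)" for n
      by (rule conv_measurable[OF m])
    show "(\<Sum>n. V_norm n S T (conv (chaos_coeff M W S T K1) (chaos_coeff M W S T K2) n)) < \<infinity>"
      by (rule V_norm_sum_conv_finite[OF m]) (use K1 K2 in \<open>simp_all add: KF_def KF_norm_def\<close>)
  qed
qed

lemma star_resolvent_exists: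
  fixes K :: "('w, 'd::finite) process"
  assumes S: "0 \<le> S" "S < T" and K: "K \<in> KF M W S T"
    and m: "m \<ge> 1" and U: "U 0 = S" "U m = T" "\<forall>k<m. U k < U (Suc k)"
    and block: "\<forall>k<m. KF_norm M W (U k) (U (Suc k)) (restricted_kernel M W S T K (U k) (U (Suc k))) < 1"
  shows "\<exists>R. is_star_resolvent M W S T K R"
proof -
  let ?K = "chaos_coeff M W S T K"
  have Km: "?K n \<in> borel_measurable (Delta_measure (Suc n) S T)" for n
    using K by (simp add: KF_def V_space_def)
  have Ksum: "(\<Sum>n. V_norm n S T (?K n)) < \<infinity>" using K by (simp add: KF_def KF_norm_def)
  have sub: "S \<le> U i" "U i < U (Suc i)" "U (Suc i) \<le> T" if "i < m" for i
    using strict_chain_le[of m U 0 i] strict_chain_le[of m U "Suc i" m] U that by auto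
  have block': "(\<Sum>n. V_norm n (U i) (U (Suc i)) (?K n)) < 1" if "i < m" for i
    using block[rule_format, OF that] unfolding restricted_kernel_norm[OF K S(1) sub[OF that]] .
  have Kb: "?K n \<in> borel_measurable (Delta_measure (Suc n) (U i) (U (Suc i)))" if "i < m" for n i
    by (rule borel_measurable_Delta_subinterval[OF Km]) (use sub[OF that] in auto)
  have v1: "V_norm 0 (U i) (U (Suc i)) (?K 0) < 1" if "i < m" for i
    using sum_le_suminf[of "\<lambda>n. V_norm n (U i) (U (Suc i)) (?K n)" "{0}"] block'[OF that] by (auto intro: le_less_trans)
  define v where "v i = enn2real (V_norm 0 (U i) (U (Suc i)) (?K 0))" for i
  have v: "V_norm 0 (U i) (U (Suc i)) (?K 0) = ennreal (v i)" "0 \<le> v i" "v i < 1" if "i < m" for i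
  proof -
    show 1: "V_norm 0 (U i) (U (Suc i)) (?K 0) = ennreal (v i)"
      using less_trans[OF v1[OF that] ennreal_one_less_top] by (simp add: v_def)
    show 2: "0 \<le> v i" by (simp add: v_def)
    show "v i < 1" using v1[OF that] 2 unfolding 1 by (simp add: ennreal_less_one_iff)
  qed
  \<comment> \<open>A maximum over finitely many numbers below 1 stays below 1; the set is nonempty
    because m >= 1.\<close>
  define c where "c = Max (v ` {..<m})"
  have vc: "v i \<le> c" if "i < m" for i unfolding c_def using that by (intro Max_ge) auto
  have c0: "0 \<le> c" using vc[of 0] v(2)[of 0] m by simp
  have "0 \<in> {..<m}" using m by simp
  then have "v ` {..<m} \<noteq> {}" by blast
  then have c1: "c < 1" unfolding c_def using v(3) by (subst Max_less_iff) auto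
  \<comment> \<open>Modifying \<open>k\<^sub>0\<close> on a null set makes \<open>1 - k\<^sub>0(t)\<close> invertible for every \<open>t\<close>, so that the resolvent
    equations hold pointwise.\<close>
  define k where "k n = (if n = 0 then (\<lambda>x. if op_norm (?K 0 x) \<le> c then ?K 0 x else 0) else ?K n)" for n
  have kc: "op_norm (k 0 x) \<le> c" for x using c0 by (simp add: k_def)
  have k_le: "op_norm (k n x) \<le> op_norm (?K n x)" for n x by (simp add: k_def)
  have km: "k n \<in> borel_measurable (Delta_measure (Suc n) S T)" for n
  proof (cases "n = 0")
    case True
    note [measurable] = Km[of 0]
    show ?thesis unfolding True k_def by simp
  qed (use Km in \<open>simp add: k_def\<close>)
  \<comment> \<open>On block i the operator norm of the degree-0 coefficient is almost everywhere at
    most \<open>v i\<close>, hence at most c, so the modification concerns a null set only.\<close>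
  have k_AE: "AE x in Delta_measure (Suc n) S T. ?K n x = k n x" for n
  proof (cases "n = 0")
    case True
    have "AE t in interval_measure S T. op_norm (?K 0 ((\<lambda>_. undefined)(0 := t))) \<le> c"
    proof (rule AE_interval_measure_chain[OF U(1,2)])
      fix i assume i: "i < m"
      show "AE t in interval_measure (U i) (U (Suc i)). op_norm (?K 0 ((\<lambda>_. undefined)(0 := t))) \<le> c"
        by (rule op_norm_le_V_norm_0[OF Kb[OF i] c0]) (use v(1)[OF i] vc[OF i] in \<open>simp add: ennreal_leI\<close>)
    qed
    then have "AE x in Delta_measure (Suc 0) S T. op_norm (?K 0 x) \<le> c"
    proof (rule AE_Delta_1)
      note [measurable] = Km[of 0]
      show "{x \<in> space (Delta_measure (Suc 0) S T). op_norm (?K 0 x) \<le> c} \<in> sets (Delta_measure (Suc 0) S T)" by measurable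
    qed
    then show ?thesis unfolding True by eventually_elim (simp add: k_def)
  qed (simp add: k_def)
  have ksum: "(\<Sum>n. V_norm n S T (k n)) < \<infinity>"
  proof -
    have "(\<Sum>n. V_norm n S T (k n)) \<le> (\<Sum>n. V_norm n S T (?K n))"
      by (intro suminf_le V_norm_mono[OF Km km] k_le) auto
    then show ?thesis using Ksum by (rule le_less_trans)
  qed
  have kblock: "(\<Sum>n. V_norm n (U i) (U (Suc i)) (k n)) < 1" if "i < m" for i
  proof -
    have "k n \<in> borel_measurable (Delta_measure (Suc n) (U i) (U (Suc i)))" for n
      by (rule borel_measurable_Delta_subinterval[OF km]) (use sub[OF that] in auto)
    then have "(\<Sum>n. V_norm n (U i) (U (Suc i)) (k n)) \<le> (\<Sum>n. V_norm n (U i) (U (Suc i)) (?K n))"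
      by (intro suminf_le V_norm_mono[OF Kb[OF that]] k_le) auto
    then show ?thesis using block'[OF that] by (rule le_less_trans)
  qed
  let ?r = "resolvent k"
  note rm = resolvent_measurable[OF kc c1 km]
  have rsum: "(\<Sum>n. V_norm n S T (?r n)) < \<infinity>"
    by (rule resolvent_summable[OF kc c1 km ksum U(1,2) _ kblock]) (use U(3) in auto)
  define R where "R = chaos_process M W S T ?r"
  have R: "has_chaos M W S T R ?r"
    unfolding R_def by (rule has_chaos_chaos_process[OF has_chaos_if_V_norm_summable[OF rm rsum S]])
  have RKF: "R \<in> KF M W S T" by (rule KF_if_V_norm_summable[OF R rsum S(1)])
  let ?R = "chaos_coeff M W S T R"
  note R' = has_chaos_chaos_coeff[OF R]
  have r_AE: "AE x in Delta_measure (Suc n) S T. ?r n x = ?R n x" for n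
    by (rule has_chaos_coeff_unique[OF R R' S(1)])
  have K_AE: "AE x in Delta_measure (Suc n) S T. k n x = ?K n x" for n
    using k_AE[of n] by eventually_elim simp
  have ext: "AE x in Delta_measure (Suc n) S T. x \<in> extensional {..<Suc n}" for n
    by (rule AE_I2) (simp add: Delta_def)
  \<comment> \<open>The equation for \<open>resolvent k\<close> holds at every extensional tuple. It
    passes to the chosen coefficients of \<open>K\<close> and \<open>R\<close> outside a null set,
    because \<open>conv\<close> respects almost-everywhere equality.\<close>
  have right: "AE x in Delta_measure (Suc n) S T. ?R n x = ?K n x + conv ?K ?R n x" for n
    using r_AE[of n] K_AE[of n] conv_cong_AE[OF K_AE r_AE, of n] ext[of n]
    by eventually_elim (use resolvent_right[of k c, OF kc c1] in metis)
  have left: "AE x in Delta_measure (Suc n) S T. ?R n x = ?K n x + conv ?R ?K n x" for n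
    using r_AE[of n] K_AE[of n] conv_cong_AE[OF r_AE K_AE, of n] ext[of n]
    by eventually_elim (use resolvent_left[of k c, OF kc c1] in metis)
  have "is_star_resolvent M W S T K R"
    unfolding is_star_resolvent_def
    using RKF has_chaos_process_unique[OF R' KF_add_star[OF K K RKF S] S(1) right]
      has_chaos_process_unique[OF R' KF_add_star[OF K RKF K S] S(1) left]
    by (intro conjI)
  then show ?thesis by blast
qed

end

theorem corollary5p5:
  fixes M :: "'w measure" and W :: "real \<Rightarrow> 'w \<Rightarrow> real"
    and K :: "('w, 'd::finite) process"
    and S T :: real and m :: nat and U :: "nat \<Rightarrow> real"
  assumes "brownian_motion M W"
    and "0 \<le> S" and "S < T"
    and "K \<in> KF M W S T"
    and "m \<ge> 1" and "U 0 = S" and "U m = T" and "\<forall>k<m. U k < U (Suc k)"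
    and "\<forall>k<m. KF_norm M W (U k) (U (Suc k))
           (restricted_kernel M W S T K (U k) (U (Suc k))) < 1"
  shows "\<exists>R. is_star_resolvent M W S T K R"
  using assms by (rule brownian_motion.star_resolvent_exists)

end
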